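(* Let $d\ge1$, $G=\mathbb{Z}/d\mathbb{Z}$, $W_n=G\wr S_n$, and let $P(d,n)$ be the pure monomial braid group. For each $i\ge1$, the characters of the $W_n$-representations $\mathrm{gr}\,P(d,n)^i$ are given by a single character polynomial for all $n$.
   Context: $G=\mathbb{Z}/d\mathbb{Z}$ acts on $\mathbb{C}^*$ by multiplication by $d$-th roots of unity; $\mathrm{Conf}_n^G(\mathbb{C}^* )=\{(v_i)\in(\mathbb{C}^* )^n:Gv_i\cap Gv_j=\emptyset,\ i\ne j\}$, on which $W_n$ acts by acting on and permuting coordinates, and $P(d,n)=\pi_1(\mathrm{Conf}_n^G(\mathbb{C}^* ))$. For a group $\Gamma$ let $\Gamma_1=\Gamma$ and $\Gamma_{j+1}=[\Gamma_j,\Gamma]$. The associated graded Lie algebra over a field $k$ (here of characteristic $0$ and containing a primitive $d$-th root of unity, e.g. $\mathbb{Q}(\zeta_d)$ or $\mathbb{C}$) is $\mathrm{gr}(\Gamma)=\bigoplus_{j\ge1}(\Gamma_j/\Gamma_{j+1})\otimes_{\mathbb{Z}}k$, with Lie bracket induced by the commutator; $\mathrm{gr}(\Gamma)^i$ is its degree-$i$ piece. Conjugation acts trivially on $\mathrm{gr}(\Gamma)$, so $Z\mapsto\mathrm{gr}\,\pi_1(Z)$ is a functor on spaces; this gives the $W_n$-action on $\mathrm{gr}\,P(d,n)$. A character polynomial is a polynomial in variables $X_m^C$ ($m\ge1$, $C$ a conjugacy class of $G$), where $X_m^C$ is the class function on every $W_n$ counting the $m$-cycles whose label (the class of the product of the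 $G$-entries around the cycle) is $C$. *)

theory Defs
  imports
    "HOL-Analysis.Analysis"
    "HOL-Combinatorics.Combinatorics"
    "HOL-Algebra.Algebra"
    "HOL-Algebra.Free_Abelian_Groups"
    "HOL-Library.Poly_Mapping"
    "Jordan_Normal_Form.VS_Connect"
begin

section \<open>Wreath products with the symmetric groups and their labelled cycles\<close>

text \<open>A pair \<open>(g, \<sigma>)\<close> sends the \<open>j\<close>-th coordinate to the \<open>\<sigma> j\<close>-th place and there
  lets \<open>g (\<sigma> j)\<close> act on it; the product is composition of such maps.\<close>

definition wreath_product ::
  "'g monoid \<Rightarrow> nat \<Rightarrow> ((nat \<Rightarrow> 'g) \<times> (nat \<Rightarrow> nat)) monoid"
  where "wreath_product G n = \<lparr>
    carrier = ({..<n} \<rightarrow>\<^sub>E carrier G) \<times> {\<sigma>. \<sigma> permutes {..<n}},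
    monoid.mult = (\<lambda>(g, \<sigma>) (h, \<tau>).
      (\<lambda>i\<in>{..<n}. g i \<otimes>\<^bsub>G\<^esub> h (inv_into UNIV \<sigma> i), \<sigma> \<circ> \<tau>)),
    one = (\<lambda>i\<in>{..<n}. \<one>\<^bsub>G\<^esub>, id)\<rparr>"

definition conj_class :: "'g monoid \<Rightarrow> 'g \<Rightarrow> 'g set"
  where "conj_class G a = {b \<otimes>\<^bsub>G\<^esub> a \<otimes>\<^bsub>G\<^esub> inv\<^bsub>G\<^esub> b | b. b \<in> carrier G}"

text \<open>For \<open>i\<close> on an \<open>m\<close>-cycle of \<open>\<sigma>\<close>, the product
  \<open>g (\<sigma>\<^sup>m i) \<otimes> \<dots> \<otimes> g (\<sigma>\<^sup>2 i) \<otimes> g (\<sigma> i)\<close>. Another starting point on the same cycle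
  gives a conjugate element.\<close>

definition cycle_product ::
  "'g monoid \<Rightarrow> (nat \<Rightarrow> 'g) \<times> (nat \<Rightarrow> nat) \<Rightarrow> nat \<Rightarrow> nat \<Rightarrow> 'g"
  where "cycle_product G w m i =
    fold (\<lambda>k a. fst w ((snd w ^^ k) i) \<otimes>\<^bsub>G\<^esub> a) [1..<Suc m] \<one>\<^bsub>G\<^esub>"

definition count_cycles ::
  "'g monoid \<Rightarrow> nat \<Rightarrow> (nat \<Rightarrow> 'g) \<times> (nat \<Rightarrow> nat) \<Rightarrow> nat \<times> 'g set \<Rightarrow> nat"
  where "count_cycles G n w = (\<lambda>(m, C). card {c. \<exists>i<n.
    c = Orbits.orbit (snd w) i \<and> card c = m \<and> conj_class G (cycle_product G w m i) = C})"


section \<open>Character polynomials\<close>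

text \<open>A polynomial with variables in \<open>'x\<close> is a finitely supported map from monomials to
  coefficients, and a monomial is a finitely supported map from variables to exponents.\<close>

type_synonym ('x, 'k) mv_poly = "('x \<Rightarrow>\<^sub>0 nat) \<Rightarrow>\<^sub>0 'k"

definition eval_polynomial :: "('x \<Rightarrow> 'k) \<Rightarrow> ('x, 'k::comm_semiring_1) mv_poly \<Rightarrow> 'k"
  where "eval_polynomial v p = (\<Sum>m\<in>Poly_Mapping.keys p.
    Poly_Mapping.lookup p m * (\<Prod>x\<in>Poly_Mapping.keys m. v x ^ Poly_Mapping.lookup m x))"

text \<open>The pair \<open>(m, C)\<close> stands for the variable \<open>X\<^sub>m\<^sup>C\<close>.\<close>

definition character_polynomials ::
  "'g monoid \<Rightarrow> (nat \<times> 'g set, 'k::comm_semiring_1) mv_poly set"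
  where "character_polynomials G = {p. \<forall>m\<in>Poly_Mapping.keys p.
    Poly_Mapping.keys m \<subseteq> {1..} \<times> (conj_class G ` carrier G)}"

definition eval_character_polynomial ::
  "'g monoid \<Rightarrow> nat \<Rightarrow> (nat \<times> 'g set, 'k::comm_semiring_1) mv_poly
    \<Rightarrow> (nat \<Rightarrow> 'g) \<times> (nat \<Rightarrow> nat) \<Rightarrow> 'k"
  where "eval_character_polynomial G n p w =
    eval_polynomial (\<lambda>x. of_nat (count_cycles G n w x)) p"


section \<open>Fundamental groups\<close>

definition homotopy_class ::
  "'a::topological_space set \<Rightarrow> (real \<Rightarrow> 'a) \<Rightarrow> (real \<Rightarrow> 'a) set"
  where "homotopy_class S p = {q. homotopic_paths S p q}"

definition paths_between ::
  "'a::topological_space set \<Rightarrow> 'a \<Rightarrow> 'a \<Rightarrow> (real \<Rightarrow> 'a) set"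
  where "paths_between S x y =
    {p. path p \<and> path_image p \<subseteq> S \<and> pathstart p = x \<and> pathfinish p = y}"

definition fundamental_group ::
  "'a::topological_space set \<Rightarrow> 'a \<Rightarrow> (real \<Rightarrow> 'a) set monoid"
  where "fundamental_group S x = \<lparr>
    carrier = homotopy_class S ` paths_between S x x,
    monoid.mult = (\<lambda>A B. \<Union>p\<in>A. \<Union>q\<in>B. homotopy_class S (p +++ q)),
    one = homotopy_class S (\<lambda>_. x)\<rparr>"

text \<open>The endomorphism of the fundamental group at \<open>x = pathstart \<gamma>\<close> induced by a
  self-map \<open>f\<close> of the space, where the path \<open>\<gamma>\<close> from \<open>x\<close> to \<open>f x\<close> identifies the
  fundamental groups at \<open>x\<close> and at \<open>f x\<close>. Another choice of \<open>\<gamma>\<close> changes it by an inner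
  automorphism.\<close>

definition fundamental_group_map ::
  "'a::topological_space set \<Rightarrow> (real \<Rightarrow> 'a) \<Rightarrow> ('a \<Rightarrow> 'a)
    \<Rightarrow> (real \<Rightarrow> 'a) set \<Rightarrow> (real \<Rightarrow> 'a) set"
  where "fundamental_group_map S \<gamma> f U =
    (\<Union>p\<in>U. homotopy_class S (\<gamma> +++ (f \<circ> p) +++ reversepath \<gamma>))"


section \<open>The associated graded of the lower central series\<close>

definition commutator_subgroup :: "'a monoid \<Rightarrow> 'a set \<Rightarrow> 'a set \<Rightarrow> 'a set"
  where "commutator_subgroup G H K = generate G
    {h \<otimes>\<^bsub>G\<^esub> k \<otimes>\<^bsub>G\<^esub> inv\<^bsub>G\<^esub> h \<otimes>\<^bsub>G\<^esub> inv\<^bsub>G\<^esub> k | h k. h \<in> H \<and> k \<in> K}"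

text \<open>Indexed from \<open>1\<close>; the value at \<open>0\<close> is a dummy.\<close>

fun lower_central :: "'a monoid \<Rightarrow> nat \<Rightarrow> 'a set"
  where
    "lower_central G 0 = carrier G"
  | "lower_central G (Suc 0) = carrier G"
  | "lower_central G (Suc (Suc j)) =
      commutator_subgroup G (lower_central G (Suc j)) (carrier G)"

definition lower_central_quotient :: "'a monoid \<Rightarrow> nat \<Rightarrow> 'a set monoid"
  where "lower_central_quotient G j =
    (G\<lparr>carrier := lower_central G j\<rparr>) Mod (lower_central G (Suc j))"

text \<open>For an endomorphism \<open>\<phi>\<close> and a coset \<open>U = N #> x\<close>, where \<open>N\<close> is the next term of the
  series, the set product \<open>N <#> \<phi> ` U\<close> is the coset \<open>N #> \<phi> x\<close>, because
  \<open>\<phi> ` N \<subseteq> N\<close>. The same device is used for the quotients below.\<close>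

definition lower_central_quotient_map ::
  "'a monoid \<Rightarrow> nat \<Rightarrow> ('a \<Rightarrow> 'a) \<Rightarrow> 'a set \<Rightarrow> 'a set"
  where "lower_central_quotient_map G j \<phi> U = lower_central G (Suc j) <#>\<^bsub>G\<^esub> (\<phi> ` U)"

text \<open>The tensor product over the integers of an abelian group \<open>A\<close> (written
  multiplicatively) with the additive group of a field \<open>'k\<close>: the free abelian group on pairs,
  modulo biadditivity, with scalars acting on the second factor.\<close>

abbreviation tensor_free :: "'a monoid \<Rightarrow> ('a \<times> 'k \<Rightarrow>\<^sub>0 int) monoid"
  where "tensor_free A \<equiv> free_Abelian_group (carrier A \<times> UNIV)"

definition tensor_relations :: "'a monoid \<Rightarrow> ('a \<times> 'k::field \<Rightarrow>\<^sub>0 int) set"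
  where "tensor_relations A = generate (tensor_free A)
    ({frag_of (a \<otimes>\<^bsub>A\<^esub> b, c) - frag_of (a, c) - frag_of (b, c) | a b c.
        a \<in> carrier A \<and> b \<in> carrier A}
     \<union> {frag_of (a, c + c') - frag_of (a, c) - frag_of (a, c') | a c c'. a \<in> carrier A})"

text \<open>A \<open>module\<close> record also has the fields of a ring; the multiplicative ones are not
  used for a vector space.\<close>

definition tensor_field :: "'a monoid \<Rightarrow> ('k::field, ('a \<times> 'k \<Rightarrow>\<^sub>0 int) set) module"
  where "tensor_field A = \<lparr>
    carrier = rcosets\<^bsub>tensor_free A\<^esub> (tensor_relations A),
    monoid.mult = undefined,
    one = undefined,
    ring.zero = tensor_relations A,
    ring.add = set_mult (tensor_free A),
    smult = (\<lambda>s U. tensor_relations A <#>\<^bsub>tensor_free A\<^esub>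
      (frag_extend (\<lambda>(a, c). frag_of (a, s * c)) ` U))\<rparr>"

definition tensor_field_map ::
  "'a monoid \<Rightarrow> ('a \<Rightarrow> 'a) \<Rightarrow> ('a \<times> 'k::field \<Rightarrow>\<^sub>0 int) set \<Rightarrow> ('a \<times> 'k \<Rightarrow>\<^sub>0 int) set"
  where "tensor_field_map A f U = tensor_relations A <#>\<^bsub>tensor_free A\<^esub>
    (frag_extend (\<lambda>(a, c). frag_of (f a, c)) ` U)"

definition gr_piece :: "'a monoid \<Rightarrow> nat \<Rightarrow> ('k::field, ('a set \<times> 'k \<Rightarrow>\<^sub>0 int) set) module"
  where "gr_piece G j = tensor_field (lower_central_quotient G j)"

definition gr_map :: "'a monoid \<Rightarrow> nat \<Rightarrow> ('a \<Rightarrow> 'a)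
    \<Rightarrow> ('a set \<times> 'k::field \<Rightarrow>\<^sub>0 int) set \<Rightarrow> ('a set \<times> 'k \<Rightarrow>\<^sub>0 int) set"
  where "gr_map G j \<phi> =
    tensor_field_map (lower_central_quotient G j) (lower_central_quotient_map G j \<phi>)"


section \<open>Traces\<close>

text \<open>The matrix of \<open>f\<close> with respect to a finite basis \<open>B\<close> has entry \<open>M b' b\<close> in row
  \<open>b'\<close> and column \<open>b\<close>. On an infinite-dimensional space no \<open>f\<close> has a trace.\<close>

definition has_trace ::
  "('k::field, 'v) module \<Rightarrow> ('v \<Rightarrow> 'v) \<Rightarrow> 'k \<Rightarrow> bool"
  where "has_trace V f t \<longleftrightarrow> (\<exists>B M. finite B \<and> vectorspace.basis class_ring V B \<and>
    (\<forall>b\<in>B. f b = module.lincomb V (\<lambda>b'. M b' b) B) \<and> t = (\<Sum>b\<in>B. M b b))"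


section \<open>The orbit configuration space of the punctured plane\<close>

abbreviation Zmod :: "nat \<Rightarrow> int monoid"
  where "Zmod d \<equiv> integer_mod_group d"

definition root_act :: "nat \<Rightarrow> int \<Rightarrow> complex \<Rightarrow> complex"
  where "root_act d k z = cis (2 * pi * of_int k / of_nat d) * z"

text \<open>Points are functions on \<open>{..<n}\<close>, extended by \<open>undefined\<close>; with the product topology
  on the type \<open>nat \<Rightarrow> complex\<close> they form a copy of a subspace of \<open>n\<close>-dimensional complex
  space.\<close>

definition orbit_config :: "nat \<Rightarrow> nat \<Rightarrow> (nat \<Rightarrow> complex) set"
  where "orbit_config d n = {v \<in> {..<n} \<rightarrow>\<^sub>E (UNIV - {0}).
    \<forall>i<n. \<forall>j<n. i \<noteq> j \<longrightarrow>
      Group_Action.orbit (Zmod d) (root_act d) (v i) \<inter>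
      Group_Action.orbit (Zmod d) (root_act d) (v j) = {}}"

definition wreath_act ::
  "nat \<Rightarrow> nat \<Rightarrow> (nat \<Rightarrow> int) \<times> (nat \<Rightarrow> nat) \<Rightarrow> (nat \<Rightarrow> complex) \<Rightarrow> (nat \<Rightarrow> complex)"
  where "wreath_act d n = (\<lambda>(g, \<sigma>) v. \<lambda>i\<in>{..<n}. root_act d (g i) (v (inv_into UNIV \<sigma> i)))"

definition pure_monomial_braid_group ::
  "nat \<Rightarrow> nat \<Rightarrow> (nat \<Rightarrow> complex) \<Rightarrow> (real \<Rightarrow> nat \<Rightarrow> complex) set monoid"
  where "pure_monomial_braid_group d n x = fundamental_group (orbit_config d n) x"

definition primitive_root_of_unity :: "nat \<Rightarrow> 'k::field \<Rightarrow> bool"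
  where "primitive_root_of_unity d z \<longleftrightarrow> z ^ d = 1 \<and> (\<forall>j. 0 < j \<and> j < d \<longrightarrow> z ^ j \<noteq> 1)"

text \<open>The action of \<open>w\<close> on the degree \<open>i\<close> piece, computed at the base point \<open>x\<close> with the
  help of a path \<open>\<gamma>\<close> from \<open>x\<close> to \<open>w x\<close>; it does not depend on \<open>\<gamma>\<close>.\<close>

definition gr_braid_action ::
  "nat \<Rightarrow> nat \<Rightarrow> (nat \<Rightarrow> complex) \<Rightarrow> nat \<Rightarrow> (real \<Rightarrow> nat \<Rightarrow> complex)
    \<Rightarrow> (nat \<Rightarrow> int) \<times> (nat \<Rightarrow> nat)
    \<Rightarrow> ((real \<Rightarrow> nat \<Rightarrow> complex) set set \<times> 'k::field \<Rightarrow>\<^sub>0 int) set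
    \<Rightarrow> ((real \<Rightarrow> nat \<Rightarrow> complex) set set \<times> 'k \<Rightarrow>\<^sub>0 int) set"
  where "gr_braid_action d n x i \<gamma> w =
    gr_map (pure_monomial_braid_group d n x) i
      (fundamental_group_map (orbit_config d n) \<gamma> (wreath_act d n w))"

end

theory Submission
  imports Defs "HOL-Complex_Analysis.Complex_Analysis"
begin

text \<open>
  Keeping the coordinates in \<open>T\<close> and moving all others far out along fixed distinct rays gives self-maps \<open>ins d S T\<close>
  of the configuration space of \<open>S\<close> with \<open>e\<^sub>T e\<^sub>U \<simeq> e\<^sub>T\<^sub>\<inter>\<^sub>U\<close>, hence commuting idempotents of
  every \<open>gr\<^sup>i\<close>. By Moebius inversion the trace of \<open>w\<close> is the sum over \<open>A \<subseteq> {..<n}\<close> of the cumulants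
  \<open>\<Sum>T\<subseteq>A. (-1)\<^bsup>|A - T|\<^esup> tr (e\<^sub>T w)\<close>.
  The cumulant vanishes if \<open>A\<close> is not \<open>w\<close>-stable, because by cyclicity of the trace \<open>tr (e\<^sub>T w)\<close> only depends on the largest
  stable subset of \<open>T\<close>. It vanishes if \<open>|A| > 2 i\<close>, because \<open>gr\<^sup>i\<close> is spanned by \<open>i\<close>-fold
  commutators of meridians, each involving at most two points. Otherwise it is computed inside the configuration space of \<open>A\<close>
  and depends only on the labelled cycle type of \<open>w\<close> on \<open>A\<close>, and the number of stable \<open>A\<close> of a given type is a product of
  binomial coefficients in the cycle counts.

  The generation of the abelianization by meridians is proved by adding one point at a time: a van Kampen argument on a cover by
  convex boxes, each of which avoids the new hyperplanes or lies in a tube around one of them.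
\<close>

section \<open>The lower central series\<close>

text \<open>The insertion maps keep no base point and compose only up to homotopy. Homotopic maps
  induce homomorphisms that differ by an inner automorphism, and inner automorphisms act trivially
  on each graded piece; hence identities between traces can be read off from free homotopies, with
  any choice of base points and connecting paths. No presentation, basis or dimension of the graded
  pieces is computed. Generation of the abelianization by finitely many meridians gives finite
  dimension, so that traces exist, and a spanning set of commutators. The winding numbers of the
  linear forms are dual to the meridians, so that membership in the commutator subgroup can be
  tested numerically. In this way a projection that keeps the points of a meridian is seen to fix
  its class in the abelianization, and an iterated commutator, taken in the graded piece, depends
  only on such classes.\<close>

declare lower_central.simps(3) [simp del]

context group begin

lemma cancel_inv:
  assumes "x \<in> carrier G" "y \<in> carrier G"
  shows "x \<otimes> (inv x \<otimes> y) = y" "inv x \<otimes> (x \<otimes> y) = y"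
  using assms by (simp_all add: m_assoc[symmetric])

lemmas group_word_simps = m_assoc inv_mult_group cancel_inv

end

lemma (in comm_group) comm_word:
  assumes "x \<in> carrier G" "y \<in> carrier G"
  shows "x \<otimes> y \<otimes> inv x \<otimes> inv y = \<one>"
  using assms m_comm[of x y] by (simp add: m_assoc)

text \<open>The lower central series is declared for plain \<open>monoid\<close> records, without
  extension fields; the locale fixes this type.\<close>

locale plain_group = group G for G :: "'a monoid" (structure)
begin

text \<open>Conjugation carries a commutator to the commutator of the conjugates, so the generating
  set of the next term is stable under it. Two consecutive terms are treated at once because the
  recursion has two base cases.\<close>

lemma subgroup_lower_central_normal:
  "lower_central G j \<lhd> G \<and> lower_central G (Suc j) \<lhd> G"
proof (induction j)
  case 0
  then show ?case
    by (auto simp: normal_inv_iff subgroup_self)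
next
  case (Suc j)
  let ?N = "lower_central G (Suc j)"
  let ?S = "{h \<otimes> k \<otimes> inv h \<otimes> inv k | h k. h \<in> ?N \<and> k \<in> carrier G}"
  have N: "?N \<lhd> G" using Suc by auto
  then have sub: "?N \<subseteq> carrier G" by (simp add: normal_imp_subgroup subgroup.subset)
  have "generate G ?S \<lhd> G"
  proof (rule normal_generateI)
    show "?S \<subseteq> carrier G" using sub by auto
    fix h g assume h: "h \<in> ?S" and g: "g \<in> carrier G"
    then obtain a b where ab: "a \<in> ?N" "b \<in> carrier G" "h = a \<otimes> b \<otimes> inv a \<otimes> inv b" by auto
    have a: "a \<in> carrier G" using ab sub by auto
    let ?a = "g \<otimes> a \<otimes> inv g" and ?b = "g \<otimes> b \<otimes> inv g"
    have "?a \<in> ?N" using N ab g by (simp add: normal_inv_iff)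
    moreover have "g \<otimes> h \<otimes> inv g = ?a \<otimes> ?b \<otimes> inv ?a \<otimes> inv ?b"
      using a ab g by (simp add: group_word_simps)
    ultimately show "g \<otimes> h \<otimes> inv g \<in> ?S" using ab g by blast
  qed
  then show ?case using N by (simp add: commutator_subgroup_def lower_central.simps(3))
qed

lemma lower_central_normal: "lower_central G j \<lhd> G"
  using subgroup_lower_central_normal by blast

lemma lower_central_subgroup: "subgroup (lower_central G j) G"
  using lower_central_normal by (rule normal_imp_subgroup)

lemma lower_central_subset: "lower_central G j \<subseteq> carrier G"
  using lower_central_subgroup by (rule subgroup.subset)

lemma lower_central_carrier: "x \<in> lower_central G j \<Longrightarrow> x \<in> carrier G"
  using lower_central_subset by blast

lemma lower_central_commutator:
  assumes "h \<in> lower_central G (Suc j)" "k \<in> carrier G"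
  shows "h \<otimes> k \<otimes> inv h \<otimes> inv k \<in> lower_central G (Suc (Suc j))"
  using assms by (auto simp: commutator_subgroup_def lower_central.simps(3) intro!: generate.incl)

lemma lower_central_antimono: "lower_central G (Suc j) \<subseteq> lower_central G j"
proof (cases j)
  case (Suc i)
  let ?N = "lower_central G (Suc i)"
  have N: "?N \<lhd> G" by (rule lower_central_normal)
  have "generate G {h \<otimes> k \<otimes> inv h \<otimes> inv k | h k. h \<in> ?N \<and> k \<in> carrier G} \<subseteq> ?N"
  proof (rule generate_subgroup_incl[OF _ lower_central_subgroup], clarify)
    fix h k assume h: "h \<in> ?N" and k: "k \<in> carrier G"
    have hc: "h \<in> carrier G" using h by (rule lower_central_carrier)
    have "k \<otimes> inv h \<otimes> inv k \<in> ?N"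
      using N h k by (simp add: normal_inv_iff subgroup.m_inv_closed)
    then have "h \<otimes> (k \<otimes> inv h \<otimes> inv k) \<in> ?N"
      using h lower_central_subgroup by (simp add: subgroup.m_closed)
    then show "h \<otimes> k \<otimes> inv h \<otimes> inv k \<in> ?N" using hc k by (simp add: m_assoc)
  qed
  then show ?thesis unfolding Suc by (simp add: commutator_subgroup_def lower_central.simps(3))
qed (auto simp: lower_central_subset)

lemma rcoset_eq_iff:
  assumes "subgroup N G" "x \<in> carrier G" "y \<in> carrier G"
  shows "N #> x = N #> y \<longleftrightarrow> x \<otimes> inv y \<in> N"
proof
  assume "N #> x = N #> y"
  then have "x \<in> N #> y" using rcos_self[OF assms(2,1)] by simp
  then obtain n where n: "n \<in> N" "x = n \<otimes> y" by (auto simp: r_coset_def)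
  then show "x \<otimes> inv y \<in> N" using assms subgroup.mem_carrier[OF assms(1)]
    by (simp add: m_assoc)
next
  assume *: "x \<otimes> inv y \<in> N"
  have "x \<in> N #> y"
    unfolding r_coset_def using * assms by (auto intro!: bexI[of _ "x \<otimes> inv y"] simp: m_assoc)
  then show "N #> x = N #> y" using repr_independence assms by metis
qed

lemma rcoset_commutator:
  assumes N: "N \<lhd> G" and "x \<in> carrier G" "y \<in> carrier G"
    and "x \<otimes> y \<otimes> inv x \<otimes> inv y \<in> N"
  shows "N #> (x \<otimes> y) = N #> (y \<otimes> x)"
  using assms by (simp add: rcoset_eq_iff normal_imp_subgroup inv_mult_group m_assoc)

text \<open>This is why inner automorphisms act trivially on the graded pieces, so that base points
  and connecting paths may be changed freely later on.\<close>

lemma lower_central_conj_rcoset: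
  assumes "h \<in> lower_central G (Suc j)" "k \<in> carrier G"
  shows "lower_central G (Suc (Suc j)) #> (k \<otimes> h \<otimes> inv k) = lower_central G (Suc (Suc j)) #> h"
proof -
  let ?N = "lower_central G (Suc (Suc j))"
  have h: "h \<in> carrier G" using assms lower_central_carrier by blast
  have "h \<otimes> k \<otimes> inv h \<otimes> inv k \<in> ?N" using assms by (rule lower_central_commutator)
  then have "inv (h \<otimes> k \<otimes> inv h \<otimes> inv k) \<in> ?N"
    by (rule subgroup.m_inv_closed[OF lower_central_subgroup])
  then have "(k \<otimes> h \<otimes> inv k) \<otimes> inv h \<in> ?N" using h assms by (simp add: inv_mult_group m_assoc)
  then show ?thesis using h assms lower_central_subgroup by (simp add: rcoset_eq_iff)
qed

lemma lower_central_quotient_simps: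
  "carrier (lower_central_quotient G j) = {lower_central G (Suc j) #> x | x. x \<in> lower_central G j}"
  "\<one>\<^bsub>lower_central_quotient G j\<^esub> = lower_central G (Suc j)"
  by (auto simp: lower_central_quotient_def FactGroup_def RCOSETS_def r_coset_def)

lemma lower_central_quotient_mult:
  assumes "x \<in> carrier G" "y \<in> carrier G"
  shows "(lower_central G (Suc j) #> x) \<otimes>\<^bsub>lower_central_quotient G j\<^esub> (lower_central G (Suc j) #> y)
      = lower_central G (Suc j) #> (x \<otimes> y)"
  using normal.rcos_sum[OF lower_central_normal assms]
  by (simp add: lower_central_quotient_def FactGroup_def set_mult_def)

lemma lower_central_quotient_comm_group:
  "comm_group (lower_central_quotient G (Suc j))"
proof -
  have "lower_central G (Suc (Suc j)) \<lhd> G\<lparr>carrier := lower_central G (Suc j)\<rparr>"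
    by (rule normal_restrict_supergroup[OF lower_central_subgroup lower_central_normal
          lower_central_antimono])
  then have grp: "group (lower_central_quotient G (Suc j))"
    unfolding lower_central_quotient_def by (rule normal.factorgroup_is_group)
  show ?thesis
  proof (rule group.group_comm_groupI[OF grp])
    fix U V assume "U \<in> carrier (lower_central_quotient G (Suc j))"
      "V \<in> carrier (lower_central_quotient G (Suc j))"
    then obtain x y where xy: "x \<in> lower_central G (Suc j)" "y \<in> lower_central G (Suc j)"
      "U = lower_central G (Suc (Suc j)) #> x" "V = lower_central G (Suc (Suc j)) #> y"
      unfolding lower_central_quotient_simps by auto
    then show "U \<otimes>\<^bsub>lower_central_quotient G (Suc j)\<^esub> V = V \<otimes>\<^bsub>lower_central_quotient G (Suc j)\<^esub> U"
      using lower_central_carrier rcoset_commutator lower_central_normal lower_central_commutator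
      by (simp add: lower_central_quotient_mult)
  qed
qed

text \<open>The list is read from its end: the head is the entry bracketed last. It stands on the
  right, as the new factor does in the recursion of \<open>lower_central\<close>.\<close>

fun left_normed :: "'a list \<Rightarrow> 'a" where
  "left_normed [] = \<one>"
| "left_normed [x] = x"
| "left_normed (x # y # xs) =
    left_normed (y # xs) \<otimes> x \<otimes> inv (left_normed (y # xs)) \<otimes> inv x"

lemma left_normed_lower_central:
  "\<lbrakk>set xs \<subseteq> carrier G; xs \<noteq> []\<rbrakk> \<Longrightarrow> left_normed xs \<in> lower_central G (length xs)"
proof (induction xs rule: left_normed.induct)
  case (3 x y xs)
  then have "left_normed (y # xs) \<in> lower_central G (Suc (length xs))" by simp
  from lower_central_commutator[OF this, of x] "3.prems" show ?case by simp
qed auto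

lemma commutator_mult_left:
  assumes "a \<in> carrier G" "b \<in> carrier G" "k \<in> carrier G"
  shows "(a \<otimes> b) \<otimes> k \<otimes> inv (a \<otimes> b) \<otimes> inv k
    = a \<otimes> (b \<otimes> k \<otimes> inv b \<otimes> inv k) \<otimes> inv a \<otimes> (a \<otimes> k \<otimes> inv a \<otimes> inv k)"
  using assms by (simp add: group_word_simps)

lemma commutator_mult_right:
  assumes "a \<in> carrier G" "k \<in> carrier G" "l \<in> carrier G"
  shows "a \<otimes> (k \<otimes> l) \<otimes> inv a \<otimes> inv (k \<otimes> l)
    = (a \<otimes> k \<otimes> inv a \<otimes> inv k) \<otimes> (k \<otimes> (a \<otimes> l \<otimes> inv a \<otimes> inv l) \<otimes> inv k)"
  using assms by (simp add: group_word_simps)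


lemma commutator_inv_left:
  assumes "a \<in> carrier G" "k \<in> carrier G"
  shows "inv a \<otimes> k \<otimes> inv (inv a) \<otimes> inv k = inv a \<otimes> inv (a \<otimes> k \<otimes> inv a \<otimes> inv k) \<otimes> inv (inv a)"
  using assms by (simp add: group_word_simps)

lemma commutator_inv_right:
  assumes "a \<in> carrier G" "k \<in> carrier G"
  shows "a \<otimes> inv k \<otimes> inv a \<otimes> inv (inv k) = inv k \<otimes> inv (a \<otimes> k \<otimes> inv a \<otimes> inv k) \<otimes> inv (inv k)"
  using assms by (simp add: group_word_simps)

lemma hom_comm_group_derived:
  assumes "comm_group A" "f \<in> hom G A" "x \<in> lower_central G 2"
  shows "f x = \<one>\<^bsub>A\<^esub>"
proof -
  interpret A: comm_group A by fact
  interpret f: group_hom G A f by standard (use assms in auto)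
  have "x \<in> generate G {h \<otimes> k \<otimes> inv h \<otimes> inv k | h k. h \<in> carrier G \<and> k \<in> carrier G}"
    using assms(3) by (simp add: numeral_2_eq_2 commutator_subgroup_def lower_central.simps(3))
  moreover have "generate G {h \<otimes> k \<otimes> inv h \<otimes> inv k | h k. h \<in> carrier G \<and> k \<in> carrier G}
      \<subseteq> kernel G A f"
    by (rule generate_subgroup_incl[OF _ f.subgroup_kernel])
      (auto simp: kernel_def A.comm_word)
  ultimately show ?thesis by (auto simp: kernel_def)
qed

text \<open>For fixed \<open>h\<close> the commutator with \<open>k\<close> is, modulo the target
  term, a homomorphism in \<open>k\<close> to an abelian group, so it kills the derived subgroup.
  This replaces an appeal to the three subgroups lemma.\<close>

lemma commutator_derived:
  assumes h: "h \<in> lower_central G (Suc j)" and k: "k \<in> lower_central G 2"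
  shows "h \<otimes> k \<otimes> inv h \<otimes> inv k \<in> lower_central G (Suc (Suc (Suc j)))"
proof -
  let ?Q = "lower_central_quotient G (Suc (Suc j))" and ?N = "lower_central G (Suc (Suc (Suc j)))"
  let ?c = "\<lambda>k. h \<otimes> k \<otimes> inv h \<otimes> inv k"
  have hc: "h \<in> carrier G" using h by (rule lower_central_carrier)
  have c: "?c k \<in> lower_central G (Suc (Suc j))" if "k \<in> carrier G" for k
    using lower_central_commutator[OF h that] .
  have "(\<lambda>k. ?N #> ?c k) \<in> hom G ?Q"
  proof (rule homI)
    fix k assume "k \<in> carrier G"
    then show "?N #> ?c k \<in> carrier ?Q"
      unfolding lower_central_quotient_simps using c by blast
  next
    fix k l assume kl: "k \<in> carrier G" "l \<in> carrier G"
    have cc: "?c k \<in> carrier G" "?c l \<in> carrier G" using kl hc by auto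
    have "?N #> ?c (k \<otimes> l) = ?N #> (?c k \<otimes> (k \<otimes> ?c l \<otimes> inv k))"
      using commutator_mult_right[OF hc kl] by simp
    also have "\<dots> = (?N #> ?c k) \<otimes>\<^bsub>?Q\<^esub> (?N #> (k \<otimes> ?c l \<otimes> inv k))"
      using cc kl by (intro lower_central_quotient_mult[symmetric]) auto
    \<comment> \<open>\<open>?c l\<close> is already one step deeper than \<open>h\<close>, so
      conjugating it by \<open>k\<close> is invisible modulo \<open>?N\<close>.\<close>
    also have "?N #> (k \<otimes> ?c l \<otimes> inv k) = ?N #> ?c l"
      by (rule lower_central_conj_rcoset[OF c kl(1)]) fact
    finally show "?N #> ?c (k \<otimes> l) = (?N #> ?c k) \<otimes>\<^bsub>?Q\<^esub> (?N #> ?c l)" .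
  qed
  from hom_comm_group_derived[OF lower_central_quotient_comm_group this k]
  have "?N #> ?c k = ?N #> \<one>" using lower_central_subset
    by (simp add: lower_central_quotient_simps coset_mult_one)
  then have "?c k \<otimes> inv \<one> \<in> ?N"
    using rcoset_eq_iff[OF lower_central_subgroup, of "?c k" \<one>] hc k lower_central_carrier
    by auto
  then show ?thesis using hc k lower_central_carrier[of k 2] by simp
qed

text \<open>Modulo the next term a commutator is bilinear, so commutators of generators of the
  previous term with elements of \<open>F\<close> suffice. The proof fixes the target
  \<open>?L\<close> and shows, one argument at a time, that the elements whose commutators land in
  \<open>?L\<close> form a subgroup.\<close>

lemma lower_central_generate:
  assumes F: "F \<subseteq> carrier G" and gen: "carrier G = generate G (F \<union> lower_central G 2)"
  shows "lower_central G (Suc j) = generate G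
    ({left_normed xs | xs. length xs = Suc j \<and> set xs \<subseteq> F} \<union> lower_central G (Suc (Suc j)))"
proof (induction j)
  case 0
  have "{left_normed xs | xs. length xs = Suc 0 \<and> set xs \<subseteq> F} = F"
    by (force simp: length_Suc_conv)
  then show ?case using gen by (simp add: numeral_2_eq_2)
next
  case (Suc j)
  let ?N = "\<lambda>i. lower_central G (Suc (i + j))"
  let ?C = "\<lambda>i. {left_normed xs | xs. length xs = Suc (i + j) \<and> set xs \<subseteq> F}"
  let ?L = "generate G (?C 1 \<union> ?N 2)"
  have C: "?C i \<subseteq> ?N i" for i
    using left_normed_lower_central F by force
  have CN: "?C 1 \<union> ?N 2 \<subseteq> ?N 1"
    using C[of 1] lower_central_antimono[of "Suc (Suc j)"] by simp
  then have CNc: "?C 1 \<union> ?N 2 \<subseteq> carrier G" using lower_central_subset by blast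
  have L: "subgroup ?L G" by (rule generate_is_subgroup[OF CNc])
  have LN: "?L \<subseteq> ?N 1" by (rule generate_subgroup_incl[OF CN lower_central_subgroup])
  \<comment> \<open>\<open>?L\<close> lies between two consecutive terms of the series, so a
    conjugate of its element differs from that element by something in the deeper term.\<close>
  have conj: "k \<otimes> l \<otimes> inv k \<in> ?L" if "l \<in> ?L" "k \<in> carrier G" for k l
  proof -
    have l: "l \<in> ?N 1" "l \<in> carrier G" using that LN lower_central_subset by blast+
    have "l \<otimes> k \<otimes> inv l \<otimes> inv k \<in> ?N 2"
      using lower_central_commutator[of l "Suc j" k] l that by simp
    then have "l \<otimes> k \<otimes> inv l \<otimes> inv k \<in> ?L" by (simp add: generate.incl)
    from subgroup.m_closed[OF L subgroup.m_inv_closed[OF L this] that(1)]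
    show ?thesis using l that by (simp add: group_word_simps)
  qed
  \<comment> \<open>\<open>K h\<close> collects the second arguments admissible for one
    \<open>h\<close>; \<open>M\<close> below collects the first arguments admissible against the
    whole group. Elements of the derived subgroup enter \<open>K h\<close> through
    \<open>commutator_derived\<close>.\<close>
  define K where "K = (\<lambda>h. {k \<in> carrier G. h \<otimes> k \<otimes> inv h \<otimes> inv k \<in> ?L})"
  have K: "subgroup (K h) G" if h: "h \<in> carrier G" for h
  proof (rule subgroupI)
    show "K h \<noteq> {}" using h subgroup.one_closed[OF L] by (auto simp: K_def intro!: exI[of _ \<one>])
    fix k assume "k \<in> K h"
    then show "inv k \<in> K h"
      using h commutator_inv_right[of h k] conj[of "inv (h \<otimes> k \<otimes> inv h \<otimes> inv k)" "inv k"]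
        subgroup.m_inv_closed[OF L] by (auto simp: K_def)
    fix l assume "l \<in> K h"
    with \<open>k \<in> K h\<close> show "k \<otimes> l \<in> K h"
      using h commutator_mult_right[of h k l] conj[of "h \<otimes> l \<otimes> inv h \<otimes> inv l" k]
        subgroup.m_closed[OF L] by (auto simp: K_def)
  qed (auto simp: K_def)
  define M where "M = {h \<in> carrier G. \<forall>k\<in>carrier G. h \<otimes> k \<otimes> inv h \<otimes> inv k \<in> ?L}"
  have M: "subgroup M G"
  proof (rule subgroupI)
    show "M \<noteq> {}" using subgroup.one_closed[OF L] by (auto simp: M_def intro!: exI[of _ \<one>])
    fix h assume "h \<in> M"
    then show "inv h \<in> M"
      using commutator_inv_left[of h] conj[of _ "inv h"] subgroup.m_inv_closed[OF L]
      by (auto simp: M_def)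
    fix h' assume "h' \<in> M"
    with \<open>h \<in> M\<close> show "h \<otimes> h' \<in> M"
      using commutator_mult_left[of h h'] conj[of _ h] subgroup.m_closed[OF L] by (auto simp: M_def)
  qed (auto simp: M_def)
  have "?C 0 \<union> ?N 1 \<subseteq> M"
  proof
    fix h assume h: "h \<in> ?C 0 \<union> ?N 1"
    show "h \<in> M"
    proof (cases "h \<in> ?N 1")
      case True
      then have "h \<otimes> k \<otimes> inv h \<otimes> inv k \<in> ?L" if "k \<in> carrier G" for k
        using lower_central_commutator[of h "Suc j" k] that
        by (auto intro!: generate.incl)
      then show ?thesis using True lower_central_carrier by (auto simp: M_def)
    next
      case False
      then obtain xs where xs: "h = left_normed xs" "length xs = Suc j" "set xs \<subseteq> F" using h by auto
      have hN: "h \<in> lower_central G (Suc j)" using left_normed_lower_central[of xs] xs F by force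
      have hc: "h \<in> carrier G" using hN by (rule lower_central_carrier)
      have "F \<union> lower_central G 2 \<subseteq> K h"
      proof (intro Un_least subsetI)
        fix x assume x: "x \<in> F"
        obtain y ys where "xs = y # ys" using xs by (cases xs) auto
        then have "h \<otimes> x \<otimes> inv h \<otimes> inv x = left_normed (x # xs)" using xs by simp
        moreover have "left_normed (x # xs) \<in> ?C 1" using x xs by (auto intro!: exI[of _ "x # xs"])
        ultimately show "x \<in> K h" using x F by (auto simp: K_def intro!: generate.incl)
      next
        fix x assume "x \<in> lower_central G 2"
        then show "x \<in> K h"
          using commutator_derived[OF hN] lower_central_carrier
          by (auto simp: K_def intro!: generate.incl)
      qed
      then have "carrier G \<subseteq> K h" using generate_subgroup_incl[OF _ K[OF hc]] gen by metis
      then show ?thesis using hc by (auto simp: M_def K_def)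
    qed
  qed
  then have "generate G (?C 0 \<union> ?N 1) \<subseteq> M" by (rule generate_subgroup_incl[OF _ M])
  then have NM: "lower_central G (Suc j) \<subseteq> M" using Suc.IH by simp
  have "lower_central G (Suc (Suc j)) \<subseteq> ?L"
    unfolding lower_central.simps commutator_subgroup_def
    using NM by (intro generate_subgroup_incl[OF _ L]) (auto simp: M_def)
  then show ?case using LN by auto
qed

end

section \<open>Functoriality of the lower central series\<close>

lemma hom_lower_central:
  assumes "group G" "group H" "\<phi> \<in> hom G H" "x \<in> lower_central G j"
  shows "\<phi> x \<in> lower_central H j"
proof -
  interpret G: plain_group G using assms by (simp add: plain_group_def)
  interpret H: plain_group H using assms by (simp add: plain_group_def)
  interpret \<phi>: group_hom G H \<phi> by standard (use assms in auto)
  have "\<phi> ` lower_central G j \<subseteq> lower_central H j"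
  proof (induction j rule: induct_nat_012)
    case (ge2 j)
    let ?S = "{h \<otimes>\<^bsub>G\<^esub> k \<otimes>\<^bsub>G\<^esub> inv\<^bsub>G\<^esub> h \<otimes>\<^bsub>G\<^esub> inv\<^bsub>G\<^esub> k | h k. h \<in> lower_central G (Suc j) \<and> k \<in> carrier G}"
    have S: "?S \<subseteq> carrier G" using G.lower_central_carrier by auto
    have "\<phi> ` ?S \<subseteq> {h \<otimes>\<^bsub>H\<^esub> k \<otimes>\<^bsub>H\<^esub> inv\<^bsub>H\<^esub> h \<otimes>\<^bsub>H\<^esub> inv\<^bsub>H\<^esub> k | h k. h \<in> lower_central H (Suc j) \<and> k \<in> carrier H}"
    proof (clarify)
      fix h k assume h: "h \<in> lower_central G (Suc j)" and k: "k \<in> carrier G"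
      have "h \<in> carrier G" using h by (rule G.lower_central_carrier)
      then show "\<exists>h' k'. \<phi> (h \<otimes>\<^bsub>G\<^esub> k \<otimes>\<^bsub>G\<^esub> inv\<^bsub>G\<^esub> h \<otimes>\<^bsub>G\<^esub> inv\<^bsub>G\<^esub> k)
          = h' \<otimes>\<^bsub>H\<^esub> k' \<otimes>\<^bsub>H\<^esub> inv\<^bsub>H\<^esub> h' \<otimes>\<^bsub>H\<^esub> inv\<^bsub>H\<^esub> k' \<and> h' \<in> lower_central H (Suc j) \<and> k' \<in> carrier H"
        using ge2(2) h k by (intro exI[of _ "\<phi> h"] exI[of _ "\<phi> k"]) auto
    qed
    then have "generate H (\<phi> ` ?S) \<subseteq> lower_central H (Suc (Suc j))"
      unfolding lower_central.simps commutator_subgroup_def by (rule H.mono_generate)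
    then show ?case using \<phi>.generate_img[OF S] by (simp add: commutator_subgroup_def lower_central.simps(3))
  qed auto
  then show ?thesis using assms by blast
qed

text \<open>Turns the set product used in the definitions of quotient maps into the coset of the
  image, both for the lower central quotients and for the tensor relations.\<close>

lemma set_mult_image_rcoset:
  assumes "group G" "group H" "\<phi> \<in> hom G H" "x \<in> carrier G"
    and M: "subgroup M G" and N: "subgroup N H" and sub: "\<phi> ` M \<subseteq> N"
  shows "N <#>\<^bsub>H\<^esub> (\<phi> ` (M #>\<^bsub>G\<^esub> x)) = N #>\<^bsub>H\<^esub> \<phi> x"
proof -
  interpret G: group G by fact
  interpret H: group H by fact
  interpret \<phi>: group_hom G H \<phi> by standard (use assms in auto)
  have *: "m \<in> carrier G" "\<phi> m \<in> N" if "m \<in> M" for m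
    using that sub subgroup.mem_carrier[OF M] by auto
  show ?thesis
  proof (rule equalityI; rule subsetI)
    fix z assume "z \<in> N <#>\<^bsub>H\<^esub> (\<phi> ` (M #>\<^bsub>G\<^esub> x))"
    then obtain n m where nm: "z = n \<otimes>\<^bsub>H\<^esub> \<phi> (m \<otimes>\<^bsub>G\<^esub> x)" "n \<in> N" "m \<in> M"
      by (auto simp: set_mult_def r_coset_def)
    then have "z = (n \<otimes>\<^bsub>H\<^esub> \<phi> m) \<otimes>\<^bsub>H\<^esub> \<phi> x"
      using * assms(4) subgroup.mem_carrier[OF N] by (simp add: H.m_assoc)
    then show "z \<in> N #>\<^bsub>H\<^esub> \<phi> x"
      using nm * subgroup.m_closed[OF N] by (auto simp: r_coset_def)
  next
    fix z assume "z \<in> N #>\<^bsub>H\<^esub> \<phi> x"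
    then obtain n where n: "n \<in> N" "z = n \<otimes>\<^bsub>H\<^esub> \<phi> x" by (auto simp: r_coset_def)
    have "x \<in> M #>\<^bsub>G\<^esub> x" using G.rcos_self[OF assms(4) M] .
    then show "z \<in> N <#>\<^bsub>H\<^esub> (\<phi> ` (M #>\<^bsub>G\<^esub> x))" using n by (force simp: set_mult_def)
  qed
qed

lemma lower_central_quotient_map_rcoset:
  assumes "group G" "group H" "\<phi> \<in> hom G H" "x \<in> carrier G"
  shows "lower_central_quotient_map H j \<phi> (lower_central G (Suc j) #>\<^bsub>G\<^esub> x)
    = lower_central H (Suc j) #>\<^bsub>H\<^esub> \<phi> x"
  unfolding lower_central_quotient_map_def
  using assms hom_lower_central[OF assms(1-3)]
  by (intro set_mult_image_rcoset) (auto simp: plain_group_def intro!: plain_group.lower_central_subgroup)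

section \<open>Tensor products with a field\<close>

lemma frag_extend_hom:
  assumes "\<And>x. x \<in> S \<Longrightarrow> Poly_Mapping.keys (f x) \<subseteq> T"
  shows "frag_extend f \<in> hom (free_Abelian_group S) (free_Abelian_group T)"
proof (rule homI)
  fix x assume "x \<in> carrier (free_Abelian_group S)"
  then show "frag_extend f x \<in> carrier (free_Abelian_group T)"
    using assms keys_frag_extend[of f x] by fastforce
qed (simp add: frag_extend_add)

definition pure_tensor :: "'a monoid \<Rightarrow> 'a \<Rightarrow> 'k::field \<Rightarrow> ('a \<times> 'k \<Rightarrow>\<^sub>0 int) set" where
  "pure_tensor A a c = tensor_relations A #>\<^bsub>tensor_free A\<^esub> frag_of (a, c)"

text \<open>The field occurs only as a type, so an \<open>itself\<close> parameter carries it into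
  the locale.\<close>

locale tensor_base = comm_group A for A :: "'a monoid" +
  fixes K :: "'k::field itself"
begin

abbreviation F :: "('a \<times> 'k \<Rightarrow>\<^sub>0 int) monoid" where "F \<equiv> tensor_free A"
abbreviation R :: "('a \<times> 'k \<Rightarrow>\<^sub>0 int) set" where "R \<equiv> tensor_relations A"
abbreviation V :: "('k, ('a \<times> 'k \<Rightarrow>\<^sub>0 int) set) module" where "V \<equiv> tensor_field A"
abbreviation cls :: "('a \<times> 'k \<Rightarrow>\<^sub>0 int) \<Rightarrow> ('a \<times> 'k \<Rightarrow>\<^sub>0 int) set" where "cls x \<equiv> R #>\<^bsub>F\<^esub> x"
abbreviation sc :: "'k \<Rightarrow> ('a \<times> 'k \<Rightarrow>\<^sub>0 int) \<Rightarrow> ('a \<times> 'k \<Rightarrow>\<^sub>0 int)"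
  where "sc s \<equiv> frag_extend (\<lambda>(a, c). frag_of (a, s * c))"

lemma F_closed: "x \<in> carrier F \<Longrightarrow> y \<in> carrier F \<Longrightarrow> x + y \<in> carrier F" "x \<in> carrier F \<Longrightarrow> - x \<in> carrier F"
    "0 \<in> carrier F" "a \<in> carrier A \<Longrightarrow> frag_of (a, c) \<in> carrier F"
    "x \<in> carrier F \<Longrightarrow> y \<in> carrier F \<Longrightarrow> x - y \<in> carrier F"
  using keys_add[of x y] keys_diff[of x y] by auto

lemma R_sub: "subgroup R F"
  unfolding tensor_relations_def
proof (rule group.generate_is_subgroup)
  show "{frag_of (a \<otimes>\<^bsub>A\<^esub> b, c) - frag_of (a, c) - frag_of (b, c) | a b c. a \<in> carrier A \<and> b \<in> carrier A}
     \<union> {frag_of (a, c + c') - frag_of (a, c) - frag_of (a, c') | a c c'. a \<in> carrier A}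
    \<subseteq> carrier (tensor_free A :: ('a \<times> 'k \<Rightarrow>\<^sub>0 int) monoid)"
    using F_closed(4,5) m_closed by (auto simp del: carrier_free_Abelian_group_iff)
qed simp

lemma R_closed: "x \<in> R \<Longrightarrow> y \<in> R \<Longrightarrow> x + y \<in> R" "x \<in> R \<Longrightarrow> - x \<in> R" "0 \<in> R"
    "x \<in> R \<Longrightarrow> y \<in> R \<Longrightarrow> x - y \<in> R"
proof -
  show 1: "x \<in> R \<Longrightarrow> y \<in> R \<Longrightarrow> x + y \<in> R" for x y using subgroup.m_closed[OF R_sub] by simp
  show 2: "x \<in> R \<Longrightarrow> - x \<in> R" for x
    using subgroup.m_inv_closed[OF R_sub, of x] subgroup.mem_carrier[OF R_sub, of x] by simp
  show "0 \<in> R" using subgroup.one_closed[OF R_sub] by simp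
  show "x \<in> R \<Longrightarrow> y \<in> R \<Longrightarrow> x - y \<in> R" using 1[OF _ 2, of x y] by simp
qed

lemma cls_def': "cls x = {r + x | r. r \<in> R}"
  by (auto simp: r_coset_def)

lemma cls_eq_iff: "cls x = cls y \<longleftrightarrow> x - y \<in> R"
proof
  assume "cls x = cls y"
  moreover have "x \<in> cls x" unfolding cls_def' using R_closed(3) by force
  ultimately show "x - y \<in> R" unfolding cls_def' by force
next
  assume *: "x - y \<in> R"
  show "cls x = cls y" unfolding cls_def'
  proof (rule equalityI; rule subsetI)
    fix z assume "z \<in> {r + x | r. r \<in> R}"
    then obtain r where "r \<in> R" "z = r + x" by blast
    then have "r + (x - y) \<in> R" "z = (r + (x - y)) + y" using R_closed(1) * by auto
    then show "z \<in> {r + y | r. r \<in> R}" by blast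
  next
    fix z assume "z \<in> {r + y | r. r \<in> R}"
    then obtain r where "r \<in> R" "z = r + y" by blast
    then have "r - (x - y) \<in> R" "z = (r - (x - y)) + x" using R_closed(4) * by auto
    then show "z \<in> {r + x | r. r \<in> R}" by blast
  qed
qed

lemma F_induct [consumes 1, case_names one minus]:
  assumes "x \<in> carrier F"
    and "\<And>a c. a \<in> carrier A \<Longrightarrow> P (frag_of (a, c))" "\<And>x y. P x \<Longrightarrow> P y \<Longrightarrow> P (x - y)" "P 0"
  shows "P x"
proof -
  have "Poly_Mapping.keys x \<subseteq> carrier A \<times> UNIV" using assms(1) by simp
  then show ?thesis
    by (rule frag_induction) (use assms in auto)
qed

lemma V_carrier: "carrier V = cls ` carrier F"
  by (auto simp: tensor_field_def RCOSETS_def)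

lemma V_zero: "\<zero>\<^bsub>V\<^esub> = cls 0"
  by (auto simp: tensor_field_def cls_def')

lemma V_add: "cls x \<oplus>\<^bsub>V\<^esub> cls y = cls (x + y)"
proof -
  have "{r + x + (s + y) | r s. r \<in> R \<and> s \<in> R} = {r + (x + y) | r. r \<in> R}"
  proof (rule equalityI; rule subsetI)
    fix z assume "z \<in> {r + x + (s + y) | r s. r \<in> R \<and> s \<in> R}"
    then obtain r s where "r \<in> R" "s \<in> R" "z = r + x + (s + y)" by blast
    then have "z = (r + s) + (x + y)" "r + s \<in> R" using R_closed(1) by auto
    then show "z \<in> {r + (x + y) | r. r \<in> R}" by blast
  next
    fix z assume "z \<in> {r + (x + y) | r. r \<in> R}"
    then obtain r where "r \<in> R" "z = r + x + (0 + y)" by (auto simp: add.assoc)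
    then show "z \<in> {r + x + (s + y) | r s. r \<in> R \<and> s \<in> R}" using R_closed(3) by blast
  qed
  moreover have "cls x \<oplus>\<^bsub>V\<^esub> cls y = {r + x + (s + y) | r s. r \<in> R \<and> s \<in> R}"
    unfolding tensor_field_def set_mult_def cls_def' by simp blast
  ultimately show ?thesis by (simp add: cls_def')
qed

text \<open>Serves both scalar multiplication and the maps induced by homomorphisms. Each is given
  on the generating pairs, and the elements sent to relations form a subgroup, so only the two
  families of defining relations have to be checked.\<close>

lemma induced_map:
  assumes A': "comm_group A'" and f: "\<And>a c. a \<in> carrier A \<Longrightarrow> g (a, c) \<in> carrier A' \<times> UNIV"
    and rel: "\<And>a b c. \<lbrakk>a \<in> carrier A; b \<in> carrier A\<rbrakk> \<Longrightarrow>
      frag_of (g (a \<otimes>\<^bsub>A\<^esub> b, c)) - frag_of (g (a, c)) - frag_of (g (b, c)) \<in> tensor_relations A'"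
      "\<And>a c c'. a \<in> carrier A \<Longrightarrow>
      frag_of (g (a, c + c')) - frag_of (g (a, c)) - frag_of (g (a, c')) \<in> tensor_relations A'"
    and x: "x \<in> carrier F"
  shows "tensor_relations A' <#>\<^bsub>tensor_free A'\<^esub> (frag_extend (\<lambda>p. frag_of (g p)) ` cls x)
    = tensor_relations A' #>\<^bsub>tensor_free A'\<^esub> frag_extend (\<lambda>p. frag_of (g p :: 'b \<times> 'k)) x"
proof (rule set_mult_image_rcoset)
  let ?h = "frag_extend (\<lambda>p. frag_of (g p))"
  interpret A': tensor_base A' "TYPE('k)" using A' by (simp add: tensor_base_def)
  show h: "?h \<in> hom F A'.F"
    by (rule frag_extend_hom) (use f in auto)
  interpret P: group F by simp
  have sub: "subgroup {y \<in> carrier F. ?h y \<in> A'.R} F"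
  proof (rule P.subgroupI)
    show "{y \<in> carrier F. ?h y \<in> A'.R} \<noteq> {}" using F_closed(3) A'.R_closed(3) by force
    fix y assume y: "y \<in> {y \<in> carrier F. ?h y \<in> A'.R}"
    then have "- y \<in> carrier F" "?h (- y) \<in> A'.R"
      using F_closed(2) A'.R_closed(2) by (auto simp: frag_extend_minus simp del: carrier_free_Abelian_group_iff)
    then show "inv\<^bsub>F\<^esub> y \<in> {y \<in> carrier F. ?h y \<in> A'.R}" using y by simp
    fix z assume "z \<in> {y \<in> carrier F. ?h y \<in> A'.R}"
    with y have "y + z \<in> carrier F" "?h (y + z) \<in> A'.R"
      using F_closed(1) A'.R_closed(1) by (auto simp: frag_extend_add simp del: carrier_free_Abelian_group_iff)
    then show "y \<otimes>\<^bsub>F\<^esub> z \<in> {y \<in> carrier F. ?h y \<in> A'.R}" by simp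
  qed auto
  have "generate F
    ({frag_of (a \<otimes>\<^bsub>A\<^esub> b, c) - frag_of (a, c) - frag_of (b, c) | a b c. a \<in> carrier A \<and> b \<in> carrier A}
     \<union> {frag_of (a, c + c') - frag_of (a, c) - frag_of (a, c') | a c c'. a \<in> carrier A})
    \<subseteq> {y \<in> carrier F. ?h y \<in> A'.R}"
    by (rule P.generate_subgroup_incl[OF _ sub])
      (use rel F_closed(4,5) in \<open>auto simp: frag_extend_diff frag_extend_of simp del: carrier_free_Abelian_group_iff\<close>)
  then show "?h ` R \<subseteq> A'.R" unfolding tensor_relations_def by blast
  show "subgroup A'.R A'.F" by (rule A'.R_sub)
qed (use x in \<open>simp_all add: R_sub\<close>)

lemma rel1: "\<lbrakk>a \<in> carrier A; b \<in> carrier A\<rbrakk> \<Longrightarrow> frag_of (a \<otimes>\<^bsub>A\<^esub> b, c) - frag_of (a, c) - frag_of (b, c) \<in> R"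
  and rel2: "a \<in> carrier A \<Longrightarrow> frag_of (a, c + c') - frag_of (a, c) - frag_of (a, c') \<in> R"
  unfolding tensor_relations_def by (rule generate.incl, blast)+

lemma V_smult: "x \<in> carrier F \<Longrightarrow> s \<odot>\<^bsub>V\<^esub> cls x = cls (sc s x)"
proof -
  assume x: "x \<in> carrier F"
  have "R <#>\<^bsub>F\<^esub> (frag_extend (\<lambda>p. frag_of ((\<lambda>(a, c). (a, s * c)) p)) ` cls x)
    = cls (frag_extend (\<lambda>p. frag_of ((\<lambda>(a, c). (a, s * c)) p)) x)"
    by (rule induced_map) (use x rel1 rel2 in \<open>auto simp: distrib_left comm_group_axioms\<close>)
  then show ?thesis by (simp add: tensor_field_def case_prod_unfold)
qed

lemma sc_closed: "x \<in> carrier F \<Longrightarrow> sc s x \<in> carrier F"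
proof -
  have "sc s \<in> hom F F" by (rule frag_extend_hom) auto
  then show "x \<in> carrier F \<Longrightarrow> sc s x \<in> carrier F" by (rule hom_in_carrier)
qed

lemma V_abelian_group: "abelian_group V"
proof (rule abelian_groupI)
  fix u v w assume "u \<in> carrier V" "v \<in> carrier V" "w \<in> carrier V"
  then show "u \<oplus>\<^bsub>V\<^esub> v \<oplus>\<^bsub>V\<^esub> w = u \<oplus>\<^bsub>V\<^esub> (v \<oplus>\<^bsub>V\<^esub> w)"
    unfolding V_carrier by (auto simp only: V_add add.assoc)
next
  fix u assume "u \<in> carrier V"
  then obtain x where "x \<in> carrier F" "u = cls x" unfolding V_carrier by blast
  then show "\<exists>v\<in>carrier V. v \<oplus>\<^bsub>V\<^esub> u = \<zero>\<^bsub>V\<^esub>"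
    using F_closed by (intro bexI[of _ "cls (- x)"]) (auto simp only: V_carrier V_add V_zero add.left_inverse)
qed (auto simp only: V_carrier V_add V_zero add_0_left add_0_right add.commute intro: F_closed)

lemma V_module: "module class_ring V"
proof (rule moduleI)
  show "cring (class_ring :: 'k ring)" using class_field[where 'a = 'k] by (simp add: field_def domain_def)
  show "abelian_group V" by (rule V_abelian_group)
next
  fix s t :: 'k and v assume "v \<in> carrier V"
  then obtain x where x: "x \<in> carrier F" "v = cls x" unfolding V_carrier by blast
  have "sc (s + t) x - (sc s x + sc t x) \<in> R"
    using x(1)
  proof (induction rule: F_induct)
    case (one a c)
    then show ?case using rel2[of a "s * c" "t * c"] by (simp add: frag_extend_of distrib_right diff_diff_eq)
  next
    case (minus x y)
    then show ?case using R_closed(4)[OF minus(1) minus(2)] by (simp add: frag_extend_diff algebra_simps)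
  qed (simp add: R_closed)
  then show "(s \<oplus>\<^bsub>class_ring\<^esub> t) \<odot>\<^bsub>V\<^esub> v = s \<odot>\<^bsub>V\<^esub> v \<oplus>\<^bsub>V\<^esub> t \<odot>\<^bsub>V\<^esub> v"
    using x by (simp add: V_smult V_add cls_eq_iff del: carrier_free_Abelian_group_iff)
  have "sc (s * t) x = sc s (sc t x)"
    using x(1) by (induction rule: F_induct) (simp_all add: frag_extend_of frag_extend_diff mult.assoc)
  then show "(s \<otimes>\<^bsub>class_ring\<^esub> t) \<odot>\<^bsub>V\<^esub> v = s \<odot>\<^bsub>V\<^esub> (t \<odot>\<^bsub>V\<^esub> v)"
    using x sc_closed by (simp add: V_smult del: carrier_free_Abelian_group_iff)
  have "sc 1 x = x"
    using x(1) by (induction rule: F_induct) (simp_all add: frag_extend_of frag_extend_diff)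
  then show "\<one>\<^bsub>class_ring\<^esub> \<odot>\<^bsub>V\<^esub> v = v"
    using x by (simp add: V_smult del: carrier_free_Abelian_group_iff)
  show "s \<odot>\<^bsub>V\<^esub> v \<in> carrier V"
    using x sc_closed by (auto simp: V_carrier V_smult simp del: carrier_free_Abelian_group_iff)
  fix w assume "w \<in> carrier V"
  then obtain y where y: "y \<in> carrier F" "w = cls y" unfolding V_carrier by blast
  show "s \<odot>\<^bsub>V\<^esub> (v \<oplus>\<^bsub>V\<^esub> w) = s \<odot>\<^bsub>V\<^esub> v \<oplus>\<^bsub>V\<^esub> s \<odot>\<^bsub>V\<^esub> w"
    using x y F_closed by (simp add: V_smult V_add frag_extend_add del: carrier_free_Abelian_group_iff)
qed

lemma V_vectorspace: "vectorspace class_ring V"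
  using V_module class_field[where 'a = 'k] by (simp add: vectorspace_def)

sublocale V: vectorspace class_ring V
  by (rule V_vectorspace)

abbreviation pt :: "'a \<Rightarrow> 'k \<Rightarrow> ('a \<times> 'k \<Rightarrow>\<^sub>0 int) set" where "pt \<equiv> pure_tensor A"

lemma pt_closed: "a \<in> carrier A \<Longrightarrow> pt a c \<in> carrier V"
  unfolding V_carrier pure_tensor_def using F_closed by blast

lemma pt_mult: "\<lbrakk>a \<in> carrier A; b \<in> carrier A\<rbrakk> \<Longrightarrow> pt (a \<otimes>\<^bsub>A\<^esub> b) c = pt a c \<oplus>\<^bsub>V\<^esub> pt b c"
  unfolding pure_tensor_def V_add cls_eq_iff using rel1[of a b c] by (simp add: diff_diff_eq)

lemma pt_smult: "a \<in> carrier A \<Longrightarrow> s \<odot>\<^bsub>V\<^esub> pt a c = pt a (s * c)"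
  unfolding pure_tensor_def by (simp add: V_smult frag_extend_of)

text \<open>Sums without differences are enough, because the negative of a pure tensor is the pure
  tensor with the negated scalar.\<close>

lemma V_induct [consumes 1, case_names zero pt add]:
  assumes "v \<in> carrier V" and "P \<zero>\<^bsub>V\<^esub>" "\<And>a c. a \<in> carrier A \<Longrightarrow> P (pt a c)"
    and add: "\<And>u v. \<lbrakk>u \<in> carrier V; v \<in> carrier V; P u; P v\<rbrakk> \<Longrightarrow> P (u \<oplus>\<^bsub>V\<^esub> v)"
  shows "P v"
proof -
  obtain x where x: "x \<in> carrier F" "v = cls x" using assms(1) unfolding V_carrier by blast
  have m1: "cls (- frag_of (a, c)) = pt a (- c)" if "a \<in> carrier A" for a c
  proof -
    have "frag_of (a, 0) - frag_of (a, 0) - frag_of (a, 0) \<in> R" using rel2[OF that, of 0 0] by simp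
    then have "- frag_of (a, 0) \<in> R" by simp
    have "frag_of (a, 0) - frag_of (a, c) - frag_of (a, - c) \<in> R" using rel2[OF that, of c "- c"] by simp
    from R_closed(1)[OF this \<open>- frag_of (a, 0) \<in> R\<close>]
    have "- frag_of (a, c) - frag_of (a, - c) \<in> R" by (simp add: algebra_simps)
    then show ?thesis by (simp add: cls_eq_iff pure_tensor_def)
  qed
  \<comment> \<open>The induction over the free abelian group forms differences, while
    \<open>add\<close> only offers sums; hence the claim is carried for \<open>x\<close> and
    \<open>- x\<close> together.\<close>
  have "x \<in> carrier F \<and> (P (cls x) \<and> P (cls (- x)))" using x(1)
  proof (induction rule: F_induct)
    case (one a c)
    then show ?case using assms(3)[of a] m1 F_closed by (metis pure_tensor_def)
  next
    case (minus x y)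
    have c: "cls z \<in> carrier V" if "z \<in> carrier F" for z using that V_carrier by blast
    have "P (cls x \<oplus>\<^bsub>V\<^esub> cls (- y))" "P (cls (- x) \<oplus>\<^bsub>V\<^esub> cls y)"
      using minus F_closed c by (auto intro!: add)
    then show ?case using minus F_closed by (simp add: V_add del: carrier_free_Abelian_group_iff)
  qed (use assms(2) V_zero F_closed in simp)
  then show ?thesis using x by simp
qed

text \<open>The group elements whose tensor with 1 lies in \<open>S\<close> form a subgroup, so
  group generators of \<open>A\<close> already span over the field.\<close>

lemma V_span_generators:
  assumes Y: "Y \<subseteq> carrier A" "generate A Y = carrier A"
    and S: "submodule class_ring S V" 
    and gen: "\<And>a. a \<in> Y \<Longrightarrow> pt a 1 \<in> S"
  shows "S = carrier V"
proof
  show "S \<subseteq> carrier V" using S by (simp add: submodule_def)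
  have Sc: "0\<in>UNIV \<Longrightarrow> \<zero>\<^bsub>V\<^esub> \<in> S" "u \<in> S \<Longrightarrow> v \<in> S \<Longrightarrow> u \<oplus>\<^bsub>V\<^esub> v \<in> S" "v \<in> S \<Longrightarrow> s \<odot>\<^bsub>V\<^esub> v \<in> S" for s u v
    using S by (auto simp: submodule_def)
  have sc1: "pt a 1 \<in> S \<Longrightarrow> a \<in> carrier A \<Longrightarrow> pt a c \<in> S" for a c
    using Sc(3)[of "pt a 1" c] pt_smult[of a c 1] by simp
  have one: "pt \<one>\<^bsub>A\<^esub> 1 = \<zero>\<^bsub>V\<^esub>"
  proof -
    have "pt \<one>\<^bsub>A\<^esub> 1 = pt \<one>\<^bsub>A\<^esub> 1 \<oplus>\<^bsub>V\<^esub> pt \<one>\<^bsub>A\<^esub> 1" using pt_mult[of "\<one>\<^bsub>A\<^esub>" "\<one>\<^bsub>A\<^esub>" 1] by simp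
    then show ?thesis using pt_closed[OF one_closed, of 1] V.add.r_cancel_one by metis
  qed
  have sub: "subgroup {a \<in> carrier A. pt a 1 \<in> S} A"
  proof (rule subgroupI)
    show "{a \<in> carrier A. pt a 1 \<in> S} \<noteq> {}" using one Sc(1) by auto
    fix a assume a: "a \<in> {a \<in> carrier A. pt a 1 \<in> S}"
    have "pt (inv\<^bsub>A\<^esub> a) 1 \<oplus>\<^bsub>V\<^esub> pt a 1 = \<zero>\<^bsub>V\<^esub>" using pt_mult[of "inv\<^bsub>A\<^esub> a" a 1] a one by simp
    then have "pt (inv\<^bsub>A\<^esub> a) 1 = \<ominus>\<^bsub>V\<^esub> pt a 1"
      using a pt_closed[of a 1] pt_closed[of "inv\<^bsub>A\<^esub> a" 1] by (simp add: V.minus_equality)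
    also have "\<dots> = (- 1) \<odot>\<^bsub>V\<^esub> pt a 1"
      using V.smult_minus_1[of "pt a 1"] a pt_closed[of a 1] by (simp add: class_ring_simps)
    finally show "inv\<^bsub>A\<^esub> a \<in> {a \<in> carrier A. pt a 1 \<in> S}" using a Sc(3) by simp
    fix b assume "b \<in> {a \<in> carrier A. pt a 1 \<in> S}"
    then show "a \<otimes>\<^bsub>A\<^esub> b \<in> {a \<in> carrier A. pt a 1 \<in> S}" using a Sc(2) pt_mult by auto
  qed auto
  have "generate A Y \<subseteq> {a \<in> carrier A. pt a 1 \<in> S}"
    by (rule generate_subgroup_incl[OF _ sub]) (use Y gen in auto)
  then have all: "a \<in> carrier A \<Longrightarrow> pt a c \<in> S" for a c using sc1 Y by auto
  show "carrier V \<subseteq> S"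
  proof
    fix v assume "v \<in> carrier V"
    then show "v \<in> S" by (induction rule: V_induct) (auto intro: Sc all)
  qed
qed

lemma V_fin_dim:
  assumes "finite Y" "Y \<subseteq> carrier A" "generate A Y = carrier A"
  shows "V.fin_dim"
proof -
  have c: "(\<lambda>a. pt a 1) ` Y \<subseteq> carrier V" using assms pt_closed by auto
  have "V.span ((\<lambda>a. pt a 1) ` Y) = carrier V"
    by (rule V_span_generators[OF assms(2,3) V.span_is_submodule[OF c]]) (use V.in_own_span[OF c] in auto)
  then show ?thesis unfolding V.fin_dim_def using assms(1) c by blast
qed

lemma tensor_field_map:
  assumes A': "comm_group A'" and f: "f \<in> hom A A'"
  shows "tensor_field_map A' f \<in> module_hom class_ring V (tensor_field A' :: ('k, ('a \<times> 'k \<Rightarrow>\<^sub>0 int) set) module)"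
    and "a \<in> carrier A \<Longrightarrow> tensor_field_map A' f (pt a c) = pure_tensor A' (f a) c"
proof -
  interpret A': tensor_base A' "TYPE('k)" using A' by (simp add: tensor_base_def)
  interpret f: group_hom A A' f by standard (use f in auto)
  let ?h = "frag_extend (\<lambda>(a, c). frag_of (f a, c :: 'k))"
  have eq: "tensor_field_map A' f (cls x) = A'.cls (?h x)" if x: "x \<in> carrier F" for x
  proof -
    have "A'.R <#>\<^bsub>A'.F\<^esub> (frag_extend (\<lambda>p. frag_of ((\<lambda>(a, c). (f a, c)) p)) ` cls x)
      = A'.cls (frag_extend (\<lambda>p. frag_of ((\<lambda>(a, c). (f a, c)) p)) x)"
      by (rule induced_map[OF A']) (use x A'.rel1 A'.rel2 in auto)
    then show ?thesis by (simp add: tensor_field_map_def case_prod_unfold)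
  qed
  have hc: "?h x \<in> carrier A'.F" if "x \<in> carrier F" for x
  proof -
    have "?h \<in> hom F A'.F" by (rule frag_extend_hom) auto
    then show ?thesis using that by (rule hom_in_carrier)
  qed
  show "tensor_field_map A' f (pt a c) = A'.pt (f a) c" if "a \<in> carrier A" for a c
    using eq[of "frag_of (a, c)"] that by (simp add: pure_tensor_def frag_extend_of)
  have sch: "?h (sc s x) = A'.sc s (?h x)" if "x \<in> carrier F" for s x
    using that by (induction rule: F_induct) (simp_all add: frag_extend_of frag_extend_diff)
  have 1: "tensor_field_map A' f u \<in> carrier A'.V" if "u \<in> carrier V" for u
    using that eq hc A'.V_carrier V_carrier by auto
  have 2: "tensor_field_map A' f (s \<odot>\<^bsub>V\<^esub> u) = s \<odot>\<^bsub>A'.V\<^esub> tensor_field_map A' f u"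
    if u: "u \<in> carrier V" for s u
  proof -
    obtain x where x: "x \<in> carrier F" "u = cls x" using u unfolding V_carrier by blast
    then show ?thesis
      using hc sc_closed[OF x(1)] sch by (simp add: eq V_smult A'.V_smult del: carrier_free_Abelian_group_iff)
  qed
  have 3: "tensor_field_map A' f (u \<oplus>\<^bsub>V\<^esub> v) = tensor_field_map A' f u \<oplus>\<^bsub>A'.V\<^esub> tensor_field_map A' f v"
    if u: "u \<in> carrier V" and v: "v \<in> carrier V" for u v
  proof -
    obtain x where "x \<in> carrier F" "u = cls x" using u unfolding V_carrier by blast
    moreover obtain y where "y \<in> carrier F" "v = cls y" using v unfolding V_carrier by blast
    ultimately show ?thesis
      using F_closed by (simp add: eq V_add A'.V_add frag_extend_add del: carrier_free_Abelian_group_iff)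
  qed
  show "tensor_field_map A' f \<in> module_hom class_ring V A'.V"
    unfolding module_hom_def using 1 2 3 by auto
qed

end

section \<open>Traces on graded pieces\<close>

definition some_basis :: "('k::field, 'v) module \<Rightarrow> 'v set" where
  "some_basis V = (SOME B. finite B \<and> vectorspace.basis class_ring V B)"

definition coord :: "('k::field, 'v) module \<Rightarrow> 'v \<Rightarrow> 'v \<Rightarrow> 'k" where
  "coord V v = (THE a. a \<in> some_basis V \<rightarrow>\<^sub>E UNIV \<and> module.lincomb V a (some_basis V) = v)"

text \<open>\<open>has_trace\<close> is a relation, whereas the alternating sums below need a value.
  Invariance of this value under a change of basis or of space is supplied by
  \<open>lin_trace_commute\<close>.\<close>

definition lin_trace :: "('k::field, 'v) module \<Rightarrow> ('v \<Rightarrow> 'v) \<Rightarrow> 'k" where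
  "lin_trace V f = (\<Sum>b\<in>some_basis V. coord V (f b) b)"

locale fin_vectorspace = vectorspace class_ring V for V :: "('k::field, 'v) module" +
  assumes fin: fin_dim
begin

abbreviation "BB \<equiv> some_basis V"

lemma basis_BB: "finite BB" "basis BB"
  using someI_ex[OF finite_basis_exists[OF fin]] by (simp_all add: some_basis_def)

lemma BB_carrier: "BB \<subseteq> carrier V"
  using basis_BB by (simp add: basis_def)

lemma ex1_coord: "v \<in> carrier V \<Longrightarrow> \<exists>!a. a \<in> BB \<rightarrow>\<^sub>E UNIV \<and> lincomb a BB = v"
  using basis_criterion[OF basis_BB(1) BB_carrier] basis_BB(2) by (simp add: class_ring_simps)

lemma lincomb_coord: "v \<in> carrier V \<Longrightarrow> lincomb (coord V v) BB = v"
  using theI'[OF ex1_coord] by (simp add: coord_def)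

lemma lincomb_restrict: "lincomb (restrict a BB) BB = lincomb a BB"
  unfolding lincomb_def using BB_carrier by (intro finsum_cong') auto

lemma coord_unique:
  assumes "lincomb a BB = v" "b \<in> BB"
  shows "coord V v b = a b"
proof -
  have "v \<in> carrier V" using assms(1) BB_carrier by (auto intro!: lincomb_closed)
  from the1_equality[OF ex1_coord[OF this], of "restrict a BB"]
  have "coord V v = restrict a BB" using assms lincomb_restrict by (simp add: coord_def)
  then show ?thesis using assms by simp
qed

lemma coord_add: "\<lbrakk>u \<in> carrier V; v \<in> carrier V; b \<in> BB\<rbrakk> \<Longrightarrow> coord V (u \<oplus>\<^bsub>V\<^esub> v) b = coord V u b + coord V v b"
  using lincomb_sum[OF basis_BB(1) BB_carrier, of "coord V u" "coord V v"] lincomb_coord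
  by (intro coord_unique) (auto simp: class_ring_simps)

lemma coord_smult: "\<lbrakk>v \<in> carrier V; b \<in> BB\<rbrakk> \<Longrightarrow> coord V (s \<odot>\<^bsub>V\<^esub> v) b = s * coord V v b"
  using lincomb_smult[OF BB_carrier, of "coord V v" s] lincomb_coord
  by (intro coord_unique) (auto simp: class_ring_simps)

lemma coord_zero: "b \<in> BB \<Longrightarrow> coord V \<zero>\<^bsub>V\<^esub> b = 0"
  using coord_smult[of "\<zero>\<^bsub>V\<^esub>" b 0] by simp

lemma coord_finsum:
  assumes "finite I" "f \<in> I \<rightarrow> carrier V" "b \<in> BB"
  shows "coord V (\<Oplus>\<^bsub>V\<^esub>i\<in>I. f i) b = (\<Sum>i\<in>I. coord V (f i) b)"
  using assms(1,2)
proof (induction I)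
  case (insert i I)
  then have "f \<in> I \<rightarrow> carrier V" "f i \<in> carrier V" by auto
  then show ?case using insert assms(3) by (simp add: coord_add)
qed (simp add: coord_zero assms)

lemma has_trace_lin_trace:
  assumes "f \<in> module_hom class_ring V V"
  shows "has_trace V f (lin_trace V f)"
  unfolding has_trace_def
proof (intro exI conjI ballI)
  show "f b = lincomb (\<lambda>b'. coord V (f b) b') BB" if "b \<in> BB" for b
    using that BB_carrier module_hom_closed[OF assms] by (intro lincomb_coord[symmetric]) auto
qed (use basis_BB in \<open>simp_all add: lin_trace_def\<close>)

lemma lin_trace_cong:
  "(\<And>v. v \<in> carrier V \<Longrightarrow> f v = g v) \<Longrightarrow> lin_trace V f = lin_trace V g"
  unfolding lin_trace_def using BB_carrier by (intro sum.cong) auto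

end

lemma module_hom_lincomb:
  assumes "module R V" "module R W" "f \<in> module_hom R V W" "finite C" "C \<subseteq> carrier V" "a \<in> C \<rightarrow> carrier R"
  shows "f (module.lincomb V a C) = (\<Oplus>\<^bsub>W\<^esub>c\<in>C. a c \<odot>\<^bsub>W\<^esub> f c)"
proof -
  interpret V: module R V by fact
  interpret W: module R W by fact
  have fc: "v \<in> carrier V \<Longrightarrow> f v \<in> carrier W" for v using module_hom_closed[OF assms(3)] by auto
  have f0: "f \<zero>\<^bsub>V\<^esub> = \<zero>\<^bsub>W\<^esub>"
    using module_hom_add[OF assms(3), of "\<zero>\<^bsub>V\<^esub>" "\<zero>\<^bsub>V\<^esub>"] fc[of "\<zero>\<^bsub>V\<^esub>"] W.add.r_cancel_one by force
  show ?thesis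
    unfolding V.lincomb_def using assms(4-6)
  proof (induction C)
    case (insert c C)
    then have "(\<lambda>c. a c \<odot>\<^bsub>V\<^esub> c) \<in> C \<rightarrow> carrier V" "a c \<odot>\<^bsub>V\<^esub> c \<in> carrier V" "a c \<in> carrier R" "c \<in> carrier V"
      "(\<lambda>c. a c \<odot>\<^bsub>W\<^esub> f c) \<in> C \<rightarrow> carrier W" "a c \<odot>\<^bsub>W\<^esub> f c \<in> carrier W"
      by (auto intro!: V.smult_closed W.smult_closed fc)
    then show ?case using insert module_hom_add[OF assms(3)] module_hom_smult[OF assms(3)]
      by (simp add: V.finsum_closed)
  qed (simp add: f0)
qed

text \<open>Both sides expand to the same double sum of products of matrix coefficients. The two
  spaces may be different, which is what later moves a trace from one configuration space to a
  smaller one.\<close>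

lemma lin_trace_commute:
  fixes V :: "('k::field, 'v) module" and W :: "('k, 'w) module"
  assumes "fin_vectorspace V" "fin_vectorspace W"
    and f: "f \<in> module_hom class_ring V W" and g: "g \<in> module_hom class_ring W V"
  shows "lin_trace V (\<lambda>v. g (f v)) = lin_trace W (\<lambda>w. f (g w))"
proof -
  interpret V: fin_vectorspace V by fact
  interpret W: fin_vectorspace W by fact
  have fc: "v \<in> carrier V \<Longrightarrow> f v \<in> carrier W" for v using module_hom_closed[OF f] by auto
  have gc: "v \<in> carrier W \<Longrightarrow> g v \<in> carrier V" for v using module_hom_closed[OF g] by auto
  have 1: "coord V (g w) b = (\<Sum>c\<in>W.BB. coord W w c * coord V (g c) b)" if "w \<in> carrier W" "b \<in> V.BB" for w b
  proof -
    have "g w = (\<Oplus>\<^bsub>V\<^esub>c\<in>W.BB. coord W w c \<odot>\<^bsub>V\<^esub> g c)"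
      using module_hom_lincomb[OF W.module_axioms V.module_axioms g W.basis_BB(1) W.BB_carrier, of "coord W w"]
        W.lincomb_coord[OF that(1)] by simp
    then have "coord V (g w) b = (\<Sum>c\<in>W.BB. coord V (coord W w c \<odot>\<^bsub>V\<^esub> g c) b)"
      using that W.basis_BB(1) W.BB_carrier gc by (simp, intro V.coord_finsum) auto
    also have "\<dots> = (\<Sum>c\<in>W.BB. coord W w c * coord V (g c) b)"
      using that W.BB_carrier gc by (intro sum.cong refl V.coord_smult) auto
    finally show ?thesis .
  qed
  have 2: "coord W (f v) c = (\<Sum>b\<in>V.BB. coord V v b * coord W (f b) c)" if "v \<in> carrier V" "c \<in> W.BB" for v c
  proof -
    have "f v = (\<Oplus>\<^bsub>W\<^esub>b\<in>V.BB. coord V v b \<odot>\<^bsub>W\<^esub> f b)"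
      using module_hom_lincomb[OF V.module_axioms W.module_axioms f V.basis_BB(1) V.BB_carrier, of "coord V v"]
        V.lincomb_coord[OF that(1)] by simp
    then have "coord W (f v) c = (\<Sum>b\<in>V.BB. coord W (coord V v b \<odot>\<^bsub>W\<^esub> f b) c)"
      using that V.basis_BB(1) V.BB_carrier fc by (simp, intro W.coord_finsum) auto
    also have "\<dots> = (\<Sum>b\<in>V.BB. coord V v b * coord W (f b) c)"
      using that V.BB_carrier fc by (intro sum.cong refl W.coord_smult) auto
    finally show ?thesis .
  qed
  have "lin_trace V (\<lambda>v. g (f v)) = (\<Sum>b\<in>V.BB. \<Sum>c\<in>W.BB. coord W (f b) c * coord V (g c) b)"
    unfolding lin_trace_def using V.BB_carrier fc by (intro sum.cong refl 1) auto
  also have "\<dots> = (\<Sum>c\<in>W.BB. \<Sum>b\<in>V.BB. coord V (g c) b * coord W (f b) c)"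
    by (subst sum.swap) (simp add: mult.commute)
  also have "\<dots> = lin_trace W (\<lambda>w. f (g w))"
    unfolding lin_trace_def using W.BB_carrier gc by (intro sum.cong refl 2[symmetric]) auto
  finally show ?thesis .
qed

section \<open>Graded pieces: spanning sets and induced maps\<close>

definition gr_elem :: "'a monoid \<Rightarrow> nat \<Rightarrow> 'a \<Rightarrow> 'k::field \<Rightarrow> ('a set \<times> 'k \<Rightarrow>\<^sub>0 int) set" where
  "gr_elem G j x c = pure_tensor (lower_central_quotient G j) (lower_central G (Suc j) #>\<^bsub>G\<^esub> x) c"

text \<open>Degrees are written \<open>Suc j\<close> from here on, which leaves out the dummy term
  of the series at index 0.\<close>

locale gr_base = plain_group G for G :: "'a monoid" (structure) + fixes K :: "'k::field itself" and j :: nat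
begin

abbreviation "Q \<equiv> lower_central_quotient G (Suc j)"

abbreviation gr :: "('k, ('a set \<times> 'k \<Rightarrow>\<^sub>0 int) set) module" where "gr \<equiv> gr_piece G (Suc j)"

abbreviation "gre \<equiv> gr_elem G (Suc j) :: 'a \<Rightarrow> 'k \<Rightarrow> _"

sublocale T: tensor_base Q "TYPE('k)"
  using lower_central_quotient_comm_group by (simp add: tensor_base_def)

lemma gr_eq: "gr = T.V" by (simp add: gr_piece_def)

sublocale gr: vectorspace class_ring gr
  unfolding gr_eq by (rule T.V_vectorspace)

lemma coset_Q: "x \<in> lower_central G (Suc j) \<Longrightarrow> lower_central G (Suc (Suc j)) #> x \<in> carrier Q"
  by (auto simp: lower_central_quotient_simps)

lemma gre_closed: "x \<in> lower_central G (Suc j) \<Longrightarrow> gre x c \<in> carrier gr"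
  unfolding gr_eq gr_elem_def by (intro T.pt_closed coset_Q)

lemma gr_induct [consumes 1, case_names zero elem add]:
  assumes "v \<in> carrier gr" and "P \<zero>\<^bsub>gr\<^esub>" "\<And>x c. x \<in> lower_central G (Suc j) \<Longrightarrow> P (gre x c)"
    and "\<And>u v. \<lbrakk>u \<in> carrier gr; v \<in> carrier gr; P u; P v\<rbrakk> \<Longrightarrow> P (u \<oplus>\<^bsub>gr\<^esub> v)"
  shows "P v"
  using assms(1) unfolding gr_eq
proof (induction rule: T.V_induct)
  case (pt a c)
  then show ?case using assms(3) by (auto simp: lower_central_quotient_simps gr_elem_def)
qed (use assms in \<open>auto simp: gr_eq\<close>)

lemma gr_generators:
  assumes F: "F \<subseteq> carrier G" "carrier G = generate G (F \<union> lower_central G 2)"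
  defines "C \<equiv> {left_normed xs | xs. length xs = Suc j \<and> set xs \<subseteq> F}"
  shows "(\<lambda>x. lower_central G (Suc (Suc j)) #> x) ` C \<subseteq> carrier Q"
    and "generate Q ((\<lambda>x. lower_central G (Suc (Suc j)) #> x) ` C) = carrier Q"
proof -
  let ?N = "lower_central G (Suc (Suc j))"
  let ?X = "(\<lambda>x. ?N #> x) ` C"
  have C: "C \<subseteq> lower_central G (Suc j)"
    using F left_normed_lower_central unfolding C_def by fastforce
  then show sub: "?X \<subseteq> carrier Q" using coset_Q by blast
  have gX: "subgroup (generate Q ?X) Q" by (rule T.generate_is_subgroup[OF sub])
  \<comment> \<open>The elements whose coset is generated by \<open>?X\<close> form a subgroup of
    \<open>G\<close>, so \<open>lower_central_generate\<close> can be applied upstairs instead of in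
    the quotient.\<close>
  have sub': "subgroup {x \<in> lower_central G (Suc j). ?N #> x \<in> generate Q ?X} G"
  proof (rule subgroupI)
    let ?S = "{x \<in> lower_central G (Suc j). ?N #> x \<in> generate Q ?X}"
    have one: "?N #> \<one> = \<one>\<^bsub>Q\<^esub>" 
      using lower_central_subset by (simp add: lower_central_quotient_simps coset_mult_one)
    show "?S \<subseteq> carrier G" using lower_central_carrier by auto
    show "?S \<noteq> {}" using one subgroup.one_closed[OF gX] subgroup.one_closed[OF lower_central_subgroup]
      by (auto intro!: exI[of _ \<one>])
    fix x assume x: "x \<in> ?S"
    have xc: "x \<in> carrier G" using x lower_central_carrier by auto
    have ix: "inv x \<in> lower_central G (Suc j)" using x subgroup.m_inv_closed[OF lower_central_subgroup] by auto
    have "(?N #> inv x) \<otimes>\<^bsub>Q\<^esub> (?N #> x) = \<one>\<^bsub>Q\<^esub>"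
      using xc one by (simp add: lower_central_quotient_mult)
    then have "?N #> inv x = inv\<^bsub>Q\<^esub> (?N #> x)"
      using x ix coset_Q by (intro T.inv_equality[symmetric]) auto
    then show "inv x \<in> ?S" using x ix subgroup.m_inv_closed[OF gX] by auto
    fix y assume y: "y \<in> ?S"
    have yc: "y \<in> carrier G" using y lower_central_carrier by auto
    show "x \<otimes> y \<in> ?S"
      using x y subgroup.m_closed[OF gX] subgroup.m_closed[OF lower_central_subgroup]
        lower_central_quotient_mult[OF xc yc, of "Suc j"] by force
  qed
  have "C \<union> ?N \<subseteq> {x \<in> lower_central G (Suc j). ?N #> x \<in> generate Q ?X}"
  proof
    fix x assume x: "x \<in> C \<union> ?N"
    show "x \<in> {x \<in> lower_central G (Suc j). ?N #> x \<in> generate Q ?X}"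
    proof (cases "x \<in> C")
      case True
      then show ?thesis using C by (auto intro: generate.incl)
    next
      case False
      then have "x \<in> ?N" using x by auto
      then have "?N #> x = \<one>\<^bsub>Q\<^esub>"
        using coset_join2[of x ?N] lower_central_subgroup lower_central_carrier
        by (auto simp: lower_central_quotient_simps)
      then show ?thesis using \<open>x \<in> ?N\<close> lower_central_antimono[of "Suc j"] subgroup.one_closed[OF gX] by auto
    qed
  qed
  from generate_subgroup_incl[OF this sub']
  have "lower_central G (Suc j) \<subseteq> {x \<in> lower_central G (Suc j). ?N #> x \<in> generate Q ?X}"
    unfolding lower_central_generate[OF F, of j, folded C_def] .
  then show "generate Q ?X = carrier Q"
    using subgroup.subset[OF gX] by (auto simp: lower_central_quotient_simps)
qed

text \<open>In this form a linear condition on the graded piece has to be verified only on iterated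
  commutators of elements of \<open>F\<close>.\<close>

lemma gr_span:
  assumes F: "F \<subseteq> carrier G" "carrier G = generate G (F \<union> lower_central G 2)"
    and S: "submodule class_ring S gr"
    and gen: "\<And>xs. \<lbrakk>length xs = Suc j; set xs \<subseteq> F\<rbrakk> \<Longrightarrow> gre (left_normed xs) 1 \<in> S"
  shows "S = carrier gr"
  unfolding gr_eq
  by (rule T.V_span_generators[OF gr_generators[OF F]])
    (use S gen in \<open>auto simp: gr_elem_def gr_eq[symmetric]\<close>)

text \<open>There are finitely many lists of fixed length over a finite set. Finite dimension is all
  that the existence of traces requires.\<close>

lemma gr_fin:
  assumes F: "F \<subseteq> carrier G" "carrier G = generate G (F \<union> lower_central G 2)" "finite F"
  shows "fin_vectorspace gr"
proof -
  have "finite {left_normed xs | xs. length xs = Suc j \<and> set xs \<subseteq> F}"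
    using finite_lists_length_eq[OF F(3), of "Suc j"] by (simp add: setcompr_eq_image conj_commute)
  then have "T.V.fin_dim" using gr_generators[OF F(1,2)] by (intro T.V_fin_dim) auto
  then show ?thesis
    using gr.vectorspace_axioms by (simp add: fin_vectorspace_def fin_vectorspace_axioms_def gr_eq)
qed

end

lemma lower_central_quotient_map_hom:
  assumes "group G" "group H" "\<phi> \<in> hom G H"
  shows "lower_central_quotient_map H j \<phi> \<in> hom (lower_central_quotient G j) (lower_central_quotient H j)"
proof -
  interpret G: plain_group G using assms by (simp add: plain_group_def)
  interpret H: plain_group H using assms by (simp add: plain_group_def)
  show ?thesis
  proof (rule homI)
    fix U assume "U \<in> carrier (lower_central_quotient G j)"
    then show "lower_central_quotient_map H j \<phi> U \<in> carrier (lower_central_quotient H j)"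
      unfolding G.lower_central_quotient_simps H.lower_central_quotient_simps
      using lower_central_quotient_map_rcoset[OF assms] hom_lower_central[OF assms] G.lower_central_carrier
      by blast
    fix W assume "W \<in> carrier (lower_central_quotient G j)"
    with \<open>U \<in> _\<close> obtain x y where xy: "x \<in> carrier G" "y \<in> carrier G"
      "U = lower_central G (Suc j) #>\<^bsub>G\<^esub> x" "W = lower_central G (Suc j) #>\<^bsub>G\<^esub> y"
      unfolding G.lower_central_quotient_simps using G.lower_central_carrier by blast
    then show "lower_central_quotient_map H j \<phi> (U \<otimes>\<^bsub>lower_central_quotient G j\<^esub> W)
      = lower_central_quotient_map H j \<phi> U \<otimes>\<^bsub>lower_central_quotient H j\<^esub> lower_central_quotient_map H j \<phi> W"
      using hom_in_carrier[OF assms(3)]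
      by (simp add: G.lower_central_quotient_mult H.lower_central_quotient_mult
          lower_central_quotient_map_rcoset[OF assms] hom_mult[OF assms(3)])
  qed
qed

lemma gr_map_hom:
  assumes "group G" "group H" "\<phi> \<in> hom G H"
  shows "gr_map H (Suc j) \<phi> \<in> module_hom class_ring
      (gr_piece G (Suc j) :: ('k::field, ('a set \<times> 'k \<Rightarrow>\<^sub>0 int) set) module) (gr_piece H (Suc j))"
proof -
  interpret G: gr_base G "TYPE('k)" j using assms by (simp add: gr_base_def plain_group_def)
  interpret H: gr_base H "TYPE('k)" j using assms by (simp add: gr_base_def plain_group_def)
  show ?thesis
    unfolding gr_map_def G.gr_eq H.gr_eq
    using G.T.tensor_field_map(1)[OF H.T.comm_group_axioms lower_central_quotient_map_hom[OF assms]] .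
qed

lemma gr_map_elem:
  assumes "group G" "group H" "\<phi> \<in> hom G H" "x \<in> lower_central G (Suc j)"
  shows "gr_map H (Suc j) \<phi> (gr_elem G (Suc j) x (c :: 'k::field)) = gr_elem H (Suc j) (\<phi> x) c"
proof -
  interpret G: gr_base G "TYPE('k)" j using assms by (simp add: gr_base_def plain_group_def)
  interpret H: gr_base H "TYPE('k)" j using assms by (simp add: gr_base_def plain_group_def)
  show ?thesis
    unfolding gr_map_def gr_elem_def
    using G.T.tensor_field_map(2)[OF H.T.comm_group_axioms lower_central_quotient_map_hom[OF assms(1-3)]
        G.coset_Q[OF assms(4)]] lower_central_quotient_map_rcoset[OF assms(1-3) G.lower_central_carrier[OF assms(4)]]
    by simp
qed

lemma module_hom_zero:
  assumes "module R V" "module R W" "f \<in> module_hom R V W"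
  shows "f \<zero>\<^bsub>V\<^esub> = \<zero>\<^bsub>W\<^esub>"
  using module_hom_lincomb[OF assms, of "{}"] by (simp add: module.lincomb_def[OF assms(1)] abelian_monoid.finsum_empty[OF abelian_group.axioms(1)[OF module.axioms(2)[OF assms(2)]]] abelian_monoid.finsum_empty[OF abelian_group.axioms(1)[OF module.axioms(2)[OF assms(1)]]])

lemma gr_hom_eqI:
  assumes G: "group G" and W: "module class_ring W"
    and f: "f \<in> module_hom class_ring (gr_piece G (Suc j) :: ('k::field, ('a set \<times> 'k \<Rightarrow>\<^sub>0 int) set) module) W"
    and g: "g \<in> module_hom class_ring (gr_piece G (Suc j)) W"
    and eq: "\<And>x c. x \<in> lower_central G (Suc j) \<Longrightarrow> f (gr_elem G (Suc j) x c) = g (gr_elem G (Suc j) x c)"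
    and v: "v \<in> carrier (gr_piece G (Suc j) :: ('k, ('a set \<times> 'k \<Rightarrow>\<^sub>0 int) set) module)"
  shows "f v = g v"
proof -
  interpret G: gr_base G "TYPE('k)" j using assms by (simp add: gr_base_def plain_group_def)
  show ?thesis using v
  proof (induction rule: G.gr_induct)
    case zero
    then show ?case
      using module_hom_zero[OF G.gr.module_axioms W f] module_hom_zero[OF G.gr.module_axioms W g] by simp
  next
    case (add u v)
    then show ?case using module_hom_add[OF f add(1,2)] module_hom_add[OF g add(1,2)] by simp
  qed (rule eq)
qed

lemma gr_map_cong:
  assumes G: "group G" and H: "group H" and "\<phi> \<in> hom G H" "\<psi> \<in> hom G H"
    and eq: "\<And>x. x \<in> lower_central G (Suc j) \<Longrightarrow>
      lower_central H (Suc (Suc j)) #>\<^bsub>H\<^esub> \<phi> x = lower_central H (Suc (Suc j)) #>\<^bsub>H\<^esub> \<psi> x"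
    and v: "v \<in> carrier (gr_piece G (Suc j) :: ('k::field, ('a set \<times> 'k \<Rightarrow>\<^sub>0 int) set) module)"
  shows "gr_map H (Suc j) \<phi> v = gr_map H (Suc j) \<psi> v"
proof -
  interpret H: gr_base H "TYPE('k)" j using assms by (simp add: gr_base_def plain_group_def)
  show ?thesis
  proof (rule gr_hom_eqI[OF G H.gr.module_axioms gr_map_hom[OF G H assms(3)] gr_map_hom[OF G H assms(4)] _ v])
    fix x and c :: 'k assume x: "x \<in> lower_central G (Suc j)"
    show "gr_map H (Suc j) \<phi> (gr_elem G (Suc j) x c) = gr_map H (Suc j) \<psi> (gr_elem G (Suc j) x c)"
      using gr_map_elem[OF G H assms(3) x, of c] gr_map_elem[OF G H assms(4) x, of c] eq[OF x]
      by (simp add: gr_elem_def)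
  qed
qed

text \<open>Conjugating a representative by \<open>a\<close> changes it only by an element of the
  next term.\<close>

lemma gr_map_inner:
  assumes G: "group G" and H: "group H" and "\<phi> \<in> hom G H" "\<psi> \<in> hom G H"
    and a: "a \<in> carrier H" "\<And>x. x \<in> carrier G \<Longrightarrow> \<phi> x = a \<otimes>\<^bsub>H\<^esub> \<psi> x \<otimes>\<^bsub>H\<^esub> inv\<^bsub>H\<^esub> a"
    and v: "v \<in> carrier (gr_piece G (Suc j) :: ('k::field, ('a set \<times> 'k \<Rightarrow>\<^sub>0 int) set) module)"
  shows "gr_map H (Suc j) \<phi> v = gr_map H (Suc j) \<psi> v"
proof (rule gr_map_cong[OF G H assms(3,4) _ v])
  fix x assume x: "x \<in> lower_central G (Suc j)"
  interpret G: plain_group G using assms by (simp add: plain_group_def)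
  interpret H: plain_group H using assms by (simp add: plain_group_def)
  show "lower_central H (Suc (Suc j)) #>\<^bsub>H\<^esub> \<phi> x = lower_central H (Suc (Suc j)) #>\<^bsub>H\<^esub> \<psi> x"
    using H.lower_central_conj_rcoset[OF hom_lower_central[OF G H assms(4) x] a(1)] a(2)
      G.lower_central_carrier[OF x] by simp
qed

text \<open>The composite is a separate map \<open>\<theta>\<close> that has to agree on the carrier
  only: composites of \<open>fundamental_group_map\<close> are identified on loop classes, not on
  arbitrary sets of paths.\<close>

lemma gr_map_comp:
  assumes G: "group G" and H: "group H" and L: "group L" and \<phi>: "\<phi> \<in> hom G H" and \<psi>: "\<psi> \<in> hom H L"
    and \<theta>: "\<theta> \<in> hom G L" "\<And>x. x \<in> carrier G \<Longrightarrow> \<theta> x = \<psi> (\<phi> x)"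
    and v: "v \<in> carrier (gr_piece G (Suc j) :: ('k::field, ('a set \<times> 'k \<Rightarrow>\<^sub>0 int) set) module)"
  shows "gr_map L (Suc j) \<psi> (gr_map H (Suc j) \<phi> v) = gr_map L (Suc j) \<theta> v"
proof -
  interpret G: gr_base G "TYPE('k)" j using assms by (simp add: gr_base_def plain_group_def)
  interpret H: gr_base H "TYPE('k)" j using assms by (simp add: gr_base_def plain_group_def)
  interpret L: gr_base L "TYPE('k)" j using assms by (simp add: gr_base_def plain_group_def)
  note h1 = gr_map_hom[OF G H \<phi>, of j, where 'k = 'k] and h2 = gr_map_hom[OF H L \<psi>, of j, where 'k = 'k]
  have "(\<lambda>v. gr_map L (Suc j) \<psi> (gr_map H (Suc j) \<phi> v)) \<in> module_hom class_ring G.gr L.gr"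
    using module_hom_closed[OF h1] module_hom_closed[OF h2] 
      module_hom_add[OF h1] module_hom_add[OF h2] module_hom_smult[OF h1] module_hom_smult[OF h2]
    unfolding module_hom_def[of class_ring G.gr L.gr] by (auto simp: Pi_iff)
  then show ?thesis
  proof (rule gr_hom_eqI[OF G L.gr.module_axioms _ gr_map_hom[OF G L \<theta>(1)] _ v])
    fix x and c :: 'k assume x: "x \<in> lower_central G (Suc j)"
    show "gr_map L (Suc j) \<psi> (gr_map H (Suc j) \<phi> (gr_elem G (Suc j) x c)) = gr_map L (Suc j) \<theta> (gr_elem G (Suc j) x c)"
      using gr_map_elem[OF G H \<phi> x, of c] gr_map_elem[OF H L \<psi> hom_lower_central[OF G H \<phi> x], of c]
        gr_map_elem[OF G L \<theta>(1) x, of c] \<theta>(2)[OF G.lower_central_carrier[OF x]] by simp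
  qed
qed

section \<open>Path groupoids and induced maps\<close>

abbreviation paths_in :: "'a::topological_space set \<Rightarrow> (real \<Rightarrow> 'a) set" where
  "paths_in S \<equiv> {p. path p \<and> path_image p \<subseteq> S}"

text \<open>These are the morphisms of the fundamental groupoid, encoded as in
  \<open>fundamental_group\<close>. The operations below are total functions that are meaningful
  when the endpoints match.\<close>

definition path_classes :: "'a::topological_space set \<Rightarrow> (real \<Rightarrow> 'a) set set" where
  "path_classes S = homotopy_class S ` paths_in S"

definition pmul :: "'a::topological_space set \<Rightarrow> (real \<Rightarrow> 'a) set \<Rightarrow> (real \<Rightarrow> 'a) set \<Rightarrow> (real \<Rightarrow> 'a) set" where
  "pmul S A B = (\<Union>p\<in>A. \<Union>q\<in>B. homotopy_class S (p +++ q))"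

definition pinv :: "'a::topological_space set \<Rightarrow> (real \<Rightarrow> 'a) set \<Rightarrow> (real \<Rightarrow> 'a) set" where
  "pinv S A = (\<Union>p\<in>A. homotopy_class S (reversepath p))"

definition ppush :: "'a::topological_space set \<Rightarrow> ('b::topological_space \<Rightarrow> 'a) \<Rightarrow> (real \<Rightarrow> 'b) set \<Rightarrow> (real \<Rightarrow> 'a) set" where
  "ppush S f A = (\<Union>p\<in>A. homotopy_class S (f \<circ> p))"

text \<open>All paths in one class have the same endpoints, so any representative may be
  chosen.\<close>

definition psrc :: "(real \<Rightarrow> 'a::topological_space) set \<Rightarrow> 'a" where
  "psrc A = pathstart (SOME p. p \<in> A)"

definition ptgt :: "(real \<Rightarrow> 'a::topological_space) set \<Rightarrow> 'a" where
  "ptgt A = pathfinish (SOME p. p \<in> A)"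

abbreviation pid :: "'a::topological_space set \<Rightarrow> 'a \<Rightarrow> (real \<Rightarrow> 'a) set" where
  "pid S x \<equiv> homotopy_class S (\<lambda>_. x)"

lemma homotopy_class_self: "p \<in> paths_in S \<Longrightarrow> p \<in> homotopy_class S p"
  by (simp add: homotopy_class_def)

lemma homotopy_class_eqI: "homotopic_paths S p q \<Longrightarrow> homotopy_class S p = homotopy_class S q"
  unfolding homotopy_class_def using homotopic_paths_sym homotopic_paths_trans by blast

lemma psrc_class [simp]: "p \<in> paths_in S \<Longrightarrow> psrc (homotopy_class S p) = pathstart p"
  and ptgt_class [simp]: "p \<in> paths_in S \<Longrightarrow> ptgt (homotopy_class S p) = pathfinish p"
proof -
  assume p: "p \<in> paths_in S"
  have "(SOME q. q \<in> homotopy_class S p) \<in> homotopy_class S p"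
    using homotopy_class_self[OF p] by (rule someI[where P = "\<lambda>q. q \<in> homotopy_class S p"])
  then have "homotopic_paths S p (SOME q. q \<in> homotopy_class S p)" by (simp add: homotopy_class_def)
  from homotopic_paths_imp_pathstart[OF this] homotopic_paths_imp_pathfinish[OF this]
  show "psrc (homotopy_class S p) = pathstart p" "ptgt (homotopy_class S p) = pathfinish p"
    by (auto simp: psrc_def ptgt_def)
qed

lemma path_classesE:
  assumes "A \<in> path_classes S"
  obtains p where "path p" "path_image p \<subseteq> S" "A = homotopy_class S p" "psrc A = pathstart p" "ptgt A = pathfinish p"
  using assms by (auto simp: path_classes_def)

lemma homotopy_class_in [simp]: "p \<in> paths_in S \<Longrightarrow> homotopy_class S p \<in> path_classes S"
  by (auto simp: path_classes_def)

lemma const_paths_in: "x \<in> S \<Longrightarrow> (\<lambda>_. x) \<in> paths_in S"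
  by (auto simp: path_def path_image_def)

lemma pathstart_const: "pathstart (\<lambda>_. x) = x" "pathfinish (\<lambda>_. x) = x"
  by (auto simp: pathstart_def pathfinish_def)

lemma pmul_class:
  assumes "p \<in> paths_in S" "q \<in> paths_in S" "pathfinish p = pathstart q"
  shows "pmul S (homotopy_class S p) (homotopy_class S q) = homotopy_class S (p +++ q)"
proof -
  have "homotopy_class S (p' +++ q') = homotopy_class S (p +++ q)"
    if "p' \<in> homotopy_class S p" "q' \<in> homotopy_class S q" for p' q'
    using that assms(3) by (intro homotopy_class_eqI homotopic_paths_sym[OF homotopic_paths_join]) (auto simp: homotopy_class_def)
  then show ?thesis
    unfolding pmul_def using homotopy_class_self[OF assms(1)] homotopy_class_self[OF assms(2)] by blast
qed

lemma pinv_class: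
  assumes "p \<in> paths_in S"
  shows "pinv S (homotopy_class S p) = homotopy_class S (reversepath p)"
proof -
  have "homotopy_class S (reversepath p') = homotopy_class S (reversepath p)"
    if "p' \<in> homotopy_class S p" for p'
    using that by (intro homotopy_class_eqI homotopic_paths_sym[OF homotopic_paths_reversepath_D]) (auto simp: homotopy_class_def)
  then show ?thesis
    unfolding pinv_def using homotopy_class_self[OF assms(1)] by blast
qed

lemma ppush_class:
  assumes "p \<in> paths_in S" "continuous_on S f" "f \<in> S \<rightarrow> T"
  shows "ppush T f (homotopy_class S p) = homotopy_class T (f \<circ> p)"
proof -
  have "homotopy_class T (f \<circ> p') = homotopy_class T (f \<circ> p)"
    if "p' \<in> homotopy_class S p" for p'
    using that assms by (intro homotopy_class_eqI homotopic_paths_sym[OF homotopic_paths_continuous_image[of S]])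
      (auto simp: homotopy_class_def)
  then show ?thesis
    unfolding ppush_def using homotopy_class_self[OF assms(1)] by blast
qed

lemma compose_paths_in:
  assumes "p \<in> paths_in S" "continuous_on S f" "f \<in> S \<rightarrow> T"
  shows "f \<circ> p \<in> paths_in T"
  using assms path_continuous_image[of p f] continuous_on_subset[of S f "path_image p"]
  by (auto simp: path_image_def Pi_iff subset_iff)

lemma pmul_simps [simp]:
  assumes "A \<in> path_classes S" "B \<in> path_classes S" "ptgt A = psrc B"
  shows "pmul S A B \<in> path_classes S" "psrc (pmul S A B) = psrc A" "ptgt (pmul S A B) = ptgt B"
  using assms by (auto elim!: path_classesE simp: pmul_class subset_path_image_join)

lemma pinv_simps [simp]:
  assumes "A \<in> path_classes S"
  shows "pinv S A \<in> path_classes S" "psrc (pinv S A) = ptgt A" "ptgt (pinv S A) = psrc A" "pinv S (pinv S A) = A"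
  using assms by (auto elim!: path_classesE simp: pinv_class)

lemma psrc_in: "A \<in> path_classes S \<Longrightarrow> psrc A \<in> S" "A \<in> path_classes S \<Longrightarrow> ptgt A \<in> S"
  by (metis path_classesE pathstart_in_path_image pathfinish_in_path_image subsetD)+

lemma pid_simps [simp]:
  assumes "x \<in> S"
  shows "pid S x \<in> path_classes S" "psrc (pid S x) = x" "ptgt (pid S x) = x" "pinv S (pid S x) = pid S x"
  using const_paths_in[OF assms] by (auto simp: pathstart_const pinv_class reversepath_def)

lemma ppush_simps:
  assumes "A \<in> path_classes S" "continuous_on S f" "f \<in> S \<rightarrow> T"
  shows "ppush T f A \<in> path_classes T" "psrc (ppush T f A) = f (psrc A)" "ptgt (ppush T f A) = f (ptgt A)"
    "pinv T (ppush T f A) = ppush T f (pinv S A)"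
proof -
  from assms obtain p where p: "p \<in> paths_in S" "A = homotopy_class S p" by (auto simp: path_classes_def)
  have fp: "f \<circ> p \<in> paths_in T" by (rule compose_paths_in) (use assms p in auto)
  have rp: "reversepath p \<in> paths_in S" using p by auto
  have "reversepath (f \<circ> p) = f \<circ> reversepath p" by (auto simp: reversepath_def)
  then show "ppush T f A \<in> path_classes T" "psrc (ppush T f A) = f (psrc A)" "ptgt (ppush T f A) = f (ptgt A)"
    "pinv T (ppush T f A) = ppush T f (pinv S A)"
    using p fp rp assms by (auto simp: ppush_class pathstart_compose pathfinish_compose pinv_class simp del: mem_Collect_eq)
qed

lemma ppush_pmul:
  assumes "A \<in> path_classes S" "B \<in> path_classes S" "ptgt A = psrc B" "continuous_on S f" "f \<in> S \<rightarrow> T"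
  shows "ppush T f (pmul S A B) = pmul T (ppush T f A) (ppush T f B)"
proof -
  from assms obtain p where p: "p \<in> paths_in S" "A = homotopy_class S p" by (auto simp: path_classes_def)
  from assms obtain q where q: "q \<in> paths_in S" "B = homotopy_class S q" by (auto simp: path_classes_def)
  have pq: "pathfinish p = pathstart q" using assms p q by simp
  then have j: "p +++ q \<in> paths_in S" using p q by (auto simp: subset_path_image_join)
  have "pathfinish (f \<circ> p) = pathstart (f \<circ> q)" using pq by (simp add: pathstart_compose pathfinish_compose)
  then show ?thesis
    using p q pq j compose_paths_in[OF _ assms(4,5)] assms
    by (simp add: pmul_class ppush_class path_compose_join del: mem_Collect_eq)
qed

lemma continuous_comp_into:
  assumes "continuous_on S f" "f \<in> S \<rightarrow> T" "continuous_on T g" "g \<in> T \<rightarrow> U"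
  shows "continuous_on S (g \<circ> f)" "g \<circ> f \<in> S \<rightarrow> U"
  using assms continuous_on_compose2[of T g S f] by (auto simp: comp_def)

lemma ppush_ppush:
  assumes "A \<in> path_classes S" "continuous_on S f" "f \<in> S \<rightarrow> T" "continuous_on T g" "g \<in> T \<rightarrow> U"
  shows "ppush U g (ppush T f A) = ppush U (g \<circ> f) A"
proof -
  from assms obtain p where p: "p \<in> paths_in S" "A = homotopy_class S p" by (auto simp: path_classes_def)
  have "continuous_on S (g \<circ> f)" "g \<circ> f \<in> S \<rightarrow> U"
    by (rule continuous_comp_into[OF assms(2-5)])+
  then show ?thesis
    using p compose_paths_in[OF p(1) assms(2,3)] assms by (simp add: ppush_class comp_assoc del: mem_Collect_eq)
qed

lemma pmul_assoc [simp]: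
  assumes "A \<in> path_classes S" "B \<in> path_classes S" "C \<in> path_classes S" "ptgt A = psrc B" "ptgt B = psrc C"
  shows "pmul S (pmul S A B) C = pmul S A (pmul S B C)"
proof -
  from assms obtain p where p: "p \<in> paths_in S" "A = homotopy_class S p" by (auto simp: path_classes_def)
  from assms obtain q where q: "q \<in> paths_in S" "B = homotopy_class S q" by (auto simp: path_classes_def)
  from assms obtain r where r: "r \<in> paths_in S" "C = homotopy_class S r" by (auto simp: path_classes_def)
  have "pathfinish p = pathstart q" "pathfinish q = pathstart r" using assms p q r by auto
  then show ?thesis
    using p q r by (auto simp: pmul_class subset_path_image_join
        intro!: homotopy_class_eqI homotopic_paths_sym[OF homotopic_paths_assoc])
qed

text \<open>Every path is the image of the identity path of the unit interval, so the unit and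
  inverse laws have to be known only for that interval.\<close>

lemma homotopic_paths_unit_interval_image:
  assumes "p \<in> paths_in S" and "homotopic_paths {0..1} a b"
  shows "homotopic_paths S (p \<circ> a) (p \<circ> b)"
  using assms by (intro homotopic_paths_continuous_image[of "{0..1}"]) (auto simp: path_def path_image_def)

lemma homotopic_paths_units:
  assumes p: "p \<in> paths_in S"
  shows "homotopic_paths S (p +++ (\<lambda>_. pathfinish p)) p" "homotopic_paths S ((\<lambda>_. pathstart p) +++ p) p"
    "homotopic_paths S (p +++ reversepath p) (\<lambda>_. pathstart p)"
    "homotopic_paths S (reversepath p +++ p) (\<lambda>_. pathfinish p)"
proof -
  let ?i = "\<lambda>t::real. t"
  have i: "path ?i" "path_image ?i \<subseteq> {0..1}" by (auto simp: path_def path_image_def)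
  have "p \<circ> (?i +++ linepath 1 1) = p +++ (\<lambda>_. pathfinish p)"
    "p \<circ> (linepath 0 0 +++ ?i) = (\<lambda>_. pathstart p) +++ p"
    "p \<circ> (?i +++ reversepath ?i) = p +++ reversepath p"
    "p \<circ> (reversepath ?i +++ ?i) = reversepath p +++ p"
    by (auto simp: fun_eq_iff joinpaths_def linepath_refl pathfinish_def pathstart_def reversepath_def)
  then show "homotopic_paths S (p +++ (\<lambda>_. pathfinish p)) p" "homotopic_paths S ((\<lambda>_. pathstart p) +++ p) p"
    "homotopic_paths S (p +++ reversepath p) (\<lambda>_. pathstart p)"
    "homotopic_paths S (reversepath p +++ p) (\<lambda>_. pathfinish p)"
    using homotopic_paths_unit_interval_image[OF p homotopic_paths_rid[OF i]]
      homotopic_paths_unit_interval_image[OF p homotopic_paths_lid[OF i]]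
      homotopic_paths_unit_interval_image[OF p homotopic_paths_rinv[OF i]]
      homotopic_paths_unit_interval_image[OF p homotopic_paths_linv[OF i]]
    by (simp_all add: pathstart_def pathfinish_def comp_def linepath_refl)
qed

lemma pmul_pid [simp]:
  assumes "A \<in> path_classes S"
  shows "ptgt A = x \<Longrightarrow> pmul S A (pid S x) = A" "psrc A = x \<Longrightarrow> pmul S (pid S x) A = A"
proof -
  from assms obtain p where p: "p \<in> paths_in S" "A = homotopy_class S p" by (auto simp: path_classes_def)
  have "pathfinish p \<in> S" "pathstart p \<in> S" using p by auto
  with homotopic_paths_units(1,2)[OF p(1)] show "ptgt A = x \<Longrightarrow> pmul S A (pid S x) = A" "psrc A = x \<Longrightarrow> pmul S (pid S x) A = A"
    using p by (auto simp: pmul_class const_paths_in pathstart_const intro!: homotopy_class_eqI simp del: mem_Collect_eq)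
qed

lemma pmul_pinv [simp]:
  assumes "A \<in> path_classes S"
  shows "pmul S A (pinv S A) = pid S (psrc A)" "pmul S (pinv S A) A = pid S (ptgt A)"
proof -
  from assms obtain p where p: "p \<in> paths_in S" "A = homotopy_class S p" by (auto simp: path_classes_def)
  have rp: "reversepath p \<in> paths_in S" using p by auto
  from homotopic_paths_units(3,4)[OF p(1)] show "pmul S A (pinv S A) = pid S (psrc A)" "pmul S (pinv S A) A = pid S (ptgt A)"
    using p rp by (auto simp: pmul_class pinv_class intro!: homotopy_class_eqI simp del: mem_Collect_eq)
qed

lemma pmul_cancel [simp]:
  assumes "A \<in> path_classes S" "B \<in> path_classes S"
  shows "psrc A = psrc B \<Longrightarrow> pmul S A (pmul S (pinv S A) B) = B"
    "ptgt A = psrc B \<Longrightarrow> pmul S (pinv S A) (pmul S A B) = B"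
proof -
  show "psrc A = psrc B \<Longrightarrow> pmul S A (pmul S (pinv S A) B) = B"
    using pmul_assoc[of A S "pinv S A" B] assms by (simp del: pmul_assoc)
  show "ptgt A = psrc B \<Longrightarrow> pmul S (pinv S A) (pmul S A B) = B"
    using pmul_assoc[of "pinv S A" S A B] assms by (simp del: pmul_assoc)
qed

lemma pinv_pmul [simp]:
  assumes "A \<in> path_classes S" "B \<in> path_classes S" "ptgt A = psrc B"
  shows "pinv S (pmul S A B) = pmul S (pinv S B) (pinv S A)"
proof -
  let ?C = "pmul S A B" and ?D = "pmul S (pinv S B) (pinv S A)"
  have C: "?C \<in> path_classes S" "psrc ?C = psrc A" "ptgt ?C = ptgt B"
    and D: "?D \<in> path_classes S" "psrc ?D = ptgt B" "ptgt ?D = psrc A"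
    using assms by simp_all
  have "pmul S ?D ?C = pid S (ptgt B)" using assms by simp
  then have "pinv S ?C = pmul S (pmul S ?D ?C) (pinv S ?C)" using C by simp
  also have "\<dots> = pmul S ?D (pmul S ?C (pinv S ?C))" by (rule pmul_assoc) (use C D in simp_all)
  also have "\<dots> = pmul S ?D (pid S (psrc A))" using pmul_pinv(1)[OF C(1)] C by simp
  also have "\<dots> = ?D" by (rule pmul_pid(1)) (use D in simp_all)
  finally show ?thesis .
qed

section \<open>Fundamental groups inside the path groupoid\<close>

lemma fundamental_group_simps:
  "carrier (fundamental_group S x) = {A \<in> path_classes S. psrc A = x \<and> ptgt A = x}"
  "A \<otimes>\<^bsub>fundamental_group S x\<^esub> B = pmul S A B"
  "\<one>\<^bsub>fundamental_group S x\<^esub> = pid S x"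
  by (auto simp: fundamental_group_def path_classes_def paths_between_def pmul_def)

lemma group_fundamental_group:
  assumes "x \<in> S"
  shows "group (fundamental_group S x)"
proof (rule groupI)
  fix A assume "A \<in> carrier (fundamental_group S x)"
  then show "\<exists>B\<in>carrier (fundamental_group S x). B \<otimes>\<^bsub>fundamental_group S x\<^esub> A = \<one>\<^bsub>fundamental_group S x\<^esub>"
    by (intro bexI[of _ "pinv S A"]) (auto simp: fundamental_group_simps)
qed (auto simp: fundamental_group_simps assms)

lemma inv_fundamental_group:
  assumes "A \<in> carrier (fundamental_group S x)"
  shows "inv\<^bsub>fundamental_group S x\<^esub> A = pinv S A"
proof -
  have "x \<in> S" using assms psrc_in by (auto simp: fundamental_group_simps)
  then interpret group "fundamental_group S x" by (rule group_fundamental_group)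
  show ?thesis by (rule inv_equality) (use assms in \<open>auto simp: fundamental_group_simps\<close>)
qed

lemma paths_between_class:
  assumes "\<gamma> \<in> paths_between S x y"
  shows "homotopy_class S \<gamma> \<in> path_classes S" "psrc (homotopy_class S \<gamma>) = x" "ptgt (homotopy_class S \<gamma>) = y"
  using assms by (auto simp: paths_between_def)

text \<open>Rewrites the definition by paths as a conjugation in the groupoid, where the later
  identities follow from the groupoid laws.\<close>

lemma fundamental_group_map_class:
  assumes A: "A \<in> carrier (fundamental_group E x)" and f: "continuous_on E f" "f \<in> E \<rightarrow> Y"
    and \<gamma>: "\<gamma> \<in> paths_between Y y (f x)"
  shows "fundamental_group_map Y \<gamma> f A
    = pmul Y (homotopy_class Y \<gamma>) (pmul Y (ppush Y f A) (pinv Y (homotopy_class Y \<gamma>)))"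
proof -
  from A obtain p where p: "p \<in> paths_in E" "A = homotopy_class E p" "pathstart p = x" "pathfinish p = x"
    by (auto simp: fundamental_group_simps path_classes_def)
  have g: "\<gamma> \<in> paths_in Y" "pathstart \<gamma> = y" "pathfinish \<gamma> = f x" using \<gamma> by (auto simp: paths_between_def)
  have *: "homotopy_class Y (\<gamma> +++ (f \<circ> q) +++ reversepath \<gamma>) =
     pmul Y (homotopy_class Y \<gamma>) (pmul Y (ppush Y f A) (pinv Y (homotopy_class Y \<gamma>)))" if "q \<in> A" for q
  proof -
    have h: "homotopic_paths E p q" using that p by (simp add: homotopy_class_def)
    then have q: "q \<in> paths_in E" "pathstart q = x" "pathfinish q = x" "A = homotopy_class E q"
      using homotopic_paths_imp_path[OF h] homotopic_paths_imp_subset[OF h] homotopic_paths_imp_pathstart[OF h]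
        homotopic_paths_imp_pathfinish[OF h] p homotopy_class_eqI[OF h] by auto
    have "f \<circ> q \<in> paths_in Y" "pathstart (f \<circ> q) = f x" "pathfinish (f \<circ> q) = f x"
      using compose_paths_in[OF q(1) f] q by (auto simp: pathstart_compose pathfinish_compose)
    moreover have "(f \<circ> q) +++ reversepath \<gamma> \<in> paths_in Y" "reversepath \<gamma> \<in> paths_in Y"
      using calculation g by (auto simp: subset_path_image_join)
    ultimately show ?thesis
      using g q f by (simp add: pmul_class pinv_class ppush_class del: mem_Collect_eq)
  qed
  have "p \<in> A" using p homotopy_class_self by blast
  then show ?thesis unfolding fundamental_group_map_def using * by blast
qed

lemma fundamental_group_map_hom:
  assumes f: "continuous_on E f" "f \<in> E \<rightarrow> Y" and x: "x \<in> E"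
    and \<gamma>: "\<gamma> \<in> paths_between Y y (f x)"
  shows "fundamental_group_map Y \<gamma> f \<in> hom (fundamental_group E x) (fundamental_group Y y)"
proof -
  note g = paths_between_class[OF \<gamma>]
  note [simp] = ppush_simps[OF _ f]
  show ?thesis
  proof (rule homI)
    fix A assume A: "A \<in> carrier (fundamental_group E x)"
    show "fundamental_group_map Y \<gamma> f A \<in> carrier (fundamental_group Y y)"
      unfolding fundamental_group_map_class[OF A f \<gamma>] using A f g by (auto simp: fundamental_group_simps)
    fix B assume B: "B \<in> carrier (fundamental_group E x)"
    have AB: "A \<otimes>\<^bsub>fundamental_group E x\<^esub> B \<in> carrier (fundamental_group E x)"
      using A B by (auto simp: fundamental_group_simps)
    show "fundamental_group_map Y \<gamma> f (A \<otimes>\<^bsub>fundamental_group E x\<^esub> B)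
      = fundamental_group_map Y \<gamma> f A \<otimes>\<^bsub>fundamental_group Y y\<^esub> fundamental_group_map Y \<gamma> f B"
      unfolding fundamental_group_map_class[OF A f \<gamma>] fundamental_group_map_class[OF B f \<gamma>]
        fundamental_group_map_class[OF AB f \<gamma>]
      using A B f g by (simp add: fundamental_group_simps ppush_pmul)
  qed
qed

lemma fundamental_group_map_comp:
  assumes f: "continuous_on E f" "f \<in> E \<rightarrow> Y" and g: "continuous_on Y g" "g \<in> Y \<rightarrow> Z" and x: "x \<in> E"
    and \<gamma>: "\<gamma> \<in> paths_between Y y (f x)" and \<delta>: "\<delta> \<in> paths_between Z z (g y)"
    and A: "A \<in> carrier (fundamental_group E x)"
  shows "fundamental_group_map Z \<delta> g (fundamental_group_map Y \<gamma> f A)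
    = fundamental_group_map Z (\<delta> +++ (g \<circ> \<gamma>)) (g \<circ> f) A"
    and "\<delta> +++ (g \<circ> \<gamma>) \<in> paths_between Z z ((g \<circ> f) x)"
proof -
  have \<gamma>p: "\<gamma> \<in> paths_in Y" "pathstart \<gamma> = y" "pathfinish \<gamma> = f x" using \<gamma> by (auto simp: paths_between_def)
  have \<delta>p: "\<delta> \<in> paths_in Z" "pathstart \<delta> = z" "pathfinish \<delta> = g y" using \<delta> by (auto simp: paths_between_def)
  have g\<gamma>: "g \<circ> \<gamma> \<in> paths_in Z" "pathstart (g \<circ> \<gamma>) = g y" "pathfinish (g \<circ> \<gamma>) = g (f x)"
    using compose_paths_in[OF \<gamma>p(1) g] \<gamma>p by (auto simp: pathstart_compose pathfinish_compose)
  show c: "\<delta> +++ (g \<circ> \<gamma>) \<in> paths_between Z z ((g \<circ> f) x)"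
    using \<delta>p g\<gamma> by (auto simp: paths_between_def subset_path_image_join)
  have gf: "continuous_on E (g \<circ> f)" "g \<circ> f \<in> E \<rightarrow> Z"
    by (rule continuous_comp_into[OF f g])+
  note [simp] = ppush_simps[OF _ f] ppush_simps[OF _ g] ppush_simps[OF _ gf]
  have fA: "fundamental_group_map Y \<gamma> f A \<in> carrier (fundamental_group Y y)"
    using fundamental_group_map_hom[OF f x \<gamma>] A by (rule hom_in_carrier)
  have "homotopy_class Z (\<delta> +++ (g \<circ> \<gamma>)) = pmul Z (homotopy_class Z \<delta>) (ppush Z g (homotopy_class Y \<gamma>))"
    using \<gamma>p \<delta>p g\<gamma> g by (simp add: pmul_class ppush_class del: mem_Collect_eq)
  then show "fundamental_group_map Z \<delta> g (fundamental_group_map Y \<gamma> f A)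
    = fundamental_group_map Z (\<delta> +++ (g \<circ> \<gamma>)) (g \<circ> f) A"
    unfolding fundamental_group_map_class[OF fA g \<delta>]
    unfolding fundamental_group_map_class[OF A f \<gamma>] fundamental_group_map_class[OF A gf c]
    using A f g gf paths_between_class[OF \<gamma>] paths_between_class[OF \<delta>]
    by (simp add: fundamental_group_simps ppush_pmul ppush_ppush[of A E f Y g Z])
qed

text \<open>The square is convex, hence simply connected, so its two boundary routes between
  opposite corners are homotopic; \<open>H\<close> pushes this homotopy forward.\<close>

lemma square_homotopy:
  fixes H :: "real \<times> real \<Rightarrow> 'a::topological_space"
  assumes H: "continuous_on ({0..1} \<times> {0..1}) H" "H \<in> {0..1} \<times> {0..1} \<rightarrow> S"
  shows "homotopic_paths S ((\<lambda>t. H (0, t)) +++ (\<lambda>s. H (s, 1))) ((\<lambda>s. H (s, 0)) +++ (\<lambda>t. H (1, t)))"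
proof -
  let ?Q = "{0..1::real} \<times> {0..1::real}"
  let ?p = "linepath (0::real,0::real) (0,1) +++ linepath (0,1) (1,1)"
  let ?q = "linepath (0::real,0::real) (1,0) +++ linepath (1,0) (1,1)"
  have cv: "convex ?Q" by (intro convex_Times) auto
  have seg: "closed_segment a b \<subseteq> ?Q" if "a \<in> ?Q" "b \<in> ?Q" for a b
    using that cv by (simp add: closed_segment_subset)
  have "homotopic_paths ?Q ?p ?q"
    using simply_connected_eq_homotopic_paths[of ?Q] convex_imp_simply_connected[OF cv] seg
    by (auto simp: path_image_join)
  from homotopic_paths_continuous_image[OF this H]
  have "homotopic_paths S (H \<circ> ?p) (H \<circ> ?q)" .
  moreover have "H \<circ> ?p = (\<lambda>t. H (0, t)) +++ (\<lambda>s. H (s, 1))" "H \<circ> ?q = (\<lambda>s. H (s, 0)) +++ (\<lambda>t. H (1, t))"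
    by (auto simp: path_compose_join fun_eq_iff joinpaths_def linepath_def)
  ultimately show ?thesis by simp
qed

text \<open>A homotopy is a natural transformation between the induced functors on path groupoids;
  its component at a point is the track of that point.\<close>

lemma homotopic_maps_push:
  assumes h: "continuous_on ({0..1} \<times> E) h" "h \<in> {0..1} \<times> E \<rightarrow> Y" and A: "A \<in> path_classes E"
  shows "x \<in> E \<Longrightarrow> (\<lambda>s. h (s, x)) \<in> paths_in Y"
    and "pmul Y (ppush Y (\<lambda>x. h (0, x)) A) (homotopy_class Y (\<lambda>s. h (s, ptgt A)))
      = pmul Y (homotopy_class Y (\<lambda>s. h (s, psrc A))) (ppush Y (\<lambda>x. h (1, x)) A)"
proof -
  have tau: "(\<lambda>s. h (s, x)) \<in> paths_in Y" if "x \<in> E" for x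
  proof -
    have "continuous_on {0..1} (\<lambda>s. h (s, x))"
      by (rule continuous_on_compose2[OF h(1)]) (use that in \<open>auto intro!: continuous_intros\<close>)
    then show ?thesis using h(2) that by (auto simp: path_def path_image_def)
  qed
  then show "x \<in> E \<Longrightarrow> (\<lambda>s. h (s, x)) \<in> paths_in Y" .
  from A obtain p where p: "p \<in> paths_in E" "A = homotopy_class E p" by (auto simp: path_classes_def)
  have pX: "p t \<in> E" if "t \<in> {0..1}" for t using p that by (auto simp: path_image_def)
  have c: "continuous_on E (\<lambda>x. h (i, x))" "(\<lambda>x. h (i, x)) \<in> E \<rightarrow> Y" if "i \<in> {0..1}" for i
  proof -
    show "continuous_on E (\<lambda>x. h (i, x))"
      by (rule continuous_on_compose2[OF h(1)]) (use that in \<open>auto intro!: continuous_intros\<close>)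
    show "(\<lambda>x. h (i, x)) \<in> E \<rightarrow> Y" using h(2) that by auto
  qed
  have "continuous_on {0..1} p" using p by (simp add: path_def)
  then have cp: "continuous_on ({0..1} \<times> {0..1}) (\<lambda>z. p (snd z))"
    by (rule continuous_on_compose2) (auto intro!: continuous_intros)
  have "homotopic_paths Y ((\<lambda>t. (\<lambda>(s, t). h (s, p t)) (0, t)) +++ (\<lambda>s. (\<lambda>(s, t). h (s, p t)) (s, 1)))
    ((\<lambda>s. (\<lambda>(s, t). h (s, p t)) (s, 0)) +++ (\<lambda>t. (\<lambda>(s, t). h (s, p t)) (1, t)))"
  proof (rule square_homotopy)
    show "continuous_on ({0..1} \<times> {0..1}) (\<lambda>(s, t). h (s, p t))"
      unfolding case_prod_unfold
      by (rule continuous_on_compose2[OF h(1)]) (use pX in \<open>auto intro!: continuous_intros cp\<close>)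
  qed (use h(2) pX in auto)
  then have "homotopic_paths Y (((\<lambda>x. h (0, x)) \<circ> p) +++ (\<lambda>s. h (s, p 1))) ((\<lambda>s. h (s, p 0)) +++ ((\<lambda>x. h (1, x)) \<circ> p))"
    by (simp add: comp_def)
  then show "pmul Y (ppush Y (\<lambda>x. h (0, x)) A) (homotopy_class Y (\<lambda>s. h (s, ptgt A)))
      = pmul Y (homotopy_class Y (\<lambda>s. h (s, psrc A))) (ppush Y (\<lambda>x. h (1, x)) A)"
    using p c tau[OF pX] compose_paths_in[OF p(1) c]
    by (auto simp: ppush_class pmul_class pathstart_def pathfinish_def intro!: homotopy_class_eqI simp del: mem_Collect_eq)
qed

text \<open>The homotopy is free: base points move along tracks, which accounts for the conjugation
  in the conclusion.\<close>

lemma fundamental_group_map_homotopic: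
  assumes h: "homotopic_with_canon (\<lambda>_. True) E Y f g" and x: "x \<in> E"
    and \<gamma>: "\<gamma> \<in> paths_between Y y (f x)" and \<delta>: "\<delta> \<in> paths_between Y y (g x)"
  shows "\<exists>a\<in>carrier (fundamental_group Y y). \<forall>A\<in>carrier (fundamental_group E x). fundamental_group_map Y \<gamma> f A
      = a \<otimes>\<^bsub>fundamental_group Y y\<^esub> fundamental_group_map Y \<delta> g A \<otimes>\<^bsub>fundamental_group Y y\<^esub> inv\<^bsub>fundamental_group Y y\<^esub> a"
proof -
  have f: "continuous_on E f" "f \<in> E \<rightarrow> Y" and g: "continuous_on E g" "g \<in> E \<rightarrow> Y"
    using homotopic_with_imp_continuous[OF h] homotopic_with_imp_funspace1[OF h] homotopic_with_imp_funspace2[OF h] by auto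
  note [simp] = ppush_simps[OF _ f] ppush_simps[OF _ g]
  from h have "\<exists>k. continuous_on ({0..1::real} \<times> E) k \<and> k \<in> {0..1} \<times> E \<rightarrow> Y
    \<and> (\<forall>x. k (0, x) = f x) \<and> (\<forall>x. k (1, x) = g x)"
    by (auto simp: homotopic_with_def continuous_map_in_subtopology image_subset_iff_funcset prod_topology_subtopology_eu)
  then obtain k where k: "continuous_on ({0..1::real} \<times> E) k" "k \<in> {0..1} \<times> E \<rightarrow> Y"
    "\<And>x. k (0, x) = f x" "\<And>x. k (1, x) = g x"
    by blast
  have kf: "(\<lambda>x. k (0, x)) = f" "(\<lambda>x. k (1, x)) = g" using k by auto
  note G = paths_between_class[OF \<gamma>] and D = paths_between_class[OF \<delta>]
  let ?t = "homotopy_class Y (\<lambda>s. k (s, x))"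
  have "pid E x \<in> path_classes E" using x by simp
  from homotopic_maps_push(1)[OF k(1,2) this x] have "(\<lambda>s. k (s, x)) \<in> paths_in Y" .
  then have t: "?t \<in> path_classes Y" "psrc ?t = f x" "ptgt ?t = g x"
    using k by (auto simp: pathstart_def pathfinish_def simp del: mem_Collect_eq)
  \<comment> \<open>The loop that runs along \<open>\<gamma>\<close>, follows the track of
    \<open>x\<close> and returns along \<open>\<delta>\<close>.\<close>
  let ?a = "pmul Y (homotopy_class Y \<gamma>) (pmul Y ?t (pinv Y (homotopy_class Y \<delta>)))"
  have a: "?a \<in> carrier (fundamental_group Y y)" using G D t by (simp add: fundamental_group_simps)
  moreover have "fundamental_group_map Y \<gamma> f A
      = ?a \<otimes>\<^bsub>fundamental_group Y y\<^esub> fundamental_group_map Y \<delta> g A \<otimes>\<^bsub>fundamental_group Y y\<^esub> inv\<^bsub>fundamental_group Y y\<^esub> ?a"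
    if A: "A \<in> carrier (fundamental_group E x)" for A
  proof -
    have A': "A \<in> path_classes E" "psrc A = x" "ptgt A = x" using A by (auto simp: fundamental_group_simps)
    from homotopic_maps_push(2)[OF k(1,2) A'(1)]
    have "pmul Y (ppush Y f A) ?t = pmul Y ?t (ppush Y g A)" using A' kf by simp
    moreover have "pmul Y (ppush Y f A) (pinv Y (homotopy_class Y \<gamma>))
      = pmul Y (pmul Y (ppush Y f A) ?t) (pmul Y (pinv Y ?t) (pinv Y (homotopy_class Y \<gamma>)))"
      using A' f G t by simp
    ultimately show ?thesis
      unfolding inv_fundamental_group[OF a] fundamental_group_map_class[OF A f \<gamma>] fundamental_group_map_class[OF A g \<delta>]
      using A' f g G D t by (simp add: fundamental_group_simps)
  qed
  ultimately show ?thesis by blast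
qed

section \<open>The graded functor on path-connected spaces and its traces\<close>

abbreviation gr_space :: "nat \<Rightarrow> 'a::topological_space set \<Rightarrow> 'a
    \<Rightarrow> ('k::field, ((real \<Rightarrow> 'a) set set \<times> 'k \<Rightarrow>\<^sub>0 int) set) module" where
  "gr_space j S x \<equiv> gr_piece (fundamental_group S x) (Suc j)"

text \<open>The connecting path is chosen and forgotten: by \<open>gr_map_induced\<close> every
  other path gives the same map on the graded piece.\<close>

definition induced :: "nat \<Rightarrow> 'a::topological_space \<Rightarrow> 'a set \<Rightarrow> 'a \<Rightarrow> ('a \<Rightarrow> 'a)
    \<Rightarrow> ((real \<Rightarrow> 'a) set set \<times> 'k::field \<Rightarrow>\<^sub>0 int) set \<Rightarrow> ((real \<Rightarrow> 'a) set set \<times> 'k \<Rightarrow>\<^sub>0 int) set" where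
  "induced j x Y y f = gr_map (fundamental_group Y y) (Suc j)
    (fundamental_group_map Y (SOME \<gamma>. \<gamma> \<in> paths_between Y y (f x)) f)"

abbreviation maps :: "'a::topological_space set \<Rightarrow> 'b::topological_space set \<Rightarrow> ('a \<Rightarrow> 'b) \<Rightarrow> bool" where
  "maps S T f \<equiv> continuous_on S f \<and> f \<in> S \<rightarrow> T"

abbreviation homotopic_maps :: "'a::topological_space set \<Rightarrow> 'b::topological_space set \<Rightarrow> ('a \<Rightarrow> 'b) \<Rightarrow> ('a \<Rightarrow> 'b) \<Rightarrow> bool" where
  "homotopic_maps S T f g \<equiv> homotopic_with_canon (\<lambda>_. True) S T f g"

lemma paths_between_some:
  assumes "path_connected Y" "y \<in> Y" "z \<in> Y"
  shows "(SOME \<gamma>. \<gamma> \<in> paths_between Y y z) \<in> paths_between Y y z"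
proof -
  have "\<exists>\<gamma>. \<gamma> \<in> paths_between Y y z"
    using assms unfolding path_connected_def paths_between_def by blast
  then show ?thesis by (rule someI_ex)
qed

lemma homotopic_maps_maps:
  assumes "homotopic_maps E Y f g"
  shows "maps E Y f" "maps E Y g"
  using homotopic_with_imp_continuous[OF assms] homotopic_with_imp_funspace1[OF assms]
    homotopic_with_imp_funspace2[OF assms] by auto

lemma homotopic_maps_equal:
  assumes "maps E Y f" "\<And>x. x \<in> E \<Longrightarrow> f x = g x"
  shows "homotopic_maps E Y f g"
proof -
  have "homotopic_maps E Y f f" using assms(1) by (simp add: continuous_map_in_subtopology image_subset_iff_funcset)
  then show ?thesis by (rule homotopic_with_eq) (use assms(2) in auto)
qed

lemma gr_map_homotopic:
  assumes h: "homotopic_maps E Y f g" and x: "x \<in> E"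
    and \<gamma>: "\<gamma> \<in> paths_between Y y (f x)" and \<delta>: "\<delta> \<in> paths_between Y y (g x)"
    and v: "v \<in> carrier (gr_space j E x :: ('k::field, _) module)"
  shows "gr_map (fundamental_group Y y) (Suc j) (fundamental_group_map Y \<gamma> f) v
    = gr_map (fundamental_group Y y) (Suc j) (fundamental_group_map Y \<delta> g) v"
proof -
  have y: "y \<in> Y" using \<gamma> pathstart_in_path_image[of \<gamma>] by (auto simp: paths_between_def)
  note m = homotopic_maps_maps[OF h]
  obtain a where a: "a \<in> carrier (fundamental_group Y y)"
    "\<And>A. A \<in> carrier (fundamental_group E x) \<Longrightarrow> fundamental_group_map Y \<gamma> f A
      = a \<otimes>\<^bsub>fundamental_group Y y\<^esub> fundamental_group_map Y \<delta> g A \<otimes>\<^bsub>fundamental_group Y y\<^esub> inv\<^bsub>fundamental_group Y y\<^esub> a"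
    using fundamental_group_map_homotopic[OF h x \<gamma> \<delta>] by blast
  show ?thesis
  proof (rule gr_map_inner[where a = a, OF group_fundamental_group[OF x] group_fundamental_group[OF y] _ _ a(1)])
    show "fundamental_group_map Y \<gamma> f \<in> hom (fundamental_group E x) (fundamental_group Y y)"
      using m by (intro fundamental_group_map_hom[of E f Y x, OF _ _ x \<gamma>]) auto
    show "fundamental_group_map Y \<delta> g \<in> hom (fundamental_group E x) (fundamental_group Y y)"
      using m by (intro fundamental_group_map_hom[of E g Y x, OF _ _ x \<delta>]) auto
  qed (use a v in auto)
qed

lemma gr_map_induced:
  assumes "path_connected Y" and f: "maps E Y f" and x: "x \<in> E" and \<gamma>: "\<gamma> \<in> paths_between Y y (f x)"
    and v: "v \<in> carrier (gr_space j E x :: ('k::field, _) module)"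
  shows "gr_map (fundamental_group Y y) (Suc j) (fundamental_group_map Y \<gamma> f) v = induced j x Y y f v"
  unfolding induced_def
proof (rule gr_map_homotopic[where f = f and g = f, OF _ x \<gamma> _ v])
  show "homotopic_maps E Y f f" using f by (rule homotopic_maps_equal) auto
  have "y \<in> Y" "f x \<in> Y" using \<gamma> pathstart_in_path_image[of \<gamma>] f x by (auto simp: paths_between_def)
  then show "(SOME \<gamma>. \<gamma> \<in> paths_between Y y (f x)) \<in> paths_between Y y (f x)"
    using assms(1) by (intro paths_between_some)
qed

lemma induced_hom:
  assumes "path_connected Y" "maps E Y f" "x \<in> E" "y \<in> Y"
  shows "induced j x Y y f \<in> module_hom class_ring (gr_space j E x :: ('k::field, _) module) (gr_space j Y y)"
proof -
  have "f x \<in> Y" using assms by auto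
  note \<gamma> = paths_between_some[OF assms(1,4) this]
  have "fundamental_group_map Y (SOME \<gamma>. \<gamma> \<in> paths_between Y y (f x)) f
      \<in> hom (fundamental_group E x) (fundamental_group Y y)"
    using fundamental_group_map_hom[of E f Y x, OF _ _ assms(3) \<gamma>] assms by blast
  from gr_map_hom[OF group_fundamental_group[OF assms(3)] group_fundamental_group[OF assms(4)] this]
  show ?thesis by (simp add: induced_def)
qed

lemma induced_homotopic:
  assumes "path_connected Y" "homotopic_maps E Y f g" "x \<in> E" "y \<in> Y"
    and v: "v \<in> carrier (gr_space j E x :: ('k::field, _) module)"
  shows "induced j x Y y f v = induced j x Y y g v"
  unfolding induced_def
proof (rule gr_map_homotopic[where f = f and g = g, OF assms(2,3) _ _ v])
  note m = homotopic_maps_maps[OF assms(2)]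
  show "(SOME \<gamma>. \<gamma> \<in> paths_between Y y (f x)) \<in> paths_between Y y (f x)"
    "(SOME \<gamma>. \<gamma> \<in> paths_between Y y (g x)) \<in> paths_between Y y (g x)"
    using m assms by (auto intro!: paths_between_some)
qed

lemma induced_comp:
  assumes Y: "path_connected Y" and Z: "path_connected Z" and f: "maps E Y f" and g: "maps Y Z g"
    and x: "x \<in> E" and y: "y \<in> Y" and z: "z \<in> Z"
    and v: "v \<in> carrier (gr_space j E x :: ('k::field, _) module)"
  shows "induced j y Z z g (induced j x Y y f v) = induced j x Z z (\<lambda>x. g (f x)) v"
proof -
  have fx: "f x \<in> Y" "g y \<in> Z" using f g x y by auto
  define \<gamma> where "\<gamma> = (SOME \<gamma>. \<gamma> \<in> paths_between Y y (f x))"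
  define \<delta> where "\<delta> = (SOME \<gamma>. \<gamma> \<in> paths_between Z z (g y))"
  have \<gamma>: "\<gamma> \<in> paths_between Y y (f x)" unfolding \<gamma>_def by (rule paths_between_some[OF Y y fx(1)])
  have \<delta>: "\<delta> \<in> paths_between Z z (g y)" unfolding \<delta>_def by (rule paths_between_some[OF Z z fx(2)])
  have f': "continuous_on E f" "f \<in> E \<rightarrow> Y" and g': "continuous_on Y g" "g \<in> Y \<rightarrow> Z" using f g by auto
  note comp = fundamental_group_map_comp[OF f' g' x \<gamma> \<delta>]
  have gf: "maps E Z (g \<circ> f)" using continuous_comp_into[OF f' g'] by auto
  have c: "\<delta> +++ (g \<circ> \<gamma>) \<in> paths_between Z z ((g \<circ> f) x)"
  proof -
    have "\<one>\<^bsub>fundamental_group E x\<^esub> \<in> carrier (fundamental_group E x)"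
      using group_fundamental_group[OF x] by (simp add: group.is_monoid monoid.one_closed)
    then show ?thesis by (rule comp(2))
  qed
  have "induced j y Z z g (induced j x Y y f v)
    = gr_map (fundamental_group Z z) (Suc j) (fundamental_group_map Z \<delta> g)
       (gr_map (fundamental_group Y y) (Suc j) (fundamental_group_map Y \<gamma> f) v)"
    by (simp add: induced_def \<gamma>_def \<delta>_def)
  also have "\<dots> = gr_map (fundamental_group Z z) (Suc j) (fundamental_group_map Z (\<delta> +++ (g \<circ> \<gamma>)) (g \<circ> f)) v"
  proof (rule gr_map_comp[OF group_fundamental_group[OF x] group_fundamental_group[OF y] group_fundamental_group[OF z] _ _ _ _ v])
    show "fundamental_group_map Y \<gamma> f \<in> hom (fundamental_group E x) (fundamental_group Y y)"
      by (rule fundamental_group_map_hom[OF f' x \<gamma>])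
    show "fundamental_group_map Z \<delta> g \<in> hom (fundamental_group Y y) (fundamental_group Z z)"
      by (rule fundamental_group_map_hom[OF g' y \<delta>])
    show "fundamental_group_map Z (\<delta> +++ (g \<circ> \<gamma>)) (g \<circ> f) \<in> hom (fundamental_group E x) (fundamental_group Z z)"
      using gf by (intro fundamental_group_map_hom[of E "g \<circ> f" Z x, OF _ _ x c]) auto
  qed (rule comp(1)[symmetric])
  also have "\<dots> = induced j x Z z (g \<circ> f) v"
    by (rule gr_map_induced[OF Z gf x c v])
  finally show ?thesis by (simp add: comp_def)
qed

definition gr_trace :: "'k::field itself \<Rightarrow> nat \<Rightarrow> 'a::topological_space set \<Rightarrow> 'a \<Rightarrow> ('a \<Rightarrow> 'a) \<Rightarrow> 'k" where
  "gr_trace K j S x f = lin_trace (gr_space j S x) (induced j x S x f)"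

lemma gr_trace_homotopic:
  assumes "path_connected S" "homotopic_maps S S f g" "x \<in> S"
    and fin: "fin_vectorspace (gr_space j S x :: ('k::field, _) module)"
  shows "gr_trace TYPE('k) j S x f = gr_trace TYPE('k) j S x g"
  unfolding gr_trace_def
  by (rule fin_vectorspace.lin_trace_cong[OF fin], rule induced_homotopic[OF assms(1,2,3,3)])

text \<open>Cyclicity at the level of spaces. It is the only means by which a trace changes its base
  point, its space or the place of a projection.\<close>

lemma gr_trace_commute:
  fixes S T :: "'a::topological_space set"
  assumes S: "path_connected S" "x \<in> S" "fin_vectorspace (gr_space j S x :: ('k::field, _) module)"
    and T: "path_connected T" "y \<in> T" "fin_vectorspace (gr_space j T y :: ('k, _) module)"
    and f: "maps S T f" and g: "maps T S g"
  shows "gr_trace TYPE('k) j S x (\<lambda>x. g (f x)) = gr_trace TYPE('k) j T y (\<lambda>x. f (g x))"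
proof -
  have "gr_trace TYPE('k) j S x (\<lambda>x. g (f x))
    = lin_trace (gr_space j S x :: ('k, _) module) (\<lambda>v. induced j y S x g (induced j x T y f v))"
    unfolding gr_trace_def
    by (rule fin_vectorspace.lin_trace_cong[OF S(3)]) (rule induced_comp[OF T(1) S(1) f g S(2) T(2) S(2), symmetric])
  also have "\<dots> = lin_trace (gr_space j T y :: ('k, _) module) (\<lambda>v. induced j x T y f (induced j y S x g v))"
    by (rule lin_trace_commute[OF S(3) T(3) induced_hom[OF T(1) f S(2) T(2)] induced_hom[OF S(1) g T(2) S(2)]])
  also have "\<dots> = gr_trace TYPE('k) j T y (\<lambda>x. f (g x))"
    unfolding gr_trace_def
    by (rule fin_vectorspace.lin_trace_cong[OF T(3)]) (rule induced_comp[OF S(1) T(1) g f T(2) S(2) T(2)])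
  finally show ?thesis .
qed

section \<open>Orbit configuration spaces\<close>

text \<open>Two nonzero numbers have disjoint orbits exactly when their \<open>d\<close>-th powers
  differ. Arbitrary index sets are allowed because the cumulants live on subsets of the
  points.\<close>

definition Conf :: "nat \<Rightarrow> nat set \<Rightarrow> (nat \<Rightarrow> complex) set" where
  "Conf d S = {v \<in> S \<rightarrow>\<^sub>E (UNIV - {0}). \<forall>i\<in>S. \<forall>j\<in>S. i \<noteq> j \<longrightarrow> v i ^ d \<noteq> v j ^ d}"

abbreviation rootc :: "nat \<Rightarrow> int \<Rightarrow> complex" where
  "rootc d k \<equiv> cis (2 * pi * of_int k / of_nat d)"

text \<open>The \<open>d\<close>-th power has argument \<open>2 * pi / (i + 2)\<close>. These angles
  are distinct and lie in the interval from 0 to \<open>pi\<close>, where the cosine is injective,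
  so points on different rays never share an orbit.\<close>

definition ray :: "nat \<Rightarrow> nat \<Rightarrow> complex" where
  "ray d i = cis (2 * pi / (of_nat d * (of_nat i + 2)))"

text \<open>The common radius depends only on the kept coordinates and exceeds the norm of each of
  them, so an inserted point cannot collide with a kept one. \<open>S\<close> indexes the target;
  the source may be indexed by any set that contains \<open>T\<close>.\<close>

definition ins :: "nat \<Rightarrow> nat set \<Rightarrow> nat set \<Rightarrow> (nat \<Rightarrow> complex) \<Rightarrow> (nat \<Rightarrow> complex)" where
  "ins d S T v = (\<lambda>i\<in>S. if i \<in> T then v i else of_real (1 + (\<Sum>j\<in>T. norm (v j))) * ray d i)"

text \<open>The action of \<open>(g, \<sigma>)\<close> is the case where \<open>\<pi>\<close> is the
  inverse of \<open>\<sigma>\<close>. The map \<open>\<pi>\<close> may also lead from one index set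
  to another, as relabellings of the points do.\<close>

definition wr :: "nat \<Rightarrow> nat set \<Rightarrow> (nat \<Rightarrow> int) \<Rightarrow> (nat \<Rightarrow> nat) \<Rightarrow> (nat \<Rightarrow> complex) \<Rightarrow> (nat \<Rightarrow> complex)" where
  "wr d S g \<pi> v = (\<lambda>i\<in>S. rootc d (g i) * v (\<pi> i))"

lemma less_convex_combination:
  fixes r :: real
  assumes "0 \<le> r" "r \<le> 1" "x < y" "x < z"
  shows "x < (1 - r) * y + r * z"
proof -
  have "(1 - r) * (y - x) + r * (z - x) > 0"
  proof (cases "r = 0")
    case False
    then have "r * (z - x) > 0" "(1 - r) * (y - x) \<ge> 0" using assms by auto
    then show ?thesis by linarith
  qed (use assms in simp)
  then show ?thesis by (simp add: algebra_simps)
qed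

lemma continuous_on_productI:
  fixes f :: "'a::topological_space \<Rightarrow> nat \<Rightarrow> complex"
  assumes "\<And>i. i \<in> S \<Longrightarrow> continuous_on E (\<lambda>x. f x i)"
  shows "continuous_on E (\<lambda>x. \<lambda>i\<in>S. f x i)"
proof (rule continuous_on_coordinatewise_then_product)
  fix i show "continuous_on E (\<lambda>x. (\<lambda>i\<in>S. f x i) i)"
    by (cases "i \<in> S") (auto intro: assms)
qed

lemma continuous_on_coord:
  fixes f :: "'a::topological_space \<Rightarrow> nat \<Rightarrow> complex"
  assumes "continuous_on E f"
  shows "continuous_on E (\<lambda>x. f x i)"
  using continuous_on_compose2[OF continuous_on_product_coordinates[of i] assms] by auto

lemma continuous_on_coord_id: "continuous_on E (\<lambda>v :: nat \<Rightarrow> complex. v i)"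
  by (rule continuous_on_coord[OF continuous_on_id])

lemma homotopic_mapsI:
  assumes h: "continuous_on ({0..1::real} \<times> E) h" "\<And>s x. \<lbrakk>s \<in> {0..1}; x \<in> E\<rbrakk> \<Longrightarrow> h (s, x) \<in> Y"
    and "\<And>x. x \<in> E \<Longrightarrow> h (0, x) = f x" "\<And>x. x \<in> E \<Longrightarrow> h (1, x) = g x"
  shows "homotopic_maps E Y f g"
proof -
  have "homotopic_maps E Y (\<lambda>x. h (0, x)) (\<lambda>x. h (1, x))"
    unfolding homotopic_with_def using h
    by (auto simp: continuous_map_in_subtopology image_subset_iff_funcset prod_topology_subtopology_eu
        intro!: exI[of _ h])
  then show ?thesis by (rule homotopic_with_eq) (use assms(3,4) in auto)
qed

lemma ConfI:
  assumes "\<And>i. i \<in> S \<Longrightarrow> v i \<noteq> 0" "\<And>i. i \<notin> S \<Longrightarrow> v i = undefined"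
    "\<And>i j. \<lbrakk>i \<in> S; j \<in> S; i \<noteq> j\<rbrakk> \<Longrightarrow> v i ^ d \<noteq> v j ^ d"
  shows "v \<in> Conf d S"
  using assms unfolding Conf_def by (auto simp: PiE_iff extensional_def)

lemma ConfD:
  assumes "v \<in> Conf d S"
  shows "i \<in> S \<Longrightarrow> v i \<noteq> 0" "i \<notin> S \<Longrightarrow> v i = undefined"
    "\<lbrakk>i \<in> S; j \<in> S; i \<noteq> j\<rbrakk> \<Longrightarrow> v i ^ d \<noteq> v j ^ d"
  using assms unfolding Conf_def by (auto simp: PiE_iff extensional_def)

lemma Conf_eqI: "\<lbrakk>u \<in> Conf d S; v \<in> Conf d S; \<And>i. i \<in> S \<Longrightarrow> u i = v i\<rbrakk> \<Longrightarrow> u = v"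
  unfolding Conf_def by (auto intro: PiE_ext)

locale config =
  fixes d :: nat
  assumes d_pos: "d \<ge> 1"
begin

lemma rootc_power: "rootc d k ^ d = 1"
proof -
  have "rootc d k ^ d = cis (real d * (2 * pi * of_int k / of_nat d))" by (rule Complex.DeMoivre)
  also have "real d * (2 * pi * of_int k / of_nat d) = 2 * pi * of_int k" using d_pos by simp
  also have "cis (2 * pi * of_int k) = 1" by (rule cis_multiple_2pi) auto
  finally show ?thesis .
qed

lemma power_eq_imp_root:
  assumes "(z::complex) ^ d = w ^ d" "w \<noteq> 0"
  obtains k where "k < d" "z = rootc d (int k) * w"
proof -
  have "(z / w) ^ d = 1" using assms by (simp add: power_divide)
  then have "z / w \<in> {z. z ^ d = 1}" by simp
  then have "z / w \<in> (\<lambda>k. cis (2 * pi * real k / real d)) ` {..<d}"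
    using Complex.bij_betw_roots_unity[of d] d_pos by (simp add: bij_betw_def)
  then obtain k where "k < d" "z / w = cis (2 * pi * real k / real d)" by auto
  then show ?thesis using assms by (intro that[of k]) (auto simp: field_simps)
qed

lemma ray_power: "ray d i ^ d = cis (2 * pi / (of_nat i + 2))"
proof -
  have "ray d i ^ d = cis (real d * (2 * pi / (of_nat d * (of_nat i + 2))))"
    unfolding ray_def by (rule Complex.DeMoivre)
  also have "real d * (2 * pi / (of_nat d * (of_nat i + 2))) = 2 * pi / (of_nat i + 2)" using d_pos by simp
  finally show ?thesis .
qed

lemma ray_power_inj:
  assumes "of_real r * ray d i ^ d = of_real s * ray d j ^ d" "r > 0" "s > 0"
  shows "i = j"
proof -
  let ?x = "2 * pi / (real i + 2)" and ?y = "2 * pi / (real j + 2)"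
  have e: "of_real r * cis ?x = of_real s * cis ?y" using assms by (simp add: ray_power)
  from arg_cong[OF this, of norm] have "r = s" using assms by (simp add: norm_mult)
  with e assms have "cis ?x = cis ?y" by simp
  then have "cos ?x = cos ?y" by (metis cis.sel(1))
  moreover have "0 \<le> ?x" "?x \<le> pi" "0 \<le> ?y" "?y \<le> pi" by (auto simp: field_simps)
  ultimately have "?x = ?y" using cos_inj_pi[of ?x ?y] by blast
  then show ?thesis by (simp add: field_simps)
qed

lemma norm_ray [simp]: "norm (ray d i) = 1" by (simp add: ray_def)

lemma ray_nonzero [simp]: "ray d i \<noteq> 0" by (simp add: ray_def)

lemma orbit_config_eq: "orbit_config d n = Conf d {..<n}"
proof -
  have orb: "Group_Action.orbit (Zmod d) (root_act d) z = (\<lambda>k. rootc d k * z) ` {0..<int d}" for z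
    using d_pos by (auto simp: Group_Action.orbit_def root_act_def integer_mod_group_def)
  have dis: "(\<lambda>k. rootc d k * z) ` {0..<int d} \<inter> (\<lambda>k. rootc d k * w) ` {0..<int d} = {} \<longleftrightarrow> z ^ d \<noteq> w ^ d"
    if z: "z \<noteq> 0" and w: "w \<noteq> 0" for z w
  proof
    assume e: "(\<lambda>k. rootc d k * z) ` {0..<int d} \<inter> (\<lambda>k. rootc d k * w) ` {0..<int d} = {}"
    show "z ^ d \<noteq> w ^ d"
    proof
      assume "z ^ d = w ^ d"
      then obtain k where "k < d" "z = rootc d (int k) * w" by (rule power_eq_imp_root[OF _ w])
      then have "z \<in> (\<lambda>k. rootc d k * w) ` {0..<int d}" by (intro image_eqI[of _ _ "int k"]) auto
      moreover have "z \<in> (\<lambda>k. rootc d k * z) ` {0..<int d}" using d_pos by (intro image_eqI[of _ _ 0]) auto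
      ultimately show False using e by blast
    qed
  next
    assume "z ^ d \<noteq> w ^ d"
    moreover have "(rootc d k * z) ^ d = z ^ d" for k z by (simp only: power_mult_distrib rootc_power mult_1)
    ultimately show "(\<lambda>k. rootc d k * z) ` {0..<int d} \<inter> (\<lambda>k. rootc d k * w) ` {0..<int d} = {}"
      by (auto simp only: disjoint_iff image_iff) metis
  qed
  show ?thesis
    unfolding orbit_config_def Conf_def orb Ball_def lessThan_iff
  proof (intro Collect_cong conj_cong all_cong1 imp_cong refl)
    fix v i j assume "v \<in> {..<n} \<rightarrow>\<^sub>E UNIV - {0 :: complex}" "i < n" "j < n"
    then have "v i \<noteq> 0" "v j \<noteq> 0" by (auto simp: PiE_iff)
    then show "(\<lambda>k. rootc d k * v i) ` {0..<int d} \<inter> (\<lambda>k. rootc d k * v j) ` {0..<int d} = {} \<longleftrightarrow> v i ^ d \<noteq> v j ^ d"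
      by (rule dis)
  qed
qed

lemma ins_maps:
  assumes "finite S" "T \<subseteq> S" "T \<subseteq> R"
  shows "maps (Conf d R) (Conf d S) (ins d S T)"
proof
  show "continuous_on (Conf d R) (ins d S T)"
    unfolding ins_def
  proof (rule continuous_on_productI)
    fix i show "continuous_on (Conf d R)
      (\<lambda>v. if i \<in> T then v i else complex_of_real (1 + (\<Sum>j\<in>T. norm (v j))) * ray d i)"
      by (cases "i \<in> T"; simp only: if_True if_False simp_thms; intro continuous_intros continuous_on_coord_id)
  qed
  show "ins d S T \<in> Conf d R \<rightarrow> Conf d S"
  proof
    fix v assume v: "v \<in> Conf d R"
    have fin: "finite T" using assms finite_subset by blast
    let ?s = "1 + (\<Sum>j\<in>T. norm (v j))"
    have s: "norm (v j) < ?s" if "j \<in> T" for j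
      using member_le_sum[OF that, of "\<lambda>j. norm (v j)"] fin by simp
    have s0: "?s > 0" using sum_nonneg[of T "\<lambda>j. norm (v j)"] by simp
    have lt: "norm (v j ^ d) < norm ((of_real ?s * ray d i) ^ d)" if "j \<in> T" for i j
      using s[OF that] s0 d_pos by (simp add: norm_power norm_mult power_strict_mono del: of_real_add)
    show "ins d S T v \<in> Conf d S"
    proof (rule ConfI)
      fix i j assume ij: "i \<in> S" "j \<in> S" "i \<noteq> j"
      show "ins d S T v i ^ d \<noteq> ins d S T v j ^ d"
      proof (cases "i \<in> T"; cases "j \<in> T")
        assume "i \<in> T" "j \<in> T" then show ?thesis using ij ConfD(3)[OF v, of i j] assms by (auto simp: ins_def)
      next
        assume "i \<in> T" "j \<notin> T" then show ?thesis using ij lt[of i j] by (force simp: ins_def)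
      next
        assume "i \<notin> T" "j \<in> T" then show ?thesis using ij lt[of j i] by (force simp: ins_def)
      next
        assume "i \<notin> T" "j \<notin> T"
        then show ?thesis using ij ray_power_inj[of "?s ^ d" i "?s ^ d" j] s0
          by (auto simp: ins_def power_mult_distrib simp del: of_real_add)
      qed
    next
      fix i assume "i \<in> S"
      moreover have "complex_of_real ?s \<noteq> 0" using s0 by (metis of_real_eq_0_iff less_irrefl)
      ultimately show "ins d S T v i \<noteq> 0" using ConfD(1)[OF v, of i] assms by (auto simp: ins_def)
    qed (simp add: ins_def)
  qed
qed

lemma Conf_empty: "Conf d {} = {\<lambda>_. undefined}"
  by (auto simp: Conf_def)

lemma ins_self: "v \<in> Conf d S \<Longrightarrow> ins d S S v = v"
  by (auto simp: ins_def fun_eq_iff dest: ConfD)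

text \<open>Induction on the number of points. With the others fixed, the new point moves to its far
  position in a plane with finitely many points removed; after that the configuration lies in the
  image of the smaller space.\<close>

lemma path_connected_Conf:
  assumes "finite S"
  shows "path_connected (Conf d S)"
  using assms
proof (induction S)
  case empty
  then show ?case by (simp add: Conf_empty)
next
  case (insert a S)
  let ?E = "Conf d (insert a S)"
  let ?r = "ins d (insert a S) S"
  have r: "maps (Conf d S) ?E ?r" "maps ?E ?E ?r"
    using insert ins_maps[of "insert a S" S S] ins_maps[of "insert a S" S "insert a S"] by blast+
  have rho: "maps ?E (Conf d S) (ins d S S)" using insert by (intro ins_maps) auto
  have pc: "path_connected (?r ` Conf d S)" using r insert path_connected_continuous_image by blast
  have 1: "path_component ?E x (?r x)" if x: "x \<in> ?E" for x
  proof -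
    \<comment> \<open>The positions forbidden to the new point: the origin and the orbits of the
      other points, each orbit given by its \<open>d\<close>-th power.\<close>
    define B where "B = {z. z = 0 \<or> (\<exists>j\<in>S. z ^ d = x j ^ d)}"
    have "B \<subseteq> insert 0 (\<Union>j\<in>S. (\<lambda>k. rootc d (int k) * x j) ` {..<d})"
    proof
      fix z assume z: "z \<in> B"
      show "z \<in> insert 0 (\<Union>j\<in>S. (\<lambda>k. rootc d (int k) * x j) ` {..<d})"
      proof (cases "z = 0")
        case False
        then obtain j where "j \<in> S" "z ^ d = x j ^ d" using z by (auto simp: B_def)
        moreover obtain k where "k < d" "z = rootc d (int k) * x j"
          by (rule power_eq_imp_root[OF \<open>z ^ d = x j ^ d\<close>]) (use ConfD(1)[OF x, of j] \<open>j \<in> S\<close> in auto)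
        ultimately show ?thesis by blast
      qed simp
    qed
    then have "finite B" by (rule finite_subset) (use insert in auto)
    then have "path_connected (- B)"
      by (intro path_connected_complement_countable) (auto simp: countable_finite)
    have u: "y a \<in> - B" if "y \<in> ?E" "\<And>j. j \<in> S \<Longrightarrow> y j = x j" for y
      using ConfD(1)[OF that(1), of a] ConfD(3)[OF that(1), of a] that(2) insert(2) by (force simp: B_def)
    have "?r x \<in> ?E" using r x by auto
    then have "?r x a \<in> - B" by (rule u) (auto simp: ins_def)
    with u[OF x] \<open>path_connected (- B)\<close> obtain p where p: "path p" "path_image p \<subseteq> - B" "pathstart p = x a" "pathfinish p = ?r x a"
      unfolding path_connected_def by blast
    define q where "q = (\<lambda>t. \<lambda>i\<in>insert a S. if i = a then p t else x i)"
    have "path q" unfolding path_def q_def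
    proof (rule continuous_on_productI)
      fix i show "continuous_on {0..1} (\<lambda>t. if i = a then p t else x i)"
        using p(1) by (cases "i = a") (auto simp: path_def)
    qed
    moreover have "path_image q \<subseteq> ?E"
    proof
      fix v assume "v \<in> path_image q"
      then obtain t where t: "t \<in> {0..1}" "v = q t" by (auto simp: path_image_def)
      then have pt: "p t \<in> - B" using p(2) unfolding path_image_def by blast
      show "v \<in> ?E"
      proof (rule ConfI)
        fix i assume "i \<in> insert a S"
        then show "v i \<noteq> 0" using t pt ConfD(1)[OF x, of i] by (auto simp: q_def B_def)
      next
        fix i j assume "i \<in> insert a S" "j \<in> insert a S" "i \<noteq> j"
        then show "v i ^ d \<noteq> v j ^ d" using t pt ConfD(3)[OF x, of i j] by (auto simp: q_def B_def)
      qed (simp add: t q_def)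
    qed
    moreover have "pathstart q = x"
      using p(3) ConfD(2)[OF x] by (auto simp: q_def pathstart_def fun_eq_iff)
    moreover have "pathfinish q = ?r x"
      using p(4) by (auto simp: q_def pathfinish_def fun_eq_iff ins_def)
    ultimately show ?thesis unfolding path_component_def by blast
  qed
  \<comment> \<open>\<open>?r\<close> depends only on the old coordinates, so its values lie in the
    continuous image of a space that is connected by induction.\<close>
  have 2: "path_component ?E (?r x) (?r y)" if "x \<in> ?E" "y \<in> ?E" for x y
  proof -
    have rr: "?r z \<in> ?r ` Conf d S" if "z \<in> ?E" for z
    proof
      show "ins d S S z \<in> Conf d S" using rho that by auto
      show "?r z = ?r (ins d S S z)" by (auto simp: ins_def fun_eq_iff)
    qed
    have "path_component (?r ` Conf d S) (?r x) (?r y)"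
      using pc rr[OF that(1)] rr[OF that(2)] unfolding path_connected_component by blast
    then show ?thesis by (rule path_component_of_subset[rotated]) (use r in auto)
  qed
  show ?case
    unfolding path_connected_component
    using 1 2 by (blast intro: path_component_sym path_component_trans)
qed

lemma Conf_nonempty: "(\<lambda>i\<in>S. ray d i) \<in> Conf d S"
proof (rule ConfI)
  fix i j assume "i \<in> S" "j \<in> S" "i \<noteq> j"
  then show "(\<lambda>i\<in>S. ray d i) i ^ d \<noteq> (\<lambda>i\<in>S. ray d i) j ^ d"
    using ray_power_inj[of 1 i 1 j] by auto
qed auto

section \<open>Homotopies between insertion maps and the group action\<close>

lemma far_in_Conf:
  assumes Q: "Q \<subseteq> S" and a: "a \<in> Conf d Q" and c: "c \<in> Conf d (S - Q)"
    and far: "\<And>i j. \<lbrakk>i \<in> S - Q; j \<in> Q\<rbrakk> \<Longrightarrow> norm (a j) < norm (c i)"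
  shows "(\<lambda>i\<in>S. if i \<in> Q then a i else c i) \<in> Conf d S"
proof (rule ConfI)
  fix i assume "i \<in> S"
  then show "(\<lambda>i\<in>S. if i \<in> Q then a i else c i) i \<noteq> 0" using ConfD(1)[OF a, of i] ConfD(1)[OF c, of i] by auto
next
  have ne: "a j ^ d \<noteq> c i ^ d" if "i \<in> S - Q" "j \<in> Q" for i j
  proof -
    have "norm (a j) ^ d < norm (c i) ^ d" using far[OF that] d_pos by (intro power_strict_mono) auto
    then show ?thesis by (metis norm_power less_irrefl)
  qed
  fix i j assume "i \<in> S" "j \<in> S" "i \<noteq> j"
  then show "(\<lambda>i\<in>S. if i \<in> Q then a i else c i) i ^ d \<noteq> (\<lambda>i\<in>S. if i \<in> Q then a i else c i) j ^ d"
    using ConfD(3)[OF a, of i j] ConfD(3)[OF c, of i j] ne[of i j] ne[of j i] by (auto simp: eq_commute)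
qed simp

lemma Conf_scale:
  assumes "c \<in> Conf d S" "\<And>i. i \<in> S \<Longrightarrow> u i = of_real s * c i" "\<And>i. i \<notin> S \<Longrightarrow> u i = undefined" "s \<noteq> 0"
  shows "u \<in> Conf d S"
  using assms ConfD[OF assms(1)] by (intro ConfI) (auto simp: power_mult_distrib)

text \<open>The outer points are moved from \<open>c0\<close> to \<open>c1\<close> along a path of
  configurations. On the way some of them could come close to the inner points, so the path is
  rescaled until every outer point has norm at least 1; the factor \<open>\<sigma>\<close> then
  keeps it beyond the inner ones.\<close>

lemma homotopic_far:
  assumes S: "finite S" "Q \<subseteq> S" and a: "maps E (Conf d Q) a"
    and \<sigma>: "continuous_on E \<sigma>0" "continuous_on E \<sigma>1"
      "\<And>v j. v \<in> E \<Longrightarrow> \<sigma>0 v > 0 \<and> \<sigma>1 v > 0"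
      "\<And>v j. \<lbrakk>v \<in> E; j \<in> Q\<rbrakk> \<Longrightarrow> norm (a v j) < \<sigma>0 v \<and> norm (a v j) < \<sigma>1 v"
    and c: "c0 \<in> Conf d (S - Q)" "c1 \<in> Conf d (S - Q)"
      "\<And>i. i \<in> S - Q \<Longrightarrow> norm (c0 i) = 1" "\<And>i. i \<in> S - Q \<Longrightarrow> norm (c1 i) = 1"
  shows "homotopic_maps E (Conf d S) (\<lambda>v. \<lambda>i\<in>S. if i \<in> Q then a v i else of_real (\<sigma>0 v) * c0 i)
    (\<lambda>v. \<lambda>i\<in>S. if i \<in> Q then a v i else of_real (\<sigma>1 v) * c1 i)"
proof -
  have "path_connected (Conf d (S - Q))" using S by (intro path_connected_Conf) auto
  then obtain c where cp: "path c" "path_image c \<subseteq> Conf d (S - Q)" "pathstart c = c0" "pathfinish c = c1"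
    using c unfolding path_connected_def by metis
  have cC: "c r \<in> Conf d (S - Q)" if "r \<in> {0..1}" for r using cp that by (auto simp: path_image_def)
  \<comment> \<open>A product of factors that are at least 1 is bounded below by each of them and
    depends continuously on \<open>r\<close>. It is 1 at both ends, where all outer norms are
    1.\<close>
  define \<Lambda> where "\<Lambda> = (\<lambda>r. \<Prod>i\<in>S-Q. max 1 (1 / norm (c r i)))"
  have L0: "\<Lambda> 0 = 1" "\<Lambda> 1 = 1" using cp c by (auto simp: \<Lambda>_def pathstart_def pathfinish_def intro!: prod.neutral)
  have Lge: "1 \<le> \<Lambda> r * norm (c r i)" "\<Lambda> r > 0" if "r \<in> {0..1}" "i \<in> S - Q" for r i
  proof -
    have "norm (c r i) > 0" using ConfD(1)[OF cC[OF that(1)] that(2)] by simp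
    have "\<Lambda> r = max 1 (1 / norm (c r i)) * (\<Prod>i\<in>S-Q-{i}. max 1 (1 / norm (c r i)))"
      unfolding \<Lambda>_def by (rule prod.remove) (use S that in auto)
    moreover have "(\<Prod>i\<in>S-Q-{i}. max 1 (1 / norm (c r i))) \<ge> 1" by (rule prod_ge_1) auto
    ultimately have "\<Lambda> r \<ge> max 1 (1 / norm (c r i))"
      using mult_left_mono[of 1 "\<Prod>i\<in>S-Q-{i}. max 1 (1 / norm (c r i))" "max 1 (1 / norm (c r i))"] by simp
    then have "\<Lambda> r \<ge> 1 / norm (c r i)" "\<Lambda> r \<ge> 1" by auto
    then show "1 \<le> \<Lambda> r * norm (c r i)" "\<Lambda> r > 0" using \<open>norm (c r i) > 0\<close> by (auto simp: field_simps)
  qed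
  have cc: "continuous_on {0..1} c" using cp by (simp add: path_def)
  have contL: "continuous_on {0..1} \<Lambda>"
    unfolding \<Lambda>_def
  proof (intro continuous_on_prod continuous_on_max continuous_on_const continuous_on_divide
      continuous_on_norm continuous_on_coord cc ballI)
    fix i r assume "i \<in> S - Q" "r \<in> {0..1::real}"
    then show "norm (c r i) \<noteq> 0" using ConfD(1)[OF cC] by auto
  qed
  define \<tau> where "\<tau> = (\<lambda>(r, v). ((1 - r) * \<sigma>0 v + r * \<sigma>1 v) * \<Lambda> r)"
  define h where "h = (\<lambda>(r, v). \<lambda>i\<in>S. if i \<in> Q then a v i else of_real (\<tau> (r, v)) * c r i)"
  have ct: "continuous_on ({0..1} \<times> E) \<tau>"
    unfolding \<tau>_def case_prod_unfold
    by (intro continuous_intros continuous_on_compose2[OF \<sigma>(1)] continuous_on_compose2[OF \<sigma>(2)]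
        continuous_on_compose2[OF contL]) auto
  show ?thesis
  proof (rule homotopic_mapsI[of _ h])
    show "continuous_on ({0..1} \<times> E) h"
      unfolding h_def case_prod_unfold
    proof (rule continuous_on_productI)
      have ca: "continuous_on ({0..1::real} \<times> E) (\<lambda>x. a (snd x))"
        by (rule continuous_on_compose2[OF conjunct1[OF a] continuous_on_snd[OF continuous_on_id]]) auto
      have cr: "continuous_on ({0..1} \<times> E) (\<lambda>x. c (fst x))"
        by (rule continuous_on_compose2[OF cc]) (auto intro!: continuous_intros)
      fix i show "continuous_on ({0..1} \<times> E) (\<lambda>x. if i \<in> Q then a (snd x) i else complex_of_real (\<tau> (fst x, snd x)) * c (fst x) i)"
        by (cases "i \<in> Q"; simp only: if_True if_False simp_thms prod.collapse;
            intro continuous_intros continuous_on_coord[OF ca] continuous_on_coord[OF cr] ct)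
    qed
    fix r v assume rv: "r \<in> {0..1::real}" "v \<in> E"
    have mid: "\<And>x y z::real. x < y \<Longrightarrow> x < z \<Longrightarrow> x < (1 - r) * y + r * z"
      using rv(1) by (intro less_convex_combination) auto
    let ?t = "(1 - r) * \<sigma>0 v + r * \<sigma>1 v"
    have t0: "?t > 0" using mid[of 0] \<sigma>(3)[OF rv(2)] by auto
    have "(\<lambda>i\<in>S. if i \<in> Q then a v i else (\<lambda>i\<in>S - Q. of_real (\<tau> (r, v)) * c r i) i) \<in> Conf d S"
    proof (rule far_in_Conf[OF S(2)])
      show "a v \<in> Conf d Q" using a rv by auto
      show "(\<lambda>i\<in>S - Q. of_real (\<tau> (r, v)) * c r i) \<in> Conf d (S - Q)"
      proof (cases "S - Q = {}")
        case True
        show ?thesis unfolding True by (simp add: Conf_empty restrict_def)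
      next
        case False
        then obtain i where "i \<in> S - Q" by blast
        then have "\<Lambda> r > 0" using Lge(2)[OF rv(1)] by blast
        then have "\<tau> (r, v) \<noteq> 0" using t0 by (simp add: \<tau>_def)
        then show ?thesis by (intro Conf_scale[OF cC[OF rv(1)], of _ "\<tau> (r, v)"]) (auto simp: restrict_def)
      qed
      fix i j assume ij: "i \<in> S - Q" "j \<in> Q"
      have "norm (a v j) < ?t" using mid \<sigma>(4)[OF rv(2) ij(2)] by auto
      also have "\<dots> \<le> ?t * (\<Lambda> r * norm (c r i))" using Lge(1)[OF rv(1) ij(1)] t0 by simp
      also have "\<dots> = norm ((\<lambda>i\<in>S - Q. of_real (\<tau> (r, v)) * c r i) i)"
        using ij t0 Lge(2)[OF rv(1) ij(1)] by (simp add: \<tau>_def norm_mult abs_mult del: of_real_add of_real_mult)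
      finally show "norm (a v j) < norm ((\<lambda>i\<in>S - Q. of_real (\<tau> (r, v)) * c r i) i)" .
    qed
    then show "h (r, v) \<in> Conf d S"
      unfolding h_def by (auto simp: restrict_def cong: if_cong elim!: back_subst[of "\<lambda>x. x \<in> Conf d S"])
  qed (use cp L0 in \<open>auto simp: h_def \<tau>_def pathstart_def pathfinish_def\<close>)
qed

text \<open>Points on different rays may have independent radii, so the radii can be interpolated
  linearly one by one.\<close>

lemma homotopic_rays:
  assumes S: "finite S" "Q \<subseteq> S" and a: "maps E (Conf d Q) a"
    and \<sigma>: "\<And>i. i \<in> S - Q \<Longrightarrow> continuous_on E (\<lambda>v. \<sigma>0 v i)" "\<And>i. i \<in> S - Q \<Longrightarrow> continuous_on E (\<lambda>v. \<sigma>1 v i)"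
      "\<And>v i. v \<in> E \<Longrightarrow> i \<in> S - Q \<Longrightarrow> \<sigma>0 v i > 0 \<and> \<sigma>1 v i > 0"
      "\<And>v i j. \<lbrakk>v \<in> E; i \<in> S - Q; j \<in> Q\<rbrakk> \<Longrightarrow> norm (a v j) < \<sigma>0 v i \<and> norm (a v j) < \<sigma>1 v i"
  shows "homotopic_maps E (Conf d S) (\<lambda>v. \<lambda>i\<in>S. if i \<in> Q then a v i else of_real (\<sigma>0 v i) * ray d i)
    (\<lambda>v. \<lambda>i\<in>S. if i \<in> Q then a v i else of_real (\<sigma>1 v i) * ray d i)"
proof -
  define \<tau> where "\<tau> = (\<lambda>(r, v) i. (1 - r) * \<sigma>0 v i + r * \<sigma>1 v i)"
  define h where "h = (\<lambda>(r, v). \<lambda>i\<in>S. if i \<in> Q then a v i else of_real (\<tau> (r, v) i) * ray d i)"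
  have ct: "continuous_on ({0..1} \<times> E) (\<lambda>x. \<tau> x i)" if "i \<in> S - Q" for i
    unfolding \<tau>_def case_prod_unfold
    by (intro continuous_intros continuous_on_compose2[OF \<sigma>(1)[OF that]] continuous_on_compose2[OF \<sigma>(2)[OF that]]) auto
  show ?thesis
  proof (rule homotopic_mapsI[of _ h])
    show "continuous_on ({0..1} \<times> E) h"
      unfolding h_def case_prod_unfold
    proof (rule continuous_on_productI)
      have ca: "continuous_on ({0..1::real} \<times> E) (\<lambda>x. a (snd x))"
        by (rule continuous_on_compose2[OF conjunct1[OF a] continuous_on_snd[OF continuous_on_id]]) auto
      fix i assume "i \<in> S"
      then show "continuous_on ({0..1} \<times> E) (\<lambda>x. if i \<in> Q then a (snd x) i else complex_of_real (\<tau> (fst x, snd x) i) * ray d i)"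
        by (cases "i \<in> Q"; simp only: if_True if_False simp_thms prod.collapse;
            intro continuous_intros continuous_on_coord[OF ca] ct) simp_all
    qed
    fix r v assume rv: "r \<in> {0..1::real}" "v \<in> E"
    have mid: "\<And>x y z::real. x < y \<Longrightarrow> x < z \<Longrightarrow> x < (1 - r) * y + r * z"
      using rv(1) by (intro less_convex_combination) auto
    have t0: "\<tau> (r, v) i > 0" if "i \<in> S - Q" for i using mid[of 0] \<sigma>(3)[OF rv(2) that] by (auto simp: \<tau>_def)
    have "(\<lambda>i\<in>S. if i \<in> Q then a v i else (\<lambda>i\<in>S - Q. of_real (\<tau> (r, v) i) * ray d i) i) \<in> Conf d S"
    proof (rule far_in_Conf[OF S(2)])
      show "a v \<in> Conf d Q" using a rv by auto
      show "(\<lambda>i\<in>S - Q. of_real (\<tau> (r, v) i) * ray d i) \<in> Conf d (S - Q)"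
      proof (rule ConfI)
        fix i j assume ij: "i \<in> S - Q" "j \<in> S - Q" "i \<noteq> j"
        have "\<tau> (r, v) i ^ d > 0" "\<tau> (r, v) j ^ d > 0" using t0 ij by auto
        then show "(\<lambda>i\<in>S - Q. of_real (\<tau> (r, v) i) * ray d i) i ^ d \<noteq> (\<lambda>i\<in>S - Q. of_real (\<tau> (r, v) i) * ray d i) j ^ d"
          using ij ray_power_inj[of "\<tau> (r, v) i ^ d" i "\<tau> (r, v) j ^ d" j] by (auto simp: power_mult_distrib)
      next
        fix i assume "i \<in> S - Q" then show "(\<lambda>i\<in>S - Q. of_real (\<tau> (r, v) i) * ray d i) i \<noteq> 0" using t0[of i] by auto
      qed (auto simp: restrict_def)
      fix i j assume ij: "i \<in> S - Q" "j \<in> Q"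
      have "norm (a v j) < \<tau> (r, v) i" using mid \<sigma>(4)[OF rv(2) ij] by (auto simp: \<tau>_def)
      also have "\<dots> = norm ((\<lambda>i\<in>S - Q. of_real (\<tau> (r, v) i) * ray d i) i)"
        using ij t0[OF ij(1)] by (simp add: norm_mult)
      finally show "norm (a v j) < norm ((\<lambda>i\<in>S - Q. of_real (\<tau> (r, v) i) * ray d i) i)" .
    qed
    then show "h (r, v) \<in> Conf d S"
      unfolding h_def by (auto simp: restrict_def cong: if_cong elim!: back_subst[of "\<lambda>x. x \<in> Conf d S"])
  qed (auto simp: h_def \<tau>_def)
qed

lemma norm_sum_bound:
  assumes "finite T" "j \<in> T"
  shows "norm (v j :: complex) < 1 + (\<Sum>j\<in>T. norm (v j))"
  using member_le_sum[OF assms(2), of "\<lambda>j. norm (v j)"] assms(1) by simp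

lemma norm_sum_pos: "0 < 1 + (\<Sum>j\<in>T. norm (v j :: complex))"
  using sum_nonneg[of T "\<lambda>j. norm (v j)"] by simp

text \<open>Both maps keep the coordinates in \<open>T \<inter> T'\<close> and put every other point
  on its own ray; they differ only in the radii. The composite has two of these: the inner radius
  for points kept by the outer map, the outer radius for the rest.\<close>

lemma ins_ins_homotopic:
  assumes fin: "finite S" "finite S'" and T: "T \<subseteq> S'" "T \<subseteq> S" and T': "T' \<subseteq> S'" "T' \<subseteq> R"
  shows "homotopic_maps (Conf d R) (Conf d S) (\<lambda>v. ins d S T (ins d S' T' v)) (ins d S (T \<inter> T'))"
proof -
  let ?E = "Conf d R" and ?Q = "T \<inter> T'"
  have finT: "finite T" "finite T'" using fin T T' finite_subset by blast+
  define \<sigma>0 where "\<sigma>0 = (\<lambda>v i. if i \<in> T then 1 + (\<Sum>j\<in>T'. norm (v j :: complex)) else 1 + (\<Sum>j\<in>T. norm (ins d S' T' v j)))"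
  define \<sigma>1 where "\<sigma>1 = (\<lambda>(v :: nat \<Rightarrow> complex) (i :: nat). 1 + (\<Sum>j\<in>?Q. norm (v j)))"
  have ci: "continuous_on ?E (ins d S' T')" using ins_maps[OF fin(2) T'] by auto
  have "homotopic_maps ?E (Conf d S) (\<lambda>v. \<lambda>i\<in>S. if i \<in> ?Q then ins d ?Q ?Q v i else of_real (\<sigma>0 v i) * ray d i)
    (\<lambda>v. \<lambda>i\<in>S. if i \<in> ?Q then ins d ?Q ?Q v i else of_real (\<sigma>1 v i) * ray d i)"
  proof (rule homotopic_rays)
    show "maps ?E (Conf d ?Q) (ins d ?Q ?Q)" using finT T' by (intro ins_maps) auto
    fix i show "continuous_on ?E (\<lambda>v. \<sigma>0 v i)"
      unfolding \<sigma>0_def by (cases "i \<in> T"; simp only: if_True if_False simp_thms;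
          intro continuous_intros continuous_on_coord_id continuous_on_coord[OF ci])
    show "continuous_on ?E (\<lambda>v. \<sigma>1 v i)"
      unfolding \<sigma>1_def by (intro continuous_intros continuous_on_coord_id)
    fix v show "\<sigma>0 v i > 0 \<and> \<sigma>1 v i > 0" using norm_sum_pos by (auto simp: \<sigma>0_def \<sigma>1_def)
    fix j assume j: "j \<in> ?Q"
    have "ins d S' T' v j = v j" using j T by (auto simp: ins_def)
    then have "norm (v j) < \<sigma>0 v i"
      using j norm_sum_bound[OF finT(2), of j v] norm_sum_bound[OF finT(1), of j "ins d S' T' v"]
      by (auto simp: \<sigma>0_def)
    moreover have "norm (v j) < \<sigma>1 v i" using j norm_sum_bound[of ?Q j v] finT by (auto simp: \<sigma>1_def)
    ultimately show "norm (ins d ?Q ?Q v j) < \<sigma>0 v i \<and> norm (ins d ?Q ?Q v j) < \<sigma>1 v i"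
      using j by (simp add: ins_def)
  qed (use fin T in auto)
  then show ?thesis
  proof (rule homotopic_with_eq)
    fix v
    show "ins d S T (ins d S' T' v) = (\<lambda>i\<in>S. if i \<in> ?Q then ins d ?Q ?Q v i else of_real (\<sigma>0 v i) * ray d i)"
      using T by (auto simp: ins_def \<sigma>0_def fun_eq_iff)
    show "ins d S ?Q v = (\<lambda>i\<in>S. if i \<in> ?Q then ins d ?Q ?Q v i else of_real (\<sigma>1 v i) * ray d i)"
      by (auto simp: ins_def \<sigma>1_def fun_eq_iff)
  qed simp
qed

lemma wr_maps:
  assumes "inj_on \<pi> S" "\<pi> ` S \<subseteq> R"
  shows "maps (Conf d R) (Conf d S) (wr d S g \<pi>)"
proof
  show "continuous_on (Conf d R) (wr d S g \<pi>)"
    unfolding wr_def by (intro continuous_on_productI continuous_intros continuous_on_coord_id)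
  show "wr d S g \<pi> \<in> Conf d R \<rightarrow> Conf d S"
  proof
    fix v assume v: "v \<in> Conf d R"
    show "wr d S g \<pi> v \<in> Conf d S"
    proof (rule ConfI)
      fix i j assume ij: "i \<in> S" "j \<in> S" "i \<noteq> j"
      then have "\<pi> i \<noteq> \<pi> j" "\<pi> i \<in> R" "\<pi> j \<in> R" using assms by (auto simp: inj_on_def)
      then show "wr d S g \<pi> v i ^ d \<noteq> wr d S g \<pi> v j ^ d"
        using ij ConfD(3)[OF v] by (simp add: wr_def power_mult_distrib rootc_power)
    next
      fix i assume "i \<in> S"
      then show "wr d S g \<pi> v i \<noteq> 0" using ConfD(1)[OF v] assms by (auto simp: wr_def)
    qed (simp add: wr_def)
  qed
qed

text \<open>After the group action the far points lie on rotated and permuted rays. Bringing them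
  back to their own rays takes a genuine path of configurations, hence \<open>homotopic_far\<close>
  instead of \<open>homotopic_rays\<close>. The set that is kept becomes the preimage of
  \<open>T\<close>.\<close>

lemma wr_ins_homotopic:
  assumes fin: "finite S" "finite S'" and T: "T \<subseteq> S" "T \<subseteq> R" and \<pi>: "inj_on \<pi> S'" "\<pi> ` S' \<subseteq> S"
    and T': "T' = {i \<in> S'. \<pi> i \<in> T}"
  shows "homotopic_maps (Conf d R) (Conf d S') (\<lambda>v. wr d S' g \<pi> (ins d S T v)) (\<lambda>v. ins d S' T' (wr d T' g \<pi> v))"
proof -
  let ?E = "Conf d R"
  have finT: "finite T" "finite T'" using fin T T' finite_subset by auto
  define \<sigma>0 where "\<sigma>0 = (\<lambda>v. 1 + (\<Sum>j\<in>T. norm (v j :: complex)))"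
  define \<sigma>1 where "\<sigma>1 = (\<lambda>v. 1 + (\<Sum>j\<in>T'. norm (wr d T' g \<pi> v j :: complex)))"
  have a: "maps ?E (Conf d T') (wr d T' g \<pi>)"
    using \<pi> T T' by (intro wr_maps) (auto simp: inj_on_def)
  have "homotopic_maps ?E (Conf d S') (\<lambda>v. \<lambda>i\<in>S'. if i \<in> T' then wr d T' g \<pi> v i else of_real (\<sigma>0 v) * wr d (S' - T') g \<pi> (\<lambda>i\<in>S. ray d i) i)
    (\<lambda>v. \<lambda>i\<in>S'. if i \<in> T' then wr d T' g \<pi> v i else of_real (\<sigma>1 v) * (\<lambda>i\<in>S' - T'. ray d i) i)"
  proof (rule homotopic_far[OF fin(2) _ a])
    show "T' \<subseteq> S'" using T' by auto
    show "continuous_on ?E \<sigma>0" unfolding \<sigma>0_def by (intro continuous_intros continuous_on_coord_id)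
    show "continuous_on ?E \<sigma>1" unfolding \<sigma>1_def by (intro continuous_intros continuous_on_coord[OF conjunct1[OF a]])
    fix v show "\<sigma>0 v > 0 \<and> \<sigma>1 v > 0" using norm_sum_pos by (auto simp: \<sigma>0_def \<sigma>1_def)
    fix j assume j: "j \<in> T'"
    then have "\<pi> j \<in> T" using T' by auto
    from norm_sum_bound[OF finT(1) this, of v] norm_sum_bound[OF finT(2) j, of "wr d T' g \<pi> v"]
    show "norm (wr d T' g \<pi> v j) < \<sigma>0 v \<and> norm (wr d T' g \<pi> v j) < \<sigma>1 v"
      using j by (auto simp: \<sigma>0_def \<sigma>1_def wr_def norm_mult)
  next
    have "maps (Conf d S) (Conf d (S' - T')) (wr d (S' - T') g \<pi>)"
      using \<pi> by (intro wr_maps) (auto simp: inj_on_def)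
    then show "wr d (S' - T') g \<pi> (\<lambda>i\<in>S. ray d i) \<in> Conf d (S' - T')" using Conf_nonempty by auto
    show "(\<lambda>i\<in>S' - T'. ray d i) \<in> Conf d (S' - T')" by (rule Conf_nonempty)
  qed (use \<pi> in \<open>auto simp: wr_def norm_mult\<close>)
  then show ?thesis
  proof (rule homotopic_with_eq)
    fix v
    show "wr d S' g \<pi> (ins d S T v) = (\<lambda>i\<in>S'. if i \<in> T' then wr d T' g \<pi> v i else of_real (\<sigma>0 v) * wr d (S' - T') g \<pi> (\<lambda>i\<in>S. ray d i) i)"
      using \<pi> T' T by (auto simp: ins_def wr_def \<sigma>0_def fun_eq_iff)
    show "ins d S' T' (wr d T' g \<pi> v) = (\<lambda>i\<in>S'. if i \<in> T' then wr d T' g \<pi> v i else of_real (\<sigma>1 v) * (\<lambda>i\<in>S' - T'. ray d i) i)"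
      by (auto simp: ins_def \<sigma>1_def fun_eq_iff)
  qed simp
qed

lemma wr_wr:
  assumes "\<And>i. i \<in> S \<Longrightarrow> \<pi> i \<in> S'"
  shows "wr d S g \<pi> (wr d S' g' \<pi>' v) = wr d S (\<lambda>i. g i + g' (\<pi> i)) (\<lambda>i. \<pi>' (\<pi> i)) v"
  using assms by (auto simp: wr_def fun_eq_iff cis_mult add_divide_distrib distrib_left)

end

section \<open>Path functors on a cover\<close>

lemma (in group) eq_conjI:
  assumes eq: "x \<otimes> q = q \<otimes> y" and c: "x \<in> carrier G" "q \<in> carrier G" "y \<in> carrier G"
  shows "x = q \<otimes> y \<otimes> inv q"
proof -
  have "q \<otimes> y \<otimes> inv q = x \<otimes> q \<otimes> inv q" by (simp only: eq)
  also have "\<dots> = x" using c by (simp add: m_assoc)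
  finally show ?thesis ..
qed

text \<open>The library's \<open>subpath\<close> is restricted to normed spaces.\<close>

definition seg :: "real \<Rightarrow> real \<Rightarrow> (real \<Rightarrow> 'a) \<Rightarrow> real \<Rightarrow> 'a::topological_space" where
  "seg u v p = p \<circ> subpath u v (\<lambda>x. x)"

lemma seg_ends [simp]: "pathstart (seg u v p) = p u" "pathfinish (seg u v p) = p v"
  by (simp_all add: seg_def pathstart_def pathfinish_def subpath_def)

lemma path_image_seg: "u \<le> v \<Longrightarrow> path_image (seg u v p) = p ` {u..v}"
  using path_image_subpath[of u v "\<lambda>x. x"] by (simp add: seg_def path_image_compose)

lemma seg_paths_in:
  assumes "p \<in> paths_in S" "u \<in> {0..1}" "v \<in> {0..1}"
  shows "seg u v p \<in> paths_in S"
  unfolding seg_def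
proof (rule compose_paths_in)
  have "path (\<lambda>x::real. x)" "path_image (\<lambda>x::real. x) = {0..1}" by (auto simp: path_def path_image_def)
  then show "subpath u v (\<lambda>x. x) \<in> paths_in {0..1}"
    using path_image_subpath_subset[of u v "\<lambda>x. x"] assms by (auto simp: path_subpath)
qed (use assms in \<open>auto simp: path_def path_image_def\<close>)

lemma homotopic_join_seg:
  assumes "p \<in> paths_in S" "u \<in> {0..1}" "v \<in> {0..1}" "w \<in> {0..1}"
  shows "homotopic_paths S (seg u v p +++ seg v w p) (seg u w p)"
proof -
  have "path (\<lambda>x::real. x)" "path_image (\<lambda>x::real. x) \<subseteq> {0..1}" by (auto simp: path_def path_image_def)
  then have "homotopic_paths {0..1} (subpath u v (\<lambda>x. x) +++ subpath v w (\<lambda>x. x)) (subpath u w (\<lambda>x. x))"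
    using assms by (intro homotopic_join_subpaths) auto
  from homotopic_paths_unit_interval_image[OF assms(1) this] show ?thesis by (simp add: seg_def path_compose_join)
qed

text \<open>A functor from the path groupoid of \<open>M\<close> to a group, seen as a groupoid with
  one object. Its values are defined on open paths too, so a subdivision argument does not have to
  tie each piece to a base point.\<close>

locale path_functor =
  fixes M :: "'a::topological_space set" and Q :: "('q, 'm) monoid_scheme" (structure)
    and \<Phi> :: "(real \<Rightarrow> 'a) set \<Rightarrow> 'q"
  assumes group_Q: "group Q"
    and closed: "A \<in> path_classes M \<Longrightarrow> \<Phi> A \<in> carrier Q"
    and mult: "\<lbrakk>A \<in> path_classes M; B \<in> path_classes M; ptgt A = psrc B\<rbrakk> \<Longrightarrow> \<Phi> (pmul M A B) = \<Phi> A \<otimes> \<Phi> B"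
begin

sublocale Q: group Q by (rule group_Q)

lemma functor_pid: "x \<in> M \<Longrightarrow> \<Phi> (pid M x) = \<one>"
  using mult[of "pid M x" "pid M x"] closed[of "pid M x"] Q.r_cancel_one' by simp

lemma functor_pinv: "A \<in> path_classes M \<Longrightarrow> \<Phi> (pinv M A) = inv (\<Phi> A)"
  using mult[of "pinv M A" A] closed[of A] closed[of "pinv M A"] functor_pid[of "ptgt A"] psrc_in(2)[of A M]
  by (intro Q.inv_equality[symmetric]) auto

lemma functor_free_homotopy:
  assumes h: "homotopic_maps E M f g" and A: "A \<in> path_classes E" "psrc A = ptgt A"
  shows "\<exists>q\<in>carrier Q. \<Phi> (ppush M f A) = q \<otimes> \<Phi> (ppush M g A) \<otimes> inv q"
proof -
  from h have "\<exists>k. continuous_on ({0..1::real} \<times> E) k \<and> k \<in> {0..1} \<times> E \<rightarrow> M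
    \<and> (\<forall>x. k (0, x) = f x) \<and> (\<forall>x. k (1, x) = g x)"
    by (auto simp: homotopic_with_def continuous_map_in_subtopology image_subset_iff_funcset prod_topology_subtopology_eu)
  then obtain k where k: "continuous_on ({0..1::real} \<times> E) k" "k \<in> {0..1} \<times> E \<rightarrow> M"
    "\<And>x. k (0, x) = f x" "\<And>x. k (1, x) = g x"
    by blast
  have kf: "(\<lambda>x. k (0, x)) = f" "(\<lambda>x. k (1, x)) = g" using k by auto
  have f: "continuous_on E f" "f \<in> E \<rightarrow> M" and g: "continuous_on E g" "g \<in> E \<rightarrow> M"
    using homotopic_with_imp_continuous[OF h] homotopic_with_imp_funspace1[OF h] homotopic_with_imp_funspace2[OF h] by auto
  let ?t = "homotopy_class M (\<lambda>s. k (s, psrc A))"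
  have "(\<lambda>s. k (s, psrc A)) \<in> paths_in M"
    by (rule homotopic_maps_push(1)[OF k(1,2) A(1) psrc_in(1)[OF A(1)]])
  then have t: "?t \<in> path_classes M" "psrc ?t = f (psrc A)" "ptgt ?t = g (psrc A)"
    using k by (auto simp: pathstart_def pathfinish_def simp del: mem_Collect_eq)
  from homotopic_maps_push(2)[OF k(1,2) A(1)]
  have "pmul M (ppush M f A) ?t = pmul M ?t (ppush M g A)" using A kf by simp
  note fa = ppush_simps[OF A(1) f] and ga = ppush_simps[OF A(1) g]
  have "\<Phi> (ppush M f A) \<otimes> \<Phi> ?t = \<Phi> ?t \<otimes> \<Phi> (ppush M g A)"
    using mult[OF fa(1) t(1)] mult[OF t(1) ga(1)] \<open>pmul M (ppush M f A) ?t = _\<close> fa ga t A by simp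
  then have "\<Phi> (ppush M f A) = \<Phi> ?t \<otimes> \<Phi> (ppush M g A) \<otimes> inv (\<Phi> ?t)"
    using closed[OF fa(1)] closed[OF ga(1)] closed[OF t(1)] by (intro Q.eq_conjI)
  then show ?thesis using closed[OF t(1)] by blast
qed

lemma functor_free_homotopy_one:
  assumes "homotopic_maps E M f g" "A \<in> path_classes E" "psrc A = ptgt A" "\<Phi> (ppush M g A) = \<one>"
  shows "\<Phi> (ppush M f A) = \<one>"
  using functor_free_homotopy[OF assms(1-3)] assms(4) by auto

abbreviation \<Psi> :: "(real \<Rightarrow> 'a) \<Rightarrow> 'q" where "\<Psi> p \<equiv> \<Phi> (homotopy_class M p)"

lemma functor_path_closed: "p \<in> paths_in M \<Longrightarrow> \<Psi> p \<in> carrier Q"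
  by (rule closed) simp

lemma functor_path_join: "\<lbrakk>p \<in> paths_in M; q \<in> paths_in M; pathfinish p = pathstart q\<rbrakk> \<Longrightarrow> \<Psi> (p +++ q) = \<Psi> p \<otimes> \<Psi> q"
  using mult[of "homotopy_class M p" "homotopy_class M q"] by (simp add: pmul_class del: mem_Collect_eq)

lemma functor_path_reverse: "p \<in> paths_in M \<Longrightarrow> \<Psi> (reversepath p) = inv (\<Psi> p)"
  using functor_pinv[of "homotopy_class M p"] by (simp add: pinv_class del: mem_Collect_eq)

fun path_prod :: "(nat \<Rightarrow> real \<Rightarrow> 'a) \<Rightarrow> nat \<Rightarrow> 'q" where
  "path_prod \<rho> 0 = \<one>"
| "path_prod \<rho> (Suc n) = path_prod \<rho> n \<otimes> \<Psi> (\<rho> n)"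

lemma path_prod_closed: "(\<And>b. b < n \<Longrightarrow> \<rho> b \<in> paths_in M) \<Longrightarrow> path_prod \<rho> n \<in> carrier Q"
  by (induction n) (auto simp: functor_path_closed simp del: mem_Collect_eq)

lemma path_prod_subpaths:
  assumes p: "p \<in> paths_in M" and N: "N > 0"
  shows "path_prod (\<lambda>b. seg (real b / real N) (real (Suc b) / real N) p) N = \<Psi> p"
proof -
  note sub = seg_paths_in[OF p]
  have "n \<le> N \<Longrightarrow> path_prod (\<lambda>b. seg (real b / real N) (real (Suc b) / real N) p) n = \<Psi> (seg 0 (real n / real N) p)" for n
  proof (induction n)
    case 0
    have "seg 0 0 p = (\<lambda>_. p 0)" by (auto simp: seg_def subpath_def)
    moreover have "p 0 \<in> M" using p pathstart_in_path_image[of p] by (auto simp: pathstart_def)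
    ultimately show ?case by (simp add: functor_pid)
  next
    case (Suc n)
    have u: "real n / real N \<in> {0..1}" "real (Suc n) / real N \<in> {0..1}" "real n / real N \<le> real (Suc n) / real N"
      using Suc N by (auto simp: field_simps)
    have "homotopic_paths M (seg 0 (real n / real N) p +++ seg (real n / real N) (real (Suc n) / real N) p)
      (seg 0 (real (Suc n) / real N) p)"
      using p u by (intro homotopic_join_seg) auto
    then have "\<Psi> (seg 0 (real (Suc n) / real N) p)
      = \<Psi> (seg 0 (real n / real N) p +++ seg (real n / real N) (real (Suc n) / real N) p)"
      by (simp add: homotopy_class_eqI)
    also have "\<dots> = \<Psi> (seg 0 (real n / real N) p) \<otimes> \<Psi> (seg (real n / real N) (real (Suc n) / real N) p)"
      using u by (intro functor_path_join sub) auto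
    finally show ?case using Suc by simp
  qed
  from this[of N] show ?thesis using N by (simp add: seg_def comp_def subpath_def)
qed

end

text \<open>One half of the van Kampen theorem: a path functor on \<open>M\<close> that is
  trivial on loops inside the members of a suitable open cover of the bigger space \<open>T\<close> changes
  only by conjugation along free homotopies of loops in \<open>T\<close>.\<close>

locale path_functor_cover = path_functor M Q \<Phi>
  for M :: "'a::topological_space set" and Q :: "('q, 'm) monoid_scheme" (structure) and \<Phi> +
  fixes T :: "'a set" and \<U> :: "'a set set"
  assumes cover: "z \<in> T \<Longrightarrow> \<exists>U\<in>\<U>. z \<in> U \<and> openin (top_of_set T) U"
    and inter: "\<lbrakk>U \<in> \<U>; V \<in> \<U>; U \<inter> V \<noteq> {}\<rbrakk> \<Longrightarrow> U \<inter> V \<in> \<U>"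
    and nonempty: "U \<in> \<U> \<Longrightarrow> U \<inter> M \<noteq> {}"
    and pconn: "U \<in> \<U> \<Longrightarrow> path_connected (U \<inter> M)"
    and local: "\<lbrakk>U \<in> \<U>; p \<in> paths_in (U \<inter> M); pathfinish p = pathstart p\<rbrakk> \<Longrightarrow> \<Phi> (homotopy_class M p) = \<one>"
begin

text \<open>The first path followed by the reverse of the second is a loop inside
  \<open>U \<inter> M\<close>.\<close>

lemma local_eq:
  assumes "U \<in> \<U>" "p \<in> paths_in (U \<inter> M)" "q \<in> paths_in (U \<inter> M)" "pathstart p = pathstart q" "pathfinish p = pathfinish q"
  shows "\<Psi> p = \<Psi> q"
proof -
  have m: "p \<in> paths_in M" "q \<in> paths_in M" "reversepath q \<in> paths_in M" using assms by auto
  have "\<Psi> (p +++ reversepath q) = \<one>"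
    using assms by (intro local[of U]) (auto simp: subset_path_image_join)
  moreover have "\<Psi> (p +++ reversepath q) = \<Psi> p \<otimes> inv (\<Psi> q)"
    using functor_path_join[OF m(1,3)] functor_path_reverse[OF m(2)] assms by simp
  ultimately show ?thesis using functor_path_closed[OF m(1)] functor_path_closed[OF m(2)]
    by (metis Q.inv_closed Q.inv_equality Q.inv_inv)
qed

text \<open>A closed chain of paths, each inside its member of the cover. The paths stay in
  \<open>M\<close> because \<open>\<Phi>\<close> is defined only there, although the homotopy that
  is being approximated may leave \<open>M\<close>.\<close>

definition is_row :: "nat \<Rightarrow> (nat \<Rightarrow> 'a set) \<Rightarrow> (nat \<Rightarrow> real \<Rightarrow> 'a) \<Rightarrow> bool" where
  "is_row N W \<rho> \<longleftrightarrow> (\<forall>b<N. \<rho> b \<in> paths_in (W b \<inter> M)) \<and> (\<forall>b. Suc b < N \<longrightarrow> pathfinish (\<rho> b) = pathstart (\<rho> (Suc b)))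
    \<and> pathfinish (\<rho> (N - 1)) = pathstart (\<rho> 0)"

lemma connect:
  assumes "U \<in> \<U>" "V \<in> \<U>" "y \<in> U \<inter> V \<inter> M" "z \<in> U \<inter> V \<inter> M"
  obtains r where "r \<in> paths_in (U \<inter> V \<inter> M)" "pathstart r = y" "pathfinish r = z"
proof -
  have "U \<inter> V \<in> \<U>" using assms by (intro inter) auto
  from pconn[OF this] show ?thesis using assms(3,4) that unfolding path_connected_def by blast
qed

text \<open>A closed ladder. Rungs join the corresponding starting points of the two rows inside
  intersections of adjacent members; each cell lies in one member, so it commutes under
  \<open>\<Phi>\<close> by \<open>local_eq\<close>, and the products telescope up to the first
  rung.\<close>

lemma rows_conjugate:
  assumes N: "N > 0" and W: "\<And>b. b < N \<Longrightarrow> W b \<in> \<U>" and \<rho>: "is_row N W \<rho>" and \<rho>': "is_row N W \<rho>'"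
  shows "\<exists>q\<in>carrier Q. path_prod \<rho> N = q \<otimes> path_prod \<rho>' N \<otimes> inv q"
proof -
  define pb where "pb = (\<lambda>b. if b = 0 then N - 1 else b - 1)"
  have pb: "pb b < N" if "b < N" for b using that N by (auto simp: pb_def)
  have start: "pathstart (\<tau> b) \<in> W b \<inter> W (pb b) \<inter> M" if \<tau>: "is_row N W \<tau>" and b: "b < N" for \<tau> b
  proof -
    have 1: "\<tau> b \<in> paths_in (W b \<inter> M)" "\<tau> (pb b) \<in> paths_in (W (pb b) \<inter> M)" using \<tau> b pb by (auto simp: is_row_def)
    have "pathfinish (\<tau> (pb b)) = pathstart (\<tau> b)" using \<tau> b by (auto simp: is_row_def pb_def)
    then show ?thesis using 1 pathstart_in_path_image[of "\<tau> b"] pathfinish_in_path_image[of "\<tau> (pb b)"] by auto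
  qed
  have "\<exists>r. r \<in> paths_in (W b \<inter> W (pb b) \<inter> M) \<and> pathstart r = pathstart (\<rho> b) \<and> pathfinish r = pathstart (\<rho>' b)"
    if b: "b < N" for b
    by (rule connect[OF W[OF b] W[OF pb[OF b]] start[OF \<rho> b] start[OF \<rho>' b]]) blast
  then have "\<exists>r. b < N \<longrightarrow> r \<in> paths_in (W b \<inter> W (pb b) \<inter> M) \<and> pathstart r = pathstart (\<rho> b) \<and> pathfinish r = pathstart (\<rho>' b)" for b
    by blast
  then obtain r where "\<And>b. b < N \<longrightarrow> r b \<in> paths_in (W b \<inter> W (pb b) \<inter> M) \<and> pathstart (r b) = pathstart (\<rho> b) \<and> pathfinish (r b) = pathstart (\<rho>' b)"
    by metis
  then have r: "\<And>b. b < N \<Longrightarrow> r b \<in> paths_in (W b \<inter> W (pb b) \<inter> M)"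
    "\<And>b. b < N \<Longrightarrow> pathstart (r b) = pathstart (\<rho> b)" "\<And>b. b < N \<Longrightarrow> pathfinish (r b) = pathstart (\<rho>' b)" by blast+
  \<comment> \<open>Index \<open>N\<close> repeats the first rung, which closes the ladder and turns
    the telescoped identity into a conjugation.\<close>
  define r' where "r' = (\<lambda>b. if b = N then r 0 else r b)"
  have r'M: "r' b \<in> paths_in M" if "b \<le> N" for b using r(1)[of b] r(1)[of 0] that N by (auto simp: r'_def)
  have \<rho>M: "\<rho> b \<in> paths_in M" "\<rho>' b \<in> paths_in M" if "b < N" for b
    using \<rho> \<rho>' that by (auto simp: is_row_def)
  have step: "\<Psi> (\<rho> b) \<otimes> \<Psi> (r' (Suc b)) = \<Psi> (r' b) \<otimes> \<Psi> (\<rho>' b)" if b: "b < N" for b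
  proof -
    have e: "pathfinish (\<rho> b) = pathstart (r' (Suc b))" "pathfinish (\<rho>' b) = pathfinish (r' (Suc b))"
      using b \<rho> \<rho>' r(2,3)[of "Suc b"] r(2,3)[of 0] N by (cases "Suc b = N"; auto simp: is_row_def r'_def)+
    have s: "pathstart (r' b) = pathstart (\<rho> b)" "pathfinish (r' b) = pathstart (\<rho>' b)"
      using b r(2,3)[OF b] by (auto simp: r'_def)
    have in1: "r' b \<in> paths_in (W b \<inter> M)" using b r(1)[OF b] by (auto simp: r'_def)
    have in2: "r' (Suc b) \<in> paths_in (W b \<inter> M)"
      using b r(1)[of "Suc b"] r(1)[of 0] N by (cases "Suc b = N") (auto simp: r'_def pb_def)
    have in3: "\<rho> b \<in> paths_in (W b \<inter> M)" "\<rho>' b \<in> paths_in (W b \<inter> M)" using b \<rho> \<rho>' by (auto simp: is_row_def)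
    have "\<Psi> (\<rho> b +++ r' (Suc b)) = \<Psi> (r' b +++ \<rho>' b)"
      using in1 in2 in3 e s by (intro local_eq[OF W[OF b]]) (auto simp: subset_path_image_join)
    then show ?thesis
      using functor_path_join[OF \<rho>M(1)[OF b] r'M[of "Suc b"] e(1)] functor_path_join[OF r'M[of b] \<rho>M(2)[OF b] s(2)] b by simp
  qed
  have "n \<le> N \<Longrightarrow> path_prod \<rho> n \<otimes> \<Psi> (r' n) = \<Psi> (r' 0) \<otimes> path_prod \<rho>' n" for n
  proof (induction n)
    case 0
    then show ?case using functor_path_closed[OF r'M[of 0]] by simp
  next
    case (Suc n)
    have c: "path_prod \<rho> n \<in> carrier Q" "path_prod \<rho>' n \<in> carrier Q"
      using Suc.prems by (auto intro!: path_prod_closed \<rho>M simp del: mem_Collect_eq)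
    have c': "\<Psi> (\<rho> n) \<in> carrier Q" "\<Psi> (\<rho>' n) \<in> carrier Q" "\<Psi> (r' n) \<in> carrier Q" "\<Psi> (r' (Suc n)) \<in> carrier Q" "\<Psi> (r' 0) \<in> carrier Q"
      using Suc.prems functor_path_closed[OF \<rho>M(1), of n] functor_path_closed[OF \<rho>M(2), of n]
        functor_path_closed[OF r'M, of n] functor_path_closed[OF r'M, of "Suc n"] functor_path_closed[OF r'M, of 0] by simp_all
    have "path_prod \<rho> (Suc n) \<otimes> \<Psi> (r' (Suc n)) = path_prod \<rho> n \<otimes> (\<Psi> (\<rho> n) \<otimes> \<Psi> (r' (Suc n)))"
      using c c' by (simp add: Q.m_assoc)
    also have "\<dots> = (path_prod \<rho> n \<otimes> \<Psi> (r' n)) \<otimes> \<Psi> (\<rho>' n)"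
      using step[of n] Suc.prems c c' by (simp add: Q.m_assoc)
    also have "\<dots> = \<Psi> (r' 0) \<otimes> path_prod \<rho>' (Suc n)" using Suc c c' by (simp add: Q.m_assoc)
    finally show ?case .
  qed
  from this[of N] have "path_prod \<rho> N \<otimes> \<Psi> (r 0) = \<Psi> (r 0) \<otimes> path_prod \<rho>' N" using N by (simp add: r'_def)
  moreover have "\<Psi> (r 0) \<in> carrier Q" using r'M[of 0] N by (intro functor_path_closed) (simp add: r'_def)
  moreover have "path_prod \<rho> N \<in> carrier Q" "path_prod \<rho>' N \<in> carrier Q" by (intro path_prod_closed \<rho>M; assumption)+
  ultimately show ?thesis by (intro bexI[of _ "\<Psi> (r 0)"] Q.eq_conjI)
qed

text \<open>At intermediate times the loop of the homotopy need not lie in \<open>M\<close>. Its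
  points \<open>z\<close> only show that adjacent members meet; vertices and edges of the row are
  then chosen afresh inside \<open>M\<close>.\<close>

lemma row_exists:
  assumes N: "N > 0" and W: "\<And>b. b < N \<Longrightarrow> W b \<in> \<U>"
    and z: "\<And>b. b < N \<Longrightarrow> z b \<in> W b" "\<And>b. b < N \<Longrightarrow> z (Suc b) \<in> W b" "z N = z 0"
  shows "\<exists>\<rho>. is_row N W \<rho>"
proof -
  define pb where "pb = (\<lambda>b. if b = 0 then N - 1 else b - 1)"
  have pb: "pb b < N" if "b < N" for b using that N by (auto simp: pb_def)
  have "W b \<inter> W (pb b) \<inter> M \<noteq> {}" if "b < N" for b
  proof -
    have "z b \<in> W (pb b)" using z(2)[of "pb b"] z(3) that N pb[OF that] by (cases b) (auto simp: pb_def)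
    then have "W b \<inter> W (pb b) \<in> \<U>" using z(1)[OF that] W[OF that] W[OF pb[OF that]] by (intro inter) auto
    then show ?thesis by (rule nonempty)
  qed
  then have "\<exists>m. b < N \<longrightarrow> m \<in> W b \<inter> W (pb b) \<inter> M" for b by blast
  then obtain m where m: "\<And>b. b < N \<Longrightarrow> m b \<in> W b \<inter> W (pb b) \<inter> M" by metis
  define m' where "m' = (\<lambda>b. if b = N then m 0 else m b)"
  have "\<exists>r. r \<in> paths_in (W b \<inter> M) \<and> pathstart r = m' b \<and> pathfinish r = m' (Suc b)" if b: "b < N" for b
  proof -
    have "m' b \<in> W b \<inter> M" "m' (Suc b) \<in> W b \<inter> M"
      using b m[OF b] m[of "Suc b"] m[of 0] N by (auto simp: m'_def pb_def split: if_splits)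
    then show ?thesis using pconn[OF W[OF b]] unfolding path_connected_def by blast
  qed
  then obtain \<rho> where \<rho>: "\<And>b. b < N \<Longrightarrow> \<rho> b \<in> paths_in (W b \<inter> M) \<and> pathstart (\<rho> b) = m' b \<and> pathfinish (\<rho> b) = m' (Suc b)"
    by metis
  have "is_row N W \<rho>"
    unfolding is_row_def
  proof (intro conjI allI impI)
    show "pathfinish (\<rho> (N - 1)) = pathstart (\<rho> 0)"
      using \<rho>[of "N - 1"] \<rho>[of 0] N by (auto simp: m'_def)
  qed (use \<rho> in auto)
  then show ?thesis by blast
qed

lemma is_row_mono:
  assumes "is_row N W \<rho>" and sub: "\<And>b. b < N \<Longrightarrow> W b \<subseteq> W' b"
  shows "is_row N W' \<rho>"
proof -
  have "\<rho> b \<in> paths_in (W' b \<inter> M)" if "b < N" for b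
  proof -
    have "\<rho> b \<in> paths_in (W b \<inter> M)" using assms(1) that by (simp add: is_row_def)
    then show ?thesis using sub[OF that] by blast
  qed
  then show ?thesis using assms(1) by (simp add: is_row_def)
qed

lemma square_subdivision:
  assumes h: "continuous_on ({0..1} \<times> {0..1::real}) h" "h \<in> {0..1::real} \<times> {0..1} \<rightarrow> T"
  shows "\<exists>N W. N > 0 \<and> (\<forall>a<N. \<forall>b<N. W a b \<in> \<U> \<and>
    h ` ({real a / real N..real (Suc a) / real N} \<times> {real b / real N..real (Suc b) / real N}) \<subseteq> W a b)"
proof -
  let ?Q = "{0..1::real} \<times> {0..1::real}"
  \<comment> \<open>The preimages of the cover are open only relative to the square; they are
    replaced by open subsets of the plane, as the Lebesgue number lemma expects.\<close>
  define \<C> where "\<C> = {V. open V \<and> (\<exists>U\<in>\<U>. h ` (V \<inter> ?Q) \<subseteq> U)}"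
  have cov: "\<exists>V\<in>\<C>. w \<in> V" if w: "w \<in> ?Q" for w
  proof -
    have hT: "h y \<in> T" if "y \<in> ?Q" for y by (rule funcset_mem[OF h(2) that])
    obtain U where U: "U \<in> \<U>" "h w \<in> U" "openin (top_of_set T) U" using cover[OF hT[OF w]] by auto
    obtain V where V: "open V" "U = T \<inter> V" using U(3) unfolding openin_open by auto
    have "\<exists>V'. open V' \<and> V' \<inter> ?Q = h -` V \<inter> ?Q"
      using h(1) V(1) by (simp add: continuous_on_open_invariant)
    then obtain V' where V': "open V'" "V' \<inter> ?Q = h -` V \<inter> ?Q" by auto
    have "h ` (V' \<inter> ?Q) \<subseteq> U" using hT unfolding V'(2) V(2) by auto
    then have "V' \<in> \<C>" unfolding \<C>_def using V'(1) U(1) by auto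
    moreover have "w \<in> V'"
    proof -
      have "w \<in> h -` V \<inter> ?Q" using w U(2) V(2) by auto
      then show ?thesis unfolding V'(2)[symmetric] by simp
    qed
    ultimately show ?thesis by blast
  qed
  have c1: "compact ?Q" by (intro compact_Times) auto
  have c2: "?Q \<subseteq> \<Union>\<C>" using cov by blast
  have c3: "\<C> \<noteq> {}" using cov[of "(0, 0)"] by auto
  have c4: "open V" if "V \<in> \<C>" for V using that by (simp add: \<C>_def)
  obtain \<delta> where \<delta>: "\<delta> > 0" "\<And>S. \<lbrakk>S \<subseteq> ?Q; diameter S < \<delta>\<rbrakk> \<Longrightarrow> \<exists>V\<in>\<C>. S \<subseteq> V"
    using Lebesgue_number_lemma[OF c1 c3 c2 c4] by blast
  \<comment> \<open>A cell has sides of length \<open>1 / N\<close>, so the sum of two sides bounds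
    its diameter by \<open>2 / N\<close>.\<close>
  obtain N :: nat where N: "N > 0" "2 / real N < \<delta>"
  proof -
    obtain n :: nat where n: "2 / \<delta> < real n" using reals_Archimedean2 by blast
    then have "n > 0" using \<delta>(1) by (intro gr0I) (auto simp: field_simps)
    then show ?thesis using n \<delta>(1) that[of n] by (simp add: field_simps)
  qed
  have "\<exists>U\<in>\<U>. h ` ({real a / N..real (Suc a) / N} \<times> {real b / N..real (Suc b) / N}) \<subseteq> U" if ab: "a < N" "b < N" for a b
  proof -
    let ?S = "{real a / N..real (Suc a) / N} \<times> {real b / N..real (Suc b) / N}"
    have frac: "real c / N \<ge> 0" "real (Suc c) / N \<le> 1" if "c < N" for c
      using that by (auto simp: field_simps)
    have SQ: "?S \<subseteq> ?Q"
      using frac[OF ab(1)] frac[OF ab(2)] by (intro Sigma_mono) auto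
    have "diameter ?S \<le> 2 / N"
    proof (rule diameter_le)
      fix x y assume xy: "x \<in> ?S" "y \<in> ?S"
      have e: "real (Suc c) / N = real c / N + 1 / N" for c by (simp add: add_divide_distrib)
      have "norm (fst x - fst y) \<le> 1 / N" "norm (snd x - snd y) \<le> 1 / N" using xy unfolding e by (auto simp: abs_le_iff)
      then show "norm (x - y) \<le> 2 / N"
        using norm_Pair_le[of "fst x - fst y" "snd x - snd y"] by (simp add: minus_prod_def)
    qed simp
    then have "\<exists>V\<in>\<C>. ?S \<subseteq> V" using N SQ by (intro \<delta>(2)) auto
    then obtain V where V: "V \<in> \<C>" "?S \<subseteq> V" ..
    then obtain U where U: "U \<in> \<U>" "h ` (V \<inter> ?Q) \<subseteq> U" unfolding \<C>_def by auto
    have "h ` ?S \<subseteq> h ` (V \<inter> ?Q)" using V(2) SQ by (intro image_mono Int_greatest)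
    then show ?thesis using U by (intro bexI[of _ U]) (rule order_trans)
  qed
  then have "\<exists>U. a < N \<and> b < N \<longrightarrow> U \<in> \<U> \<and> h ` ({real a / N..real (Suc a) / N} \<times> {real b / N..real (Suc b) / N}) \<subseteq> U" for a b
    by blast
  then obtain W where "\<And>a b. a < N \<and> b < N \<longrightarrow> W a b \<in> \<U> \<and> h ` ({real a / N..real (Suc a) / N} \<times> {real b / N..real (Suc b) / N}) \<subseteq> W a b"
    by metis
  then show ?thesis using N(1) by (intro exI[of _ N] exI[of _ W]) simp
qed

text \<open>The square of the homotopy is cut into cells that each lie in one member of the cover.
  The rows at the two ends are the given loops, those between are auxiliary, and consecutive rows
  are conjugate by \<open>rows_conjugate\<close>.\<close>

lemma loops_conjugate:
  assumes h: "continuous_on ({0..1} \<times> {0..1::real}) h" "h \<in> {0..1::real} \<times> {0..1} \<rightarrow> T"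
    and loop: "\<And>s. s \<in> {0..1} \<Longrightarrow> h (s, 0) = h (s, 1)"
    and ends: "\<And>t. t \<in> {0..1} \<Longrightarrow> h (0, t) \<in> M" "\<And>t. t \<in> {0..1} \<Longrightarrow> h (1, t) \<in> M"
  shows "\<exists>q\<in>carrier Q. \<Psi> (\<lambda>t. h (0, t)) = q \<otimes> \<Psi> (\<lambda>t. h (1, t)) \<otimes> inv q"
proof -
  obtain N W where N: "N > 0" and W: "\<And>a b. \<lbrakk>a < N; b < N\<rbrakk> \<Longrightarrow> W a b \<in> \<U>"
    "\<And>a b. \<lbrakk>a < N; b < N\<rbrakk> \<Longrightarrow> h ` ({real a / N..real (Suc a) / N} \<times> {real b / N..real (Suc b) / N}) \<subseteq> W a b"
    using square_subdivision[OF h] by blast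
  have hp: "(\<lambda>t. h (s, t)) \<in> paths_in M" if s: "s \<in> {0, 1}" for s
  proof -
    have "continuous_on {0..1} (\<lambda>t. h (s, t))"
      by (rule continuous_on_compose2[OF h(1)]) (use s in \<open>auto intro!: continuous_intros\<close>)
    then show ?thesis using s ends by (auto simp: path_def path_image_def)
  qed
  have frac: "real c / N \<le> real (Suc c) / N" "real c / N \<ge> 0" "real (Suc c) / N \<le> 1" if "c < N" for c
    using that by (auto simp: field_simps)
  have W0: "h (real a / N, real b / N) \<in> W a b" "h (real a / N, real (Suc b) / N) \<in> W a b"
    "h (real (Suc a) / N, real b / N) \<in> W a b" "h (real (Suc a) / N, real (Suc b) / N) \<in> W a b"
    if "a < N" "b < N" for a b
    using W(2)[OF that] frac[OF that(1)] frac[OF that(2)] by (auto simp: image_subset_iff)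
  have bnd: "is_row N (W a) (\<lambda>b. seg (real b / N) (real (Suc b) / N) (\<lambda>t. h (s, t)))"
    if a: "a < N" and s: "s \<in> {0, 1}" "s \<in> {real a / N..real (Suc a) / N}" for a s
    unfolding is_row_def
  proof (intro conjI allI impI)
    fix b assume b: "b < N"
    let ?p = "seg (real b / N) (real (Suc b) / N) (\<lambda>t. h (s, t))"
    have "path_image ?p = (\<lambda>t. h (s, t)) ` {real b / N..real (Suc b) / N}"
      using frac[OF b] by (simp only: path_image_seg)
    also have "\<dots> \<subseteq> W a b" using W(2)[OF a b] s by force
    finally have "path_image ?p \<subseteq> W a b" .
    moreover have "path ?p" "path_image ?p \<subseteq> M"
      using seg_paths_in[OF hp[OF s(1)], of "real b / N" "real (Suc b) / N"] frac[OF b] by auto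
    ultimately show "?p \<in> paths_in (W a b \<inter> M)" by simp
  next
    show "pathfinish (seg (real (N - 1) / N) (real (Suc (N - 1)) / N) (\<lambda>t. h (s, t)))
      = pathstart (seg (real 0 / N) (real (Suc 0) / N) (\<lambda>t. h (s, t)))"
      using N loop[of s] s by auto
  qed simp
  \<comment> \<open>An intermediate row must be comparable with both of its neighbours, so it is
    placed in the intersection of the members for the strips on its two sides.\<close>
  define A where "A = (\<lambda>a b. if a = 0 then W 0 b else if a = N then W (N - 1) b else W (a - 1) b \<inter> W a b)"
  have rows: "\<exists>\<rho>. is_row N (A a) \<rho> \<and> (a = 0 \<longrightarrow> path_prod \<rho> N = \<Psi> (\<lambda>t. h (0, t))) \<and> (a = N \<longrightarrow> path_prod \<rho> N = \<Psi> (\<lambda>t. h (1, t)))"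
    if a: "a \<le> N" for a
  proof -
    consider "a = 0" | "a = N" | "0 < a" "a < N" using a by linarith
    then show ?thesis
    proof cases
      case 1
      have "is_row N (A a) (\<lambda>b. seg (real b / N) (real (Suc b) / N) (\<lambda>t. h (0, t)))"
        using bnd[of 0 0] N 1 by (simp add: A_def)
      moreover have "path_prod (\<lambda>b. seg (real b / N) (real (Suc b) / N) (\<lambda>t. h (0, t))) N = \<Psi> (\<lambda>t. h (0, t))"
        by (rule path_prod_subpaths[OF hp N]) simp
      ultimately show ?thesis using 1 N by blast
    next
      case 2
      have "is_row N (A a) (\<lambda>b. seg (real b / N) (real (Suc b) / N) (\<lambda>t. h (1, t)))"
        using bnd[of "N - 1" 1] N 2 by (simp add: A_def)
      moreover have "path_prod (\<lambda>b. seg (real b / N) (real (Suc b) / N) (\<lambda>t. h (1, t))) N = \<Psi> (\<lambda>t. h (1, t))"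
        by (rule path_prod_subpaths[OF hp N]) simp
      ultimately show ?thesis using 2 N by blast
    next
      case 3
      then have Suc: "Suc (a - 1) = a" "a - 1 < N" by auto
      have Ab: "A a b = W (a - 1) b \<inter> W a b" for b using 3 by (simp add: A_def)
      have "\<exists>\<rho>. is_row N (A a) \<rho>"
      proof (rule row_exists[OF N, of _ "\<lambda>b. h (real a / N, real b / N)"])
        fix b assume b: "b < N"
        show 1: "h (real a / N, real b / N) \<in> A a b"
          using W0(1)[OF 3(2) b] W0(3)[OF Suc(2) b] unfolding Suc(1) Ab by blast
        show "h (real a / N, real (Suc b) / N) \<in> A a b"
          using W0(2)[OF 3(2) b] W0(4)[OF Suc(2) b] unfolding Suc(1) Ab by blast
        show "A a b \<in> \<U>" using 1 W(1)[OF 3(2) b] W(1)[OF Suc(2) b] unfolding Ab by (intro inter) auto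
      next
        show "h (real a / N, real N / N) = h (real a / N, real 0 / N)" using loop[of "real a / N"] 3 N by simp
      qed
      then show ?thesis using 3 by auto
    qed
  qed
  then have "\<exists>\<rho>. a \<le> N \<longrightarrow> is_row N (A a) \<rho> \<and> (a = 0 \<longrightarrow> path_prod \<rho> N = \<Psi> (\<lambda>t. h (0, t))) \<and> (a = N \<longrightarrow> path_prod \<rho> N = \<Psi> (\<lambda>t. h (1, t)))" for a
    by blast
  then obtain \<rho> where r: "\<And>a. a \<le> N \<longrightarrow> is_row N (A a) (\<rho> a) \<and> (a = 0 \<longrightarrow> path_prod (\<rho> a) N = \<Psi> (\<lambda>t. h (0, t))) \<and> (a = N \<longrightarrow> path_prod (\<rho> a) N = \<Psi> (\<lambda>t. h (1, t)))"
    by metis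
  have \<rho>: "\<And>a. a \<le> N \<Longrightarrow> is_row N (A a) (\<rho> a)"
    "path_prod (\<rho> 0) N = \<Psi> (\<lambda>t. h (0, t))" "path_prod (\<rho> N) N = \<Psi> (\<lambda>t. h (1, t))"
    using r by blast (use r[of 0] r[of N] in auto)
  have cl: "path_prod (\<rho> a) N \<in> carrier Q" if "a \<le> N" for a
    using \<rho>(1)[OF that] by (intro path_prod_closed) (auto simp: is_row_def)
  have "a \<le> N \<Longrightarrow> \<exists>q\<in>carrier Q. path_prod (\<rho> 0) N = q \<otimes> path_prod (\<rho> a) N \<otimes> inv q" for a
  proof (induction a)
    case 0
    then show ?case using cl[of 0] by (intro bexI[of _ \<one>]) auto
  next
    case (Suc a)
    have sub: "A a b \<subseteq> W a b" "A (Suc a) b \<subseteq> W a b" if "b < N" for b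
      using Suc.prems N by (auto simp: A_def split: if_splits)
    have "is_row N (W a) (\<rho> a)" "is_row N (W a) (\<rho> (Suc a))"
      using \<rho>(1)[of a] \<rho>(1)[of "Suc a"] Suc.prems sub is_row_mono[of N _ _ "W a"] by auto
    then obtain q where q: "q \<in> carrier Q" "path_prod (\<rho> a) N = q \<otimes> path_prod (\<rho> (Suc a)) N \<otimes> inv q"
      using rows_conjugate[of N "W a" "\<rho> a" "\<rho> (Suc a)"] N W(1)[of a] Suc.prems by auto
    obtain q' where q': "q' \<in> carrier Q" "path_prod (\<rho> 0) N = q' \<otimes> path_prod (\<rho> a) N \<otimes> inv q'"
      using Suc by auto
    have "path_prod (\<rho> 0) N = (q' \<otimes> q) \<otimes> path_prod (\<rho> (Suc a)) N \<otimes> inv (q' \<otimes> q)"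
      using q q' cl[OF Suc.prems] by (simp add: Q.group_word_simps)
    then show ?case using q q' by blast
  qed
  from this[of N] show ?thesis using \<rho>(2,3) by simp
qed

end

section \<open>Winding numbers\<close>

abbreviation punctured :: "complex set" where "punctured \<equiv> - {0}"

text \<open>It is taken for open paths as well, which makes it additive on the whole groupoid; on
  loops it is an integer.\<close>

definition wn :: "(real \<Rightarrow> complex) set \<Rightarrow> complex" where
  "wn B = winding_number (SOME p. p \<in> B) 0"

lemma wn_class:
  assumes "p \<in> paths_in punctured"
  shows "wn (homotopy_class punctured p) = winding_number p 0"
proof -
  have "(SOME q. q \<in> homotopy_class punctured p) \<in> homotopy_class punctured p"
    using homotopy_class_self[OF assms] by (rule someI[where P = "\<lambda>q. q \<in> homotopy_class punctured p"])
  then have "homotopic_paths punctured p (SOME q. q \<in> homotopy_class punctured p)" by (simp add: homotopy_class_def)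
  from winding_number_homotopic_paths[OF this] show ?thesis by (simp add: wn_def)
qed

lemma wn_pmul:
  assumes "A \<in> path_classes punctured" "B \<in> path_classes punctured" "ptgt A = psrc B"
  shows "wn (pmul punctured A B) = wn A + wn B"
proof -
  from assms obtain p where p: "p \<in> paths_in punctured" "A = homotopy_class punctured p" by (auto simp: path_classes_def)
  from assms obtain q where q: "q \<in> paths_in punctured" "B = homotopy_class punctured q" by (auto simp: path_classes_def)
  have e: "pathfinish p = pathstart q" using assms p q by simp
  then have "p +++ q \<in> paths_in punctured" using p q subset_path_image_join[of p punctured q] by auto
  moreover have "winding_number (p +++ q) 0 = winding_number p 0 + winding_number q 0"
    using p q e by (intro winding_number_join) auto
  ultimately show ?thesis using p q e by (simp add: pmul_class wn_class del: mem_Collect_eq)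
qed

lemma wn_pinv:
  assumes "A \<in> path_classes punctured"
  shows "wn (pinv punctured A) = - wn A"
proof -
  from assms obtain p where p: "p \<in> paths_in punctured" "A = homotopy_class punctured p" by (auto simp: path_classes_def)
  have "reversepath p \<in> paths_in punctured" using p by auto
  moreover have "winding_number (reversepath p) 0 = - winding_number p 0"
    using p by (intro winding_number_reversepath) auto
  ultimately show ?thesis using p by (simp add: pinv_class wn_class del: mem_Collect_eq)
qed

lemma wn_integer:
  assumes "A \<in> path_classes punctured" "psrc A = ptgt A"
  shows "wn A \<in> \<int>"
proof -
  from assms obtain p where p: "p \<in> paths_in punctured" "A = homotopy_class punctured p" by (auto simp: path_classes_def)
  then have "winding_number p 0 \<in> \<int>" using assms by (intro integer_winding_number) auto
  then show ?thesis using p by (simp add: wn_class del: mem_Collect_eq)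
qed

lemma wn_convex:
  assumes f: "maps E punctured f" and A: "A \<in> path_classes E" "psrc A = ptgt A"
    and C: "convex C" "0 \<notin> C" "f ` E \<subseteq> C"
  shows "wn (ppush punctured f A) = 0"
proof -
  have f': "continuous_on E f" "f \<in> E \<rightarrow> punctured" using f by auto
  from A obtain p where p: "p \<in> paths_in E" "A = homotopy_class E p" by (auto simp: path_classes_def)
  have fp: "f \<circ> p \<in> paths_in punctured" by (rule compose_paths_in[OF p(1) f'])
  have "pathfinish p = pathstart p" using p A by simp
  then have "winding_number (f \<circ> p) 0 = 0"
    using fp C p by (intro winding_number_zero_outside[of _ C])
      (auto simp: pathstart_compose pathfinish_compose path_image_compose)
  then show ?thesis using p fp f' by (simp add: ppush_class wn_class del: mem_Collect_eq)
qed

lemma wn_inject: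
  assumes "A \<in> path_classes punctured" "B \<in> path_classes punctured" "psrc A = psrc B" "ptgt A = ptgt B" "wn A = wn B"
  shows "A = B"
proof -
  from assms obtain p where p: "p \<in> paths_in punctured" "A = homotopy_class punctured p" by (auto simp: path_classes_def)
  from assms obtain q where q: "q \<in> paths_in punctured" "B = homotopy_class punctured q" by (auto simp: path_classes_def)
  have "winding_number p 0 = winding_number q 0" using assms p q by (simp add: wn_class del: mem_Collect_eq)
  then have "homotopic_paths punctured p q"
    using p q assms winding_number_homotopic_paths_eq[of p 0 q] by auto
  then show ?thesis using p q by (simp add: homotopy_class_eqI)
qed

definition circ :: "(real \<Rightarrow> complex) set" where
  "circ = homotopy_class punctured (circlepath 0 1)"

lemma circlepath_paths_in: "r > 0 \<Longrightarrow> circlepath 0 r \<in> paths_in punctured"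
  by (auto simp: path_image_circlepath)

lemma circ_simps: "circ \<in> path_classes punctured" "psrc circ = 1" "ptgt circ = 1" "wn circ = 1"
  using circlepath_paths_in[of 1] winding_number_circlepath_centre[of 1 0]
  by (simp_all add: circ_def wn_class del: mem_Collect_eq)

text \<open>Classes with the same endpoints are separated by their winding numbers, so a loop equals
  the power of \<open>circ\<close> with the same winding number.\<close>

lemma fundamental_group_punctured:
  assumes B: "B \<in> carrier (fundamental_group punctured 1)"
  shows "B \<in> generate (fundamental_group punctured 1) {circ}"
proof -
  let ?P = "fundamental_group punctured 1"
  interpret group ?P by (rule group_fundamental_group) simp
  have c: "circ \<in> carrier ?P" using circ_simps by (simp add: fundamental_group_simps)
  have Bp: "B \<in> path_classes punctured" "psrc B = 1" "ptgt B = 1" using B by (auto simp: fundamental_group_simps)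
  have nat: "wn (circ [^]\<^bsub>?P\<^esub> (n :: nat)) = of_nat n" for n
  proof (induction n)
    case 0
    have "wn (pid punctured 1) = 0" 
      using wn_pmul[of "pid punctured 1" "pid punctured 1"] by simp
    then show ?case by (simp add: fundamental_group_simps)
  next
    case (Suc n)
    have "circ [^]\<^bsub>?P\<^esub> n \<in> carrier ?P" using c by simp
    then have "wn (circ [^]\<^bsub>?P\<^esub> n \<otimes>\<^bsub>?P\<^esub> circ) = wn (circ [^]\<^bsub>?P\<^esub> n) + wn circ"
      using circ_simps by (simp add: fundamental_group_simps wn_pmul)
    then show ?case using Suc circ_simps by (simp add: nat_pow_Suc)
  qed
  obtain k where k: "wn B = of_int k" using wn_integer[of B] Bp by (auto elim: Ints_cases)
  have ck: "circ [^]\<^bsub>?P\<^esub> k \<in> carrier ?P" using c by simp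
  have "wn (circ [^]\<^bsub>?P\<^esub> k) = of_int k"
  proof (cases k rule: int_cases2)
    case (nonneg n)
    then show ?thesis using nat[of n] by (simp only: int_pow_int of_int_of_nat_eq)
  next
    case (nonpos n)
    have cn: "circ [^]\<^bsub>?P\<^esub> n \<in> carrier ?P" using c by simp
    then have "circ [^]\<^bsub>?P\<^esub> n \<in> path_classes punctured" by (simp only: fundamental_group_simps mem_Collect_eq)
    from wn_pinv[OF this] show ?thesis
      using nat[of n] unfolding nonpos int_pow_neg_int[OF c] inv_fundamental_group[OF cn] by simp
  qed
  then have "B = circ [^]\<^bsub>?P\<^esub> k"
    using ck Bp k by (intro wn_inject) (auto simp: fundamental_group_simps)
  then show ?thesis using generate_pow[OF c] by auto
qed

lemma path_connected_punctured: "path_connected punctured"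
  using path_connected_complement_countable[of "{0::complex}"] by auto

context path_functor begin

lemma functor_push_pmul:
  assumes "maps E M f" "A \<in> path_classes E" "B \<in> path_classes E" "ptgt A = psrc B"
  shows "\<Phi> (ppush M f (pmul E A B)) = \<Phi> (ppush M f A) \<otimes> \<Phi> (ppush M f B)"
  using assms ppush_pmul[of A E B f M] mult[of "ppush M f A" "ppush M f B"]
    ppush_simps[of A E f M] ppush_simps[of B E f M] by auto

text \<open>The loop may be based anywhere; a path \<open>p\<close> transports it to the base point
  1, where \<open>circ\<close> generates.\<close>

lemma functor_punctured:
  assumes f: "maps punctured M f" and c: "\<Phi> (ppush M f circ) = \<one>"
    and B: "B \<in> path_classes punctured" "psrc B = ptgt B"
  shows "\<Phi> (ppush M f B) = \<one>"
proof -
  let ?P = "fundamental_group punctured 1"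
  interpret P: group ?P by (rule group_fundamental_group) simp
  have f': "continuous_on punctured f" "f \<in> punctured \<rightarrow> M" using f by auto
  have cl: "\<Phi> (ppush M f A) \<in> carrier Q" if "A \<in> path_classes punctured" for A
    by (rule closed[OF ppush_simps(1)[OF that f']])
  have hom: "(\<lambda>A. \<Phi> (ppush M f A)) \<in> hom ?P Q"
    by (rule homI) (auto simp: fundamental_group_simps cl functor_push_pmul[OF f])
  interpret h: group_hom ?P Q "\<lambda>A. \<Phi> (ppush M f A)" by standard (rule hom)
  have "generate ?P {circ} \<subseteq> kernel ?P Q (\<lambda>A. \<Phi> (ppush M f A))"
    by (rule P.generate_subgroup_incl[OF _ h.subgroup_kernel])
      (use c circ_simps in \<open>auto simp: kernel_def fundamental_group_simps\<close>)
  then have 1: "\<Phi> (ppush M f A) = \<one>" if "A \<in> carrier ?P" for A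
    using fundamental_group_punctured[OF that] by (auto simp: kernel_def)
  have "psrc B \<in> punctured" "1 \<in> punctured" using psrc_in(1)[OF B(1)] by simp_all
  then obtain p where p: "p \<in> paths_in punctured" "pathstart p = 1" "pathfinish p = psrc B"
    using path_connected_punctured unfolding path_connected_def by blast
  let ?D = "homotopy_class punctured p"
  have D: "?D \<in> path_classes punctured" "psrc ?D = 1" "ptgt ?D = psrc B" using p by (simp_all del: mem_Collect_eq)
  have "\<one> = \<Phi> (ppush M f (pmul punctured ?D (pmul punctured B (pinv punctured ?D))))"
    using D B by (intro 1[symmetric]) (simp add: fundamental_group_simps)
  also have "\<dots> = \<Phi> (ppush M f ?D) \<otimes> (\<Phi> (ppush M f B) \<otimes> \<Phi> (ppush M f (pinv punctured ?D)))"
    using D B by (simp add: functor_push_pmul[OF f])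
  also have "\<Phi> (ppush M f (pinv punctured ?D)) = inv (\<Phi> (ppush M f ?D))"
    using functor_pinv[OF ppush_simps(1)[OF D(1) f']] ppush_simps(4)[OF D(1) f'] by simp
  finally have e: "\<Phi> (ppush M f ?D) \<otimes> (\<Phi> (ppush M f B) \<otimes> inv (\<Phi> (ppush M f ?D))) = \<one>" ..
  have "\<Phi> (ppush M f B) = inv (\<Phi> (ppush M f ?D)) \<otimes> (\<Phi> (ppush M f ?D) \<otimes> (\<Phi> (ppush M f B) \<otimes> inv (\<Phi> (ppush M f ?D)))) \<otimes> \<Phi> (ppush M f ?D)"
    using cl[OF D(1)] cl[OF B(1)] by (simp add: Q.group_word_simps)
  then show ?thesis unfolding e using cl[OF D(1)] by simp
qed

end

text \<open>The defining forms of the full monomial reflection arrangement: \<open>(i, j, k)\<close>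
  with \<open>j \<noteq> i\<close> is the hyperplane on which \<open>v i\<close> equals a root of
  unity times \<open>v j\<close>, and \<open>(i, i, 0)\<close> is a coordinate hyperplane.\<close>

definition lform :: "nat \<Rightarrow> nat \<times> nat \<times> nat \<Rightarrow> (nat \<Rightarrow> complex) \<Rightarrow> complex" where
  "lform d = (\<lambda>(i, j, k) v. if j = i then v i else v i - rootc d (int k) * v j)"

text \<open>The value of the \<open>i\<close>-th coordinate at which the form vanishes. When the new
  point is the \<open>i\<close>-th one, these are its forbidden positions.\<close>

definition center :: "nat \<Rightarrow> nat \<times> nat \<times> nat \<Rightarrow> (nat \<Rightarrow> complex) \<Rightarrow> complex" where
  "center d = (\<lambda>(i, j, k) v. if j = i then 0 else rootc d (int k) * v j)"

text \<open>The conditions \<open>j \<le> i\<close>, and \<open>k = 0\<close> on the diagonal, list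
  every hyperplane exactly once.\<close>

definition hyps :: "nat \<Rightarrow> nat set \<Rightarrow> (nat \<times> nat \<times> nat) set" where
  "hyps d S = {(i, j, k). i \<in> S \<and> j \<in> S \<and> j \<le> i \<and> k < d \<and> (j = i \<longrightarrow> k = 0)}"

text \<open>The hyperplanes that involve the new point \<open>a\<close>. It exceeds all old indices,
  so it always stands in the first place.\<close>

definition newhyps :: "nat \<Rightarrow> nat \<Rightarrow> nat set \<Rightarrow> (nat \<times> nat \<times> nat) set" where
  "newhyps d a S = insert (a, a, 0) ({a} \<times> S \<times> {..<d})"

lemma finite_hyps: "finite S \<Longrightarrow> finite (hyps d S)"
  by (rule finite_subset[of _ "S \<times> S \<times> {..<d}"]) (auto simp: hyps_def)

lemma finite_newhyps: "finite S \<Longrightarrow> finite (newhyps d a S)"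
  by (auto simp: newhyps_def)

lemma lform_center: "lform d (i, j, k) v = v i - center d (i, j, k) v"
  by (simp add: lform_def center_def)

lemma continuous_lform: "continuous_on E (lform d H)"
proof (cases H)
  case (fields i j k)
  show ?thesis unfolding fields lform_def prod.case
    by (cases "j = i"; simp only: if_True if_False simp_thms; intro continuous_intros continuous_on_coord_id)
qed

lemma continuous_center: "continuous_on E (center d H)"
proof (cases H)
  case (fields i j k)
  show ?thesis unfolding fields center_def prod.case
    by (cases "j = i"; simp only: if_True if_False simp_thms; intro continuous_intros continuous_on_coord_id)
qed

context config begin

lemma hyps_insert:
  assumes "\<And>i. i \<in> S \<Longrightarrow> i < a"
  shows "hyps d (insert a S) = hyps d S \<union> newhyps d a S"
  using assms d_pos by (auto simp: hyps_def newhyps_def dest: leD less_imp_le)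

lemma lform_nonzero:
  assumes "v \<in> Conf d S" "H \<in> hyps d S"
  shows "lform d H v \<noteq> 0"
proof (cases H)
  case (fields i j k)
  then have ij: "i \<in> S" "j \<in> S" using assms by (auto simp: hyps_def)
  show ?thesis
  proof (cases "j = i")
    case False
    have "v i ^ d \<noteq> (rootc d (int k) * v j) ^ d"
      using ConfD(3)[OF assms(1) ij] False rootc_power[of "int k"] by (auto simp: power_mult_distrib)
    then show ?thesis using False by (auto simp: fields lform_def)
  qed (use ConfD(1)[OF assms(1) ij(1)] in \<open>simp add: fields lform_def\<close>)
qed

lemma lform_maps: "H \<in> hyps d S \<Longrightarrow> maps (Conf d S) punctured (lform d H)"
  using continuous_lform lform_nonzero by auto

end

section \<open>Adding a point\<close>

lemma (in plain_group) normal_of_derived_subset: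
  assumes K: "subgroup K G" and sub: "lower_central G 2 \<subseteq> K"
  shows "K \<lhd> G"
  unfolding normal_inv_iff
proof (intro conjI ballI K)
  fix g k assume g: "g \<in> carrier G" and k: "k \<in> K"
  have kc: "k \<in> carrier G" using K k by (rule subgroup.mem_carrier)
  have "g \<otimes> k \<otimes> inv g \<otimes> inv k \<in> K"
    using lower_central_commutator[of g 0 k] g kc sub by (auto simp: numeral_2_eq_2)
  from subgroup.m_closed[OF K this k] show "g \<otimes> k \<otimes> inv g \<in> K" using g kc by (simp add: m_assoc)
qed

text \<open>Forgetting the new point maps \<open>M\<close> to \<open>C\<close> by
  \<open>rst\<close>, with section \<open>\<iota>\<close>. Each fibre is a plane with finitely many
  points removed, so the section and one small circle for each removed point should generate; the
  locale proves this for the abelianization.\<close>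

locale new_point = config +
  fixes S :: "nat set" and a :: nat
  assumes fin: "finite S" and above: "\<And>i. i \<in> S \<Longrightarrow> i < a"
begin

abbreviation "S' \<equiv> insert a S"
abbreviation "C \<equiv> Conf d S"
abbreviation "M \<equiv> Conf d S'"
abbreviation "N \<equiv> newhyps d a S"
abbreviation "\<iota> \<equiv> ins d S' S"
abbreviation "rst \<equiv> ins d S S"

definition ext :: "(nat \<Rightarrow> complex) \<Rightarrow> complex \<Rightarrow> nat \<Rightarrow> complex" where
  "ext v u = (\<lambda>i\<in>S'. if i = a then u else v i)"

text \<open>A radius that varies continuously with \<open>v\<close> and is at most half the distance
  from this center to any other: a product of factors at most 1 is bounded by each of them.\<close>

definition rad :: "nat \<times> nat \<times> nat \<Rightarrow> (nat \<Rightarrow> complex) \<Rightarrow> real" where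
  "rad H v = (\<Prod>H'\<in>N - {H}. min 1 (norm (center d H v - center d H' v))) / 2"

text \<open>A tube around one new hyperplane. The map \<open>g / (1 + |g|)\<close> shrinks the
  punctured plane to the punctured unit disc, so tubes can be parametrized by
  \<open>C \<times> punctured\<close>.\<close>

definition emb :: "nat \<times> nat \<times> nat \<Rightarrow> (nat \<Rightarrow> complex) \<times> complex \<Rightarrow> nat \<Rightarrow> complex" where
  "emb H = (\<lambda>(v, g). ext v (center d H v + of_real (rad H v / (1 + norm g)) * g))"

lemma a_notin: "a \<notin> S" using above by blast

lemma newhypsE:
  assumes "H \<in> N"
  obtains "H = (a, a, 0)" | j k where "H = (a, j, k)" "j \<in> S" "k < d" "j \<noteq> a"
  using assms a_notin by (auto simp: newhyps_def)

lemma center_cong: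
  assumes "H \<in> N" "\<And>j. j \<in> S \<Longrightarrow> v j = w j"
  shows "center d H v = center d H w"
  using assms(1) by (rule newhypsE) (use assms(2) in \<open>auto simp: center_def\<close>)

lemma rad_cong:
  assumes "H \<in> N" "\<And>j. j \<in> S \<Longrightarrow> v j = w j"
  shows "rad H v = rad H w"
  unfolding rad_def using center_cong[OF _ assms(2)] assms(1)
  by (intro arg_cong[where f = "\<lambda>x. x / 2"] prod.cong) auto

lemma rootc_inj: "\<lbrakk>k < d; k' < d; rootc d (int k) = rootc d (int k')\<rbrakk> \<Longrightarrow> k = k'"
  using Complex.bij_betw_roots_unity[of d] d_pos by (auto simp: bij_betw_def inj_on_def)

lemma center_ne:
  assumes v: "v \<in> C" and H: "H \<in> N" "H' \<in> N" "H \<noteq> H'"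
  shows "center d H v \<noteq> center d H' v"
proof
  assume e: "center d H v = center d H' v"
  have nz: "rootc d (int k) * v j \<noteq> 0" if "j \<in> S" for j k using ConfD(1)[OF v that] by simp
  from H(1) show False
  proof (cases rule: newhypsE)
    case 1
    from H(2) show False
      by (cases rule: newhypsE) (use 1 H(3) e nz in \<open>auto simp: center_def\<close>)
  next
    case (2 j k)
    note jk = 2
    from H(2) show False
    proof (cases rule: newhypsE)
      case 1
      then show False using e nz[OF jk(2), of k] jk by (auto simp: center_def)
    next
      case (2 j' k')
      have e': "rootc d (int k) * v j = rootc d (int k') * v j'" using e jk 2 by (simp add: center_def)
      from arg_cong[OF this, of "\<lambda>z. z ^ d"] have "v j ^ d = v j' ^ d" by (simp only: power_mult_distrib rootc_power mult_1)
      then have "j = j'" using ConfD(3)[OF v jk(2) 2(2)] by blast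
      then have "rootc d (int k) = rootc d (int k')" using e' ConfD(1)[OF v jk(2)] by simp
      then have "k = k'" using jk 2 by (intro rootc_inj)
      then show False using H(3) jk 2 \<open>j = j'\<close> by simp
    qed
  qed
qed

lemma ext_in_iff:
  assumes v: "v \<in> C"
  shows "ext v u \<in> M \<longleftrightarrow> (\<forall>H\<in>N. u \<noteq> center d H v)"
proof
  assume e: "ext v u \<in> M"
  show "\<forall>H\<in>N. u \<noteq> center d H v"
  proof
    fix H assume "H \<in> N"
    then show "u \<noteq> center d H v"
    proof (cases rule: newhypsE)
      case 1
      then show ?thesis using ConfD(1)[OF e, of a] by (simp add: center_def ext_def)
    next
      case (2 j k)
      have "u ^ d \<noteq> v j ^ d" using ConfD(3)[OF e, of a j] 2 by (simp add: ext_def)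
      then show ?thesis using 2 rootc_power[of "int k"] by (auto simp: center_def power_mult_distrib)
    qed
  qed
next
  assume h: "\<forall>H\<in>N. u \<noteq> center d H v"
  have u0: "u \<noteq> 0" using h by (auto simp: newhyps_def center_def)
  have ud: "u ^ d \<noteq> v j ^ d" if j: "j \<in> S" for j
  proof
    assume "u ^ d = v j ^ d"
    then obtain k where k: "k < d" "u = rootc d (int k) * v j" by (rule power_eq_imp_root[OF _ ConfD(1)[OF v j]])
    have "(a, j, k) \<in> N" using k j by (simp add: newhyps_def)
    moreover have "center d (a, j, k) v = u" using k j a_notin by (auto simp: center_def)
    ultimately show False using h by blast
  qed
  show "ext v u \<in> M"
  proof (rule ConfI)
    fix i assume "i \<in> S'"
    then show "ext v u i \<noteq> 0" using u0 ConfD(1)[OF v] by (auto simp: ext_def)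
  next
    fix i j assume "i \<in> S'" "j \<in> S'" "i \<noteq> j"
    then show "ext v u i ^ d \<noteq> ext v u j ^ d" using ud[of i] ud[of j] ConfD(3)[OF v, of i j] a_notin
      by (auto simp: ext_def eq_commute)
  qed (simp add: ext_def)
qed

lemma rad_pos:
  assumes "v \<in> C" "H \<in> N"
  shows "rad H v > 0"
  unfolding rad_def
proof (intro divide_pos_pos prod_pos ballI)
  fix H' assume "H' \<in> N - {H}"
  then have "center d H v \<noteq> center d H' v" using assms by (intro center_ne) auto
  then show "min 1 (norm (center d H v - center d H' v)) > 0" by simp
qed simp

lemma rad_le:
  assumes "H' \<in> N" "H' \<noteq> H"
  shows "2 * rad H v \<le> norm (center d H v - center d H' v)"
proof -
  let ?f = "\<lambda>H'. min 1 (norm (center d H v - center d H' v))"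
  have "2 * rad H v = ?f H' * (\<Prod>H'\<in>N - {H} - {H'}. ?f H')"
    unfolding rad_def using assms finite_newhyps[OF fin] by (subst prod.remove[of _ H']) auto
  also have "\<dots> \<le> ?f H' * 1" by (intro mult_left_mono prod_le_1) auto
  finally show ?thesis by simp
qed

lemma tube:
  assumes v: "v \<in> C" and H: "H \<in> N" and \<rho>: "\<rho> \<noteq> 0" "norm \<rho> < rad H v"
  shows "ext v (center d H v + \<rho>) \<in> M"
  unfolding ext_in_iff[OF v]
proof
  fix H' assume H': "H' \<in> N"
  show "center d H v + \<rho> \<noteq> center d H' v"
  proof (cases "H' = H")
    case False
    from rad_le[OF H' this, of v] \<rho>(2) rad_pos[OF v H]
    have "norm \<rho> < norm (center d H v - center d H' v)" by linarith
    then show ?thesis by (metis add_diff_cancel_left' less_irrefl norm_minus_commute)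
  qed (use \<rho> in simp)
qed

lemma continuous_rad: "continuous_on E (rad H)"
  unfolding rad_def by (intro continuous_intros continuous_on_min continuous_center) auto

lemma emb_bound:
  fixes g :: complex
  assumes v: "v \<in> C" and H: "H \<in> N"
  shows "norm (of_real (rad H v / (1 + norm g)) * g) < rad H v"
proof -
  have "0 < 1 + norm g" by (simp add: add_pos_nonneg)
  then have "norm g / (1 + norm g) < 1" by (simp add: divide_less_eq)
  then have "rad H v * (norm g / (1 + norm g)) < rad H v * 1" using rad_pos[OF v H] by (intro mult_strict_left_mono)
  moreover have "\<bar>rad H v / (1 + norm g)\<bar> = rad H v / (1 + norm g)"
    using rad_pos[OF v H] by (intro abs_of_nonneg divide_nonneg_nonneg) auto
  ultimately show ?thesis by (simp only: norm_mult norm_of_real) simp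
qed

lemma continuous_ext:
  assumes "continuous_on E f" "continuous_on E g"
  shows "continuous_on E (\<lambda>x. ext (f x) (g x))"
  unfolding ext_def
proof (rule continuous_on_productI)
  fix i show "continuous_on E (\<lambda>x. if i = a then g x else f x i)"
    using assms(2) continuous_on_coord[OF assms(1)] by (cases "i = a") auto
qed

lemma one_plus_norm_ne: "1 + norm (z::complex) \<noteq> 0"
proof -
  have "norm z \<ge> 0" by simp
  then show ?thesis by linarith
qed

lemma emb_maps:
  assumes H: "H \<in> N"
  shows "maps (C \<times> punctured) M (emb H)"
proof
  show "continuous_on (C \<times> punctured) (emb H)"
    unfolding emb_def case_prod_unfold using one_plus_norm_ne
    by (intro continuous_ext continuous_intros continuous_on_compose2[OF continuous_center[of UNIV]]
        continuous_on_compose2[OF continuous_rad[of UNIV]] continuous_on_fst[OF continuous_on_id] ballI) auto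
  show "emb H \<in> C \<times> punctured \<rightarrow> M"
  proof (rule Pi_I)
    fix p assume p: "p \<in> C \<times> punctured"
    obtain v g where vg: "p = (v, g)" by (cases p)
    then have v: "v \<in> C" and g: "g \<noteq> 0" using p by auto
    have "rad H v / (1 + norm g) \<noteq> 0" using rad_pos[OF v H] one_plus_norm_ne[of g] by simp
    then have "complex_of_real (rad H v / (1 + norm g)) \<noteq> 0" by (simp only: of_real_eq_0_iff not_False_eq_True)
    then have "of_real (rad H v / (1 + norm g)) * g \<noteq> 0" by (rule no_zero_divisors) (use g in simp)
    then show "emb H p \<in> M" unfolding vg emb_def prod.case by (rule tube[OF v H _ emb_bound[OF v H]])
  qed
qed

text \<open>The space in which the new coordinate is unrestricted. There any loop can be deformed to
  a loop in the section; \<open>M\<close> is the complement in \<open>T\<close> of the graphs of the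
  new centers.\<close>

definition T :: "(nat \<Rightarrow> complex) set" where
  "T = {w \<in> S' \<rightarrow>\<^sub>E UNIV. \<forall>i\<in>S. w i \<noteq> 0 \<and> (\<forall>j\<in>S. i \<noteq> j \<longrightarrow> w i ^ d \<noteq> w j ^ d)}"

lemma ext_T: "v \<in> C \<Longrightarrow> ext v u \<in> T"
  using ConfD(1,3)[of v d S] a_notin by (auto simp: T_def ext_def)

lemma rst_T: "w \<in> T \<Longrightarrow> rst w \<in> C"
  by (rule ConfI) (auto simp: T_def ins_def)

lemma ext_rst: "w \<in> S' \<rightarrow>\<^sub>E UNIV \<Longrightarrow> ext (rst w) (w a) = w"
  using a_notin by (auto simp: ext_def ins_def fun_eq_iff PiE_iff extensional_def)

lemma M_iff: "w \<in> M \<longleftrightarrow> w \<in> T \<and> (\<forall>H\<in>N. w a \<noteq> center d H w)"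
proof -
  have 1: "w \<in> T" if "w \<in> M"
    using ConfD[OF that] that by (auto simp: T_def PiE_iff extensional_def)
  have "w \<in> M \<longleftrightarrow> (\<forall>H\<in>N. w a \<noteq> center d H w)" if w: "w \<in> T"
  proof -
    have "w \<in> S' \<rightarrow>\<^sub>E UNIV" using w by (simp add: T_def)
    from ext_rst[OF this] ext_in_iff[OF rst_T[OF w], of "w a"]
    have "w \<in> M \<longleftrightarrow> (\<forall>H\<in>N. w a \<noteq> center d H (rst w))" by simp
    moreover have "center d H (rst w) = center d H w" if "H \<in> N" for H
      by (rule center_cong[OF that]) (auto simp: ins_def)
    ultimately show ?thesis by simp
  qed
  then show ?thesis using 1 by blast
qed

lemma M_sub_T: "M \<subseteq> T" using M_iff by blast

text \<open>Boxes with convex sides are closed under nonempty intersections and allow contraction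
  along segments. Smallness comes as an alternative: a box meets no new hyperplane or lies in the
  tube of a single one, and both properties pass to smaller boxes.\<close>

definition boxes :: "(nat \<Rightarrow> complex) set set" where
  "boxes = {U. \<exists>B. (\<forall>i\<in>S'. convex (B i)) \<and> (\<forall>i\<in>S'. open (B i)) \<and> U = PiE S' B \<and> U \<noteq> {} \<and> U \<subseteq> T \<and>
    (U \<subseteq> M \<or> (\<exists>H\<in>N. \<forall>w\<in>U. norm (w a - center d H w) < rad H w))}"

lemma boxesI:
  assumes "\<And>i. i \<in> S' \<Longrightarrow> convex (B i) \<and> open (B i)" "PiE S' B \<noteq> {}" "PiE S' B \<subseteq> T"
    "PiE S' B \<subseteq> M \<or> (\<exists>H\<in>N. \<forall>w\<in>PiE S' B. norm (w a - center d H w) < rad H w)"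
  shows "PiE S' B \<in> boxes"
  unfolding boxes_def mem_Collect_eq by (rule exI[of _ B]) (use assms in simp)

lemma boxesE:
  assumes "U \<in> boxes"
  shows "\<exists>B. (\<forall>i\<in>S'. convex (B i)) \<and> (\<forall>i\<in>S'. open (B i)) \<and> U = PiE S' B \<and> U \<noteq> {} \<and> U \<subseteq> T \<and>
    (U \<subseteq> M \<or> (\<exists>H\<in>N. \<forall>w\<in>U. norm (w a - center d H w) < rad H w))"
  using assms unfolding boxes_def mem_Collect_eq .

lemma box_inside:
  fixes z :: "nat \<Rightarrow> complex"
  assumes O: "open O'" "z \<in> O'" "z \<in> S' \<rightarrow>\<^sub>E UNIV"
  shows "\<exists>B. (\<forall>i\<in>S'. convex (B i) \<and> open (B i)) \<and> z \<in> PiE S' B \<and> PiE S' B \<subseteq> O'"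
proof -
  have "openin (product_topology (\<lambda>i. euclidean) UNIV) O'" using O(1) by (simp add: open_fun_def)
  from product_topology_open_contains_basis[OF this O(2)]
  obtain Y where Y: "z \<in> PiE UNIV Y" "\<And>i. open (Y i)" "PiE UNIV Y \<subseteq> O'" by auto
  have "\<exists>e>0. ball (z i) e \<subseteq> Y i" for i
  proof -
    have "z i \<in> Y i" using Y(1) by (auto simp: PiE_iff)
    then show ?thesis using Y(2)[of i] by (auto simp: open_contains_ball)
  qed
  then obtain e where e: "\<And>i. e i > 0" "\<And>i. ball (z i) (e i) \<subseteq> Y i" by metis
  show ?thesis
  proof (intro exI[of _ "\<lambda>i. ball (z i) (e i)"] conjI)
    show "z \<in> PiE S' (\<lambda>i. ball (z i) (e i))" using e(1) O(3) by (auto simp: PiE_iff)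
    show "PiE S' (\<lambda>i. ball (z i) (e i)) \<subseteq> O'"
    proof
      fix w assume w: "w \<in> PiE S' (\<lambda>i. ball (z i) (e i))"
      have "w i \<in> Y i" for i
      proof (cases "i \<in> S'")
        case True then show ?thesis using w e(2)[of i] by (auto simp: PiE_iff)
      next
        case False
        then have "w i = z i" using w O(3) by (auto simp: PiE_iff extensional_def)
        then show ?thesis using Y(1) by (auto simp: PiE_iff)
      qed
      then show "w \<in> O'" using Y(3) by auto
    qed
  qed auto
qed

lemma open_coordinates: "open {w :: nat \<Rightarrow> complex. \<forall>i\<in>S'. w i \<in> B i}" if "\<And>i. i \<in> S' \<Longrightarrow> open (B i)"
proof -
  have "open ((\<lambda>w. w i) -` B i)" if "i \<in> S'" for i
    by (rule open_vimage[OF \<open>\<And>i. i \<in> S' \<Longrightarrow> open (B i)\<close>[OF that] continuous_on_product_coordinates])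
  then have "open (\<Inter>i\<in>S'. (\<lambda>w. w i) -` B i)" using fin by (intro open_INT) auto
  moreover have "(\<Inter>i\<in>S'. (\<lambda>w. w i) -` B i) = {w. \<forall>i\<in>S'. w i \<in> B i}" by auto
  ultimately show ?thesis by simp
qed

lemma open_conds:
  "open {w :: nat \<Rightarrow> complex. \<forall>i\<in>S. w i \<noteq> 0 \<and> (\<forall>j\<in>S. i \<noteq> j \<longrightarrow> w i ^ d \<noteq> w j ^ d)}" (is "open ?O")
proof -
  have "?O = (\<Inter>i\<in>S. {w. w i \<noteq> 0}) \<inter> (\<Inter>i\<in>S. \<Inter>j\<in>S - {i}. {w. w i ^ d \<noteq> w j ^ d})" by auto
  moreover have "open {w :: nat \<Rightarrow> complex. w i \<noteq> 0}" "open {w :: nat \<Rightarrow> complex. w i ^ d \<noteq> w j ^ d}" for i j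
    by (intro open_Collect_neq continuous_intros continuous_on_coord_id)+
  ultimately show ?thesis using fin by (simp add: open_Int open_INT)
qed

text \<open>A point of \<open>T\<close> lies in \<open>M\<close>, or its new coordinate is the
  center of some \<open>H\<close>, where the radius is positive. Both alternatives persist in a
  neighbourhood.\<close>

lemma boxes_cover:
  assumes z: "z \<in> T"
  shows "\<exists>U\<in>boxes. z \<in> U \<and> openin (top_of_set T) U"
proof -
  let ?O = "{w :: nat \<Rightarrow> complex. \<forall>i\<in>S. w i \<noteq> 0 \<and> (\<forall>j\<in>S. i \<noteq> j \<longrightarrow> w i ^ d \<noteq> w j ^ d)}"
  have zP: "z \<in> S' \<rightarrow>\<^sub>E UNIV" and zO: "z \<in> ?O" using z by (auto simp: T_def)
  have PT: "w \<in> T" if "w \<in> PiE S' B" "w \<in> ?O" for w B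
  proof -
    have "w \<in> S' \<rightarrow>\<^sub>E UNIV" using that(1) by (auto simp: PiE_iff)
    then show ?thesis using that(2) unfolding T_def by blast
  qed
  obtain O' where O': "open O'" "z \<in> O'" "(\<forall>H\<in>N. \<forall>w\<in>O'. w a \<noteq> center d H w) \<or> (\<exists>H\<in>N. \<forall>w\<in>O'. norm (w a - center d H w) < rad H w)"
  proof (cases "z \<in> M")
    case True
    let ?O1 = "\<Inter>H\<in>N. {w :: nat \<Rightarrow> complex. w a \<noteq> center d H w}"
    have "open ?O1"
      using finite_newhyps[OF fin] by (intro open_INT) (auto intro!: open_Collect_neq continuous_center continuous_on_coord_id)
    moreover have "z \<in> ?O1" using True M_iff by blast
    ultimately show ?thesis by (intro that[of ?O1]) auto
  next
    case False
    then obtain H where H: "H \<in> N" "z a = center d H z" using z M_iff by blast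
    let ?O1 = "{w :: nat \<Rightarrow> complex. norm (w a - center d H w) < rad H w}"
    have "open ?O1" by (intro open_Collect_less continuous_intros continuous_center continuous_rad continuous_on_coord_id)
    moreover have "rad H z = rad H (rst z)" by (rule rad_cong[OF H(1)]) (auto simp: ins_def)
    then have "z \<in> ?O1" using H rad_pos[OF rst_T[OF z] H(1)] by simp
    ultimately show ?thesis using H(1) by (intro that[of ?O1]) auto
  qed
  have "open (?O \<inter> O')" using open_conds O'(1) by (rule open_Int)
  moreover have "z \<in> ?O \<inter> O'" using zO O'(2) by blast
  ultimately have "\<exists>B. (\<forall>i\<in>S'. convex (B i) \<and> open (B i)) \<and> z \<in> PiE S' B \<and> PiE S' B \<subseteq> ?O \<inter> O'"
    using zP by (rule box_inside)
  then obtain B where B: "\<And>i. i \<in> S' \<Longrightarrow> convex (B i) \<and> open (B i)" "z \<in> PiE S' B" "PiE S' B \<subseteq> ?O \<inter> O'"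
    by auto
  have sub: "PiE S' B \<subseteq> T"
  proof
    fix w assume w: "w \<in> PiE S' B"
    then have "w \<in> ?O" using B(3) by blast
    then show "w \<in> T" by (rule PT[OF w])
  qed
  have dich: "PiE S' B \<subseteq> M \<or> (\<exists>H\<in>N. \<forall>w\<in>PiE S' B. norm (w a - center d H w) < rad H w)"
    using O'(3)
  proof
    assume *: "\<forall>H\<in>N. \<forall>w\<in>O'. w a \<noteq> center d H w"
    have "PiE S' B \<subseteq> M"
    proof
      fix w assume w: "w \<in> PiE S' B"
      then have "w \<in> O'" "w \<in> T" using B(3) sub by blast+
      then show "w \<in> M" using * M_iff by simp
    qed
    then show ?thesis ..
  next
    assume "\<exists>H\<in>N. \<forall>w\<in>O'. norm (w a - center d H w) < rad H w"
    then obtain H where "H \<in> N" "\<forall>w\<in>O'. norm (w a - center d H w) < rad H w" ..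
    then have "\<forall>w\<in>PiE S' B. norm (w a - center d H w) < rad H w" using B(3) by (intro ballI) (elim bspec, blast)
    then show ?thesis using \<open>H \<in> N\<close> by (intro disjI2 bexI[of _ H])
  qed
  have "PiE S' B \<noteq> {}" using B(2) by auto
  from boxesI[OF B(1) this sub dich] have "PiE S' B \<in> boxes" .
  moreover have "openin (top_of_set T) (PiE S' B)"
  proof -
    have "PiE S' B = T \<inter> {w. \<forall>i\<in>S'. w i \<in> B i}"
      using sub by (auto simp: T_def PiE_iff extensional_def)
    then show ?thesis using open_coordinates[of B] B(1) by (simp add: openin_open_Int)
  qed
  ultimately show ?thesis using B(2) by (intro bexI[of _ "PiE S' B"] conjI)
qed

lemma boxes_inter:
  assumes "U \<in> boxes" "V \<in> boxes" "U \<inter> V \<noteq> {}"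
  shows "U \<inter> V \<in> boxes"
proof -
  obtain B where B0: "\<forall>i\<in>S'. convex (B i)" "\<forall>i\<in>S'. open (B i)" "U = PiE S' B" "U \<noteq> {}" "U \<subseteq> T"
    "U \<subseteq> M \<or> (\<exists>H\<in>N. \<forall>w\<in>U. norm (w a - center d H w) < rad H w)"
    using boxesE[OF assms(1)] by (elim exE conjE) (rule that)
  note B = B0(1,2)[rule_format] B0(3-6)
  obtain B' where B': "\<And>i. i \<in> S' \<Longrightarrow> convex (B' i)" "\<And>i. i \<in> S' \<Longrightarrow> open (B' i)" "V = PiE S' B'"
    using boxesE[OF assms(2)] by auto
  have e: "U \<inter> V = PiE S' (\<lambda>i. B i \<inter> B' i)" unfolding B(3) B'(3) by (rule PiE_Int)
  have "PiE S' (\<lambda>i. B i \<inter> B' i) \<in> boxes"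
  proof (rule boxesI)
    show "convex (B i \<inter> B' i) \<and> open (B i \<inter> B' i)" if "i \<in> S'" for i
      using B(1,2)[OF that] B'(1,2)[OF that] by (auto intro: convex_Int open_Int)
    show "PiE S' (\<lambda>i. B i \<inter> B' i) \<noteq> {}" using assms(3) e by simp
    show "PiE S' (\<lambda>i. B i \<inter> B' i) \<subseteq> T" using B(5) unfolding e[symmetric] by auto
    show "PiE S' (\<lambda>i. B i \<inter> B' i) \<subseteq> M \<or> (\<exists>H\<in>N. \<forall>w\<in>PiE S' (\<lambda>i. B i \<inter> B' i). norm (w a - center d H w) < rad H w)"
      using B(6) unfolding e[symmetric]
    proof
      assume "\<exists>H\<in>N. \<forall>w\<in>U. norm (w a - center d H w) < rad H w"
      then obtain H where "H \<in> N" "\<forall>w\<in>U. norm (w a - center d H w) < rad H w" ..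
      then show "U \<inter> V \<subseteq> M \<or> (\<exists>H\<in>N. \<forall>w\<in>U \<inter> V. norm (w a - center d H w) < rad H w)"
        by (intro disjI2 bexI[of _ H]) simp_all
    qed auto
  qed
  then show ?thesis unfolding e .
qed

definition seg_pt :: "real \<Rightarrow> (nat \<Rightarrow> complex) \<Rightarrow> (nat \<Rightarrow> complex) \<Rightarrow> nat \<Rightarrow> complex" where
  "seg_pt s v w = (\<lambda>i\<in>S'. of_real (1 - s) * v i + of_real s * w i)"

lemma seg_pt_box:
  assumes "\<And>i. i \<in> S' \<Longrightarrow> convex (B i)" "v \<in> PiE S' B" "w \<in> PiE S' B" "s \<in> {0..1}"
  shows "seg_pt s v w \<in> PiE S' B"
proof
  fix i assume i: "i \<in> S'"
  have "(1 - s) *\<^sub>R v i + s *\<^sub>R w i \<in> B i"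
    using assms i by (intro convexD_alt) auto
  then show "seg_pt s v w i \<in> B i" using i by (simp add: seg_pt_def scaleR_conv_of_real)
qed (simp add: seg_pt_def)

lemma seg_pt_ends: "v \<in> S' \<rightarrow>\<^sub>E UNIV \<Longrightarrow> seg_pt 0 v w = v" "w \<in> S' \<rightarrow>\<^sub>E UNIV \<Longrightarrow> seg_pt 1 v w = w"
  by (auto simp: seg_pt_def fun_eq_iff PiE_iff extensional_def)

lemma seg_pt_path: "path (\<lambda>s. seg_pt s v w)"
  unfolding path_def seg_pt_def
  by (intro continuous_on_productI continuous_intros)

lemma center_seg_pt:
  assumes "H \<in> N"
  shows "center d H (seg_pt s v w) = of_real (1 - s) * center d H v + of_real s * center d H w"
  using assms by (rule newhypsE) (auto simp: center_def seg_pt_def algebra_simps)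

text \<open>Inside the tube of \<open>H\<close> the other centers are too far away to be met, so
  only \<open>H\<close> itself has to be avoided.\<close>

lemma tube_in_M:
  assumes U: "U \<subseteq> T" and H: "H \<in> N" "\<And>w. w \<in> U \<Longrightarrow> norm (w a - center d H w) < rad H w"
  shows "w \<in> U \<Longrightarrow> w \<in> M \<longleftrightarrow> w a \<noteq> center d H w"
proof
  assume w: "w \<in> U" and ne: "w a \<noteq> center d H w"
  have wT: "w \<in> T" using w U by blast
  have c: "center d H w = center d H (rst w)" "rad H w = rad H (rst w)"
    by (rule center_cong[OF H(1)] rad_cong[OF H(1)]; simp add: ins_def)+
  have "ext (rst w) (center d H (rst w) + (w a - center d H w)) \<in> M"
    using H(2)[OF w] ne c by (intro tube[OF rst_T[OF wT] H(1)]) auto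
  moreover have "ext (rst w) (w a) = w" using wT by (intro ext_rst) (simp add: T_def)
  ultimately show "w \<in> M" using c by simp
qed (use M_iff H in blast)

text \<open>In a tube the removed set is the zero set of the complex-valued \<open>f\<close>, which
  is affine along segments. The segment from \<open>v\<close> to \<open>c\<close> avoids it unless
  \<open>f c\<close> is a real multiple of \<open>f v\<close>, so two points can be joined through a
  third one in general position.\<close>

lemma boxes_connected:
  assumes "U \<in> boxes"
  shows "U \<inter> M \<noteq> {}" "path_connected (U \<inter> M)"
proof -
  obtain B where B0: "\<forall>i\<in>S'. convex (B i)" "\<forall>i\<in>S'. open (B i)" "U = PiE S' B" "U \<noteq> {}" "U \<subseteq> T"
    "U \<subseteq> M \<or> (\<exists>H\<in>N. \<forall>w\<in>U. norm (w a - center d H w) < rad H w)"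
    using boxesE[OF assms] by (elim exE conjE) (rule that)
  note B = B0(1,2)[rule_format] B0(3-6)
  have UP: "w \<in> S' \<rightarrow>\<^sub>E UNIV" if "w \<in> U" for w using that B(3) by (auto simp: PiE_iff)
  have segp: "path_component (U \<inter> M) v w" if "v \<in> U" "w \<in> U" "\<And>s. s \<in> {0..1} \<Longrightarrow> seg_pt s v w \<in> M" for v w
    unfolding path_component_def
  proof (intro exI[of _ "\<lambda>s. seg_pt s v w"] conjI seg_pt_path)
    show "path_image (\<lambda>s. seg_pt s v w) \<subseteq> U \<inter> M"
      using that seg_pt_box[of B v w] B(1) unfolding path_image_def B(3) by blast
  qed (use seg_pt_ends UP that in \<open>auto simp: pathstart_def pathfinish_def\<close>)
  from B(6) have "U \<inter> M \<noteq> {} \<and> path_connected (U \<inter> M)"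
  proof
    assume sub: "U \<subseteq> M"
    have "seg_pt s v w \<in> M" if "v \<in> U" "w \<in> U" "s \<in> {0..1}" for s v w
      using seg_pt_box[of B v w s] B(1,3) that sub by blast
    then have "path_component (U \<inter> M) v w" if "v \<in> U" "w \<in> U" for v w using segp that by blast
    then show ?thesis using B(4) sub by (auto simp: path_connected_component)
  next
    assume "\<exists>H\<in>N. \<forall>w\<in>U. norm (w a - center d H w) < rad H w"
    then obtain H where H: "H \<in> N" "\<And>w. w \<in> U \<Longrightarrow> norm (w a - center d H w) < rad H w" by blast
    note inM = tube_in_M[OF B(5) H]
    define f where "f = (\<lambda>w. w a - center d H w)"
    have fseg: "f (seg_pt s v w) = of_real (1 - s) * f v + of_real s * f w" for s v w
      unfolding f_def center_seg_pt[OF H(1)] by (simp add: seg_pt_def algebra_simps)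
    have inM': "w \<in> U \<Longrightarrow> w \<in> M \<longleftrightarrow> f w \<noteq> 0" for w using inM[of w] by (simp add: f_def)
    \<comment> \<open>Varying only the new coordinate, \<open>f\<close> runs through a nonempty open
      set, which two real lines of measure zero cannot cover.\<close>
    have avoid: "\<exists>c\<in>U. f c \<notin> span {p} \<union> span {q}" for p q :: complex
    proof -
      obtain w where w: "w \<in> U" using B(4) by blast
      have fi: "f (ext w u) = u - center d H w" for u
      proof -
        have "center d H (ext w u) = center d H w" by (rule center_cong[OF H(1)]) (use a_notin in \<open>auto simp: ext_def\<close>)
        then show ?thesis by (simp add: f_def ext_def)
      qed
      let ?V = "(\<lambda>u. u - center d H w) ` B a"
      have "open ?V" using B(2)[of a] by (auto intro: open_translation_subtract)
      moreover have "?V \<noteq> {}" using w B(3) by auto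
      ultimately have "\<not> negligible ?V" using open_not_negligible by blast
      moreover have "negligible (span {p} \<union> span {q})"
      proof -
        have "dim (span {z :: complex}) < DIM(complex)" for z
        proof -
          have "dim (span {z}) \<le> card {z}" unfolding dim_span by (rule dim_le_card') simp
          then show ?thesis by simp
        qed
        then show ?thesis by (intro negligible_Un negligible_lowdim)
      qed
      ultimately have "\<not> ?V \<subseteq> span {p} \<union> span {q}" using negligible_subset by blast
      then obtain u where u: "u \<in> B a" "u - center d H w \<notin> span {p} \<union> span {q}" by blast
      have "ext w u \<in> U" using w u(1) unfolding B(3) by (auto simp: ext_def PiE_iff)
      then show ?thesis using u(2) fi by (intro bexI[of _ "ext w u"]) auto
    qed
    have conn: "path_component (U \<inter> M) v c" if v: "v \<in> U" "v \<in> M" and c: "c \<in> U" "f c \<notin> span {f v}" for v c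
    proof (rule segp[OF v(1) c(1)])
      fix s :: real assume s: "s \<in> {0..1}"
      have fv: "f v \<noteq> 0" using v inM' by blast
      have "f (seg_pt s v c) \<noteq> 0"
      proof
        assume e: "f (seg_pt s v c) = 0"
        show False
        proof (cases "s = 0")
          case True then show False using e fv by (simp add: fseg)
        next
          case False
          have "of_real s * f c = - (of_real (1 - s) * f v)" using e unfolding fseg by (simp add: eq_neg_iff_add_eq_0 add.commute)
          moreover have "f c = (of_real s * f c) / of_real s" using False by simp
          ultimately have "f c = - (of_real (1 - s) * f v) / of_real s" by (simp only:)
          also have "\<dots> = ((s - 1) / s) *\<^sub>R f v" using False by (simp add: scaleR_conv_of_real minus_divide_left algebra_simps)
          finally have "f c = ((s - 1) / s) *\<^sub>R f v" .
          then have "f c \<in> span {f v}" by (simp add: span_base span_scale)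
          then show False using c by blast
        qed
      qed
      moreover have "seg_pt s v c \<in> U" using seg_pt_box[of B v c s] B(1,3) v c s by blast
      ultimately show "seg_pt s v c \<in> M" using inM' by blast
    qed
    have "path_component (U \<inter> M) v w" if "v \<in> U \<inter> M" "w \<in> U \<inter> M" for v w
    proof -
      obtain c where c: "c \<in> U" "f c \<notin> span {f v} \<union> span {f w}" using avoid by blast
      then have "path_component (U \<inter> M) v c" "path_component (U \<inter> M) w c" using that by (auto intro!: conn)
      then show ?thesis by (blast intro: path_component_sym path_component_trans)
    qed
    moreover have "U \<inter> M \<noteq> {}"
    proof -
      obtain c where c: "c \<in> U" "f c \<notin> span {0} \<union> span {0}" using avoid by blast
      then have "f c \<noteq> 0" by (metis UnI1 span_zero)
      then show ?thesis using c inM' by blast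
    qed
    ultimately show ?thesis by (auto simp: path_connected_component)
  qed
  then show "U \<inter> M \<noteq> {}" "path_connected (U \<inter> M)" by auto
qed

end

section \<open>Generation by the section and the new meridians\<close>

context new_point begin

lemma emb_point_maps:
  assumes "H \<in> N" "y \<in> C"
  shows "maps punctured M (\<lambda>g. emb H (y, g))"
proof -
  have e: "continuous_on (C \<times> punctured) (emb H)" "emb H \<in> C \<times> punctured \<rightarrow> M" using emb_maps[OF assms(1)] by auto
  have "continuous_on punctured (\<lambda>g. emb H (y, g))"
    by (rule continuous_on_compose2[OF e(1) continuous_on_Pair[OF continuous_on_const continuous_on_id]]) (use assms in auto)
  then show ?thesis using e(2) assms by auto
qed

lemma emb_point_homotopic:
  assumes H: "H \<in> N" and y: "y \<in> C" "y' \<in> C"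
  shows "homotopic_maps punctured M (\<lambda>g. emb H (y, g)) (\<lambda>g. emb H (y', g))"
proof -
  have e: "continuous_on (C \<times> punctured) (emb H)" "emb H \<in> C \<times> punctured \<rightarrow> M" using emb_maps[OF H] by auto
  obtain q where q: "path q" "path_image q \<subseteq> C" "pathstart q = y" "pathfinish q = y'"
    using path_connected_Conf[OF fin] y unfolding path_connected_def by blast
  have qC: "q s \<in> C" if "s \<in> {0..1}" for s using q(2) that by (auto simp: path_image_def)
  have qc: "continuous_on ({0..1} \<times> punctured) (\<lambda>x. q (fst x))"
    by (rule continuous_on_compose2[OF q(1)[unfolded path_def] continuous_on_fst[OF continuous_on_id]]) auto
  show ?thesis
  proof (rule homotopic_mapsI[of _ "\<lambda>x. emb H (q (fst x), snd x)"])
    show "continuous_on ({0..1} \<times> punctured) (\<lambda>x. emb H (q (fst x), snd x))"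
      by (rule continuous_on_compose2[OF e(1) continuous_on_Pair[OF qc continuous_on_snd[OF continuous_on_id]]])
        (use qC in auto)
  qed (use e(2) qC q(3,4) in \<open>auto simp: pathstart_def pathfinish_def\<close>)
qed

definition mix :: "real \<Rightarrow> (nat \<Rightarrow> complex) \<Rightarrow> (nat \<Rightarrow> complex) \<Rightarrow> nat \<Rightarrow> complex" where
  "mix s v w = (\<lambda>i\<in>S. of_real (1 - s) * v i + of_real s * w i)"

lemma mix_box:
  assumes "\<And>i. i \<in> S \<Longrightarrow> convex (B i)" "v \<in> PiE S B" "w \<in> PiE S B" "s \<in> {0..1}"
  shows "mix s v w \<in> PiE S B"
proof
  fix i assume i: "i \<in> S"
  have "(1 - s) *\<^sub>R v i + s *\<^sub>R w i \<in> B i"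
    using assms i by (intro convexD_alt) auto
  then show "mix s v w i \<in> B i" using i by (simp add: mix_def scaleR_conv_of_real)
qed (simp add: mix_def)

text \<open>This inverts the parametrization of the tube: if \<open>z = r * g / (1 + |g|)\<close>
  then \<open>r - |z| = r / (1 + |g|)\<close>, and so \<open>g = z / (r - |z|)\<close>.\<close>

lemma tube_coordinates:
  assumes H: "H \<in> N" and w: "w \<in> M" "norm (w a - center d H w) < rad H w"
  defines "g \<equiv> (w a - center d H w) / of_real (rad H w - norm (w a - center d H w))"
  shows "emb H (rst w, g) = w" "g \<noteq> 0"
proof -
  have wT: "w \<in> T" and ne: "w a \<noteq> center d H w" using w(1) H M_iff by blast+
  have c: "center d H (rst w) = center d H w" "rad H (rst w) = rad H w"
    by (rule center_cong[OF H] rad_cong[OF H]; simp add: ins_def)+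
  let ?z = "w a - center d H w"
  let ?r = "rad H w" and ?n = "norm (w a - center d H w)"
  have n: "?n > 0" "?r - ?n > 0" using ne w(2) by auto
  then have r: "?r \<noteq> 0" by linarith
  have "norm g = ?n / (?r - ?n)" using n unfolding g_def by (simp only: norm_divide norm_of_real)
  then have "1 + norm g = ?r / (?r - ?n)" using n by (simp add: field_simps)
  then have "?r / (1 + norm g) = ?r - ?n" using n r by simp
  then have "of_real (?r / (1 + norm g)) * g = of_real (?r - ?n) * (?z / of_real (?r - ?n))" unfolding g_def by simp
  also have "\<dots> = ?z"
  proof -
    have "complex_of_real (?r - ?n) \<noteq> 0" using n by (simp only: of_real_eq_0_iff)
    then show ?thesis by (metis nonzero_mult_div_cancel_left times_divide_eq_right)
  qed
  finally have "emb H (rst w, g) = ext (rst w) (w a)" unfolding emb_def prod.case c by simp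
  also have "\<dots> = w" using wT by (intro ext_rst) (simp add: T_def)
  finally show "emb H (rst w, g) = w" .
  have "complex_of_real (?r - ?n) \<noteq> 0" using n by (simp only: of_real_eq_0_iff)
  then show "g \<noteq> 0" using ne unfolding g_def by (simp only: divide_eq_0_iff right_minus_eq) simp
qed

text \<open>The point to prove is triviality on small loops. A loop in a box inside \<open>M\<close>
  contracts; a loop in a tube is freely homotopic to one in a single fibre, a punctured plane
  generated by the meridian. One base point \<open>y\<close> for each \<open>H\<close> suffices,
  since meridians over different base points are freely homotopic.\<close>

lemma path_functor_coverI:
  fixes Q :: "('q, 'm) monoid_scheme"
  assumes PF: "path_functor M Q \<Phi>"
    and mer: "\<And>H. H \<in> N \<Longrightarrow> \<exists>y\<in>C. \<Phi> (ppush M (\<lambda>g. emb H (y, g)) circ) = \<one>\<^bsub>Q\<^esub>"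
  shows "path_functor_cover M Q \<Phi> T boxes"
proof -
  interpret path_functor M Q \<Phi> by (rule PF)
  have punct: "\<Phi> (ppush M (\<lambda>g. emb H (y, g)) B) = \<one>\<^bsub>Q\<^esub>"
    if H: "H \<in> N" and y: "y \<in> C" and B: "B \<in> path_classes punctured" "psrc B = ptgt B" for H y B
  proof (rule functor_punctured[OF emb_point_maps[OF H y] _ B])
    obtain y' where y': "y' \<in> C" "\<Phi> (ppush M (\<lambda>g. emb H (y', g)) circ) = \<one>\<^bsub>Q\<^esub>" using mer[OF H] by blast
    show "\<Phi> (ppush M (\<lambda>g. emb H (y, g)) circ) = \<one>\<^bsub>Q\<^esub>"
      by (rule functor_free_homotopy_one[OF emb_point_homotopic[OF H y y'(1)] circ_simps(1) _ y'(2)]) (simp add: circ_simps)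
  qed
  show ?thesis
  proof (intro path_functor_cover.intro PF path_functor_cover_axioms.intro)
    fix U p assume U: "U \<in> boxes" and p: "p \<in> paths_in (U \<inter> M)" and loop: "pathfinish p = pathstart p"
    have pM: "p \<in> paths_in M" using p by auto
    have pU: "p t \<in> U" "p t \<in> M" if "t \<in> {0..1}" for t using p that by (auto simp: path_image_def)
    have cp: "continuous_on {0..1} p" using p by (simp add: path_def)
    obtain B where B0: "\<forall>i\<in>S'. convex (B i)" "\<forall>i\<in>S'. open (B i)" "U = PiE S' B" "U \<noteq> {}" "U \<subseteq> T"
      "U \<subseteq> M \<or> (\<exists>H\<in>N. \<forall>w\<in>U. norm (w a - center d H w) < rad H w)"
      using boxesE[OF U] by (elim exE conjE) (rule that)
    have UP: "w \<in> S' \<rightarrow>\<^sub>E UNIV" if "w \<in> U" for w using that B0(3) by (auto simp: PiE_iff)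
    from B0(6) show "\<Psi> p = \<one>\<^bsub>Q\<^esub>"
    proof
      assume UM: "U \<subseteq> M"
      let ?A = "homotopy_class U p" and ?z = "p 0"
      have pU': "p \<in> paths_in U" using p by auto
      have A: "?A \<in> path_classes U" "psrc ?A = ptgt ?A" using pU' loop by auto
      have zU: "?z \<in> U" using pU(1)[of 0] by simp
      \<comment> \<open>Contraction of the convex box along segments to the starting point of the
        loop.\<close>
      have "homotopic_maps U M (\<lambda>w. w) (\<lambda>_. ?z)"
      proof (rule homotopic_mapsI[of _ "\<lambda>x. seg_pt (fst x) (snd x) ?z"])
        show "continuous_on ({0..1} \<times> U) (\<lambda>x. seg_pt (fst x) (snd x) ?z)"
          unfolding seg_pt_def
          by (intro continuous_on_productI continuous_intros continuous_on_coord[OF continuous_on_snd[OF continuous_on_id]]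
              continuous_on_fst[OF continuous_on_id])
        show "seg_pt (fst (s, w)) (snd (s, w)) ?z \<in> M" if "s \<in> {0..1}" "w \<in> U" for s w
          using seg_pt_box[of B w ?z s] B0(1,3) that zU UM by auto
        show "seg_pt (fst (0, w)) (snd (0, w)) ?z = w" "seg_pt (fst (1, w)) (snd (1, w)) ?z = ?z" if "w \<in> U" for w
          using seg_pt_ends(1)[OF UP[OF that]] seg_pt_ends(2)[OF UP[OF zU]] by simp_all
      qed
      moreover have "\<Phi> (ppush M (\<lambda>_. ?z) ?A) = \<one>\<^bsub>Q\<^esub>"
      proof -
        have "?z \<in> M" using zU UM by blast
        then have "ppush M (\<lambda>_. ?z) ?A = pid M ?z"
          using ppush_class[OF pU', of "\<lambda>_. ?z" M] by (simp add: comp_def)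
        then show ?thesis using functor_pid[OF \<open>?z \<in> M\<close>] by simp
      qed
      ultimately have "\<Phi> (ppush M (\<lambda>w. w) ?A) = \<one>\<^bsub>Q\<^esub>" by (rule functor_free_homotopy_one[OF _ A])
      moreover have "ppush M (\<lambda>w. w) ?A = homotopy_class M p"
        using ppush_class[OF pU', of "\<lambda>w. w" M] UM by (auto simp: comp_def)
      ultimately show ?thesis by simp
    next
      assume "\<exists>H\<in>N. \<forall>w\<in>U. norm (w a - center d H w) < rad H w"
      then obtain H where H: "H \<in> N" and near: "\<forall>w\<in>U. norm (w a - center d H w) < rad H w" ..
      \<comment> \<open>The shadow of the box on the old coordinates. It is convex, so the base
        coordinate of the loop can be contracted while the tube coordinate is kept.\<close>
      define W where "W = PiE S B"
      have WC: "W \<subseteq> C"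
      proof
        fix y assume y: "y \<in> W"
        obtain w where w: "w \<in> U" using B0(4) by blast
        have yP: "y \<in> S \<rightarrow>\<^sub>E UNIV" using y by (auto simp: W_def PiE_iff)
        have "ext y (w a) \<in> U" using y w unfolding B0(3) W_def by (auto simp: ext_def PiE_iff)
        then have "rst (ext y (w a)) \<in> C" using B0(5) by (intro rst_T) auto
        moreover have "rst (ext y (w a)) = y" using yP a_notin by (auto simp: ins_def ext_def fun_eq_iff PiE_iff extensional_def)
        ultimately show "y \<in> C" by simp
      qed
      have e: "continuous_on (C \<times> punctured) (emb H)" "emb H \<in> C \<times> punctured \<rightarrow> M" using emb_maps[OF H] by auto
      let ?E = "W \<times> punctured"
      have eW: "continuous_on ?E (emb H)" "emb H \<in> ?E \<rightarrow> M"
        using WC e by (auto intro: continuous_on_subset[OF e(1)])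
      define z where "z = (\<lambda>t. p t a - center d H (p t))"
      \<comment> \<open>The loop written in the coordinates of the tube.\<close>
      define P where "P = (\<lambda>t. (rst (p t), z t / of_real (rad H (p t) - norm (z t))))"
      have tc: "emb H (P t) = p t" "snd (P t) \<noteq> 0" if "t \<in> {0..1}" for t
        using tube_coordinates[OF H pU(2)[OF that]] near pU(1)[OF that] by (auto simp: P_def z_def)
      have PW: "P t \<in> ?E" if "t \<in> {0..1}" for t
        using tc(2)[OF that] pU(1)[OF that] unfolding B0(3) by (auto simp: P_def W_def ins_def PiE_iff)
      have "path P"
        unfolding path_def P_def
      proof (intro continuous_on_Pair continuous_on_divide)
        show "continuous_on {0..1} (\<lambda>t. rst (p t))"
          by (rule continuous_on_compose2[OF conjunct1[OF ins_maps[OF fin subset_refl, of S']] cp]) (use pU in auto)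
        show cz: "continuous_on {0..1} z"
          unfolding z_def by (intro continuous_intros continuous_on_coord[OF cp] continuous_on_compose2[OF continuous_center[of UNIV] cp]) auto
        show "continuous_on {0..1} (\<lambda>t. complex_of_real (rad H (p t) - cmod (z t)))"
          by (intro continuous_intros cz continuous_on_compose2[OF continuous_rad[of UNIV] cp]) auto
        show "\<forall>t\<in>{0..1}. complex_of_real (rad H (p t) - cmod (z t)) \<noteq> 0"
        proof
          fix t :: real assume "t \<in> {0..1}"
          then have "rad H (p t) - norm (z t) \<noteq> 0" using near pU(1)[of t] by (auto simp: z_def)
          then show "complex_of_real (rad H (p t) - cmod (z t)) \<noteq> 0" by (simp only: of_real_eq_0_iff not_False_eq_True)
        qed
      qed
      then have PE: "P \<in> paths_in ?E" using PW unfolding path_image_def by blast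
      let ?A = "homotopy_class ?E P"
      have ends: "pathfinish P = pathstart P" using loop by (simp add: P_def z_def pathstart_def pathfinish_def)
      have A: "?A \<in> path_classes ?E" "psrc ?A = ptgt ?A"
        using homotopy_class_in[OF PE] psrc_class[OF PE] ptgt_class[OF PE] ends by simp_all
      have "ppush M (emb H) ?A = homotopy_class M (emb H \<circ> P)" by (rule ppush_class[OF PE eW])
      also have "\<dots> = homotopy_class M p"
      proof (rule homotopy_class_eqI, rule homotopic_paths_sym, rule homotopic_paths_eq)
        show "path p" "path_image p \<subseteq> M" using pM by auto
      qed (simp add: tc)
      finally have pA: "ppush M (emb H) ?A = homotopy_class M p" .
      let ?y = "fst (P 0)"
      have y: "?y \<in> W" using PW[of 0] by auto
      then have yC: "?y \<in> C" using WC by blast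
      have "homotopic_maps ?E M (emb H) ((\<lambda>g. emb H (?y, g)) \<circ> snd)"
      proof (rule homotopic_mapsI[of _ "\<lambda>x. emb H (mix (fst x) (fst (snd x)) ?y, snd (snd x))"])
        have mW: "mix s v ?y \<in> W" if "s \<in> {0..1}" "v \<in> W" for s v
          using mix_box[of B v ?y s] B0(1) that y unfolding W_def by auto
        have cm: "continuous_on ({0..1} \<times> ?E) (\<lambda>x. mix (fst x) (fst (snd x)) ?y)"
          unfolding mix_def
          by (intro continuous_on_productI continuous_intros continuous_on_coord[OF continuous_on_fst[OF continuous_on_snd[OF continuous_on_id]]]
              continuous_on_fst[OF continuous_on_id])
        show "continuous_on ({0..1} \<times> ?E) (\<lambda>x. emb H (mix (fst x) (fst (snd x)) ?y, snd (snd x)))"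
          by (rule continuous_on_compose2[OF eW(1)
                continuous_on_Pair[OF cm continuous_on_snd[OF continuous_on_snd[OF continuous_on_id]]]])
            (use mW in auto)
        show "emb H (mix (fst (s, x)) (fst (snd (s, x))) ?y, snd (snd (s, x))) \<in> M" if "s \<in> {0..1}" "x \<in> ?E" for s x
          using eW(2) mW that by auto
        have mix_ends: "mix 0 v w = v" "mix 1 v w = w" if "v \<in> W" "w \<in> W" for v w
          using that by (auto simp: mix_def W_def fun_eq_iff PiE_iff extensional_def)
        show "emb H (mix (fst (0, x)) (fst (snd (0, x))) ?y, snd (snd (0, x))) = emb H x"
          "emb H (mix (fst (1, x)) (fst (snd (1, x))) ?y, snd (snd (1, x))) = ((\<lambda>g. emb H (?y, g)) \<circ> snd) x" if "x \<in> ?E" for x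
          using that mix_ends y by auto
      qed
      moreover have "\<Phi> (ppush M ((\<lambda>g. emb H (?y, g)) \<circ> snd) ?A) = \<one>\<^bsub>Q\<^esub>"
      proof -
        have sn: "continuous_on ?E snd" "snd \<in> ?E \<rightarrow> punctured" using continuous_on_snd[OF continuous_on_id] by auto
        have em: "continuous_on punctured (\<lambda>g. emb H (?y, g))" "(\<lambda>g. emb H (?y, g)) \<in> punctured \<rightarrow> M"
          using emb_point_maps[OF H yC] by auto
        have "ppush M ((\<lambda>g. emb H (?y, g)) \<circ> snd) ?A = ppush M (\<lambda>g. emb H (?y, g)) (ppush punctured snd ?A)"
          by (rule ppush_ppush[OF A(1) sn em, symmetric])
        then show ?thesis using punct[OF H yC ppush_simps(1)[OF A(1) sn]] ppush_simps(2,3)[OF A(1) sn] A(2) by simp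
      qed
      ultimately have "\<Phi> (ppush M (emb H) ?A) = \<one>\<^bsub>Q\<^esub>" by (rule functor_free_homotopy_one[OF _ A])
      then show ?thesis using pA by simp
    qed
  qed (use boxes_cover boxes_inter boxes_connected in auto)
qed

text \<open>As \<open>K\<close> contains the derived subgroup it is normal, and the quotient map
  extends to a path functor that kills the meridians. In \<open>T\<close> every loop is freely
  homotopic to the section over its restriction, so \<open>loops_conjugate\<close> makes its class
  conjugate to a trivial one.\<close>

lemma generated_by_section_and_meridians:
  assumes x: "x \<in> M" and K: "subgroup K (fundamental_group M x)"
    and der: "lower_central (fundamental_group M x) 2 \<subseteq> K"
    and \<gamma>: "\<gamma> \<in> paths_between M x (\<iota> (rst x))"
    and sec: "\<And>B. B \<in> carrier (fundamental_group C (rst x)) \<Longrightarrow> fundamental_group_map M \<gamma> \<iota> B \<in> K"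
    and mer: "\<And>H. H \<in> N \<Longrightarrow> \<exists>D y. y \<in> C \<and> D \<in> path_classes M \<and> psrc D = x \<and> ptgt D = emb H (y, 1) \<and>
      pmul M D (pmul M (ppush M (\<lambda>g. emb H (y, g)) circ) (pinv M D)) \<in> K"
  shows "K = carrier (fundamental_group M x)"
proof -
  let ?P = "fundamental_group M x"
  interpret P: plain_group ?P using group_fundamental_group[OF x] by (simp add: plain_group_def)
  have nK: "K \<lhd> ?P" by (rule P.normal_of_derived_subset[OF K der])
  define Q where "Q = ?P Mod K"
  have gQ: "group Q" unfolding Q_def by (rule normal.factorgroup_is_group[OF nK])
  have pcM: "path_connected M" using fin by (intro path_connected_Conf) auto
  define c where "c = (\<lambda>y. homotopy_class M (SOME \<gamma>. \<gamma> \<in> paths_between M x y))"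
  have c: "c y \<in> path_classes M" "psrc (c y) = x" "ptgt (c y) = y" if "y \<in> M" for y
    using paths_between_class[OF paths_between_some[OF pcM x that]] by (simp_all add: c_def)
  \<comment> \<open>Chosen paths from \<open>x\<close> close up an arbitrary path to a loop at
    \<open>x\<close>. At inner endpoints they cancel, which makes \<open>L\<close>
    multiplicative.\<close>
  define L where "L = (\<lambda>A. pmul M (c (psrc A)) (pmul M A (pinv M (c (ptgt A)))))"
  have L: "L A \<in> carrier ?P" if "A \<in> path_classes M" for A
    using that c[OF psrc_in(1)[OF that]] c[OF psrc_in(2)[OF that]] by (simp add: L_def fundamental_group_simps)
  define \<Phi> where "\<Phi> = (\<lambda>A. K #>\<^bsub>?P\<^esub> L A)"
  have PF: "path_functor M Q \<Phi>"
  proof (intro path_functor.intro gQ)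
    show "\<Phi> A \<in> carrier Q" if "A \<in> path_classes M" for A
      using L[OF that] unfolding Q_def \<Phi>_def FactGroup_def RCOSETS_def by auto
    show "\<Phi> (pmul M A B) = \<Phi> A \<otimes>\<^bsub>Q\<^esub> \<Phi> B" if AB: "A \<in> path_classes M" "B \<in> path_classes M" "ptgt A = psrc B" for A B
    proof -
      have "L (pmul M A B) = L A \<otimes>\<^bsub>?P\<^esub> L B"
        using AB c[OF psrc_in(1)[OF AB(1)]] c[OF psrc_in(2)[OF AB(2)]] c[OF psrc_in(1)[OF AB(2)]]
        by (simp add: L_def fundamental_group_simps)
      then show ?thesis using normal.rcos_sum[OF nK L[OF AB(1)] L[OF AB(2)]]
        by (simp add: \<Phi>_def Q_def FactGroup_def)
    qed
  qed
  have one: "\<Phi> A = \<one>\<^bsub>Q\<^esub> \<longleftrightarrow> L A \<in> K" if "A \<in> path_classes M" for A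
    using L[OF that] K P.coset_join1[of K "L A"] P.coset_join2[of "L A" K]
    by (auto simp: \<Phi>_def Q_def FactGroup_def)
  \<comment> \<open>Since \<open>K\<close> is normal, membership does not depend on the path that
    ties a loop to the base point.\<close>
  have conj: "\<Phi> A = \<one>\<^bsub>Q\<^esub> \<longleftrightarrow> pmul M D (pmul M A (pinv M D)) \<in> K"
    if A: "A \<in> path_classes M" "psrc A = ptgt A" and D: "D \<in> path_classes M" "psrc D = x" "ptgt D = psrc A" for A D
  proof -
    let ?e = "pmul M (c (psrc A)) (pinv M D)" and ?B = "pmul M D (pmul M A (pinv M D))"
    note cA = c[OF psrc_in(1)[OF A(1)]]
    have e: "?e \<in> carrier ?P" and B: "?B \<in> carrier ?P" using A D cA by (simp_all add: fundamental_group_simps)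
    have "L A = ?e \<otimes>\<^bsub>?P\<^esub> ?B \<otimes>\<^bsub>?P\<^esub> inv\<^bsub>?P\<^esub> ?e"
      unfolding inv_fundamental_group[OF e] using A D cA by (simp add: L_def fundamental_group_simps)
    moreover have "?B = inv\<^bsub>?P\<^esub> ?e \<otimes>\<^bsub>?P\<^esub> L A \<otimes>\<^bsub>?P\<^esub> inv\<^bsub>?P\<^esub> (inv\<^bsub>?P\<^esub> ?e)"
      unfolding calculation using e B by (simp add: P.group_word_simps)
    ultimately show ?thesis unfolding one[OF A(1)]
      using nK e P.inv_closed[OF e] unfolding P.normal_inv_iff by metis
  qed
  have "\<exists>y\<in>C. \<Phi> (ppush M (\<lambda>g. emb H (y, g)) circ) = \<one>\<^bsub>Q\<^esub>" if H: "H \<in> N" for H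
  proof -
    obtain D y where Dy: "y \<in> C" "D \<in> path_classes M" "psrc D = x" "ptgt D = emb H (y, 1)"
      "pmul M D (pmul M (ppush M (\<lambda>g. emb H (y, g)) circ) (pinv M D)) \<in> K" using mer[OF H] by auto
    have em: "continuous_on punctured (\<lambda>g. emb H (y, g))" "(\<lambda>g. emb H (y, g)) \<in> punctured \<rightarrow> M"
      using emb_point_maps[OF H Dy(1)] by auto
    note s = ppush_simps[OF circ_simps(1) em]
    have "\<Phi> (ppush M (\<lambda>g. emb H (y, g)) circ) = \<one>\<^bsub>Q\<^esub>"
      using conj[OF s(1) _ Dy(2,3)] s(2,3) circ_simps(2,3) Dy(4,5) by simp
    then show ?thesis using Dy(1) by blast
  qed
  then interpret path_functor_cover M Q \<Phi> T boxes by (intro path_functor_coverI[OF PF])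
  have i: "continuous_on C \<iota>" "\<iota> \<in> C \<rightarrow> M" using ins_maps[of S' S S] fin by auto
  have r: "continuous_on M rst" "rst \<in> M \<rightarrow> C" using ins_maps[of S S S'] fin by auto
  have rx: "rst x \<in> C" using r(2) x by auto
  have "A \<in> K" if A: "A \<in> carrier ?P" for A
  proof -
    from A obtain p where p: "p \<in> paths_in M" "A = homotopy_class M p" "pathstart p = x" "pathfinish p = x"
      by (auto simp: fundamental_group_simps path_classes_def)
    have pM: "p t \<in> M" if "t \<in> {0..1}" for t using p(1) that by (auto simp: path_image_def)
    have cp: "continuous_on {0..1} p" using p by (simp add: path_def)
    define q where "q = \<iota> \<circ> (rst \<circ> p)"
    have rp: "rst \<circ> p \<in> paths_in C" by (rule compose_paths_in[OF p(1) r])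
    have q: "q \<in> paths_in M" unfolding q_def by (rule compose_paths_in[OF rp i])
    have qM: "q t \<in> M" if "t \<in> {0..1}" for t using q that by (auto simp: path_image_def)
    have cq: "continuous_on {0..1} q" using q by (simp add: path_def)
    have eqS: "q t j = p t j" if "j \<in> S" for t j using that by (simp add: q_def ins_def)
    \<comment> \<open>Only the new coordinate moves, along a segment. It may cross the centers, so
      the homotopy leaves \<open>M\<close>, but it stays in \<open>T\<close>.\<close>
    define h where "h = (\<lambda>x. ext (p (snd x)) (of_real (1 - fst x) * p (snd x) a + of_real (fst x) * q (snd x) a))"
    have cps: "continuous_on ({0..1::real} \<times> {0..1}) (\<lambda>x. p (snd x))" "continuous_on ({0..1::real} \<times> {0..1}) (\<lambda>x. q (snd x))"
      by (rule continuous_on_compose2[OF cp continuous_on_snd[OF continuous_on_id]], auto)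
        (rule continuous_on_compose2[OF cq continuous_on_snd[OF continuous_on_id]], auto)
    have ch: "continuous_on ({0..1} \<times> {0..1}) h"
      unfolding h_def
      by (intro continuous_ext cps continuous_intros continuous_on_coord[OF cps(1)] continuous_on_coord[OF cps(2)]
          continuous_on_fst[OF continuous_on_id])
    have hT: "h \<in> {0..1} \<times> {0..1} \<rightarrow> T"
    proof (rule Pi_I)
      fix z :: "real \<times> real" assume "z \<in> {0..1} \<times> {0..1}"
      then have "p (snd z) \<in> M" using pM by auto
      then have "rst (p (snd z)) \<in> C" using r(2) by auto
      moreover have "h z = ext (rst (p (snd z))) (of_real (1 - fst z) * p (snd z) a + of_real (fst z) * q (snd z) a)"
        by (auto simp: h_def ext_def ins_def fun_eq_iff)
      ultimately show "h z \<in> T" using ext_T by simp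
    qed
    have h0: "h (0, t) = p t" and h1: "h (1, t) = q t" if t: "t \<in> {0..1}" for t
    proof -
      have "p t \<in> S' \<rightarrow>\<^sub>E UNIV" "q t \<in> S' \<rightarrow>\<^sub>E UNIV" using pM[OF t] qM[OF t] M_sub_T by (auto simp: T_def)
      then show "h (0, t) = p t" "h (1, t) = q t"
        using eqS[of _ t] a_notin by (auto simp: h_def ext_def fun_eq_iff PiE_iff extensional_def)
    qed
    have pq: "p 0 = p 1" "q 0 = q 1" using p(3,4) by (simp_all add: pathstart_def pathfinish_def q_def)
    obtain k where k: "k \<in> carrier Q" "\<Psi> (\<lambda>t. h (0, t)) = k \<otimes>\<^bsub>Q\<^esub> \<Psi> (\<lambda>t. h (1, t)) \<otimes>\<^bsub>Q\<^esub> inv\<^bsub>Q\<^esub> k"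
    proof -
      have "\<exists>k\<in>carrier Q. \<Psi> (\<lambda>t. h (0, t)) = k \<otimes>\<^bsub>Q\<^esub> \<Psi> (\<lambda>t. h (1, t)) \<otimes>\<^bsub>Q\<^esub> inv\<^bsub>Q\<^esub> k"
      proof (rule loops_conjugate[OF ch hT])
        show "h (s, 0) = h (s, 1)" for s using pq by (simp add: h_def)
      qed (use h0 h1 pM qM in auto)
      then show ?thesis using that by blast
    qed
    have "homotopic_paths M p (\<lambda>t. h (0, t))" "homotopic_paths M q (\<lambda>t. h (1, t))"
      using p(1) q h0 h1 by (auto intro!: homotopic_paths_eq)
    then have "\<Phi> A = k \<otimes>\<^bsub>Q\<^esub> \<Psi> q \<otimes>\<^bsub>Q\<^esub> inv\<^bsub>Q\<^esub> k"
      using k(2) p(2) by (simp add: homotopy_class_eqI)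
    moreover have "\<Psi> q = \<one>\<^bsub>Q\<^esub>"
    proof -
      let ?B = "homotopy_class C (rst \<circ> p)"
      have qB: "homotopy_class M q = ppush M \<iota> ?B" unfolding q_def by (rule ppush_class[OF rp i, symmetric])
      have B: "?B \<in> path_classes C" "psrc ?B = rst x" "ptgt ?B = rst x"
        using rp p(3,4) by (simp_all add: pathstart_compose pathfinish_compose del: mem_Collect_eq)
      then have BP: "?B \<in> carrier (fundamental_group C (rst x))" by (simp add: fundamental_group_simps)
      have "pmul M (homotopy_class M \<gamma>) (pmul M (ppush M \<iota> ?B) (pinv M (homotopy_class M \<gamma>))) \<in> K"
        using sec[OF BP] unfolding fundamental_group_map_class[OF BP i \<gamma>] .
      then show ?thesis
        unfolding qB using conj[OF ppush_simps(1)[OF B(1) i] _ paths_between_class(1,2)[OF \<gamma>]]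
          paths_between_class(3)[OF \<gamma>] ppush_simps(2,3)[OF B(1) i] B by simp
    qed
    ultimately have "\<Phi> A = \<one>\<^bsub>Q\<^esub>" using k(1) by simp
    moreover have Ap: "A \<in> path_classes M" "psrc A = x" "ptgt A = x" using A by (auto simp: fundamental_group_simps)
    ultimately have "pmul M (pid M x) (pmul M A (pinv M (pid M x))) \<in> K"
      using conj[of A "pid M x"] x by simp
    then show "A \<in> K" using Ap x by simp
  qed
  then show ?thesis using subgroup.subset[OF K] by blast
qed

end

section \<open>Meridians\<close>

lemma ppush_cong:
  assumes A: "A \<in> path_classes E" and f: "continuous_on E f" "f \<in> E \<rightarrow> Y" and eq: "\<And>x. x \<in> E \<Longrightarrow> f x = g x"
  shows "ppush Y f A = ppush Y g A"
proof -
  have g: "continuous_on E g" "g \<in> E \<rightarrow> Y"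
    using f eq continuous_on_cong[of E E f g] by (auto simp: Pi_iff)
  from A obtain p where p: "p \<in> paths_in E" "A = homotopy_class E p" by (auto simp: path_classes_def)
  have "homotopic_paths Y (f \<circ> p) (g \<circ> p)"
  proof (rule homotopic_paths_eq)
    fix t :: real assume "t \<in> {0..1}"
    then have "p t \<in> E" using p(1) by (auto simp: path_image_def)
    then show "(f \<circ> p) t = (g \<circ> p) t" using eq by simp
  qed (use compose_paths_in[OF p(1) f] in auto)
  then show ?thesis using p f g by (simp add: ppush_class homotopy_class_eqI del: mem_Collect_eq)
qed

section \<open>Winding numbers along the insertion maps\<close>

context config begin

definition windc :: "nat \<times> nat \<times> nat \<Rightarrow> (real \<Rightarrow> nat \<Rightarrow> complex) set \<Rightarrow> complex" where
  "windc H A = wn (ppush punctured (lform d H) A)"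

lemma windc_pmul:
  assumes "H \<in> hyps d S" "A \<in> path_classes (Conf d S)" "B \<in> path_classes (Conf d S)" "ptgt A = psrc B"
  shows "windc H (pmul (Conf d S) A B) = windc H A + windc H B"
proof -
  have l: "continuous_on (Conf d S) (lform d H)" "lform d H \<in> Conf d S \<rightarrow> punctured" using lform_maps[OF assms(1)] by auto
  show ?thesis unfolding windc_def ppush_pmul[OF assms(2-4) l]
    using ppush_simps[OF assms(2) l] ppush_simps[OF assms(3) l] assms(4) by (intro wn_pmul) auto
qed

lemma windc_pinv:
  assumes "H \<in> hyps d S" "A \<in> path_classes (Conf d S)"
  shows "windc H (pinv (Conf d S) A) = - windc H A"
proof -
  have l: "continuous_on (Conf d S) (lform d H)" "lform d H \<in> Conf d S \<rightarrow> punctured" using lform_maps[OF assms(1)] by auto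
  show ?thesis unfolding windc_def using ppush_simps[OF assms(2) l] wn_pinv by metis
qed

lemma windc_conj:
  assumes "H \<in> hyps d S" "A \<in> path_classes (Conf d S)" "D \<in> path_classes (Conf d S)" "ptgt D = psrc A" "psrc A = ptgt A"
  shows "windc H (pmul (Conf d S) D (pmul (Conf d S) A (pinv (Conf d S) D))) = windc H A"
  using assms by (simp add: windc_pmul windc_pinv)

lemma windc_ppush:
  assumes H: "H \<in> hyps d S" and f: "maps E (Conf d S) f" and A: "A \<in> path_classes E"
  shows "windc H (ppush (Conf d S) f A) = wn (ppush punctured (lform d H \<circ> f) A)"
  unfolding windc_def using lform_maps[OF H] f ppush_ppush[OF A, of f "Conf d S" "lform d H" punctured] by simp

lemma windc_fundamental_group_map:
  assumes H: "H \<in> hyps d S" and f: "maps E (Conf d S) f" and \<gamma>: "\<gamma> \<in> paths_between (Conf d S) y (f x)"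
    and A: "A \<in> carrier (fundamental_group E x)"
  shows "windc H (fundamental_group_map (Conf d S) \<gamma> f A) = wn (ppush punctured (lform d H \<circ> f) A)"
proof -
  have f': "continuous_on E f" "f \<in> E \<rightarrow> Conf d S" using f by auto
  have A': "A \<in> path_classes E" "psrc A = x" "ptgt A = x" using A by (auto simp: fundamental_group_simps)
  note s = ppush_simps[OF A'(1) f']
  show ?thesis
    unfolding fundamental_group_map_class[OF A f' \<gamma>]
    using windc_conj[OF H s(1) paths_between_class(1)[OF \<gamma>]] windc_ppush[OF H f A'(1)] paths_between_class[OF \<gamma>] s(2,3) A' by simp
qed

text \<open>A perturbation of length below \<open>\<sigma>\<close> cannot push a vector of length
  \<open>\<sigma>\<close> out of its open half-plane.\<close>

lemma inner_unit_pos: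
  assumes "norm c = 1" "norm w < \<sigma>"
  shows "inner c (of_real \<sigma> * c + w :: complex) > 0"
proof -
  have "\<bar>inner c w\<bar> \<le> norm c * norm w" by (rule Cauchy_Schwarz_ineq2)
  then have "\<bar>inner c w\<bar> < \<sigma>" using assms by simp
  moreover have "inner c (of_real \<sigma> * c) = \<sigma>"
    using assms(1) dot_square_norm[of c] by (simp add: scaleR_conv_of_real[symmetric])
  ultimately show ?thesis by (simp add: inner_add_right)
qed

text \<open>If one of the two points is far, its term dominates the form; the values stay in an open
  half-plane that misses 0, so they do not wind around it.\<close>

lemma far_winding:
  assumes fin: "finite S" and T: "T \<subseteq> S" "T \<subseteq> R" and H: "(i, j, k) \<in> hyps d S" "\<not> {i, j} \<subseteq> T"
    and A: "A \<in> path_classes (Conf d R)" "psrc A = ptgt A"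
  shows "wn (ppush punctured (lform d (i, j, k) \<circ> ins d S T) A) = 0"
proof -
  have ij: "i \<in> S" "j \<in> S" using H(1) by (auto simp: hyps_def)
  have finT: "finite T" using fin T finite_subset by blast
  have m: "maps (Conf d R) (Conf d S) (ins d S T)" using fin T by (rule ins_maps)
  have lm: "continuous_on (Conf d S) (lform d (i, j, k))" "lform d (i, j, k) \<in> Conf d S \<rightarrow> punctured" using lform_maps[OF H(1)] by auto
  have "\<exists>c. \<forall>v\<in>Conf d R. inner c (lform d (i, j, k) (ins d S T v)) > 0"
  proof -
    let ?z = "rootc d (int k)"
    have nb: "norm (v l) < 1 + (\<Sum>j\<in>T. norm (v j))" if "l \<in> T" for v :: "nat \<Rightarrow> complex" and l
      using finT that by (rule norm_sum_bound)
    consider "j = i" "i \<notin> T" | "j \<noteq> i" "i \<notin> T" "j \<in> T" | "j \<noteq> i" "i \<in> T" "j \<notin> T" | "j \<noteq> i" "i \<notin> T" "j \<notin> T"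
      using H(2) by auto
    then show ?thesis
    proof cases
      case 1
      have "inner (ray d i) (lform d (i, j, k) (ins d S T v)) > 0" for v
        using inner_unit_pos[of "ray d i" 0 "1 + (\<Sum>j\<in>T. norm (v j))"] norm_sum_pos[of v T] 1 ij
        by (simp add: lform_def ins_def)
      then show ?thesis by blast
    next
      case 2
      have "inner (ray d i) (lform d (i, j, k) (ins d S T v)) > 0" for v
        using inner_unit_pos[of "ray d i" "- (?z * v j)" "1 + (\<Sum>j\<in>T. norm (v j))"] nb[OF 2(3), of v] 2 ij
        by (simp add: lform_def ins_def norm_mult)
      then show ?thesis by blast
    next
      case 3
      have "inner (- (?z * ray d j)) (lform d (i, j, k) (ins d S T v)) > 0" for v
        using inner_unit_pos[of "- (?z * ray d j)" "v i" "1 + (\<Sum>j\<in>T. norm (v j))"] nb[OF 3(2), of v] 3 ij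
        by (simp add: lform_def ins_def norm_mult algebra_simps)
      then show ?thesis by blast
    next
      case 4
      \<comment> \<open>Both points are at the same radius, so the form is a positive multiple of
        its value on the configuration of rays.\<close>
      let ?c = "ray d i - ?z * ray d j"
      have "lform d (i, j, k) (\<lambda>i\<in>S. ray d i) \<noteq> 0" by (rule lform_nonzero[OF Conf_nonempty H(1)])
      then have c: "?c \<noteq> 0" using 4 ij by (simp add: lform_def)
      have "inner ?c (lform d (i, j, k) (ins d S T v)) > 0" for v
      proof -
        have "lform d (i, j, k) (ins d S T v) = (1 + (\<Sum>j\<in>T. norm (v j))) *\<^sub>R ?c"
          using 4 ij by (simp add: lform_def ins_def scaleR_conv_of_real algebra_simps)
        then have "inner ?c (lform d (i, j, k) (ins d S T v)) = (1 + (\<Sum>j\<in>T. norm (v j))) * inner ?c ?c"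
          by (simp only: inner_scaleR_right)
        then show ?thesis using norm_sum_pos[of v T] c by (simp only: inner_gt_zero_iff zero_less_mult_iff) simp
      qed
      then show ?thesis by blast
    qed
  qed
  then obtain c where c: "\<forall>v\<in>Conf d R. inner c (lform d (i, j, k) (ins d S T v)) > 0" ..
  show ?thesis
  proof (rule wn_convex[OF _ A, of _ "{z. inner c z > 0}"])
    have "continuous_on (Conf d R) (ins d S T)" "ins d S T \<in> Conf d R \<rightarrow> Conf d S" using m by auto
    from continuous_comp_into[OF this lm]
    show "maps (Conf d R) punctured (lform d (i, j, k) \<circ> ins d S T)" by blast
    show "convex {z. inner c z > 0}" by (rule convex_halfspace_gt)
  qed (use c in auto)
qed

lemma near_winding:
  assumes fin: "finite S" and T: "T \<subseteq> S" "T \<subseteq> R" and H: "(i, j, k) \<in> hyps d S" "(i, j, k) \<in> hyps d R" "{i, j} \<subseteq> T"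
    and A: "A \<in> path_classes (Conf d R)"
  shows "wn (ppush punctured (lform d (i, j, k) \<circ> ins d S T) A) = windc (i, j, k) A"
proof -
  have l: "continuous_on (Conf d R) (lform d (i, j, k))" "lform d (i, j, k) \<in> Conf d R \<rightarrow> punctured" using lform_maps[OF H(2)] by auto
  have "lform d (i, j, k) v = (lform d (i, j, k) \<circ> ins d S T) v" for v
    using T H(3) by (auto simp: lform_def ins_def)
  then show ?thesis unfolding windc_def using ppush_cong[OF A l, of "lform d (i, j, k) \<circ> ins d S T"] by simp
qed

text \<open>The last clause says that the winding numbers are dual to the meridians. With
  generation, this allows the derived subgroup to be recognized by vanishing winding numbers; see
  \<open>dual_family_zero\<close>.\<close>

definition meridian_system :: "nat set \<Rightarrow> (nat \<Rightarrow> complex) \<Rightarrow> (nat \<times> nat \<times> nat \<Rightarrow> (real \<Rightarrow> nat \<Rightarrow> complex) set) \<Rightarrow> bool" where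
  "meridian_system S x m \<longleftrightarrow> (\<forall>H\<in>hyps d S. m H \<in> carrier (fundamental_group (Conf d S) x)) \<and>
    carrier (fundamental_group (Conf d S) x) = generate (fundamental_group (Conf d S) x)
      (m ` hyps d S \<union> lower_central (fundamental_group (Conf d S) x) 2) \<and>
    (\<forall>H\<in>hyps d S. \<forall>H'\<in>hyps d S. windc H' (m H) = of_bool (H = H'))"

lemma meridian_system_empty:
  assumes x: "x \<in> Conf d {}"
  shows "meridian_system {} x m"
proof -
  interpret P: group "fundamental_group (Conf d {}) x" by (rule group_fundamental_group[OF x])
  have xx: "Conf d {} = {x}" using x Conf_empty by auto
  have "A = \<one>\<^bsub>fundamental_group (Conf d {}) x\<^esub>" if A: "A \<in> carrier (fundamental_group (Conf d {}) x)" for A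
  proof -
    from A obtain p where p: "p \<in> paths_in (Conf d {})" "A = homotopy_class (Conf d {}) p"
      by (auto simp: fundamental_group_simps path_classes_def)
    have "p t = x" if "t \<in> {0..1}" for t using p(1) that unfolding xx path_image_def by blast
    then have "homotopic_paths (Conf d {}) p (\<lambda>_. x)" using p(1) by (intro homotopic_paths_eq) auto
    then show ?thesis using p(2) by (simp add: fundamental_group_simps homotopy_class_eqI)
  qed
  then have "carrier (fundamental_group (Conf d {}) x) \<subseteq> generate (fundamental_group (Conf d {}) x) Z" for Z
    using generate.one by force
  moreover have "generate (fundamental_group (Conf d {}) x) (lower_central (fundamental_group (Conf d {}) x) 2) \<subseteq> carrier (fundamental_group (Conf d {}) x)"
  proof (rule P.generate_incl)
    interpret PP: plain_group "fundamental_group (Conf d {}) x" using P.group_axioms by (simp add: plain_group_def)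
    show "lower_central (fundamental_group (Conf d {}) x) 2 \<subseteq> carrier (fundamental_group (Conf d {}) x)" by (rule PP.lower_central_subset)
  qed
  moreover have "hyps d {} = {}" by (auto simp: hyps_def)
  ultimately show ?thesis unfolding meridian_system_def by (simp add: subset_antisym)
qed

end

section \<open>Meridian systems after adding a point\<close>

context new_point begin

text \<open>Along the meridian of \<open>H\<close>, an old form is constant, the form of
  \<open>H\<close> runs once around 0, and any other new form stays in a disc around a difference of
  two centers that does not contain 0.\<close>

lemma meridian_winding:
  assumes H: "H \<in> N" and y: "y \<in> C" and H': "H' \<in> hyps d S'"
  shows "windc H' (ppush M (\<lambda>g. emb H (y, g)) circ) = of_bool (H = H')"
proof -
  have hy: "hyps d S' = hyps d S \<union> N" by (rule hyps_insert[OF above])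
  have em: "continuous_on punctured (\<lambda>g. emb H (y, g))" "(\<lambda>g. emb H (y, g)) \<in> punctured \<rightarrow> M"
    using emb_point_maps[OF H y] by auto
  have lm: "continuous_on M (lform d H')" "lform d H' \<in> M \<rightarrow> punctured" using lform_maps[OF H'] by auto
  have comp: "maps punctured punctured (lform d H' \<circ> (\<lambda>g. emb H (y, g)))" using continuous_comp_into[OF em lm] by blast
  have w: "windc H' (ppush M (\<lambda>g. emb H (y, g)) circ) = wn (ppush punctured (lform d H' \<circ> (\<lambda>g. emb H (y, g))) circ)"
    by (rule windc_ppush[OF H' _ circ_simps(1)]) (use em in auto)
  have cl: "psrc circ = ptgt circ" by (simp add: circ_simps)
  have yj: "emb H (y, g) j = y j" if "j \<in> S" for g j using that a_notin by (auto simp: emb_def ext_def)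
  have ya: "emb H (y, g) a = center d H y + of_real (rad H y / (1 + norm g)) * g" for g by (simp add: emb_def ext_def)
  show ?thesis
  proof (cases "H' \<in> N")
    case False
    then have HS: "H' \<in> hyps d S" using H' hy by blast
    have "lform d H' (emb H (y, g)) = lform d H' y" for g
    proof (cases H')
      case (fields i j k)
      then have "i \<in> S" "j \<in> S" using HS by (auto simp: hyps_def)
      then show ?thesis using yj by (auto simp: fields lform_def)
    qed
    then have "(lform d H' \<circ> (\<lambda>g. emb H (y, g))) ` punctured \<subseteq> {lform d H' y}" by auto
    from wn_convex[OF comp circ_simps(1) cl _ _ this]
    have "wn (ppush punctured (lform d H' \<circ> (\<lambda>g. emb H (y, g))) circ) = 0"
      using lform_nonzero[OF y HS] by simp
    then show ?thesis using w False H by auto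
  next
    case True
    then obtain j k where jk: "H' = (a, j, k)" by (auto elim: newhypsE)
    have cc: "center d H' (emb H (y, g)) = center d H' y" for g by (rule center_cong[OF True yj])
    have v: "(lform d H' \<circ> (\<lambda>g. emb H (y, g))) g = center d H y - center d H' y + of_real (rad H y / (1 + norm g)) * g" for g
      using cc[of g] unfolding jk by (simp add: lform_center ya)
    show ?thesis
    proof (cases "H' = H")
      case True
      \<comment> \<open>On the unit circle \<open>1 + norm g\<close> equals 2.\<close>
      let ?r = "rad H y / 2"
      have r: "?r > 0" using rad_pos[OF y H] by simp
      have e: "((lform d H' \<circ> (\<lambda>g. emb H (y, g))) \<circ> circlepath 0 1) = circlepath 0 ?r"
      proof
        fix t
        have "norm (circlepath 0 1 t) = 1" by (simp add: circlepath norm_exp_eq_Re)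
        then show "((lform d H' \<circ> (\<lambda>g. emb H (y, g))) \<circ> circlepath 0 1) t = circlepath 0 ?r t"
          using v[of "circlepath 0 1 t"] True by (simp add: circlepath)
      qed
      have "ppush punctured (lform d H' \<circ> (\<lambda>g. emb H (y, g))) circ = homotopy_class punctured (circlepath 0 ?r)"
        unfolding circ_def using ppush_class[OF circlepath_paths_in[of 1] conjunct1[OF comp] conjunct2[OF comp]] e by simp
      then have "wn (ppush punctured (lform d H' \<circ> (\<lambda>g. emb H (y, g))) circ) = 1"
        using wn_class[OF circlepath_paths_in[OF r]] winding_number_circlepath_centre[OF r, of 0] by simp
      then show ?thesis using w True by simp
    next
      case False
      let ?c = "center d H y - center d H' y"
      have "(lform d H' \<circ> (\<lambda>g. emb H (y, g))) ` punctured \<subseteq> ball ?c (rad H y)"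
      proof
        fix z assume "z \<in> (lform d H' \<circ> (\<lambda>g. emb H (y, g))) ` punctured"
        then obtain g where "z = ?c + of_real (rad H y / (1 + norm g)) * g" using v by auto
        then have "dist ?c z = norm (of_real (rad H y / (1 + norm g)) * g)" by (simp add: dist_norm)
        then show "z \<in> ball ?c (rad H y)" using emb_bound[OF y H, of g] by simp
      qed
      moreover have "0 \<notin> ball ?c (rad H y)"
        using rad_le[OF \<open>H' \<in> N\<close> False, of y] rad_pos[OF y H] by (simp add: dist_norm)
      ultimately have "wn (ppush punctured (lform d H' \<circ> (\<lambda>g. emb H (y, g))) circ) = 0"
        by (intro wn_convex[OF comp circ_simps(1) cl convex_ball])
      then show ?thesis using w False by auto
    qed
  qed
qed

text \<open>The old meridians are carried over by the section. There the new point is far away, so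
  they do not wind around the new hyperplanes, and their old winding numbers are unchanged.\<close>

lemma meridian_system_insert:
  assumes IH: "\<And>x. x \<in> C \<Longrightarrow> \<exists>m. meridian_system S x m" and x: "x \<in> M"
  shows "\<exists>m. meridian_system S' x m"
proof -
  let ?P = "fundamental_group M x"
  interpret P: plain_group ?P using group_fundamental_group[OF x] by (simp add: plain_group_def)
  have hy: "hyps d S' = hyps d S \<union> N" by (rule hyps_insert[OF above])
  have disj: "H \<notin> N" if "H \<in> hyps d S" for H using that a_notin by (auto simp: hyps_def newhyps_def)
  have pcM: "path_connected M" using fin by (intro path_connected_Conf) auto
  have i: "continuous_on C \<iota>" "\<iota> \<in> C \<rightarrow> M" using ins_maps[of S' S S] fin by auto
  have r: "rst x \<in> C" using ins_maps[of S S S'] fin x by auto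
  interpret P0: plain_group "fundamental_group C (rst x)" using group_fundamental_group[OF r] by (simp add: plain_group_def)
  obtain m where m: "meridian_system S (rst x) m" using IH[OF r] by blast
  then have mc: "m H \<in> carrier (fundamental_group C (rst x))" if "H \<in> hyps d S" for H using that unfolding meridian_system_def by blast
  define \<gamma> where "\<gamma> = (SOME \<gamma>. \<gamma> \<in> paths_between M x (\<iota> (rst x)))"
  have \<gamma>: "\<gamma> \<in> paths_between M x (\<iota> (rst x))"
    unfolding \<gamma>_def using i(2) r by (intro paths_between_some[OF pcM x]) auto
  define \<delta> where "\<delta> = (\<lambda>H. SOME \<gamma>. \<gamma> \<in> paths_between M x (emb H (rst x, 1)))"
  have \<delta>: "\<delta> H \<in> paths_between M x (emb H (rst x, 1))" if "H \<in> N" for H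
    unfolding \<delta>_def using emb_point_maps[OF that r] by (intro paths_between_some[OF pcM x]) auto
  define D where "D = (\<lambda>H. homotopy_class M (\<delta> H))"
  have D: "D H \<in> path_classes M" "psrc (D H) = x" "ptgt (D H) = emb H (rst x, 1)" if "H \<in> N" for H
    using paths_between_class[OF \<delta>[OF that]] by (simp_all add: D_def)
  let ?\<phi> = "fundamental_group_map M \<gamma> \<iota>"
  have \<phi>: "?\<phi> \<in> hom (fundamental_group C (rst x)) ?P" by (rule fundamental_group_map_hom[OF i r \<gamma>])
  interpret \<phi>: group_hom "fundamental_group C (rst x)" ?P ?\<phi> by standard (rule \<phi>)
  define m' where "m' = (\<lambda>H. if H \<in> hyps d S then ?\<phi> (m H)
    else pmul M (D H) (pmul M (ppush M (\<lambda>g. emb H (rst x, g)) circ) (pinv M (D H))))"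
  have em: "ppush M (\<lambda>g. emb H (rst x, g)) circ \<in> path_classes M"
    "psrc (ppush M (\<lambda>g. emb H (rst x, g)) circ) = emb H (rst x, 1)"
    "ptgt (ppush M (\<lambda>g. emb H (rst x, g)) circ) = emb H (rst x, 1)" if "H \<in> N" for H
    using ppush_simps(1-3)[OF circ_simps(1), of "\<lambda>g. emb H (rst x, g)" M] emb_point_maps[OF that r] circ_simps by auto
  have m'c: "m' H \<in> carrier ?P" if "H \<in> hyps d S'" for H
  proof (cases "H \<in> hyps d S")
    case True then show ?thesis using mc hom_in_carrier[OF \<phi>] by (simp add: m'_def)
  next
    case False
    then have "H \<in> N" using that hy by blast
    then show ?thesis using False D em by (simp add: m'_def fundamental_group_simps)
  qed
  let ?K = "generate ?P (m' ` hyps d S' \<union> lower_central ?P 2)"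
  have sub: "m' ` hyps d S' \<union> lower_central ?P 2 \<subseteq> carrier ?P" using m'c P.lower_central_subset by auto
  have "?K = carrier ?P"
  proof (rule generated_by_section_and_meridians[OF x _ _ \<gamma>])
    show "subgroup ?K ?P" by (rule P.generate_is_subgroup[OF sub])
    show "lower_central ?P 2 \<subseteq> ?K" by (auto intro: generate.incl)
    have "?\<phi> ` (m ` hyps d S \<union> lower_central (fundamental_group C (rst x)) 2) \<subseteq> m' ` hyps d S' \<union> lower_central ?P 2"
    proof -
      have "?\<phi> (m H) \<in> m' ` hyps d S'" if "H \<in> hyps d S" for H
        using that hy by (intro image_eqI[of _ _ H]) (auto simp: m'_def)
      moreover have "?\<phi> B \<in> lower_central ?P 2" if "B \<in> lower_central (fundamental_group C (rst x)) 2" for B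
        by (rule hom_lower_central[OF P0.group_axioms P.group_axioms \<phi> that])
      ultimately show ?thesis by auto
    qed
    then have "generate ?P (?\<phi> ` (m ` hyps d S \<union> lower_central (fundamental_group C (rst x)) 2)) \<subseteq> ?K"
      by (rule P.mono_generate)
    moreover have "?\<phi> ` generate (fundamental_group C (rst x)) (m ` hyps d S \<union> lower_central (fundamental_group C (rst x)) 2)
      = generate ?P (?\<phi> ` (m ` hyps d S \<union> lower_central (fundamental_group C (rst x)) 2))"
      using mc P0.lower_central_subset by (intro \<phi>.generate_img[symmetric]) auto
    ultimately show "?\<phi> B \<in> ?K" if "B \<in> carrier (fundamental_group C (rst x))" for B
      using m that unfolding meridian_system_def by blast
    fix H assume H: "H \<in> N"
    then have "m' H \<in> ?K" using hy by (auto intro: generate.incl)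
    moreover have "H \<notin> hyps d S" using H disj by blast
    ultimately have "pmul M (D H) (pmul M (ppush M (\<lambda>g. emb H (rst x, g)) circ) (pinv M (D H))) \<in> ?K" by (simp add: m'_def)
    then show "\<exists>D y. y \<in> C \<and> D \<in> path_classes M \<and> psrc D = x \<and> ptgt D = emb H (y, 1) \<and>
      pmul M D (pmul M (ppush M (\<lambda>g. emb H (y, g)) circ) (pinv M D)) \<in> ?K"
      using D[OF H] r by blast
  qed
  moreover have "windc H' (m' H) = of_bool (H = H')" if H: "H \<in> hyps d S'" and H': "H' \<in> hyps d S'" for H H'
  proof (cases "H \<in> hyps d S")
    case True
    note mA = mc[OF True]
    have A: "m H \<in> path_classes C" "psrc (m H) = ptgt (m H)" using mA by (auto simp: fundamental_group_simps)
    have w: "windc H' (m' H) = wn (ppush punctured (lform d H' \<circ> \<iota>) (m H))"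
      using windc_fundamental_group_map[where f = \<iota>, OF H' _ \<gamma> mA] i True by (simp add: m'_def)
    obtain i j k where ijk: "H' = (i, j, k)" by (cases H')
    show ?thesis
    proof (cases "H' \<in> hyps d S")
      case True
      then have "{i, j} \<subseteq> S" by (auto simp: ijk hyps_def)
      then have "windc H' (m' H) = windc H' (m H)"
        using w near_winding[of S' S S i j k "m H"] fin H' True A(1) by (auto simp: ijk)
      then show ?thesis using m True \<open>H \<in> hyps d S\<close> by (simp add: meridian_system_def)
    next
      case False
      then have "H' \<in> N" using H' hy by blast
      then have "\<not> {i, j} \<subseteq> S" using a_notin by (auto simp: ijk newhyps_def)
      then have "windc H' (m' H) = 0"
        using w far_winding[of S' S S i j k "m H"] fin H' A by (auto simp: ijk)
      then show ?thesis using False \<open>H \<in> hyps d S\<close> by auto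
    qed
  next
    case False
    then have HN: "H \<in> N" using H hy by blast
    have "windc H' (m' H) = windc H' (ppush M (\<lambda>g. emb H (rst x, g)) circ)"
      using windc_conj[OF H' em(1)[OF HN] D(1)[OF HN]] D[OF HN] em[OF HN] False by (simp add: m'_def)
    then show ?thesis using meridian_winding[OF HN r H'] by simp
  qed
  ultimately have "meridian_system S' x m'" unfolding meridian_system_def using m'c by simp
  then show ?thesis by blast
qed

end

context config begin

text \<open>Points are added in increasing order, because a new point must have the largest index
  for the orientation \<open>j \<le> i\<close> in \<open>hyps\<close>.\<close>

theorem meridian_system_exists:
  assumes "finite S" "x \<in> Conf d S"
  shows "\<exists>m. meridian_system S x m"
  using assms
proof (induction S arbitrary: x rule: finite_linorder_max_induct)
  case empty
  then show ?case using meridian_system_empty by blast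
next
  case (insert a S)
  then interpret new_point d S a by unfold_locales auto
  show ?case by (rule meridian_system_insert) (use insert in auto)
qed

end

section \<open>Vanishing of large cumulants\<close>

context plain_group begin

lemma rcoset_absorb:
  assumes N: "N \<lhd> G" and n: "n \<in> N" and x: "x \<in> carrier G"
  shows "N #> (n \<otimes> x) = N #> x" "N #> (x \<otimes> n) = N #> x"
proof -
  have nc: "n \<in> carrier G" using n normal_imp_subgroup[OF N] by (rule subgroup.mem_carrier[rotated])
  have "n \<otimes> x \<otimes> inv x \<in> N" using n nc x by (simp add: group_word_simps)
  then show "N #> (n \<otimes> x) = N #> x"
    using nc x by (subst rcoset_eq_iff[OF normal_imp_subgroup[OF N]]) auto
  have "x \<otimes> n \<otimes> inv x \<in> N" using normal.inv_op_closed2[OF N x n] .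
  then show "N #> (x \<otimes> n) = N #> x"
    using nc x by (subst rcoset_eq_iff[OF normal_imp_subgroup[OF N]]) auto
qed

lemma rcoset_lower_central_absorb:
  assumes "n \<in> lower_central G j" "x \<in> carrier G"
  shows "lower_central G j #> (n \<otimes> x) = lower_central G j #> x"
    "lower_central G j #> (x \<otimes> n) = lower_central G j #> x"
  using rcoset_absorb[OF lower_central_normal assms] .

text \<open>By multilinearity a commutator modulo the next term depends only on its entries modulo
  the derived subgroup. In the step, \<open>\<phi> c = u \<otimes> c\<close> and
  \<open>\<phi> x = v \<otimes> x\<close>, and the factors \<open>u\<close> and \<open>v\<close> are
  removed one after the other.\<close>

lemma hom_left_normed:
  assumes \<phi>: "\<phi> \<in> hom G G"
  shows "\<lbrakk>xs \<noteq> []; set xs \<subseteq> carrier G; \<And>x. x \<in> set xs \<Longrightarrow> \<phi> x \<otimes> inv x \<in> lower_central G 2\<rbrakk>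
    \<Longrightarrow> \<phi> (left_normed xs) \<otimes> inv (left_normed xs) \<in> lower_central G (Suc (length xs))"
proof (induction xs rule: left_normed.induct)
  case (2 x)
  then show ?case by (simp add: numeral_2_eq_2)
next
  case (3 x y xs)
  interpret \<phi>: group_hom G G \<phi> by standard (rule \<phi>)
  let ?n = "length xs"
  let ?N = "lower_central G (Suc (Suc (Suc ?n)))"
  note ab = rcoset_lower_central_absorb[where j = "Suc (Suc (Suc ?n))"]
  define c where "c = left_normed (y # xs)"
  define u where "u = \<phi> c \<otimes> inv c"
  define v where "v = \<phi> x \<otimes> inv x"
  have cl: "c \<in> lower_central G (Suc ?n)" unfolding c_def using "3.prems" left_normed_lower_central[of "y # xs"] by simp
  have ul: "u \<in> lower_central G (Suc (Suc ?n))" using "3.IH" "3.prems" by (simp add: u_def c_def)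
  have vl: "v \<in> lower_central G 2" using "3.prems" by (simp add: v_def)
  note [simp] = lower_central_carrier[OF cl] lower_central_carrier[OF ul] lower_central_carrier[OF vl]
  have [simp]: "x \<in> carrier G" using "3.prems" by simp
  have e: "\<phi> c = u \<otimes> c" "\<phi> x = v \<otimes> x" by (simp_all add: u_def v_def m_assoc)
  let ?w = "\<lambda>h k. h \<otimes> k \<otimes> inv h \<otimes> inv k"
  have w: "?w c x \<in> lower_central G (Suc (Suc ?n))" by (rule lower_central_commutator[OF cl]) simp
  have ww: "?w c (v \<otimes> x) \<in> lower_central G (Suc (Suc ?n))" by (rule lower_central_commutator[OF cl]) simp
  have "?N #> \<phi> (?w c x) = ?N #> ?w (u \<otimes> c) (v \<otimes> x)" using e by simp
  also have "\<dots> = ?N #> (u \<otimes> ?w c (v \<otimes> x) \<otimes> inv u \<otimes> ?w u (v \<otimes> x))"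
    by (simp only: commutator_mult_left[of u c "v \<otimes> x"] \<open>x \<in> carrier G\<close> lower_central_carrier[OF cl] lower_central_carrier[OF ul] lower_central_carrier[OF vl] m_closed)
  also have "\<dots> = ?N #> (u \<otimes> ?w c (v \<otimes> x) \<otimes> inv u)"
    by (rule ab(2)) (use lower_central_commutator[OF ul] in simp_all)
  also have "\<dots> = ?N #> ?w c (v \<otimes> x)" by (rule lower_central_conj_rcoset[OF ww]) simp
  also have "\<dots> = ?N #> (?w c v \<otimes> (v \<otimes> ?w c x \<otimes> inv v))"
    by (simp only: commutator_mult_right[of c v x] \<open>x \<in> carrier G\<close> lower_central_carrier[OF cl] lower_central_carrier[OF vl])
  also have "\<dots> = ?N #> (v \<otimes> ?w c x \<otimes> inv v)"
    by (rule ab(1)) (use commutator_derived[OF cl vl] in simp_all)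
  also have "\<dots> = ?N #> ?w c x" by (rule lower_central_conj_rcoset[OF w]) simp
  finally have "\<phi> (?w c x) \<otimes> inv (?w c x) \<in> ?N"
    by (subst (asm) rcoset_eq_iff[OF lower_central_subgroup]) simp_all
  then show ?case by (simp add: c_def)
qed simp

text \<open>Modulo the derived subgroup every element is a product of integer powers of the
  \<open>m i\<close>, and the additive functions \<open>c i\<close> read off the exponents. If they
  all vanish, characteristic zero forces the exponents to vanish.\<close>

lemma dual_family_zero:
  fixes c :: "'i \<Rightarrow> 'a \<Rightarrow> 'c::ring_char_0"
  assumes fin: "finite I" and m: "m ` I \<subseteq> carrier G" and gen: "carrier G = generate G (m ` I \<union> lower_central G 2)"
    and c: "\<And>i x y. \<lbrakk>i \<in> I; x \<in> carrier G; y \<in> carrier G\<rbrakk> \<Longrightarrow> c i (x \<otimes> y) = c i x + c i y"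
    and dual: "\<And>i k. \<lbrakk>i \<in> I; k \<in> I\<rbrakk> \<Longrightarrow> c i (m k) = of_bool (k = i)"
    and x: "x \<in> carrier G" "\<And>i. i \<in> I \<Longrightarrow> c i x = 0"
  shows "x \<in> lower_central G 2"
proof -
  let ?N = "lower_central G (Suc (Suc 0))" and ?Q = "lower_central_quotient G (Suc 0)"
  interpret Q: comm_group ?Q by (rule lower_central_quotient_comm_group)
  let ?p = "\<lambda>x. ?N #> x"
  have p: "?p \<in> hom G ?Q" by (rule homI) (auto simp: lower_central_quotient_simps lower_central_quotient_mult)
  interpret p: group_hom G ?Q ?p by standard (rule p)
  have c0: "c i x = 0" if i: "i \<in> I" and x: "x \<in> lower_central G 2" for i x
  proof -
    \<comment> \<open>The additive group of the value ring, written as a monoid record so that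
      \<open>hom_comm_group_derived\<close> applies.\<close>
    let ?A = "\<lparr>carrier = UNIV, monoid.mult = (+), one = 0\<rparr> :: 'c monoid"
    have "comm_group ?A"
      by (rule comm_groupI) (auto intro: exI[of _ "- _"] simp: add_ac bex_UNIV)
    moreover have "c i \<in> hom G ?A" using c[OF i] by (auto simp: hom_def)
    ultimately show ?thesis using hom_comm_group_derived[OF _ _ x] by fastforce
  qed
  have cinv: "c i (inv x) = - c i x" if "i \<in> I" "x \<in> carrier G" for i x
  proof -
    have "c i (inv x) + c i x = c i \<one>" using c[OF that(1), of "inv x" x] that by simp
    moreover have "c i \<one> = 0" using c0[OF that(1)] subgroup.one_closed[OF lower_central_subgroup] by blast
    ultimately show ?thesis by (simp add: eq_neg_iff_add_eq_0)
  qed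
  let ?f = "\<lambda>e :: 'i \<Rightarrow> int. \<Otimes>\<^bsub>?Q\<^esub>i\<in>I. ?p (m i) [^]\<^bsub>?Q\<^esub> e i"
  have pm: "?p (m i) \<in> carrier ?Q" if "i \<in> I" for i using that m by auto
  have fcl: "(\<lambda>i. ?p (m i) [^]\<^bsub>?Q\<^esub> (e i :: int)) \<in> I \<rightarrow> carrier ?Q" for e using pm by auto
  have f_add: "?f (\<lambda>i. e i + e' i) = ?f e \<otimes>\<^bsub>?Q\<^esub> ?f e'" for e e'
  proof -
    have "?f (\<lambda>i. e i + e' i) = (\<Otimes>\<^bsub>?Q\<^esub>i\<in>I. ?p (m i) [^]\<^bsub>?Q\<^esub> e i \<otimes>\<^bsub>?Q\<^esub> ?p (m i) [^]\<^bsub>?Q\<^esub> e' i)"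
      using pm by (intro Q.finprod_cong') (auto simp: Q.int_pow_mult)
    then show ?thesis using Q.finprod_multf[OF fcl[of e] fcl[of e']] by simp
  qed
  have f0: "?f (\<lambda>_. 0) = \<one>\<^bsub>?Q\<^esub>" using fin by (simp add: Q.finprod_one_eqI)
  \<comment> \<open>Elements with a product formula whose exponents are the values of
    \<open>c\<close>. They form a subgroup that contains the generators, hence everything.\<close>
  define S where "S = {x \<in> carrier G. \<exists>e. ?p x = ?f e \<and> (\<forall>i\<in>I. c i x = of_int (e i))}"
  have SI: "x \<in> S" if "x \<in> carrier G" "?p x = ?f e" "\<forall>i\<in>I. c i x = of_int (e i)" for x e
    unfolding S_def using that by (intro CollectI conjI exI[of _ e])
  have "subgroup S G"
  proof (rule subgroupI)
    have "\<one> \<in> S" using f0 c0 subgroup.one_closed[OF lower_central_subgroup]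
      by (auto simp: S_def intro!: exI[of _ "\<lambda>_. 0"])
    then show "S \<noteq> {}" by blast
    fix x assume x: "x \<in> S"
    then obtain e where e: "x \<in> carrier G" "?p x = ?f e" "\<forall>i\<in>I. c i x = of_int (e i)" by (auto simp: S_def)
    have "?f (\<lambda>i. - e i) \<otimes>\<^bsub>?Q\<^esub> ?p x = ?f (\<lambda>i. - e i + e i)" unfolding e(2) by (rule f_add[symmetric])
    also have "\<dots> = \<one>\<^bsub>?Q\<^esub>" unfolding left_minus by (rule f0)
    finally have "inv\<^bsub>?Q\<^esub> ?p x = ?f (\<lambda>i. - e i)"
      by (rule Q.inv_equality) (use Q.finprod_closed[OF fcl[of "\<lambda>i. - e i"]] p.hom_closed[OF e(1)] in simp_all)
    then have "?p (inv x) = ?f (\<lambda>i. - e i)" using p.hom_inv[OF e(1)] by (rule trans[rotated])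
    moreover have "\<forall>i\<in>I. c i (inv x) = of_int (- e i)" using e(1,3) cinv by simp
    moreover have "inv x \<in> carrier G" using e(1) by simp
    ultimately show "inv x \<in> S" by (rule SI[rotated])
    fix y assume "y \<in> S"
    then obtain e' where e': "y \<in> carrier G" "?p y = ?f e'" "\<forall>i\<in>I. c i y = of_int (e' i)" by (auto simp: S_def)
    have "?p (x \<otimes> y) = ?f (\<lambda>i. e i + e' i)" unfolding p.hom_mult[OF e(1) e'(1)] e(2) e'(2) by (rule f_add[symmetric])
    moreover have "\<forall>i\<in>I. c i (x \<otimes> y) = of_int (e i + e' i)" using e e' c by simp
    moreover have "x \<otimes> y \<in> carrier G" using e(1) e'(1) by simp
    ultimately show "x \<otimes> y \<in> S" by (rule SI[rotated])
  qed (auto simp: S_def)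
  moreover have "m ` I \<union> lower_central G 2 \<subseteq> S"
  proof (intro Un_least subsetI)
    fix x assume "x \<in> m ` I"
    then obtain k where k: "k \<in> I" "x = m k" by auto
    have "?f (\<lambda>i. of_bool (i = k)) = (\<Otimes>\<^bsub>?Q\<^esub>i\<in>I. if k = i then ?p (m i) else \<one>\<^bsub>?Q\<^esub>)"
      using pm by (intro Q.finprod_cong') (auto simp: Q.int_pow_1)
    also have "\<dots> = ?p (m k)" using fin k pm by (intro Q.finprod_singleton) auto
    finally have "?p x = ?f (\<lambda>i. of_bool (i = k))" using k(2) by simp
    moreover have "\<forall>i\<in>I. c i x = of_int (of_bool (i = k))" using k dual by auto
    moreover have "x \<in> carrier G" using k m by blast
    ultimately show "x \<in> S" by (rule SI[rotated])
  next
    fix x assume x: "x \<in> lower_central G 2"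
    then have "?p x = \<one>\<^bsub>?Q\<^esub>"
      using rcoset_lower_central_absorb(1)[of x 2 \<one>] lower_central_carrier[OF x] lower_central_subset
      by (simp add: lower_central_quotient_simps numeral_2_eq_2 coset_mult_one)
    then have "?p x = ?f (\<lambda>_. 0)" unfolding f0 .
    moreover have "\<forall>i\<in>I. c i x = of_int 0" using x c0 by simp
    moreover have "x \<in> carrier G" using lower_central_carrier[OF x] .
    ultimately show "x \<in> S" by (rule SI[rotated])
  qed
  ultimately have "carrier G \<subseteq> S" using generate_subgroup_incl gen by metis
  then obtain e where e: "?p x = ?f e" "\<forall>i\<in>I. c i x = of_int (e i)" using x(1) by (auto simp: S_def)
  have "?f e = \<one>\<^bsub>?Q\<^esub>"
  proof (rule Q.finprod_one_eqI)
    fix i assume "i \<in> I"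
    then have "(of_int (e i) :: 'c) = 0" using e(2) x(2) by simp
    then show "?p (m i) [^]\<^bsub>?Q\<^esub> e i = \<one>\<^bsub>?Q\<^esub>" by simp
  qed
  then have "?N #> x = ?N" using e(1) by (simp add: lower_central_quotient_simps)
  then show ?thesis using rcos_self[OF x(1) lower_central_subgroup[of "Suc (Suc 0)"]] by (simp add: numeral_2_eq_2)
qed

end

section \<open>Alternating sums over subsets\<close>

lemma sum_Pow_insert:
  assumes "finite B" "a \<notin> B"
  shows "sum f (Pow (insert a B)) = (\<Sum>T\<in>Pow B. f T + f (insert a T))"
proof -
  have "sum f (Pow (insert a B)) = sum f (Pow B) + sum f (insert a ` Pow B)"
    unfolding Pow_insert using assms by (intro sum.union_disjoint) auto
  also have "sum f (insert a ` Pow B) = (\<Sum>T\<in>Pow B. f (insert a T))"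
    using assms by (subst sum.reindex) (auto simp: inj_on_def)
  finally show ?thesis by (simp add: sum.distrib)
qed

lemma card_insert_Diff:
  assumes "finite B" "a \<notin> B" "T \<subseteq> B"
  shows "card (insert a B - T) = Suc (card (B - T))" "card (insert a B - insert a T) = card (B - T)"
proof -
  have "insert a B - T = insert a (B - T)" "insert a B - insert a T = B - T" using assms by auto
  then show "card (insert a B - T) = Suc (card (B - T))" "card (insert a B - insert a T) = card (B - T)"
    using assms by simp_all
qed

lemma alternating_sum_insert:
  fixes f :: "'a set \<Rightarrow> 'b::comm_ring_1"
  assumes "finite B" "a \<notin> B"
  shows "(\<Sum>T\<in>Pow (insert a B). (-1) ^ card (insert a B - T) * f T)
    = (\<Sum>T\<in>Pow B. (-1) ^ card (B - T) * (f (insert a T) - f T))"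
  unfolding sum_Pow_insert[OF assms] using card_insert_Diff[OF assms]
  by (intro sum.cong refl) (simp add: algebra_simps)

text \<open>Subsets of \<open>A\<close> are paired by adding or removing \<open>a\<close>; the two
  members of a pair have opposite signs and equal values.\<close>

lemma alternating_sum_cancel:
  fixes f :: "'a set \<Rightarrow> 'b::comm_ring_1"
  assumes fin: "finite A" and a: "a \<in> A" and eq: "\<And>T. T \<subseteq> A - {a} \<Longrightarrow> f (insert a T) = f T"
  shows "(\<Sum>T\<in>Pow A. (-1) ^ card (A - T) * f T) = 0"
proof -
  have A: "insert a (A - {a}) = A" using a by auto
  show ?thesis
    using alternating_sum_insert[of "A - {a}" a f] fin eq unfolding A by simp
qed

lemma moebius_Pow:
  fixes f :: "'a set \<Rightarrow> 'b::comm_ring_1"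
  assumes "finite S"
  shows "(\<Sum>A\<in>Pow S. \<Sum>T\<in>Pow A. (-1) ^ card (A - T) * f T) = f S"
  using assms
\<comment> \<open>\<open>f\<close> must vary: adding \<open>a\<close> leads to the same identity for
  the function that sends \<open>T\<close> to \<open>f (insert a T)\<close>.\<close>
proof (induction S arbitrary: f rule: finite_induct)
  case (insert a B)
  let ?g = "\<lambda>f A. \<Sum>T\<in>Pow A. (-1) ^ card (A - T) * f T"
  have "(\<Sum>A\<in>Pow (insert a B). ?g f A) = (\<Sum>A\<in>Pow B. ?g f A + ?g f (insert a A))"
    by (rule sum_Pow_insert) (use insert in auto)
  also have "\<dots> = (\<Sum>A\<in>Pow B. ?g (\<lambda>T. f (insert a T)) A)"
  proof (intro sum.cong refl)
    fix A assume A: "A \<in> Pow B"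
    have fA: "finite A" "a \<notin> A" using A insert finite_subset by auto
    show "?g f A + ?g f (insert a A) = ?g (\<lambda>T. f (insert a T)) A"
      unfolding alternating_sum_insert[OF fA] by (simp add: right_diff_distrib sum_subtractf)
  qed
  finally show ?case using insert.IH by simp
qed simp

context config begin

lemma fin_vectorspace_Conf:
  assumes S: "finite S" "x \<in> Conf d S"
  shows "fin_vectorspace (gr_space j (Conf d S) x :: ('k::field, _) module)"
proof -
  interpret P: gr_base "fundamental_group (Conf d S) x" "TYPE('k)" j
    using group_fundamental_group[OF S(2)] by (simp add: gr_base_def plain_group_def)
  obtain m where m: "meridian_system S x m" using meridian_system_exists[OF S] by blast
  show ?thesis
    by (rule P.gr_fin[of "m ` hyps d S"]) (use m finite_hyps[OF S(1)] in \<open>auto simp only: meridian_system_def finite_imageI image_subset_iff\<close>)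
qed

text \<open>The winding numbers on both sides agree. Around hyperplanes within \<open>T\<close>
  nothing changes under the projection; around any other they vanish, after the projection by
  \<open>far_winding\<close> and before it by duality.\<close>

lemma meridian_fixed:
  assumes S: "finite S" "T \<subseteq> S" and x: "x \<in> Conf d S" and m: "meridian_system S x m"
    and \<gamma>: "\<gamma> \<in> paths_between (Conf d S) x (ins d S T x)"
    and H: "(i, j, k) \<in> hyps d S" "{i, j} \<subseteq> T"
  defines "P \<equiv> fundamental_group (Conf d S) x"
  defines "\<phi> \<equiv> fundamental_group_map (Conf d S) \<gamma> (ins d S T)"
  shows "\<phi> (m (i, j, k)) \<otimes>\<^bsub>P\<^esub> inv\<^bsub>P\<^esub> m (i, j, k) \<in> lower_central P 2"
proof -
  interpret P: plain_group P unfolding P_def using group_fundamental_group[OF x] by (simp add: plain_group_def)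
  have f: "maps (Conf d S) (Conf d S) (ins d S T)" using ins_maps[of S T S] S by blast
  have \<phi>: "\<phi> \<in> hom P P" unfolding P_def \<phi>_def
    using f by (intro fundamental_group_map_hom[of "Conf d S" "ins d S T" "Conf d S" x, OF _ _ x \<gamma>]) auto
  let ?A = "m (i, j, k)"
  have mc: "m H \<in> carrier P" if "H \<in> hyps d S" for H using m that unfolding meridian_system_def P_def by blast
  note A = mc[OF H(1)]
  have A': "?A \<in> path_classes (Conf d S)" "psrc ?A = ptgt ?A" using A by (auto simp: P_def fundamental_group_simps)
  have add: "windc H (B \<otimes>\<^bsub>P\<^esub> D) = windc H B + windc H D" if "H \<in> hyps d S" "B \<in> carrier P" "D \<in> carrier P" for H B D
    using that windc_pmul[OF that(1), of B D] by (simp add: P_def fundamental_group_simps)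
  have inv: "windc H (inv\<^bsub>P\<^esub> B) = - windc H B" if "H \<in> hyps d S" "B \<in> carrier P" for H B
    using that windc_pinv[OF that(1), of B] inv_fundamental_group[of B "Conf d S" x] by (simp add: P_def fundamental_group_simps)
  have w: "windc H' (\<phi> ?A) = windc H' ?A" if H': "H' \<in> hyps d S" for H'
  proof -
    obtain i' j' k' where H'e: "H' = (i', j', k')" by (cases H')
    have *: "windc H' (\<phi> ?A) = wn (ppush punctured (lform d H' \<circ> ins d S T) ?A)"
      unfolding \<phi>_def by (rule windc_fundamental_group_map[OF H' f \<gamma> A[unfolded P_def]])
    show ?thesis
    proof (cases "{i', j'} \<subseteq> T")
      case True
      then show ?thesis using * near_winding[OF S(1,2) S(2), of i' j' k' ?A] H' A'(1) by (simp add: H'e)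
    next
      case False
      then have "windc H' (\<phi> ?A) = 0" using * far_winding[OF S(1,2) S(2), of i' j' k' ?A] H' A' by (simp add: H'e)
      moreover have "windc H' ?A = 0" using m H H' False unfolding meridian_system_def H'e by auto
      ultimately show ?thesis by simp
    qed
  qed
  show ?thesis
  proof (rule P.dual_family_zero[of "hyps d S" m windc])
    show "m ` hyps d S \<subseteq> carrier P" using mc by blast
    show "carrier P = generate P (m ` hyps d S \<union> lower_central P 2)" using m unfolding meridian_system_def P_def by blast
    show "windc H' (m H) = of_bool (H = H')" if "H' \<in> hyps d S" "H \<in> hyps d S" for H H'
      using m that unfolding meridian_system_def by blast
    show "windc H' (\<phi> ?A \<otimes>\<^bsub>P\<^esub> inv\<^bsub>P\<^esub> ?A) = 0" if "H' \<in> hyps d S" for H'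
      using add[OF that, of "\<phi> ?A" "inv\<^bsub>P\<^esub> ?A"] inv[OF that A] w[OF that] A hom_in_carrier[OF \<phi>] by simp
  qed (use finite_hyps[OF S(1)] add A hom_in_carrier[OF \<phi>] in auto)
qed

text \<open>A left-normed commutator of \<open>j + 1\<close> meridians involves a set \<open>U\<close> of at most \<open>2 (j + 1)\<close> points and is fixed by the
  projection to \<open>U\<close>; so its images under the projections to \<open>T\<close> and to \<open>insert a T\<close> agree for \<open>a \<notin> U\<close>.\<close>

lemma alternating_projections_zero:
  assumes S: "finite S" and x: "x \<in> Conf d S" and A: "A \<subseteq> S" "2 * Suc j < card A"
    and b: "b \<in> some_basis (gr_space j (Conf d S) x :: ('k::field, _) module)"
    and v: "v \<in> carrier (gr_space j (Conf d S) x :: ('k, _) module)"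
  shows "(\<Sum>T\<in>Pow A. (-1) ^ card (A - T) *
    coord (gr_space j (Conf d S) x :: ('k, _) module) (induced j x (Conf d S) x (ins d S T) v) b) = 0"
proof -
  let ?M = "Conf d S" and ?P = "fundamental_group (Conf d S) x"
  let ?V = "gr_space j (Conf d S) x :: ('k, _) module"
  let ?e = "\<lambda>T. induced j x ?M x (ins d S T) :: _ \<Rightarrow> ((real \<Rightarrow> nat \<Rightarrow> complex) set set \<times> 'k \<Rightarrow>\<^sub>0 int) set"
  interpret V: fin_vectorspace ?V by (rule fin_vectorspace_Conf[OF S x])
  interpret P: gr_base ?P "TYPE('k)" j
    using group_fundamental_group[OF x] by (simp add: gr_base_def plain_group_def)
  obtain m where m: "meridian_system S x m" using meridian_system_exists[OF S x] by blast
  have pc: "path_connected ?M" by (rule path_connected_Conf[OF S])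
  have maps: "maps ?M ?M (ins d S T)" if "T \<subseteq> S" for T using ins_maps[OF S that that] .
  have hom: "?e T \<in> module_hom class_ring ?V ?V" if "T \<subseteq> S" for T
    by (rule induced_hom[OF pc maps[OF that] x x])
  let ?L = "\<lambda>v. \<Sum>T\<in>Pow A. (-1) ^ card (A - T) * coord ?V (?e T v) b"
  let ?Z = "{v \<in> carrier ?V. ?L v = 0}"
  have TS: "T \<subseteq> S" if "T \<in> Pow A" for T using that A by auto
  have cl: "?e T v \<in> carrier ?V" if "T \<in> Pow A" "v \<in> carrier ?V" for T v
    using module_hom_closed[OF hom[OF TS[OF that(1)]]] that(2) by blast
  have L_add: "?L (u \<oplus>\<^bsub>?V\<^esub> v) = ?L u + ?L v" if "u \<in> carrier ?V" "v \<in> carrier ?V" for u v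
    unfolding sum.distrib[symmetric] using that cl b
    by (intro sum.cong refl) (simp add: module_hom_add[OF hom[OF TS]] V.coord_add distrib_left del: Pow_iff)
  have L_smult: "?L (s \<odot>\<^bsub>?V\<^esub> v) = s * ?L v" if "v \<in> carrier ?V" for s v
    unfolding sum_distrib_left using that cl b
    by (intro sum.cong refl) (simp add: module_hom_smult[OF hom[OF TS]] V.coord_smult algebra_simps class_ring_simps del: Pow_iff)
  have L_zero: "?L \<zero>\<^bsub>?V\<^esub> = 0" using L_smult[of "\<zero>\<^bsub>?V\<^esub>" 0] by simp
  \<comment> \<open>The alternating sum is linear in \<open>v\<close>, so it is tested on
    commutators of meridians.\<close>
  have "?Z = carrier ?V"
  proof (rule P.gr_span[of "m ` hyps d S"])
    show "m ` hyps d S \<subseteq> carrier ?P" "carrier ?P = generate ?P (m ` hyps d S \<union> lower_central ?P 2)"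
      using m unfolding meridian_system_def by blast+
    show "submodule class_ring ?Z ?V"
      by (rule submodule.intro) (use V.module_axioms L_add L_smult L_zero in auto)
    fix xs assume xs: "length xs = Suc j" "set xs \<subseteq> m ` hyps d S"
    have xc: "set xs \<subseteq> carrier ?P" using xs(2) m unfolding meridian_system_def by blast
    have ln: "P.left_normed xs \<in> lower_central ?P (Suc j)" using P.left_normed_lower_central[OF xc] xs(1) by fastforce
    let ?u = "P.gre (P.left_normed xs) 1"
    have u: "?u \<in> carrier ?V" by (rule P.gre_closed[OF ln])
    have "\<forall>y\<in>set xs. \<exists>H. H \<in> hyps d S \<and> y = m H" using xs(2) by blast
    then obtain h where h: "\<And>y. y \<in> set xs \<Longrightarrow> h y \<in> hyps d S \<and> y = m (h y)" by metis
    \<comment> \<open>The points involved in the chosen hyperplanes of the entries: at most two for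
      each of the \<open>Suc j\<close> entries, hence fewer than \<open>card A\<close>.\<close>
    define U where "U = (\<Union>y\<in>set xs. {fst (h y), fst (snd (h y))})"
    have US: "U \<subseteq> S" using h by (fastforce simp: U_def hyps_def)
    have "card U \<le> (\<Sum>y\<in>set xs. card {fst (h y), fst (snd (h y))})" unfolding U_def by (rule card_UN_le) simp
    also have "\<dots> \<le> (\<Sum>y\<in>set xs. 2)" by (rule sum_mono) (simp add: card_insert_if)
    also have "\<dots> \<le> 2 * Suc j" using card_length[of xs] xs(1) by simp
    finally have "card U < card A" using A by simp
    moreover have "finite U" by (simp add: U_def)
    ultimately obtain a where a: "a \<in> A" "a \<notin> U" by (meson card_mono leD subsetI)
    define \<gamma> where "\<gamma> = (SOME \<gamma>. \<gamma> \<in> paths_between ?M x (ins d S U x))"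
    have \<gamma>: "\<gamma> \<in> paths_between ?M x (ins d S U x)" unfolding \<gamma>_def
      using maps[OF US] x by (intro paths_between_some[OF pc x]) auto
    let ?\<phi> = "fundamental_group_map ?M \<gamma> (ins d S U)"
    have \<phi>: "?\<phi> \<in> hom ?P ?P" using maps[OF US] by (intro fundamental_group_map_hom[of ?M "ins d S U" ?M x, OF _ _ x \<gamma>]) auto
    have "?\<phi> (P.left_normed xs) \<otimes>\<^bsub>?P\<^esub> inv\<^bsub>?P\<^esub> (P.left_normed xs) \<in> lower_central ?P (Suc (length xs))"
    proof (rule P.hom_left_normed[OF \<phi> _ xc])
      fix y assume y: "y \<in> set xs"
      obtain p q r where pqr: "h y = (p, q, r)" by (cases "h y")
      have "{p, q} \<subseteq> U" using y pqr by (force simp: U_def)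
      then show "?\<phi> y \<otimes>\<^bsub>?P\<^esub> inv\<^bsub>?P\<^esub> y \<in> lower_central ?P 2"
        using meridian_fixed[OF S US x m \<gamma>, of p q r] h[OF y] pqr by simp
    qed (use xs in auto)
    moreover have "?\<phi> (P.left_normed xs) \<in> carrier ?P" using hom_in_carrier[OF \<phi>] P.lower_central_carrier[OF ln] .
    ultimately have "lower_central ?P (Suc (Suc j)) #>\<^bsub>?P\<^esub> ?\<phi> (P.left_normed xs) = lower_central ?P (Suc (Suc j)) #>\<^bsub>?P\<^esub> P.left_normed xs"
      using P.rcoset_eq_iff[OF P.lower_central_subgroup] P.lower_central_carrier[OF ln] xs(1) by auto
    then have eU: "?e U ?u = ?u"
      using gr_map_elem[OF P.group_axioms P.group_axioms \<phi> ln, of "1 :: 'k"]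
      by (simp add: induced_def \<gamma>_def[symmetric] gr_elem_def)
    have eT: "?e T ?u = ?e (T \<inter> U) ?u" if T: "T \<subseteq> S" for T
    proof -
      have "?e T ?u = ?e T (?e U ?u)" by (simp add: eU)
      also have "\<dots> = induced j x ?M x (\<lambda>v. ins d S T (ins d S U v)) ?u"
        by (rule induced_comp[OF pc pc maps[OF US] maps[OF T] x x x u])
      also have "\<dots> = ?e (T \<inter> U) ?u"
        by (rule induced_homotopic[OF pc ins_ins_homotopic[OF S S T T US US] x x u])
      finally show ?thesis .
    qed
    have "?L ?u = 0"
    proof (rule alternating_sum_cancel[OF _ a(1)])
      fix T assume "T \<subseteq> A - {a}"
      then have "insert a T \<subseteq> S" "T \<subseteq> S" "insert a T \<inter> U = T \<inter> U" using a A by auto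
      then show "coord ?V (?e (insert a T) ?u) b = coord ?V (?e T ?u) b" using eT by metis
    qed (use S A finite_subset in blast)
    then show "?u \<in> ?Z" using u by simp
  qed
  then show ?thesis using v by blast
qed

end

section \<open>Cumulants of the trace\<close>

lemma maps_comp: "maps E Y f \<Longrightarrow> maps Y Z g \<Longrightarrow> maps E Z (\<lambda>x. g (f x))"
  using continuous_comp_into[of E f Y g Z] by (simp add: comp_def)

lemma homotopic_maps_left:
  assumes "homotopic_maps E Y f g" "maps Y Z h"
  shows "homotopic_maps E Z (\<lambda>x. h (f x)) (\<lambda>x. h (g x))"
  using homotopic_with_compose_continuous_left[of "\<lambda>_. True" h E Y f g Z] assms by (simp add: comp_def)

lemma homotopic_maps_right:
  assumes "homotopic_maps Y Z f g" "maps E Y h"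
  shows "homotopic_maps E Z (\<lambda>x. f (h x)) (\<lambda>x. g (h x))"
  using homotopic_with_compose_continuous_right[of "\<lambda>_. True" h Y Z f g E] assms by (simp add: comp_def)

context config begin

definition conf_trace :: "'k::field itself \<Rightarrow> nat \<Rightarrow> nat set \<Rightarrow> ((nat \<Rightarrow> complex) \<Rightarrow> (nat \<Rightarrow> complex)) \<Rightarrow> 'k" where
  "conf_trace K j S f = gr_trace K j (Conf d S) (\<lambda>i\<in>S. ray d i) f"

lemma conf_trace_homotopic:
  assumes "finite S" "homotopic_maps (Conf d S) (Conf d S) f g"
  shows "conf_trace TYPE('k::field) j S f = conf_trace TYPE('k) j S g"
  unfolding conf_trace_def
  by (rule gr_trace_homotopic[OF path_connected_Conf[OF assms(1)] assms(2) Conf_nonempty fin_vectorspace_Conf[OF assms(1) Conf_nonempty]])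

lemma conf_trace_cong:
  assumes "finite S" "maps (Conf d S) (Conf d S) f" "\<And>v. v \<in> Conf d S \<Longrightarrow> f v = g v"
  shows "conf_trace TYPE('k::field) j S f = conf_trace TYPE('k) j S g"
  by (rule conf_trace_homotopic[OF assms(1) homotopic_maps_equal[OF assms(2,3)]])

lemma conf_trace_commute:
  assumes S: "finite S" and T: "finite T" and f: "maps (Conf d S) (Conf d T) f" and g: "maps (Conf d T) (Conf d S) g"
  shows "conf_trace TYPE('k::field) j S (\<lambda>v. g (f v)) = conf_trace TYPE('k) j T (\<lambda>v. f (g v))"
  unfolding conf_trace_def
  by (rule gr_trace_commute[OF path_connected_Conf[OF S] Conf_nonempty fin_vectorspace_Conf[OF S Conf_nonempty]
        path_connected_Conf[OF T] Conf_nonempty fin_vectorspace_Conf[OF T Conf_nonempty] f g])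

text \<open>The identity map, read with different base points on its two sides, is inserted and
  moved around by cyclicity.\<close>

lemma gr_trace_conf_trace:
  assumes S: "finite S" "x \<in> Conf d S" and f: "maps (Conf d S) (Conf d S) f"
  shows "gr_trace TYPE('k::field) j (Conf d S) x f = conf_trace TYPE('k) j S f"
  unfolding conf_trace_def
  by (rule gr_trace_commute[OF path_connected_Conf[OF S(1)] S(2) fin_vectorspace_Conf[OF S]
        path_connected_Conf[OF S(1)] Conf_nonempty fin_vectorspace_Conf[OF S(1) Conf_nonempty] f, of "\<lambda>v. v"]) auto

definition proj_trace :: "'k::field itself \<Rightarrow> nat \<Rightarrow> nat set \<Rightarrow> (nat \<Rightarrow> int) \<Rightarrow> (nat \<Rightarrow> nat) \<Rightarrow> nat set \<Rightarrow> 'k" where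
  "proj_trace K j S g \<pi> T = conf_trace K j S (\<lambda>v. ins d S T (wr d S g \<pi> v))"

definition cumulant :: "'k::field itself \<Rightarrow> nat \<Rightarrow> nat set \<Rightarrow> (nat \<Rightarrow> int) \<Rightarrow> (nat \<Rightarrow> nat) \<Rightarrow> 'k" where
  "cumulant K j S g \<pi> = (\<Sum>T\<in>Pow S. (-1) ^ card (S - T) * proj_trace K j S g \<pi> T)"

lemma ins_wr:
  assumes "T \<subseteq> S"
  shows "ins d S T (wr d T g \<pi> v) = ins d S T (wr d S g \<pi> v)"
proof -
  have "(\<Sum>j\<in>T. norm (wr d T g \<pi> v j)) = (\<Sum>j\<in>T. norm (wr d S g \<pi> v j))"
    using assms by (intro sum.cong) (auto simp: wr_def)
  then show ?thesis using assms by (auto simp: ins_def wr_def fun_eq_iff)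
qed

context
  fixes S :: "nat set" and g :: "nat \<Rightarrow> int" and \<pi> :: "nat \<Rightarrow> nat"
  assumes fin: "finite S" and \<pi>: "inj_on \<pi> S" "\<pi> ` S \<subseteq> S"
begin

lemma wr_self_maps: "maps (Conf d S) (Conf d S) (wr d S g \<pi>)"
  by (rule wr_maps[OF \<pi>])

text \<open>With \<open>T'\<close> the preimage of \<open>T\<close>: double the projection to
  \<open>T\<close> by idempotency, move one copy to the other side of the action by cyclicity, and
  pull it back through the action, where it becomes the projection to \<open>T'\<close>.\<close>

lemma proj_trace_preimage:
  assumes T: "T \<subseteq> S"
  shows "proj_trace TYPE('k::field) j S g \<pi> T = proj_trace TYPE('k) j S g \<pi> (T \<inter> {i \<in> S. \<pi> i \<in> T})"
proof -
  let ?T' = "{i \<in> S. \<pi> i \<in> T}"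
  let ?e = "ins d S" and ?w = "wr d S g \<pi>"
  have T': "?T' \<subseteq> S" by blast
  have e: "maps (Conf d S) (Conf d S) (?e U)" if "U \<subseteq> S" for U by (rule ins_maps[OF fin that that])
  note w = wr_self_maps
  have "proj_trace TYPE('k) j S g \<pi> T = conf_trace TYPE('k) j S (\<lambda>v. ?e T (?e T (?w v)))"
    using homotopic_maps_right[OF ins_ins_homotopic[OF fin fin T T T T] w]
    unfolding proj_trace_def by (intro conf_trace_homotopic[OF fin, symmetric]) simp
  also have "\<dots> = conf_trace TYPE('k) j S (\<lambda>v. ?e T (?w (?e T v)))"
    by (rule conf_trace_commute[OF fin fin maps_comp[OF w e[OF T]] e[OF T]])
  also have "\<dots> = conf_trace TYPE('k) j S (\<lambda>v. ?e T (?e ?T' (?w v)))"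
    using homotopic_maps_left[OF wr_ins_homotopic[OF fin fin T T \<pi> refl] e[OF T]]
    unfolding ins_wr[OF T'] by (rule conf_trace_homotopic[OF fin])
  also have "\<dots> = proj_trace TYPE('k) j S g \<pi> (T \<inter> ?T')"
    unfolding proj_trace_def
    by (rule conf_trace_homotopic[OF fin homotopic_maps_right[OF ins_ins_homotopic[OF fin fin T T T' T'] w]])
  finally show ?thesis .
qed

text \<open>Iterating \<open>proj_trace_preimage\<close> shrinks \<open>T\<close> until it is
  stable. The set on the right is the largest stable subset of \<open>T\<close>.\<close>

lemma proj_trace_core:
  "T \<subseteq> S \<Longrightarrow> proj_trace TYPE('k::field) j S g \<pi> T = proj_trace TYPE('k) j S g \<pi> {i. \<forall>k. (\<pi> ^^ k) i \<in> T}"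
proof (induction "card T" arbitrary: T rule: less_induct)
  case less
  let ?T' = "T \<inter> {i \<in> S. \<pi> i \<in> T}"
  have finT: "finite T" using less.prems fin finite_subset by blast
  show ?case
  proof (cases "?T' = T")
    case True
    have "(\<pi> ^^ k) i \<in> T" if "i \<in> T" for i k using that True by (induction k) auto
    then have "{i. \<forall>k. (\<pi> ^^ k) i \<in> T} = T" by (auto dest: spec[of _ 0])
    then show ?thesis by simp
  next
    case False
    then have "card ?T' < card T" using finT by (intro psubset_card_mono) auto
    moreover have "(\<forall>k. (\<pi> ^^ k) i \<in> ?T') \<longleftrightarrow> (\<forall>k. (\<pi> ^^ k) i \<in> T)" for i
    proof
      assume *: "\<forall>k. (\<pi> ^^ k) i \<in> T"
      then have "\<pi> ((\<pi> ^^ k) i) \<in> T" for k using *[rule_format, of "Suc k"] by simp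
      then show "\<forall>k. (\<pi> ^^ k) i \<in> ?T'" using * less.prems by blast
    qed blast
    ultimately show ?thesis
      unfolding proj_trace_preimage[OF less.prems, where 'k = 'k and j = j]
      using less.hyps[of ?T', OF _ le_infI1[OF less.prems]] by simp
  qed
qed

text \<open>A point \<open>a\<close> of \<open>A\<close> with image outside \<open>A\<close> lies in
  no stable subset of \<open>A\<close>, so adding it to \<open>T\<close> does not change the
  trace.\<close>

lemma alternating_proj_trace_unstable:
  assumes A: "A \<subseteq> S" "\<not> \<pi> ` A \<subseteq> A"
  shows "(\<Sum>T\<in>Pow A. (-1) ^ card (A - T) * proj_trace TYPE('k::field) j S g \<pi> T) = 0"
proof -
  obtain a where a: "a \<in> A" "\<pi> a \<notin> A" using A by auto
  show ?thesis
  proof (rule alternating_sum_cancel[OF _ a(1)])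
    show "finite A" using fin A finite_subset by blast
    fix T assume T: "T \<subseteq> A - {a}"
    have "(\<forall>k. (\<pi> ^^ k) i \<in> insert a T) \<longleftrightarrow> (\<forall>k. (\<pi> ^^ k) i \<in> T)" for i
    proof
      assume *: "\<forall>k. (\<pi> ^^ k) i \<in> insert a T"
      have "(\<pi> ^^ k) i \<noteq> a" for k
      proof
        assume "(\<pi> ^^ k) i = a"
        then have "\<pi> a \<in> insert a T" using *[rule_format, of "Suc k"] by simp
        then show False using a T by auto
      qed
      then show "\<forall>k. (\<pi> ^^ k) i \<in> T" using * by blast
    qed blast
    moreover have "T \<subseteq> S" "insert a T \<subseteq> S" using T a A by auto
    ultimately show "proj_trace TYPE('k) j S g \<pi> (insert a T) = proj_trace TYPE('k) j S g \<pi> T"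
      using proj_trace_core[where 'k = 'k and j = j] by simp
  qed
qed

text \<open>Expanded over a basis, the alternating sum can be taken inside each diagonal
  coefficient, where \<open>alternating_projections_zero\<close> applies.\<close>

lemma alternating_proj_trace_large:
  assumes A: "A \<subseteq> S" "2 * Suc j < card A"
  shows "(\<Sum>T\<in>Pow A. (-1) ^ card (A - T) * proj_trace TYPE('k::field) j S g \<pi> T) = 0"
proof -
  let ?x = "\<lambda>i\<in>S. ray d i"
  let ?V = "gr_space j (Conf d S) ?x :: ('k, _) module"
  interpret V: fin_vectorspace ?V by (rule fin_vectorspace_Conf[OF fin Conf_nonempty])
  note pc = path_connected_Conf[OF fin]
  let ?i = "induced j ?x (Conf d S) ?x :: _ \<Rightarrow> _ \<Rightarrow> ((real \<Rightarrow> nat \<Rightarrow> complex) set set \<times> 'k \<Rightarrow>\<^sub>0 int) set"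
  have F: "proj_trace TYPE('k) j S g \<pi> T = (\<Sum>b\<in>V.BB. coord ?V (?i (ins d S T) (?i (wr d S g \<pi>) b)) b)" if "T \<in> Pow A" for T
  proof -
    have T: "T \<subseteq> S" using that A by blast
    show ?thesis
      unfolding proj_trace_def conf_trace_def gr_trace_def lin_trace_def
      using V.BB_carrier induced_comp[OF pc pc wr_self_maps ins_maps[OF fin T T] Conf_nonempty Conf_nonempty Conf_nonempty, where 'k = 'k and j = j]
      by (intro sum.cong refl) (simp add: subset_iff)
  qed
  have cl: "?i (wr d S g \<pi>) b \<in> carrier ?V" if "b \<in> V.BB" for b
    using module_hom_closed[OF induced_hom[OF pc wr_self_maps Conf_nonempty Conf_nonempty, where 'k = 'k and j = j]] that V.BB_carrier
    by blast
  have "(\<Sum>T\<in>Pow A. (-1) ^ card (A - T) * proj_trace TYPE('k) j S g \<pi> T)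
    = (\<Sum>T\<in>Pow A. \<Sum>b\<in>V.BB. (-1) ^ card (A - T) * coord ?V (?i (ins d S T) (?i (wr d S g \<pi>) b)) b)"
    using F by (simp add: sum_distrib_left)
  also have "\<dots> = (\<Sum>b\<in>V.BB. \<Sum>T\<in>Pow A. (-1) ^ card (A - T) * coord ?V (?i (ins d S T) (?i (wr d S g \<pi>) b)) b)"
    by (rule sum.swap)
  also have "\<dots> = 0"
    by (rule sum.neutral) (use alternating_projections_zero[OF fin Conf_nonempty A] cl in blast)
  finally show ?thesis .
qed

text \<open>The projection to \<open>T\<close> factors through the configurations of
  \<open>A\<close>, and cyclicity moves the trace there. This makes the cumulant of \<open>A\<close>
  independent of the surrounding set \<open>S\<close>.\<close>

lemma proj_trace_restrict:
  assumes A: "A \<subseteq> S" "\<pi> ` A \<subseteq> A" and T: "T \<subseteq> A"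
  shows "proj_trace TYPE('k::field) j S g \<pi> T = proj_trace TYPE('k) j A g \<pi> T"
proof -
  have finA: "finite A" using fin A finite_subset by blast
  have TS: "T \<subseteq> S" using T A by blast
  have iA: "inj_on \<pi> A" using \<pi>(1) A(1) by (rule inj_on_subset)
  have "\<pi> ` A = A" using iA A(2) finA by (simp add: endo_inj_surj)
  \<comment> \<open>By finiteness and injectivity a stable \<open>A\<close> is mapped onto itself,
    so no point outside can enter it and \<open>A\<close> is its own preimage.\<close>
  have "i \<in> A" if i: "i \<in> S" "\<pi> i \<in> A" for i
  proof -
    obtain a where "a \<in> A" "\<pi> i = \<pi> a" using i(2) \<open>\<pi> ` A = A\<close> by (metis imageE)
    then show ?thesis using inj_onD[OF \<pi>(1), of i a] i(1) A(1) by blast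
  qed
  then have pre: "{i \<in> S. \<pi> i \<in> A} = A" using A by blast
  note w = wr_self_maps
  have iAT: "maps (Conf d S) (Conf d A) (ins d A T)" by (rule ins_maps[OF finA T TS])
  have iSA: "maps (Conf d A) (Conf d S) (ins d S A)" by (rule ins_maps[OF fin A(1)]) simp
  have "homotopic_maps (Conf d S) (Conf d S) (\<lambda>v. ins d S A (ins d A T v)) (ins d S T)"
    using ins_ins_homotopic[OF fin finA _ A(1) T TS] T by (simp add: Int_absorb1)
  from homotopic_maps_right[OF this w]
  have "proj_trace TYPE('k) j S g \<pi> T = conf_trace TYPE('k) j S (\<lambda>v. ins d S A (ins d A T (wr d S g \<pi> v)))"
    unfolding proj_trace_def by (rule conf_trace_homotopic[OF fin, symmetric])
  also have "\<dots> = conf_trace TYPE('k) j A (\<lambda>v. ins d A T (wr d S g \<pi> (ins d S A v)))"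
    by (rule conf_trace_commute[OF fin finA maps_comp[OF w iAT] iSA])
  also have "\<dots> = conf_trace TYPE('k) j A (\<lambda>v. ins d A T (ins d S A (wr d A g \<pi> v)))"
    using wr_ins_homotopic[OF fin fin A(1) subset_refl \<pi> pre[symmetric]]
    by (intro conf_trace_homotopic[OF finA] homotopic_maps_left[OF _ iAT]) simp
  also have "(\<lambda>v. ins d A T (ins d S A (wr d A g \<pi> v))) = (\<lambda>v. ins d A T (wr d A g \<pi> v))"
  proof
    fix v
    have *: "ins d S A u i = u i" if "i \<in> A" for u i using that A by (auto simp: ins_def)
    have "(\<Sum>i\<in>T. norm (ins d S A u i)) = (\<Sum>i\<in>T. norm (u i))" for u
      using * T by (intro sum.cong) auto
    then show "ins d A T (ins d S A (wr d A g \<pi> v)) = ins d A T (wr d A g \<pi> v)"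
      unfolding ins_def[of d A T] using * T by (auto simp: fun_eq_iff)
  qed
  finally show ?thesis by (simp add: proj_trace_def)
qed

theorem trace_cumulants:
  "conf_trace TYPE('k::field) j S (wr d S g \<pi>)
    = (\<Sum>A | A \<subseteq> S \<and> \<pi> ` A \<subseteq> A \<and> card A \<le> 2 * Suc j. cumulant TYPE('k) j A g \<pi>)"
proof -
  let ?F = "proj_trace TYPE('k) j S g \<pi>"
  have "conf_trace TYPE('k) j S (wr d S g \<pi>) = ?F S"
    unfolding proj_trace_def using wr_self_maps by (intro conf_trace_cong[OF fin]) (auto simp: ins_self Pi_iff)
  also have "\<dots> = (\<Sum>A\<in>Pow S. \<Sum>T\<in>Pow A. (-1) ^ card (A - T) * ?F T)" by (rule moebius_Pow[OF fin, symmetric])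
  also have "\<dots> = (\<Sum>A | A \<subseteq> S \<and> \<pi> ` A \<subseteq> A \<and> card A \<le> 2 * Suc j. \<Sum>T\<in>Pow A. (-1) ^ card (A - T) * ?F T)"
  proof (rule sum.mono_neutral_right)
    show "\<forall>A\<in>Pow S - {A. A \<subseteq> S \<and> \<pi> ` A \<subseteq> A \<and> card A \<le> 2 * Suc j}. (\<Sum>T\<in>Pow A. (-1) ^ card (A - T) * ?F T) = 0"
    proof
      fix A assume A: "A \<in> Pow S - {A. A \<subseteq> S \<and> \<pi> ` A \<subseteq> A \<and> card A \<le> 2 * Suc j}"
      then have AS: "A \<subseteq> S" by blast
      show "(\<Sum>T\<in>Pow A. (-1) ^ card (A - T) * ?F T) = 0"
      proof (cases "\<pi> ` A \<subseteq> A")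
        case True
        then have "2 * Suc j < card A" using A by (simp only: DiffE Diff_iff mem_Collect_eq AS simp_thms not_le)
        with AS show ?thesis by (rule alternating_proj_trace_large)
      qed (rule alternating_proj_trace_unstable[OF AS])
    qed
  qed (use fin in auto)
  also have "\<dots> = (\<Sum>A | A \<subseteq> S \<and> \<pi> ` A \<subseteq> A \<and> card A \<le> 2 * Suc j. cumulant TYPE('k) j A g \<pi>)"
    unfolding cumulant_def by (intro sum.cong refl) (auto simp: proj_trace_restrict)
  finally show ?thesis .
qed

end

lemma rootc_cong:
  assumes "a mod int d = b mod int d"
  shows "rootc d a = rootc d b"
proof -
  obtain c where c: "a = b + int d * c" using assms unfolding mod_eq_dvd_iff by (metis add.commute diff_add_cancel dvdE)
  have "2 * pi * of_int a / of_nat d = 2 * pi * of_int b / of_nat d + 2 * pi * of_int c"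
    using d_pos by (simp add: c field_simps)
  then show ?thesis by (simp add: cis_mult[symmetric] cis_multiple_2pi)
qed

text \<open>Relabelling the points by \<open>\<theta>\<close> and rotating the coordinates by
  \<open>h\<close> is a homeomorphism that intertwines the two actions. The compatibility is needed
  only modulo \<open>d\<close>, as labels act through roots of unity.\<close>

lemma cumulant_conj:
  assumes fin: "finite A" "finite B" and \<pi>: "inj_on \<pi> A" "\<pi> ` A \<subseteq> A" and \<pi>': "inj_on \<pi>' B" "\<pi>' ` B \<subseteq> B"
    and \<theta>: "bij_betw \<theta> B A" "\<And>i. i \<in> B \<Longrightarrow> \<theta> (\<pi>' i) = \<pi> (\<theta> i)"
    and h: "\<And>i. i \<in> B \<Longrightarrow> (h i + g (\<theta> i)) mod int d = (g' i + h (\<pi>' i)) mod int d"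
  shows "cumulant TYPE('k::field) j A g \<pi> = cumulant TYPE('k) j B g' \<pi>'"
proof -
  define \<phi> where "\<phi> = inv_into B \<theta>"
  have \<phi>: "bij_betw \<phi> A B" "\<And>i. i \<in> A \<Longrightarrow> \<theta> (\<phi> i) = i" "\<And>i. i \<in> B \<Longrightarrow> \<phi> (\<theta> i) = i"
    unfolding \<phi>_def using \<theta>(1) bij_betw_inv_into bij_betw_inv_into_right bij_betw_inv_into_left by metis+
  have \<theta>': "inj_on \<theta> B" "\<theta> ` B \<subseteq> A" and \<phi>': "inj_on \<phi> A" "\<phi> ` A \<subseteq> B"
    using \<theta>(1) \<phi>(1) by (auto simp: bij_betw_def)
  define u where "u = wr d B h \<theta>"
  define u' where "u' = wr d A (\<lambda>i. - h (\<phi> i)) \<phi>"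
  let ?w = "wr d A g \<pi>" and ?w' = "wr d B g' \<pi>'"
  have u: "maps (Conf d A) (Conf d B) u" unfolding u_def by (rule wr_maps[OF \<theta>'])
  have u': "maps (Conf d B) (Conf d A) u'" unfolding u'_def by (rule wr_maps[OF \<phi>'])
  have w: "maps (Conf d A) (Conf d A) ?w" by (rule wr_maps[OF \<pi>])
  have w': "maps (Conf d B) (Conf d B) ?w'" by (rule wr_maps[OF \<pi>'])
  have u'u: "u' (u v) = v" if v: "v \<in> Conf d A" for v
  proof (rule Conf_eqI[OF _ v])
    show "u' (u v) \<in> Conf d A" using u u' v by auto
    fix i assume "i \<in> A"
    then show "u' (u v) i = v i"
      unfolding u_def u'_def using \<phi>' \<phi>(2) by (subst wr_wr) (auto simp: wr_def)
  qed
  have uu': "u (u' v) = v" if v: "v \<in> Conf d B" for v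
  proof (rule Conf_eqI[OF _ v])
    show "u (u' v) \<in> Conf d B" using u u' v by auto
    fix i assume "i \<in> B"
    then show "u (u' v) i = v i"
      unfolding u_def u'_def using \<theta>' \<phi>(3) by (subst wr_wr) (auto simp: wr_def)
  qed
  have uw: "u (?w v) = ?w' (u v)" for v
  proof -
    have "u (?w v) = wr d B (\<lambda>i. h i + g (\<theta> i)) (\<lambda>i. \<pi> (\<theta> i)) v" unfolding u_def using \<theta>' by (intro wr_wr) auto
    also have "\<dots> = wr d B (\<lambda>i. g' i + h (\<pi>' i)) (\<lambda>i. \<theta> (\<pi>' i)) v"
      using \<theta>(2) rootc_cong[OF h] by (auto simp: wr_def fun_eq_iff simp del: of_int_add)
    also have "\<dots> = ?w' (u v)" unfolding u_def using \<pi>' by (intro wr_wr[symmetric]) auto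
    finally show ?thesis .
  qed
  \<comment> \<open>The homeomorphism turns the projection to \<open>T\<close> into the projection
    to its preimage under \<open>\<theta>\<close>, up to homotopy.\<close>
  let ?p = "\<lambda>T. {i \<in> B. \<theta> i \<in> T}"
  have F: "proj_trace TYPE('k) j A g \<pi> T = proj_trace TYPE('k) j B g' \<pi>' (?p T)" if T: "T \<subseteq> A" for T
  proof -
    have pT: "?p T \<subseteq> B" by blast
    have e: "maps (Conf d A) (Conf d A) (ins d A T)" by (rule ins_maps[OF fin(1) T T])
    note ew = maps_comp[OF w e] and wu' = maps_comp[OF u' w]
    have "proj_trace TYPE('k) j A g \<pi> T = conf_trace TYPE('k) j A (\<lambda>v. u' (u (ins d A T (?w v))))"
      unfolding proj_trace_def using ew u'u by (intro conf_trace_cong[OF fin(1)]) (auto simp: Pi_iff)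
    also have "\<dots> = conf_trace TYPE('k) j B (\<lambda>v. u (ins d A T (?w (u' v))))"
      by (rule conf_trace_commute[OF fin maps_comp[OF ew u] u'])
    also have "\<dots> = conf_trace TYPE('k) j B (\<lambda>v. ins d B (?p T) (u (?w (u' v))))"
      using homotopic_maps_right[OF wr_ins_homotopic[OF fin T T \<theta>' refl, of h] wu']
      unfolding ins_wr[OF pT] u_def by (rule conf_trace_homotopic[OF fin(2)])
    also have "\<dots> = proj_trace TYPE('k) j B g' \<pi>' (?p T)"
      unfolding proj_trace_def uw
      using maps_comp[OF w' ins_maps[OF fin(2) pT pT]] uu'
      by (intro conf_trace_cong[OF fin(2), symmetric]) auto
    finally show ?thesis .
  qed
  show ?thesis
    unfolding cumulant_def
  proof (rule sum.reindex_bij_witness[where j = ?p and i = "\<lambda>T. \<theta> ` T"])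
    fix T assume T: "T \<in> Pow A"
    show "\<theta> ` ?p T = T" using T \<theta>(1) by (auto simp: bij_betw_def)
    have "bij_betw \<theta> (B - ?p T) (A - T)" using \<theta>(1) by (auto simp: bij_betw_def inj_on_def)
    then have "card (B - ?p T) = card (A - T)" by (rule bij_betw_same_card)
    then show "(-1) ^ card (B - ?p T) * proj_trace TYPE('k) j B g' \<pi>' (?p T) = (-1) ^ card (A - T) * proj_trace TYPE('k) j A g \<pi> T"
      using F T by simp
  next
    fix T assume T: "T \<in> Pow B"
    show "?p (\<theta> ` T) = T" using T \<theta>'(1) by (auto simp: inj_on_def)
  qed (use \<theta>' in auto)
qed

end

section \<open>Labelled cycle types\<close>

text \<open>The zeroth power is included, whereas \<open>Orbits.orbit\<close> begins with the first;
  on finite permutations the two agree.\<close>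

definition orb :: "('a \<Rightarrow> 'a) \<Rightarrow> 'a \<Rightarrow> 'a set" where
  "orb \<pi> i = range (\<lambda>k. (\<pi> ^^ k) i)"

lemma orb_self: "i \<in> orb \<pi> i"
  unfolding orb_def by (rule range_eqI[of _ _ 0]) simp

lemma orb_step: "\<pi> i \<in> orb \<pi> i"
  unfolding orb_def by (rule range_eqI[of _ _ 1]) simp

text \<open>Only the behaviour of \<open>\<pi>\<close> on \<open>A\<close> is constrained, so the
  same function serves every stable subset.\<close>

locale finite_perm =
  fixes A :: "'a set" and \<pi> :: "'a \<Rightarrow> 'a"
  assumes fin: "finite A" and inj: "inj_on \<pi> A" and into: "\<pi> ` A \<subseteq> A"
begin

lemma funpow_in: "i \<in> A \<Longrightarrow> (\<pi> ^^ k) i \<in> A"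
  using into by (induction k) auto

lemma orb_subset: "i \<in> A \<Longrightarrow> orb \<pi> i \<subseteq> A"
  by (auto simp: orb_def funpow_in)

lemma inj_funpow: "inj_on (\<pi> ^^ k) A"
proof (induction k)
  case (Suc k)
  show ?case
  proof (rule inj_onI)
    fix x y assume "x \<in> A" "y \<in> A" "(\<pi> ^^ Suc k) x = (\<pi> ^^ Suc k) y"
    then show "x = y" using inj_onD[OF inj, of "(\<pi> ^^ k) x" "(\<pi> ^^ k) y"] funpow_in inj_onD[OF Suc] by simp
  qed
qed simp

lemma funpow_return:
  assumes "i \<in> A" "(\<pi> ^^ a) i = (\<pi> ^^ b) i" "a < b"
  shows "(\<pi> ^^ (b - a)) i = i"
proof -
  have "(\<pi> ^^ a) ((\<pi> ^^ (b - a)) i) = (\<pi> ^^ (a + (b - a))) i" by (simp add: funpow_add)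
  also have "\<dots> = (\<pi> ^^ a) i" using assms by simp
  finally show ?thesis using inj_onD[OF inj_funpow] assms(1) funpow_in by metis
qed

lemma orb_period:
  assumes i: "i \<in> A"
  defines "m \<equiv> card (orb \<pi> i)"
  shows "m > 0" "(\<pi> ^^ m) i = i" "bij_betw (\<lambda>k. (\<pi> ^^ k) i) {..<m} (orb \<pi> i)"
proof -
  have "\<not> inj (\<lambda>k. (\<pi> ^^ k) i)"
    using finite_subset[OF orb_subset[OF i] fin] infinite_UNIV_nat finite_image_iff by (auto simp: orb_def)
  then obtain a b where ab: "(\<pi> ^^ a) i = (\<pi> ^^ b) i" "a \<noteq> b" by (auto simp: inj_def)
  then have ex: "\<exists>k>0. (\<pi> ^^ k) i = i"
    using funpow_return[OF i, of a b] funpow_return[OF i, of b a] by (metis nat_neq_iff zero_less_diff)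
  define p where "p = (LEAST k. k > 0 \<and> (\<pi> ^^ k) i = i)"
  have p: "p > 0" "(\<pi> ^^ p) i = i" using LeastI_ex[OF ex] by (auto simp: p_def)
  have min: "p \<le> k" if "k > 0" "(\<pi> ^^ k) i = i" for k using that by (auto simp: p_def intro: Least_le)
  have "inj_on (\<lambda>k. (\<pi> ^^ k) i) {..<p}"
  proof (rule linorder_inj_onI)
    fix a b assume ab: "a < b" "a \<in> {..<p}" "b \<in> {..<p}"
    show "(\<pi> ^^ a) i \<noteq> (\<pi> ^^ b) i"
    proof
      assume "(\<pi> ^^ a) i = (\<pi> ^^ b) i"
      then have "p \<le> b - a" using funpow_return[OF i _ ab(1)] ab by (intro min) auto
      then show False using ab by auto
    qed
  qed auto
  moreover have "orb \<pi> i = (\<lambda>k. (\<pi> ^^ k) i) ` {..<p}"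
  proof
    show "orb \<pi> i \<subseteq> (\<lambda>k. (\<pi> ^^ k) i) ` {..<p}"
    proof
      fix j assume "j \<in> orb \<pi> i"
      then obtain k where "j = (\<pi> ^^ k) i" by (auto simp: orb_def)
      then have "j = (\<pi> ^^ (k mod p)) i" using funpow_mod_eq[OF p(2)] by simp
      then show "j \<in> (\<lambda>k. (\<pi> ^^ k) i) ` {..<p}" using p(1) by auto
    qed
  qed (auto simp: orb_def)
  ultimately have bij: "bij_betw (\<lambda>k. (\<pi> ^^ k) i) {..<p} (orb \<pi> i)" by (simp add: bij_betw_def)
  then have "m = p" using bij_betw_same_card by (fastforce simp: m_def)
  then show "m > 0" "(\<pi> ^^ m) i = i" "bij_betw (\<lambda>k. (\<pi> ^^ k) i) {..<m} (orb \<pi> i)" using p bij by simp_all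
qed

lemma orb_eq:
  assumes i: "i \<in> A" and j: "j \<in> orb \<pi> i"
  shows "orb \<pi> j = orb \<pi> i"
proof -
  obtain a where a: "j = (\<pi> ^^ a) i" using j by (auto simp: orb_def)
  let ?m = "card (orb \<pi> i)"
  note m = orb_period[OF i]
  have "(\<pi> ^^ (?m * a)) i = i" using funpow_mod_eq[OF m(2), of "?m * a"] by simp
  moreover have "?m * a = (?m * a - a) + a" using m(1) by simp
  ultimately have b: "(\<pi> ^^ (?m * a - a)) j = i" unfolding a by (metis funpow_add comp_apply)
  have "(\<pi> ^^ k) j = (\<pi> ^^ (k + a)) i" for k by (simp add: a funpow_add)
  moreover have "(\<pi> ^^ k) i = (\<pi> ^^ (k + (?m * a - a))) j" for k by (simp add: b funpow_add)
  ultimately show ?thesis unfolding orb_def by blast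
qed

lemma orb_fibre:
  assumes "c \<in> orb \<pi> ` A"
  shows "{x \<in> A. orb \<pi> x = c} = c"
proof (rule equalityI; rule subsetI)
  fix x assume "x \<in> {x \<in> A. orb \<pi> x = c}"
  then show "x \<in> c" using orb_self[of x \<pi>] by simp
next
  fix x assume "x \<in> c"
  moreover obtain i where "i \<in> A" "c = orb \<pi> i" using assms by blast
  ultimately show "x \<in> {x \<in> A. orb \<pi> x = c}" using orb_eq[of i x] orb_subset[of i] by auto
qed

end

text \<open>Coordinates are permuted by the inverse of \<open>\<sigma>\<close>, while the cycles to
  be counted are those of \<open>\<sigma>\<close>.\<close>

lemma orb_inv:
  assumes "\<sigma> permutes S" "finite S" "i \<in> S"
  shows "orb (inv_into UNIV \<sigma>) i = orb \<sigma> i"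
proof -
  have sub: "orb (inv_into UNIV \<tau>) i \<subseteq> orb \<tau> i" if \<tau>: "\<tau> permutes S" for \<tau>
  proof
    fix j assume "j \<in> orb (inv_into UNIV \<tau>) i"
    then obtain k where k: "j = (inv_into UNIV \<tau> ^^ k) i" by (auto simp: orb_def)
    interpret finite_perm S \<tau> using \<tau> assms by (simp add: finite_perm_def permutes_inj_on permutes_image)
    interpret I: finite_perm S "inv_into UNIV \<tau>"
      using permutes_inv[OF \<tau>] assms by (simp add: finite_perm_def permutes_inj_on permutes_image)
    have "bij (\<tau> ^^ k)" using \<tau> by (intro bij_betw_funpow) (rule permutes_bij)
    then have "(\<tau> ^^ k) j = i" unfolding k using inv_fn[OF permutes_bij[OF \<tau>], of k] by (metis bij_inv_eq_iff)
    then have "i \<in> orb \<tau> j" by (auto simp: orb_def)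
    moreover have "j \<in> S" using I.funpow_in[OF assms(3)] k by simp
    ultimately show "j \<in> orb \<tau> i" using orb_eq orb_self by metis
  qed
  show ?thesis using sub[OF assms(1)] sub[OF permutes_inv[OF assms(1)]] permutes_inv_inv[OF assms(1)] by auto
qed

lemma bij_betw_glue:
  assumes f: "\<And>c. c \<in> C \<Longrightarrow> bij_betw (f c) {x \<in> D. k x = c} {y \<in> E. l y = c}"
    and k: "k ` D \<subseteq> C" and l: "l ` E \<subseteq> C"
  shows "bij_betw (\<lambda>x. f (k x) x) D E" "\<And>x. x \<in> D \<Longrightarrow> l (f (k x) x) = k x"
proof -
  have fx: "f (k x) x \<in> E \<and> l (f (k x) x) = k x" if "x \<in> D" for x
    using bij_betwE[OF f[of "k x"]] k that by auto
  then show "l (f (k x) x) = k x" if "x \<in> D" for x using that by blast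
  have "x = y" if xy: "x \<in> D" "y \<in> D" "f (k x) x = f (k y) y" for x y
  proof -
    have e: "k x = k y" using fx xy by metis
    show ?thesis
      using bij_betw_imp_inj_on[OF f[of "k x"]] k xy e by (auto simp: inj_on_def)
  qed
  moreover have "y \<in> (\<lambda>x. f (k x) x) ` D" if y: "y \<in> E" for y
  proof -
    have "y \<in> f (l y) ` {x \<in> D. k x = l y}" using bij_betw_imp_surj_on[OF f[of "l y"]] l y by auto
    then obtain x where "x \<in> D" "k x = l y" "y = f (l y) x" by blast
    then show ?thesis by (intro image_eqI[of _ _ x]) simp_all
  qed
  ultimately show "bij_betw (\<lambda>x. f (k x) x) D E" using fx by (auto simp: bij_betw_def inj_on_def)
qed

lemma bij_betw_same_fibres:
  assumes "finite D" "finite E" "\<And>c. card {x \<in> D. k x = c} = card {y \<in> E. l y = c}"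
  shows "\<exists>\<beta>. bij_betw \<beta> D E \<and> (\<forall>x\<in>D. l (\<beta> x) = k x)"
proof -
  have "\<forall>c. \<exists>f. bij_betw f {x \<in> D. k x = c} {y \<in> E. l y = c}"
    using assms by (intro allI finite_same_card_bij) auto
  then obtain f where "\<forall>c. bij_betw (f c) {x \<in> D. k x = c} {y \<in> E. l y = c}" by metis
  then show ?thesis using bij_betw_glue[of UNIV f D k E l] by auto
qed

text \<open>In a cyclic group a conjugacy class is a single element and the order of the factors is
  immaterial, so the label is a sum modulo \<open>d\<close>.\<close>

definition cycle_type :: "nat \<Rightarrow> ('a \<Rightarrow> int) \<Rightarrow> 'a set \<Rightarrow> nat \<times> int" where
  "cycle_type d g c = (card c, (\<Sum>i\<in>c. g i) mod int d)"

definition type_count :: "nat \<Rightarrow> ('a \<Rightarrow> int) \<Rightarrow> ('a \<Rightarrow> 'a) \<Rightarrow> 'a set \<Rightarrow> nat \<times> int \<Rightarrow> nat" where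
  "type_count d g \<pi> A t = card {c \<in> orb \<pi> ` A. cycle_type d g c = t}"

text \<open>Matching the two cycles step by step from their starting points; the relabelling \<open>h\<close> closes up modulo \<open>d\<close>
  because the two label sums agree.\<close>

lemma cycle_conj:
  assumes A: "finite_perm A \<pi>" "i \<in> A" and B: "finite_perm B \<pi>'" "i' \<in> B"
    and t: "cycle_type d g (orb \<pi> i) = cycle_type d g' (orb \<pi>' i')"
  shows "\<exists>\<theta> h. bij_betw \<theta> (orb \<pi>' i') (orb \<pi> i) \<and> (\<forall>l\<in>orb \<pi>' i'. \<theta> (\<pi>' l) = \<pi> (\<theta> l) \<and>
    (h l + g (\<theta> l)) mod int d = (g' l + h (\<pi>' l)) mod int d)"
proof -
  define m where "m = card (orb \<pi> i)"
  have m': "m = card (orb \<pi>' i')" using t by (simp add: cycle_type_def m_def)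
  note a = finite_perm.orb_period[OF A, folded m_def] and b = finite_perm.orb_period[OF B, folded m']
  define \<kappa> where "\<kappa> = inv_into {..<m} (\<lambda>k. (\<pi>' ^^ k) i')"
  have \<kappa>: "bij_betw \<kappa> (orb \<pi>' i') {..<m}" unfolding \<kappa>_def by (rule bij_betw_inv_into[OF b(3)])
  have \<kappa>_eq: "\<kappa> ((\<pi>' ^^ k) i') = k" if "k < m" for k
    unfolding \<kappa>_def using bij_betw_inv_into_left[OF b(3)] that by simp
  \<comment> \<open>The required congruence prescribes \<open>h\<close> at \<open>\<pi>' l\<close>
    from its value at \<open>l\<close>; \<open>?h\<close> solves this recursion from 0 at
    \<open>i'\<close>.\<close>
  let ?\<theta> = "\<lambda>l. (\<pi> ^^ \<kappa> l) i" and ?h = "\<lambda>l. \<Sum>k<\<kappa> l. g ((\<pi> ^^ k) i) - g' ((\<pi>' ^^ k) i')"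
  have "?\<theta> (\<pi>' l) = \<pi> (?\<theta> l) \<and> (?h l + g (?\<theta> l)) mod int d = (g' l + ?h (\<pi>' l)) mod int d"
    if l: "l \<in> orb \<pi>' i'" for l
  proof -
    obtain k where k: "k < m" "l = (\<pi>' ^^ k) i'" using l bij_betw_imp_surj_on[OF b(3)] by auto
    note kl = \<kappa>_eq[OF k(1), folded k(2)]
    show ?thesis
    proof (cases "Suc k < m")
      case True
      have "\<kappa> (\<pi>' l) = Suc k" using \<kappa>_eq[OF True] k by simp
      then show ?thesis using kl k by simp
    next
      case False
      then have sk: "Suc k = m" using k by simp
      have p: "\<pi>' l = i'" using b(2) k sk by auto
      have z: "\<kappa> (\<pi>' l) = 0" using \<kappa>_eq[OF b(1)] p by simp
      have "\<pi> (?\<theta> l) = (\<pi> ^^ m) i" using kl sk by auto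
      then have th: "?\<theta> (\<pi>' l) = \<pi> (?\<theta> l)" using z a(2) by simp
      have s: "(\<Sum>k<m. g ((\<pi> ^^ k) i)) = (\<Sum>x\<in>orb \<pi> i. g x)" "(\<Sum>k<m. g' ((\<pi>' ^^ k) i')) = (\<Sum>x\<in>orb \<pi>' i'. g' x)"
        by (rule sum.reindex_bij_betw[OF a(3)] sum.reindex_bij_betw[OF b(3)])+
      have "?h l + g (?\<theta> l) - g' l = (\<Sum>k<Suc k. g ((\<pi> ^^ k) i) - g' ((\<pi>' ^^ k) i'))" using kl k by simp
      also have "\<dots> = (\<Sum>x\<in>orb \<pi> i. g x) - (\<Sum>x\<in>orb \<pi>' i'. g' x)" unfolding sk sum_subtractf s ..
      finally have "int d dvd ?h l + g (?\<theta> l) - g' l" using t by (simp add: cycle_type_def mod_eq_dvd_iff)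
      then have "(?h l + g (?\<theta> l)) mod int d = (g' l + ?h (\<pi>' l)) mod int d" using z by (simp add: mod_eq_dvd_iff)
      with th show ?thesis by blast
    qed
  qed
  moreover have "bij_betw ?\<theta> (orb \<pi>' i') (orb \<pi> i)" using bij_betw_trans[OF \<kappa> a(3)] by (simp add: comp_def)
  ultimately show ?thesis by (intro exI[of _ ?\<theta>] exI[of _ ?h]) blast
qed

text \<open>Equal counts allow cycles of the same type to be matched by \<open>\<beta>\<close>; the
  conjugations of \<open>cycle_conj\<close> are then glued cycle by cycle.\<close>

lemma labelled_perm_conj:
  assumes A: "finite_perm A \<pi>" and B: "finite_perm B \<pi>'" and t: "type_count d g \<pi> A = type_count d g' \<pi>' B"
  shows "\<exists>\<theta> h. bij_betw \<theta> B A \<and> (\<forall>l\<in>B. \<theta> (\<pi>' l) = \<pi> (\<theta> l) \<and>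
    (h l + g (\<theta> l)) mod int d = (g' l + h (\<pi>' l)) mod int d)"
proof -
  interpret A: finite_perm A \<pi> by fact
  interpret B: finite_perm B \<pi>' by fact
  have "\<exists>\<beta>. bij_betw \<beta> (orb \<pi>' ` B) (orb \<pi> ` A) \<and> (\<forall>c\<in>orb \<pi>' ` B. cycle_type d g (\<beta> c) = cycle_type d g' c)"
    using A.fin B.fin t by (intro bij_betw_same_fibres) (auto simp: type_count_def fun_eq_iff)
  then obtain \<beta> where \<beta>: "bij_betw \<beta> (orb \<pi>' ` B) (orb \<pi> ` A)" "\<forall>c\<in>orb \<pi>' ` B. cycle_type d g (\<beta> c) = cycle_type d g' c"
    by blast
  \<comment> \<open>Each point of \<open>A\<close> is tagged with the matching cycle of
    \<open>B\<close>, so that both sets are fibred over the cycles of \<open>B\<close>.\<close>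
  define l where "l = (\<lambda>y. inv_into (orb \<pi>' ` B) \<beta> (orb \<pi> y))"
  have lB: "l y \<in> orb \<pi>' ` B" if "y \<in> A" for y
    using bij_betwE[OF bij_betw_inv_into[OF \<beta>(1)]] that by (auto simp: l_def)
  have lc: "l y = c \<longleftrightarrow> orb \<pi> y = \<beta> c" if "y \<in> A" "c \<in> orb \<pi>' ` B" for y c
  proof -
    have "\<beta> (l y) = orb \<pi> y" unfolding l_def using that by (intro bij_betw_inv_into_right[OF \<beta>(1)]) simp
    moreover have "inv_into (orb \<pi>' ` B) \<beta> (\<beta> c) = c" using bij_betw_inv_into_left[OF \<beta>(1) that(2)] .
    ultimately show ?thesis unfolding l_def by auto
  qed
  have "\<forall>c\<in>orb \<pi>' ` B. \<exists>\<theta> h. bij_betw \<theta> c (\<beta> c) \<and> (\<forall>l\<in>c. \<theta> (\<pi>' l) = \<pi> (\<theta> l) \<and>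
    (h l + g (\<theta> l)) mod int d = (g' l + h (\<pi>' l)) mod int d)"
  proof
    fix c assume c: "c \<in> orb \<pi>' ` B"
    then obtain i' where i': "i' \<in> B" "c = orb \<pi>' i'" by blast
    have "\<beta> c \<in> orb \<pi> ` A" using bij_betwE[OF \<beta>(1)] c by blast
    then obtain i where i: "i \<in> A" "\<beta> c = orb \<pi> i" by blast
    have "cycle_type d g (orb \<pi> i) = cycle_type d g' (orb \<pi>' i')" using \<beta>(2) c i i' by metis
    from cycle_conj[OF A i(1) B i'(1) this]
    show "\<exists>\<theta> h. bij_betw \<theta> c (\<beta> c) \<and> (\<forall>l\<in>c. \<theta> (\<pi>' l) = \<pi> (\<theta> l) \<and>
      (h l + g (\<theta> l)) mod int d = (g' l + h (\<pi>' l)) mod int d)" unfolding i'(2)[symmetric] i(2)[symmetric] .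
  qed
  from bchoice[OF this] obtain \<theta> where "\<forall>c\<in>orb \<pi>' ` B. \<exists>h. bij_betw (\<theta> c) c (\<beta> c) \<and> (\<forall>l\<in>c. \<theta> c (\<pi>' l) = \<pi> (\<theta> c l) \<and>
    (h l + g (\<theta> c l)) mod int d = (g' l + h (\<pi>' l)) mod int d)" ..
  from bchoice[OF this] obtain h where \<theta>h: "\<forall>c\<in>orb \<pi>' ` B. bij_betw (\<theta> c) c (\<beta> c) \<and> (\<forall>l\<in>c. \<theta> c (\<pi>' l) = \<pi> (\<theta> c l) \<and>
    (h c l + g (\<theta> c l)) mod int d = (g' l + h c (\<pi>' l)) mod int d)" ..
  have "bij_betw (\<lambda>x. \<theta> (orb \<pi>' x) x) B A"
  proof (rule bij_betw_glue(1)[where C = "orb \<pi>' ` B" and l = l])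
    fix c assume c: "c \<in> orb \<pi>' ` B"
    have "{x \<in> B. orb \<pi>' x = c} = c" by (rule B.orb_fibre[OF c])
    moreover have "{y \<in> A. l y = c} = \<beta> c"
    proof -
      have "\<beta> c \<in> orb \<pi> ` A" using bij_betwE[OF \<beta>(1)] c by blast
      then have "{y \<in> A. orb \<pi> y = \<beta> c} = \<beta> c" by (rule A.orb_fibre)
      then show ?thesis using lc[OF _ c] by (simp cong: conj_cong)
    qed
    ultimately show "bij_betw (\<theta> c) {x \<in> B. orb \<pi>' x = c} {y \<in> A. l y = c}" using conjunct1[OF bspec[OF \<theta>h c]] by simp
  qed (use lB in auto)
  moreover have "\<forall>x\<in>B. \<theta> (orb \<pi>' (\<pi>' x)) (\<pi>' x) = \<pi> (\<theta> (orb \<pi>' x) x) \<and>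
    (h (orb \<pi>' x) x + g (\<theta> (orb \<pi>' x) x)) mod int d = (g' x + h (orb \<pi>' (\<pi>' x)) (\<pi>' x)) mod int d"
  proof
    fix x assume x: "x \<in> B"
    have c: "orb \<pi>' x \<in> orb \<pi>' ` B" using x by (rule imageI)
    show "\<theta> (orb \<pi>' (\<pi>' x)) (\<pi>' x) = \<pi> (\<theta> (orb \<pi>' x) x) \<and>
      (h (orb \<pi>' x) x + g (\<theta> (orb \<pi>' x) x)) mod int d = (g' x + h (orb \<pi>' (\<pi>' x)) (\<pi>' x)) mod int d"
      unfolding B.orb_eq[OF x orb_step] by (rule bspec[OF conjunct2[OF bspec[OF \<theta>h c]] orb_self])
  qed
  ultimately show ?thesis
    by (intro exI[of _ "\<lambda>x. \<theta> (orb \<pi>' x) x"] exI[of _ "\<lambda>x. h (orb \<pi>' x) x"] conjI)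
qed

text \<open>Prescribing how many elements of each kind a subset has amounts to an independent choice
  in every fibre.\<close>

lemma card_subsets_fibres:
  assumes X: "finite X0" and O: "finite D" and \<mu>: "\<And>t. t \<notin> X0 \<Longrightarrow> \<mu> t = 0"
  shows "card {B. B \<subseteq> D \<and> (\<forall>t. card {c \<in> B. k c = t} = \<mu> t)} = (\<Prod>t\<in>X0. card {c \<in> D. k c = t} choose \<mu> t)"
proof -
  let ?L = "{B. B \<subseteq> D \<and> (\<forall>t. card {c \<in> B. k c = t} = \<mu> t)}"
  let ?R = "\<lambda>t. {C. C \<subseteq> {c \<in> D. k c = t} \<and> card C = \<mu> t}"
  have "bij_betw (\<lambda>B. \<lambda>t\<in>X0. {c \<in> B. k c = t}) ?L (PiE X0 ?R)"
  proof (rule bij_betw_byWitness[where f' = "\<lambda>f. \<Union>t\<in>X0. f t"])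
    show "\<forall>B\<in>?L. (\<Union>t\<in>X0. (\<lambda>t\<in>X0. {c \<in> B. k c = t}) t) = B"
    proof
      fix B assume B: "B \<in> ?L"
      then have fB: "finite B" using O finite_subset by blast
      have "k c \<in> X0" if "c \<in> B" for c
      proof (rule ccontr)
        assume "k c \<notin> X0"
        then have "card {c' \<in> B. k c' = k c} = 0" using B \<mu> by auto
        then show False using fB that by auto
      qed
      then show "(\<Union>t\<in>X0. (\<lambda>t\<in>X0. {c \<in> B. k c = t}) t) = B" by auto
    qed
    have restr: "{c \<in> \<Union>t\<in>X0. f t. k c = t} = (if t \<in> X0 then f t else {})" if f: "f \<in> PiE X0 ?R" for f t
    proof -
      have m: "k c = s" if "s \<in> X0" "c \<in> f s" for s c using PiE_mem[OF f that(1)] that(2) by blast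
      show ?thesis
      proof (cases "t \<in> X0")
        case True
        then show ?thesis using m by auto
      next
        case False
        then show ?thesis using m by auto
      qed
    qed
    show "\<forall>f\<in>PiE X0 ?R. (\<lambda>t\<in>X0. {c \<in> \<Union>t\<in>X0. f t. k c = t}) = f"
    proof
      fix f assume f: "f \<in> PiE X0 ?R"
      show "(\<lambda>t\<in>X0. {c \<in> \<Union>t\<in>X0. f t. k c = t}) = f"
        unfolding restr[OF f] using PiE_arb[OF f] by (simp add: fun_eq_iff)
    qed
    show "(\<lambda>B. \<lambda>t\<in>X0. {c \<in> B. k c = t}) ` ?L \<subseteq> PiE X0 ?R" by auto
    show "(\<lambda>f. \<Union>t\<in>X0. f t) ` PiE X0 ?R \<subseteq> ?L"
    proof (intro image_subsetI CollectI conjI allI)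
      fix f assume f: "f \<in> PiE X0 ?R"
      show "(\<Union>t\<in>X0. f t) \<subseteq> D" using PiE_mem[OF f] by blast
      fix t show "card {c \<in> \<Union>t\<in>X0. f t. k c = t} = \<mu> t"
        unfolding restr[OF f] using PiE_mem[OF f, of t] \<mu>[of t] by auto
    qed
  qed
  then have "card ?L = card (PiE X0 ?R)" by (rule bij_betw_same_card)
  also have "\<dots> = (\<Prod>t\<in>X0. card {c \<in> D. k c = t} choose \<mu> t)"
    using O by (simp add: card_PiE[OF X] n_subsets)
  finally show ?thesis .
qed

context finite_perm begin

lemma finite_perm_subset: "B \<subseteq> A \<Longrightarrow> \<pi> ` B \<subseteq> B \<Longrightarrow> finite_perm B \<pi>"
  using fin inj finite_subset inj_on_subset by (auto simp: finite_perm_def)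

text \<open>A stable subset is the union of its cycles, so choosing one means choosing how many and
  which cycles of each type; hence the binomial coefficients.\<close>

lemma card_stable_type:
  assumes "finite X0" "\<And>t. t \<notin> X0 \<Longrightarrow> \<mu> t = 0"
  shows "card {B. B \<subseteq> A \<and> \<pi> ` B \<subseteq> B \<and> type_count d g \<pi> B = \<mu>} = (\<Prod>t\<in>X0. type_count d g \<pi> A t choose \<mu> t)"
proof -
  have stable: "\<Union> (orb \<pi> ` B) = B" if "B \<subseteq> A" "\<pi> ` B \<subseteq> B" for B
    using finite_perm.orb_subset[OF finite_perm_subset[OF that]] orb_self by fast
  have orbs: "orb \<pi> ` \<Union> C = C" if C: "C \<subseteq> orb \<pi> ` A" for C
  proof
    show "orb \<pi> ` \<Union> C \<subseteq> C"
    proof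
      fix y assume "y \<in> orb \<pi> ` \<Union> C"
      then obtain c x where cx: "c \<in> C" "x \<in> c" "y = orb \<pi> x" by blast
      then obtain i where "i \<in> A" "c = orb \<pi> i" using C by blast
      then show "y \<in> C" using cx orb_eq[of i x] by simp
    qed
    show "C \<subseteq> orb \<pi> ` \<Union> C"
    proof
      fix c assume c: "c \<in> C"
      then obtain i where i: "c = orb \<pi> i" using C by blast
      show "c \<in> orb \<pi> ` \<Union> C"
        by (rule image_eqI[of _ _ i], rule i, rule UnionI[OF c]) (simp add: i orb_self)
    qed
  qed
  have "bij_betw (image (orb \<pi>)) {B. B \<subseteq> A \<and> \<pi> ` B \<subseteq> B \<and> type_count d g \<pi> B = \<mu>}
    {C. C \<subseteq> orb \<pi> ` A \<and> (\<forall>t. card {c \<in> C. cycle_type d g c = t} = \<mu> t)}"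
  proof (rule bij_betw_byWitness[where f' = Union])
    show "\<forall>B\<in>{B. B \<subseteq> A \<and> \<pi> ` B \<subseteq> B \<and> type_count d g \<pi> B = \<mu>}. \<Union> (orb \<pi> ` B) = B" using stable by blast
    show "\<forall>C\<in>{C. C \<subseteq> orb \<pi> ` A \<and> (\<forall>t. card {c \<in> C. cycle_type d g c = t} = \<mu> t)}. orb \<pi> ` \<Union> C = C" using orbs by blast
    show "image (orb \<pi>) ` {B. B \<subseteq> A \<and> \<pi> ` B \<subseteq> B \<and> type_count d g \<pi> B = \<mu>}
      \<subseteq> {C. C \<subseteq> orb \<pi> ` A \<and> (\<forall>t. card {c \<in> C. cycle_type d g c = t} = \<mu> t)}"
      by (auto simp: type_count_def)
    show "Union ` {C. C \<subseteq> orb \<pi> ` A \<and> (\<forall>t. card {c \<in> C. cycle_type d g c = t} = \<mu> t)}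
      \<subseteq> {B. B \<subseteq> A \<and> \<pi> ` B \<subseteq> B \<and> type_count d g \<pi> B = \<mu>}"
    proof (rule image_subsetI)
      fix C assume C: "C \<in> {C. C \<subseteq> orb \<pi> ` A \<and> (\<forall>t. card {c \<in> C. cycle_type d g c = t} = \<mu> t)}"
      then have CA: "C \<subseteq> orb \<pi> ` A" by blast
      have 1: "\<Union> C \<subseteq> A" using CA orb_subset by blast
      have 2: "\<pi> ` \<Union> C \<subseteq> \<Union> C"
      proof
        fix y assume "y \<in> \<pi> ` \<Union> C"
        then obtain c x where cx: "c \<in> C" "x \<in> c" "y = \<pi> x" by blast
        then obtain i where i: "i \<in> A" "c = orb \<pi> i" using CA by blast
        have "y \<in> orb \<pi> x" unfolding cx(3) by (rule orb_step)
        then have "y \<in> c" using orb_eq[of i x] i cx by simp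
        then show "y \<in> \<Union> C" using cx by blast
      qed
      have "type_count d g \<pi> (\<Union> C) = \<mu>" using C by (auto simp: type_count_def orbs[OF CA])
      with 1 2 show "\<Union> C \<in> {B. B \<subseteq> A \<and> \<pi> ` B \<subseteq> B \<and> type_count d g \<pi> B = \<mu>}" by blast
    qed
  qed
  then have "card {B. B \<subseteq> A \<and> \<pi> ` B \<subseteq> B \<and> type_count d g \<pi> B = \<mu>}
    = card {C. C \<subseteq> orb \<pi> ` A \<and> (\<forall>t. card {c \<in> C. cycle_type d g c = t} = \<mu> t)}" by (rule bij_betw_same_card)
  also have "\<dots> = (\<Prod>t\<in>X0. card {c \<in> orb \<pi> ` A. cycle_type d g c = t} choose \<mu> t)"
    by (rule card_subsets_fibres[OF assms(1) finite_imageI[OF fin] assms(2)])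
  finally show ?thesis unfolding type_count_def[of d g \<pi> A, symmetric] .
qed

lemma card_type_count:
  assumes "finite X0" "\<And>t. t \<notin> X0 \<Longrightarrow> type_count d g \<pi> A t = 0"
  shows "card A = (\<Sum>t\<in>X0. fst t * type_count d g \<pi> A t)"
proof -
  have tX: "cycle_type d g c \<in> X0" if c: "c \<in> orb \<pi> ` A" for c
  proof (rule ccontr)
    assume "cycle_type d g c \<notin> X0"
    then show False using assms(2)[of "cycle_type d g c"] c fin by (auto simp: type_count_def)
  qed
  have dj: "c \<inter> c' = {}" if "c \<in> orb \<pi> ` A" "c' \<in> orb \<pi> ` A" "c \<noteq> c'" for c c'
  proof (rule ccontr)
    assume "c \<inter> c' \<noteq> {}"
    then obtain x where "x \<in> c" "x \<in> c'" by blast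
    moreover obtain i i' where "i \<in> A" "c = orb \<pi> i" "i' \<in> A" "c' = orb \<pi> i'" using \<open>c \<in> _\<close> \<open>c' \<in> _\<close> by blast
    ultimately have "c = c'" using orb_eq[of i x] orb_eq[of i' x] by simp
    then show False using \<open>c \<noteq> c'\<close> by simp
  qed
  have fo: "finite c" if "c \<in> orb \<pi> ` A" for c using that orb_subset fin finite_subset by blast
  have "A = \<Union> (orb \<pi> ` A)" using orb_self orb_subset by fast
  then have "card A = card (\<Union> (orb \<pi> ` A))" by simp
  also have "\<dots> = (\<Sum>c\<in>orb \<pi> ` A. card c)"
    using dj fo by (intro card_Union_disjoint) (auto simp: pairwise_def disjnt_def)
  also have "\<dots> = (\<Sum>c\<in>orb \<pi> ` A. fst (cycle_type d g c))" by (simp add: cycle_type_def)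
  also have "\<dots> = (\<Sum>t\<in>X0. \<Sum>c\<in>{c \<in> orb \<pi> ` A. cycle_type d g c = t}. fst (cycle_type d g c))"
    using fin tX assms(1) by (intro sum.group[symmetric]) auto
  also have "\<dots> = (\<Sum>t\<in>X0. fst t * type_count d g \<pi> A t)"
    by (intro sum.cong refl) (simp add: type_count_def)
  finally show ?thesis .
qed

lemma type_count_nonzero:
  assumes "type_count d g \<pi> A t \<noteq> 0" "d \<ge> 1"
  shows "t \<in> {1..card A} \<times> {0..<int d}"
proof -
  have "{c \<in> orb \<pi> ` A. cycle_type d g c = t} \<noteq> {}" using assms(1) by (auto simp only: type_count_def card.empty)
  then obtain i where i: "i \<in> A" "t = cycle_type d g (orb \<pi> i)" by auto
  have "card (orb \<pi> i) \<le> card A" by (rule card_mono[OF fin orb_subset[OF i(1)]])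
  then show ?thesis using orb_period(1)[OF i(1)] assms(2) by (auto simp: i(2) cycle_type_def)
qed

end

section \<open>The trace as a function of the cycle counts\<close>

context config begin

text \<open>For a type that occurs, the choice does not matter, as
  \<open>cumulant_type_value\<close> shows. The realization may use any finite set of points, so
  these coefficients are the same for all \<open>n\<close>.\<close>

definition type_value :: "'k::field itself \<Rightarrow> nat \<Rightarrow> (nat \<times> int \<Rightarrow> nat) \<Rightarrow> 'k" where
  "type_value K j \<mu> = (SOME c. \<exists>A g \<pi>. finite_perm A \<pi> \<and> type_count d g \<pi> A = \<mu> \<and> c = cumulant K j A g \<pi>)"

lemma cumulant_type_value:
  assumes A: "finite_perm A \<pi>"
  shows "cumulant TYPE('k::field) j A g \<pi> = type_value TYPE('k) j (type_count d g \<pi> A)"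
proof -
  let ?c = "type_value TYPE('k) j (type_count d g \<pi> A)"
  have "\<exists>B g' \<pi>'. finite_perm B \<pi>' \<and> type_count d g' \<pi>' B = type_count d g \<pi> A \<and> ?c = cumulant TYPE('k) j B g' \<pi>'"
    unfolding type_value_def by (rule someI_ex) (use A in blast)
  then obtain B g' \<pi>' where B: "finite_perm B \<pi>'" "type_count d g' \<pi>' B = type_count d g \<pi> A" "?c = cumulant TYPE('k) j B g' \<pi>'"
    by blast
  obtain \<theta> h where "bij_betw \<theta> B A" "\<forall>l\<in>B. \<theta> (\<pi>' l) = \<pi> (\<theta> l) \<and> (h l + g (\<theta> l)) mod int d = (g' l + h (\<pi>' l)) mod int d"
    using labelled_perm_conj[OF A B(1) B(2)[symmetric]] by blast
  then show ?thesis
    using A B(1) unfolding B(3) finite_perm_def by (intro cumulant_conj[of A B \<pi> \<pi>' \<theta> h g g']) auto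
qed

text \<open>\<open>fst t * \<mu> t\<close> counts the points on cycles of type \<open>t\<close>, so
  these are the types on at most \<open>N\<close> points. This finite set indexes the terms of the
  character polynomial.\<close>

definition small_types :: "nat \<Rightarrow> (nat \<times> int \<Rightarrow> nat) set" where
  "small_types N = {\<mu>. (\<forall>t. t \<notin> {1..N} \<times> {0..<int d} \<longrightarrow> \<mu> t = 0) \<and> (\<Sum>t\<in>{1..N} \<times> {0..<int d}. fst t * \<mu> t) \<le> N}"

lemma finite_small_types: "finite (small_types N)"
proof -
  let ?X = "{1..N} \<times> {0..<int d}"
  have "\<mu> t \<le> N" if \<mu>: "\<mu> \<in> small_types N" and t: "t \<in> ?X" for \<mu> t
  proof -
    have "\<mu> t \<le> fst t * \<mu> t" using t by (cases "fst t") auto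
    also have "\<dots> \<le> (\<Sum>t\<in>?X. fst t * \<mu> t)" using t by (intro member_le_sum) auto
    finally show ?thesis using \<mu> by (simp add: small_types_def)
  qed
  then have "small_types N \<subseteq> {\<mu>. \<forall>t. (t \<in> ?X \<longrightarrow> \<mu> t \<in> {..N}) \<and> (t \<notin> ?X \<longrightarrow> \<mu> t = 0)}"
    by (auto simp: small_types_def)
  moreover have "finite {\<mu>. \<forall>t. (t \<in> ?X \<longrightarrow> \<mu> t \<in> {..N}) \<and> (t \<notin> ?X \<longrightarrow> \<mu> t = 0)}"
    by (rule finite_set_of_finite_funs) (rule finite_cartesian_product, simp_all only: finite_atLeastAtMost finite_atLeastLessThan_int finite_atMost)
  ultimately show ?thesis by (rule finite_subset)
qed

theorem trace_type_counts:
  fixes j :: nat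
  assumes "finite_perm S \<pi>"
  defines "N \<equiv> 2 * Suc j"
  shows "conf_trace TYPE('k::field) j S (wr d S g \<pi>)
    = (\<Sum>\<mu>\<in>small_types N. type_value TYPE('k) j \<mu> * (\<Prod>t\<in>{1..N} \<times> {0..<int d}. of_nat (type_count d g \<pi> S t choose \<mu> t)))"
proof -
  interpret finite_perm S \<pi> by fact
  let ?X = "{1..N} \<times> {0..<int d}" and ?t = "type_count d g \<pi>"
  let ?B = "{A. A \<subseteq> S \<and> \<pi> ` A \<subseteq> A \<and> card A \<le> N}"
  have tX: "?t A t = 0" if A: "A \<in> ?B" and t: "t \<notin> ?X" for A t
  proof (rule ccontr)
    assume "?t A t \<noteq> 0"
    moreover have "finite_perm A \<pi>" using A by (intro finite_perm_subset) blast+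
    ultimately have "t \<in> {1..card A} \<times> {0..<int d}" using d_pos by (intro finite_perm.type_count_nonzero)
    then show False using A t by (cases t) auto
  qed
  have cA: "card A = (\<Sum>t\<in>?X. fst t * ?t A t)" if "A \<subseteq> S" "\<pi> ` A \<subseteq> A" "\<And>t. t \<notin> ?X \<Longrightarrow> ?t A t = 0" for A
    by (rule finite_perm.card_type_count[OF finite_perm_subset[OF that(1,2)] _ that(3)]) simp_all
  have sub: "?t ` ?B \<subseteq> small_types N"
  proof (rule image_subsetI)
    fix A assume A: "A \<in> ?B"
    have "card A = (\<Sum>t\<in>?X. fst t * ?t A t)" by (rule cA) (use A tX[OF A] in blast)+
    then show "?t A \<in> small_types N" using A tX[OF A] unfolding small_types_def mem_Collect_eq by metis
  qed
  have "conf_trace TYPE('k) j S (wr d S g \<pi>) = (\<Sum>A\<in>?B. cumulant TYPE('k) j A g \<pi>)"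
    unfolding N_def by (rule trace_cumulants[OF fin inj into])
  also have "\<dots> = (\<Sum>A\<in>?B. type_value TYPE('k) j (?t A))"
    by (intro sum.cong refl cumulant_type_value finite_perm_subset) auto
  also have "\<dots> = (\<Sum>\<mu>\<in>small_types N. \<Sum>A | A \<in> ?B \<and> ?t A = \<mu>. type_value TYPE('k) j (?t A))"
    by (rule sum.group[symmetric]) (use fin finite_small_types sub in simp_all)
  also have "\<dots> = (\<Sum>\<mu>\<in>small_types N. type_value TYPE('k) j \<mu> * (\<Prod>t\<in>?X. of_nat (?t S t choose \<mu> t)))"
  proof (intro sum.cong refl)
    fix \<mu> assume l: "\<mu> \<in> small_types N"
    have l0: "\<mu> t = 0" if "t \<notin> ?X" for t using l that unfolding small_types_def mem_Collect_eq by blast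
    have lN: "(\<Sum>t\<in>?X. fst t * \<mu> t) \<le> N" using l unfolding small_types_def mem_Collect_eq by blast
    \<comment> \<open>The bound on the size of \<open>A\<close> already follows from its type, so
      \<open>card_stable_type\<close> counts exactly the sets in question.\<close>
    have "card A \<le> N" if "A \<subseteq> S" "\<pi> ` A \<subseteq> A" "?t A = \<mu>" for A
      using cA[OF that(1,2)] l0 lN unfolding that(3) by simp
    then have "{A. A \<in> ?B \<and> ?t A = \<mu>} = {A. A \<subseteq> S \<and> \<pi> ` A \<subseteq> A \<and> ?t A = \<mu>}"
      by blast
    moreover have "card {A. A \<subseteq> S \<and> \<pi> ` A \<subseteq> A \<and> ?t A = \<mu>} = (\<Prod>t\<in>?X. ?t S t choose \<mu> t)"
      by (rule card_stable_type[OF _ l0]) simp_all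
    ultimately show "(\<Sum>A | A \<in> ?B \<and> ?t A = \<mu>. type_value TYPE('k) j (?t A)) = type_value TYPE('k) j \<mu> * (\<Prod>t\<in>?X. of_nat (?t S t choose \<mu> t))"
      by simp
  qed
  finally show ?thesis .
qed

end

section \<open>Character polynomials\<close>

definition monomial_value :: "('x \<Rightarrow> 'k::comm_semiring_1) \<Rightarrow> ('x \<Rightarrow>\<^sub>0 nat) \<Rightarrow> 'k" where
  "monomial_value v m = (\<Prod>x\<in>Poly_Mapping.keys m. v x ^ Poly_Mapping.lookup m x)"

lemma monomial_value_superset:
  assumes "finite K" "Poly_Mapping.keys m \<subseteq> K"
  shows "monomial_value v m = (\<Prod>x\<in>K. v x ^ Poly_Mapping.lookup m x)"
  unfolding monomial_value_def using assms by (intro prod.mono_neutral_left) (auto simp: in_keys_iff)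

lemma monomial_value_times_variable:
  "monomial_value v (m + Poly_Mapping.single x 1) = monomial_value v m * v x"
proof -
  let ?K = "insert x (Poly_Mapping.keys m)"
  have "Poly_Mapping.keys (m + Poly_Mapping.single x 1) \<subseteq> ?K"
    using Poly_Mapping.keys_add[of m "Poly_Mapping.single x 1"] by auto
  then have "monomial_value v (m + Poly_Mapping.single x 1)
    = (\<Prod>y\<in>?K. v y ^ Poly_Mapping.lookup m y * v y ^ Poly_Mapping.lookup (Poly_Mapping.single x 1) y)"
    by (subst monomial_value_superset[of ?K]) (simp_all add: lookup_add power_add)
  also have "\<dots> = monomial_value v m * (\<Prod>y\<in>?K. v y ^ Poly_Mapping.lookup (Poly_Mapping.single x 1) y)"
    by (subst monomial_value_superset[of ?K m]) (auto simp: prod.distrib)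
  also have "(\<Prod>y\<in>?K. v y ^ Poly_Mapping.lookup (Poly_Mapping.single x 1) y) = (\<Prod>y\<in>?K. if y = x then v y else 1)"
    by (intro prod.cong) (auto simp: lookup_single when_def)
  also have "\<dots> = v x" by (subst prod.delta) auto
  finally show ?thesis .
qed

lemma eval_polynomial_superset:
  assumes "finite K" "Poly_Mapping.keys p \<subseteq> K"
  shows "eval_polynomial v p = (\<Sum>m\<in>K. Poly_Mapping.lookup p m * monomial_value v m)"
  unfolding eval_polynomial_def monomial_value_def using assms
  by (intro sum.mono_neutral_left) (auto simp: in_keys_iff)

lemma eval_polynomial_add: "eval_polynomial v (p + q) = eval_polynomial v p + eval_polynomial v q"
proof -
  let ?K = "Poly_Mapping.keys p \<union> Poly_Mapping.keys q"
  show ?thesis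
    using Poly_Mapping.keys_add[of p q]
    by (simp add: eval_polynomial_superset[of ?K] lookup_add distrib_right sum.distrib)
qed

lemma eval_polynomial_single: "eval_polynomial v (Poly_Mapping.single m c) = c * monomial_value v m"
  by (subst eval_polynomial_superset[of "{m}"]) (auto simp: lookup_single)

lemma eval_polynomial_sum:
  "eval_polynomial v (\<Sum>i\<in>I. p i) = (\<Sum>i\<in>I. eval_polynomial v (p i))"
  by (induction I rule: infinite_finite_induct) (auto simp: eval_polynomial_add, auto simp: eval_polynomial_def)

text \<open>Closure properties are shown for evaluation functions, so that the final polynomial need
  not be written out as a map on monomials.\<close>

definition polynomial_functions :: "'x set \<Rightarrow> (('x \<Rightarrow> 'k::comm_semiring_1) \<Rightarrow> 'k) set" where
  "polynomial_functions V = {\<phi>. \<exists>p. (\<forall>m\<in>Poly_Mapping.keys p. Poly_Mapping.keys m \<subseteq> V) \<and> (\<forall>v. eval_polynomial v p = \<phi> v)}"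

lemma polynomial_functions_monomials:
  assumes "finite I" "\<And>i. i \<in> I \<Longrightarrow> Poly_Mapping.keys (m i) \<subseteq> V"
  shows "(\<lambda>v. \<Sum>i\<in>I. c i * monomial_value v (m i)) \<in> polynomial_functions V"
proof -
  have "\<forall>n\<in>Poly_Mapping.keys (\<Sum>i\<in>I. Poly_Mapping.single (m i) (c i)). Poly_Mapping.keys n \<subseteq> V"
  proof
    fix n assume "n \<in> Poly_Mapping.keys (\<Sum>i\<in>I. Poly_Mapping.single (m i) (c i))"
    then have "n \<in> (\<Union>i\<in>I. Poly_Mapping.keys (Poly_Mapping.single (m i) (c i)))"
      using Poly_Mapping.keys_sum[of "\<lambda>i. Poly_Mapping.single (m i) (c i)" I] by blast
    then obtain i where "i \<in> I" "n = m i" by (auto split: if_splits)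
    then show "Poly_Mapping.keys n \<subseteq> V" using assms(2) by simp
  qed
  then show ?thesis
    unfolding polynomial_functions_def
    by (intro CollectI exI[of _ "\<Sum>i\<in>I. Poly_Mapping.single (m i) (c i)"])
      (simp add: eval_polynomial_sum eval_polynomial_single)
qed

lemma polynomial_functionsE:
  assumes "\<phi> \<in> polynomial_functions V"
  shows "\<exists>K c. finite K \<and> (\<forall>m\<in>K. Poly_Mapping.keys m \<subseteq> V) \<and> \<phi> = (\<lambda>v. \<Sum>m\<in>K. c m * monomial_value v m)"
proof -
  obtain p where p: "\<forall>m\<in>Poly_Mapping.keys p. Poly_Mapping.keys m \<subseteq> V" "\<forall>v. eval_polynomial v p = \<phi> v"
    using assms by (auto simp: polynomial_functions_def)
  have "\<phi> = (\<lambda>v. \<Sum>m\<in>Poly_Mapping.keys p. Poly_Mapping.lookup p m * monomial_value v m)"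
    using p(2) eval_polynomial_superset[of "Poly_Mapping.keys p" p] by (auto simp: fun_eq_iff)
  then show ?thesis using p(1) by (intro exI[of _ "Poly_Mapping.keys p"] exI[of _ "Poly_Mapping.lookup p"]) simp
qed

lemma polynomial_functions_const: "(\<lambda>_. c) \<in> polynomial_functions V"
  using polynomial_functions_monomials[of "{0 :: 'a \<Rightarrow>\<^sub>0 nat}" "\<lambda>m. m" V "\<lambda>_. c"] by (simp add: monomial_value_def)

lemma polynomial_functions_add:
  assumes "\<phi> \<in> polynomial_functions V" "\<psi> \<in> polynomial_functions V"
  shows "(\<lambda>v. \<phi> v + \<psi> v) \<in> polynomial_functions V"
proof -
  obtain p q where p: "\<forall>m\<in>Poly_Mapping.keys p. Poly_Mapping.keys m \<subseteq> V" "\<forall>v. eval_polynomial v p = \<phi> v"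
    and q: "\<forall>m\<in>Poly_Mapping.keys q. Poly_Mapping.keys m \<subseteq> V" "\<forall>v. eval_polynomial v q = \<psi> v"
    using assms by (auto simp: polynomial_functions_def)
  have "Poly_Mapping.keys m \<subseteq> V" if "m \<in> Poly_Mapping.keys (p + q)" for m
    using that Poly_Mapping.keys_add[of p q] p(1) q(1) by blast
  then show ?thesis using p(2) q(2)
    unfolding polynomial_functions_def by (intro CollectI exI[of _ "p + q"]) (simp add: eval_polynomial_add)
qed

lemma polynomial_functions_sum:
  "(\<And>i. i \<in> I \<Longrightarrow> \<phi> i \<in> polynomial_functions V) \<Longrightarrow> (\<lambda>v. \<Sum>i\<in>I. \<phi> i v) \<in> polynomial_functions V"
  by (induction I rule: infinite_finite_induct) (auto intro: polynomial_functions_add polynomial_functions_const)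

lemma polynomial_functions_scale:
  assumes "\<phi> \<in> polynomial_functions V"
  shows "(\<lambda>v. a * \<phi> v) \<in> polynomial_functions V"
proof -
  obtain K c where K: "finite K" "\<forall>m\<in>K. Poly_Mapping.keys m \<subseteq> V" "\<phi> = (\<lambda>v. \<Sum>m\<in>K. c m * monomial_value v m)"
    using polynomial_functionsE[OF assms] by blast
  then show ?thesis
    using polynomial_functions_monomials[of K "\<lambda>m. m" V "\<lambda>m. a * c m"] by (simp add: sum_distrib_left mult.assoc)
qed

lemma polynomial_functions_times_variable:
  assumes "\<phi> \<in> polynomial_functions V" "x \<in> V"
  shows "(\<lambda>v. \<phi> v * v x) \<in> polynomial_functions V"
proof -
  obtain K c where K: "finite K" "\<forall>m\<in>K. Poly_Mapping.keys m \<subseteq> V" "\<phi> = (\<lambda>v. \<Sum>m\<in>K. c m * monomial_value v m)"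
    using polynomial_functionsE[OF assms(1)] by blast
  have "Poly_Mapping.keys (m + Poly_Mapping.single x 1) \<subseteq> V" if "m \<in> K" for m
    using Poly_Mapping.keys_add[of m "Poly_Mapping.single x 1"] K(2) that assms(2) by auto
  from polynomial_functions_monomials[where c = c and m = "\<lambda>m. m + Poly_Mapping.single x 1", OF K(1) this] show ?thesis
    unfolding monomial_value_times_variable K(3) by (simp add: sum_distrib_right mult.assoc)
qed

text \<open>Induction by \<open>(k + 1) * (x gchoose (k + 1)) = (x - k) * (x gchoose k)\<close>,
  where characteristic zero permits division by \<open>k + 1\<close>.\<close>

lemma polynomial_functions_times_gbinomial:
  fixes \<phi> :: "('x \<Rightarrow> 'k::field_char_0) \<Rightarrow> 'k"
  assumes \<phi>: "\<phi> \<in> polynomial_functions V" and x: "x \<in> V"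
  shows "(\<lambda>v. \<phi> v * (v x gchoose k)) \<in> polynomial_functions V"
proof (induction k)
  case 0
  then show ?case using \<phi> by simp
next
  case (Suc k)
  have "\<phi> v * (v x gchoose Suc k)
    = inverse (of_nat (Suc k)) * (\<phi> v * (v x gchoose k) * v x + (- of_nat k) * (\<phi> v * (v x gchoose k)))" for v
  proof -
    have "of_nat (Suc k) * (v x gchoose Suc k) = v x * (v x gchoose k) - of_nat k * (v x gchoose k)"
      using gbinomial_mult_1[of "v x" k] by simp
    then have S: "v x gchoose Suc k = inverse (of_nat (Suc k)) * (v x * (v x gchoose k) - of_nat k * (v x gchoose k))"
      by (metis left_inverse mult.assoc mult_1 of_nat_neq_0)
    show ?thesis unfolding S by (simp add: algebra_simps del: of_nat_Suc)
  qed
  then show ?case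
    using polynomial_functions_scale[OF polynomial_functions_add[OF polynomial_functions_times_variable[OF Suc x] polynomial_functions_scale[OF Suc]]]
    by presburger
qed

lemma polynomial_functions_prod_gbinomial:
  fixes a :: "'k::field_char_0"
  assumes "\<And>t. t \<in> T \<Longrightarrow> f t \<in> V"
  shows "(\<lambda>v. a * (\<Prod>t\<in>T. v (f t) gchoose e t)) \<in> polynomial_functions V"
  using assms
proof (induction T rule: infinite_finite_induct)
  case (insert t T)
  then show ?case
    using polynomial_functions_times_gbinomial[of "\<lambda>v. a * (\<Prod>t\<in>T. v (f t) gchoose e t)" V "f t" "e t"]
    by (simp add: mult_ac)
qed (auto simp: polynomial_functions_const)

section \<open>Cycle counts and traces in the form of the statement\<close>

lemma conj_class_Zmod:
  assumes "a \<in> carrier (Zmod d)"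
  shows "conj_class (Zmod d) a = {a}"
proof -
  interpret comm_group "Zmod d" by (rule abelian_integer_mod_group)
  have "b \<otimes>\<^bsub>Zmod d\<^esub> a \<otimes>\<^bsub>Zmod d\<^esub> inv\<^bsub>Zmod d\<^esub> b = a" if "b \<in> carrier (Zmod d)" for b
    by (simp only: m_comm[OF that assms] m_assoc inv_closed r_inv r_one that assms)
  then have "(\<lambda>b. b \<otimes>\<^bsub>Zmod d\<^esub> a \<otimes>\<^bsub>Zmod d\<^esub> inv\<^bsub>Zmod d\<^esub> b) ` carrier (Zmod d) = (\<lambda>_. a) ` carrier (Zmod d)"
    by (rule image_cong[OF refl])
  then show ?thesis using one_closed unfolding conj_class_def Setcompr_eq_image by auto
qed

lemma cycle_product_Zmod:
  "cycle_product (Zmod d) (g, \<sigma>) m i = (\<Sum>k = 1..m. g ((\<sigma> ^^ k) i)) mod int d"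
proof (induction m)
  case 0
  then show ?case by (simp add: cycle_product_def)
next
  case (Suc m)
  then show ?case
    by (simp add: cycle_product_def mult_integer_mod_group mod_simps add.commute del: funpow.simps)
qed

text \<open>Reconciles two descriptions of the labelled cycles: orbits of \<open>\<sigma>\<close>
  with products along powers on the one side, cycles of the inverse with label sums over the cycle
  on the other.\<close>

lemma count_cycles_Zmod:
  assumes d: "d \<ge> 1" and \<sigma>: "\<sigma> permutes {..<n}" and a: "a \<in> {0..<int d}"
  shows "count_cycles (Zmod d) n (g, \<sigma>) (m, {a}) = type_count d g (inv_into UNIV \<sigma>) {..<n} (m, a)"
proof -
  interpret finite_perm "{..<n}" \<sigma> using \<sigma> by (simp add: finite_perm_def permutes_inj_on permutes_image)
  let ?\<pi> = "inv_into UNIV \<sigma>"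
  have perm: "permutation \<sigma>" using \<sigma> permutation_permutes by blast
  have o: "Orbits.orbit \<sigma> i = orb \<sigma> i" "orb ?\<pi> i = orb \<sigma> i" if "i < n" for i
    using orbit_altdef_permutation[OF perm, of i] orb_inv[OF \<sigma>] that by (auto simp: orb_def)
  have c: "conj_class (Zmod d) (cycle_product (Zmod d) (g, \<sigma>) (card (orb \<sigma> i)) i) = {snd (cycle_type d g (orb \<sigma> i))}"
    if i: "i < n" for i
  proof -
    let ?m = "card (orb \<sigma> i)" and ?f = "\<lambda>k. g ((\<sigma> ^^ k) i)"
    note p = orb_period[of i]
    \<comment> \<open>The product starts at the first power, the enumeration of the cycle at the
      zeroth; the shift is harmless because the \<open>?m\<close>-th power returns to
      \<open>i\<close>.\<close>
    have "(\<Sum>k = 1..?m. ?f k) + ?f 0 = (\<Sum>k<?m. ?f k) + ?f ?m"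
      using sum.lessThan_Suc_shift[of ?f ?m] sum.lessThan_Suc[of ?f ?m] sum.atLeast1_atMost_eq[of ?f ?m]
      by (simp only: One_nat_def add.commute)
    then have "(\<Sum>k = 1..?m. ?f k) = (\<Sum>k<?m. ?f k)" using p(2) i by simp
    also have "\<dots> = (\<Sum>x\<in>orb \<sigma> i. g x)" using p(3) i by (intro sum.reindex_bij_betw) simp
    finally have "cycle_product (Zmod d) (g, \<sigma>) ?m i = snd (cycle_type d g (orb \<sigma> i))"
      by (simp add: cycle_product_Zmod cycle_type_def)
    moreover have "snd (cycle_type d g (orb \<sigma> i)) \<in> carrier (Zmod d)"
      using d by (simp add: cycle_type_def carrier_integer_mod_group)
    ultimately show ?thesis by (simp add: conj_class_Zmod)
  qed
  have "{c. \<exists>i<n. c = Orbits.orbit \<sigma> i \<and> card c = m \<and> conj_class (Zmod d) (cycle_product (Zmod d) (g, \<sigma>) m i) = {a}}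
    = {c \<in> orb ?\<pi> ` {..<n}. cycle_type d g c = (m, a)}"
    (is "?L = ?R")
  proof (rule equalityI; rule subsetI)
    fix x assume "x \<in> ?L"
    then obtain i where i: "i < n" "x = Orbits.orbit \<sigma> i" "card x = m"
      "conj_class (Zmod d) (cycle_product (Zmod d) (g, \<sigma>) m i) = {a}" by blast
    then have "cycle_type d g x = (m, a)" using o c[OF i(1)] by (simp add: cycle_type_def)
    then show "x \<in> ?R" using i o by auto
  next
    fix x assume "x \<in> ?R"
    then obtain i where i: "i < n" "x = orb \<sigma> i" "cycle_type d g x = (m, a)" using o by auto
    then have "card x = m" by (simp add: cycle_type_def)
    then show "x \<in> ?L" using i o c[OF i(1)] by auto
  qed
  then show ?thesis by (simp add: count_cycles_def type_count_def)
qed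

text \<open>Arbitrary base point and connecting path are traded for the standard ones: the path by
  \<open>gr_map_induced\<close>, the base point by cyclicity in
  \<open>gr_trace_conf_trace\<close>.\<close>

lemma (in config) has_trace_braid_action:
  fixes g :: "nat \<Rightarrow> int"
  assumes \<sigma>: "\<sigma> permutes {..<n}" and x: "x \<in> orbit_config d n"
    and \<gamma>: "\<gamma> \<in> paths_between (orbit_config d n) x (wreath_act d n (g, \<sigma>) x)"
  shows "has_trace (gr_piece (pure_monomial_braid_group d n x) (Suc j) :: ('k::field, _) module)
    (gr_braid_action d n x (Suc j) \<gamma> (g, \<sigma>)) (conf_trace TYPE('k) j {..<n} (wr d {..<n} g (inv_into UNIV \<sigma>)))"
proof -
  let ?S = "{..<n}" and ?\<pi> = "inv_into UNIV \<sigma>"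
  let ?M = "Conf d ?S" and ?w = "wr d ?S g ?\<pi>"
  have w: "wreath_act d n (g, \<sigma>) = ?w" by (auto simp: wreath_act_def wr_def root_act_def fun_eq_iff)
  have \<pi>: "inj_on ?\<pi> ?S" "?\<pi> ` ?S \<subseteq> ?S"
    using permutes_inv[OF \<sigma>] by (simp_all add: permutes_inj_on permutes_image)
  have x': "x \<in> ?M" and \<gamma>': "\<gamma> \<in> paths_between ?M x (?w x)" using x \<gamma> by (simp_all add: orbit_config_eq w)
  have wm: "maps ?M ?M ?w" by (rule wr_maps[OF \<pi>])
  let ?V = "gr_space j ?M x :: ('k, _) module"
  let ?f = "gr_map (fundamental_group ?M x) (Suc j) (fundamental_group_map ?M \<gamma> ?w)"
  interpret V: fin_vectorspace ?V by (rule fin_vectorspace_Conf[OF finite_lessThan x'])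
  have P: "group (fundamental_group ?M x)" by (rule group_fundamental_group[OF x'])
  have "fundamental_group_map ?M \<gamma> ?w \<in> hom (fundamental_group ?M x) (fundamental_group ?M x)"
    using wm by (intro fundamental_group_map_hom[of ?M ?w ?M x, OF _ _ x' \<gamma>']) auto
  from V.has_trace_lin_trace[OF gr_map_hom[OF P P this]]
  have "has_trace ?V ?f (lin_trace ?V ?f)" .
  also have "lin_trace ?V ?f = gr_trace TYPE('k) j ?M x ?w"
    unfolding gr_trace_def by (rule V.lin_trace_cong) (rule gr_map_induced[OF path_connected_Conf[OF finite_lessThan] wm x' \<gamma>'])
  also have "\<dots> = conf_trace TYPE('k) j ?S ?w" by (rule gr_trace_conf_trace[OF finite_lessThan x' wm])
  finally show ?thesis by (simp add: pure_monomial_braid_group_def gr_braid_action_def orbit_config_eq w)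
qed

theorem theorem4p4:
  fixes d i :: nat and \<zeta> :: "'k::field_char_0"
  assumes "d \<ge> 1" and "i \<ge> 1" and "primitive_root_of_unity d \<zeta>"
  shows "\<exists>p :: (nat \<times> int set, 'k) mv_poly.
    p \<in> character_polynomials (Zmod d) \<and>
    (\<forall>n. \<forall>x \<in> orbit_config d n. \<forall>w \<in> carrier (wreath_product (Zmod d) n).
      \<forall>\<gamma> \<in> paths_between (orbit_config d n) x (wreath_act d n w x).
        has_trace (gr_piece (pure_monomial_braid_group d n x) i)
          (gr_braid_action d n x i \<gamma> w)
          (eval_character_polynomial (Zmod d) n p w))"
proof -
  interpret config d using assms(1) by unfold_locales
  obtain j where j: "i = Suc j" using assms(2) by (cases i) auto
  \<comment> \<open>Two points for each of the \<open>i\<close> entries of a commutator: larger sets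
    have vanishing cumulant.\<close>
  define N where "N = 2 * Suc j"
  let ?X = "{1..N} \<times> {0..<int d}" and ?var = "\<lambda>(m :: nat, a :: int). (m, {a})"
  let ?V = "{1..} \<times> (conj_class (Zmod d) ` carrier (Zmod d))"
  \<comment> \<open>The binomial coefficients become generalized ones, which make sense for
    field-valued variables and are polynomials in them.\<close>
  let ?\<phi> = "\<lambda>v. \<Sum>\<mu>\<in>small_types N. type_value TYPE('k) j \<mu> * (\<Prod>t\<in>?X. v (?var t) gchoose \<mu> t)"
  have "?var t \<in> ?V" if "t \<in> ?X" for t
  proof -
    obtain m a where t: "t = (m, a)" by (cases t)
    then have "a \<in> carrier (Zmod d)" using that assms(1) by (simp add: carrier_integer_mod_group)
    then have "{a} \<in> conj_class (Zmod d) ` carrier (Zmod d)" using conj_class_Zmod[of a d] by (intro image_eqI[of _ _ a]) simp_all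
    then show ?thesis using that t by simp
  qed
  then have "?\<phi> \<in> polynomial_functions ?V"
    by (intro polynomial_functions_sum polynomial_functions_prod_gbinomial)
  then obtain p where p: "p \<in> character_polynomials (Zmod d)" "\<And>v. eval_polynomial v p = ?\<phi> v"
    unfolding polynomial_functions_def character_polynomials_def by blast
  have "has_trace (gr_piece (pure_monomial_braid_group d n x) i) (gr_braid_action d n x i \<gamma> w)
      (eval_character_polynomial (Zmod d) n p w)"
    if x: "x \<in> orbit_config d n" and w: "w \<in> carrier (wreath_product (Zmod d) n)"
      and \<gamma>: "\<gamma> \<in> paths_between (orbit_config d n) x (wreath_act d n w x)" for n x w \<gamma>
  proof -
    obtain g \<sigma> where gs: "w = (g, \<sigma>)" by (cases w)
    have \<sigma>: "\<sigma> permutes {..<n}" using w by (simp add: gs wreath_product_def)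
    let ?\<pi> = "inv_into UNIV \<sigma>"
    have fp: "finite_perm {..<n} ?\<pi>"
      using permutes_inv[OF \<sigma>] by (simp add: finite_perm_def permutes_inj_on permutes_image)
    have "eval_character_polynomial (Zmod d) n p w
      = (\<Sum>\<mu>\<in>small_types N. type_value TYPE('k) j \<mu> * (\<Prod>t\<in>?X. of_nat (type_count d g ?\<pi> {..<n} t choose \<mu> t)))"
      unfolding eval_character_polynomial_def p(2) binomial_gbinomial gs
      using count_cycles_Zmod[OF assms(1) \<sigma>, of _ g] by (intro sum.cong prod.cong arg_cong2[of _ _ _ _ "(*)"] refl) auto
    also have "\<dots> = conf_trace TYPE('k) j {..<n} (wr d {..<n} g ?\<pi>)"
      unfolding N_def by (rule trace_type_counts[OF fp, symmetric])
    finally show ?thesis using has_trace_braid_action[OF \<sigma> x \<gamma>[unfolded gs], of j] by (simp only: gs j)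
  qed
  then show ?thesis using p(1) by blast
qed

end
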